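(* Let $D\subset\mathbb R^d$ be a bounded open set, $0<\alpha\le\beta$, and let $A_k,B_k$ be two sequences in $\mathcal M_{\alpha,\beta}(D)$ such that $A_k$ $H$-converges to $A$ in $D$. Let $E\subset(0,+\infty)$ be a set with $0\in\overline E$, and assume that for almost all $x\in D$ $$\lim_{\rho\to0,\ \rho\in E}\limsup_{k\to+\infty}\frac1{\rho^d}\int_{B_\rho(x)}|A_k-B_k|\,dy=0.$$ Then $B_k$ $H$-converges to $A$. Furthermore, if $A,B\in\mathcal M_{\alpha,\beta}(\mathbb R^d)$ satisfy $$\lim_{R\to+\infty}\frac1{R^d}\int_{B_R}|A(x)-B(x)|\,dx=0,$$ then (with respect to a given positive sequence $\varepsilon_k\to0$) $A$ is homogenizable if and only if $B$ is homogenizable, and in this case $A_{\rm hom}=B_{\rm hom}$.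
   Context: For an open set $D$, $\mathcal M_{\alpha,\beta}(D)$ is the family of measurable (not necessarily symmetric) $A:D\to\mathbb M^{d\times d}$ with $\alpha|\xi|^2\le\langle A(x)\xi,\xi\rangle$ and $|A(x)|\le\beta$ for a.e. $x\in D$ and all $\xi\in\mathbb R^d$. For $D$ bounded open and $A_k\in\mathcal M_{\alpha,\beta}(D)$, $A_k$ $H$-converges to $A\in\mathcal M_{\alpha,\beta'}(D)$ (some $\beta'\ge\alpha$) if for every $\phi\in H^{-1}(D)$ the solutions $u_k\in H^1_0(D)$ of $-{\rm div}(A_k\nabla u_k)=\phi$ converge weakly in $H^1_0(D)$ to the solution $u\in H^1_0(D)$ of $-{\rm div}(A\nabla u)=\phi$, and $A_k\nabla u_k\rightharpoonup A\nabla u$ weakly in $L^2(D;\mathbb R^d)$. $A\in\mathcal M_{\alpha,\beta}(\mathbb R^d)$ is homogenizable if $A_k(x)=A(x/\varepsilon_k)$ $H$-converges to a constant matrix $A_{\rm hom}$ (in every bounded open set). $B_\rho(x)$ is the ball of radius $\rho$ centred at $x$, $B_R=B_R(0)$. *)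

theory Defs
  imports "HOL-Analysis.Analysis"
begin

definition Mab :: "real \<Rightarrow> real \<Rightarrow> (real^'n) set \<Rightarrow> (real^'n \<Rightarrow> real^'n^'n) \<Rightarrow> bool" where
  "Mab \<alpha> \<beta> D A \<longleftrightarrow> A \<in> borel_measurable (lebesgue_on D) \<and>
     (AE x in lebesgue_on D. (\<forall>\<xi>. \<alpha> * (norm \<xi>)\<^sup>2 \<le> (A x *v \<xi>) \<bullet> \<xi>) \<and> onorm (\<lambda>\<xi>. A x *v \<xi>) \<le> \<beta>)"

definition L2 :: "(real^'n) set \<Rightarrow> (real^'n \<Rightarrow> 'b::euclidean_space) \<Rightarrow> bool" where
  "L2 D f \<longleftrightarrow> f \<in> borel_measurable (lebesgue_on D) \<and> integrable (lebesgue_on D) (\<lambda>x. (norm (f x))\<^sup>2)"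

definition l2inner :: "(real^'n) set \<Rightarrow> (real^'n \<Rightarrow> 'b::euclidean_space) \<Rightarrow> (real^'n \<Rightarrow> 'b) \<Rightarrow> real" where
  "l2inner D f g = (\<integral>x. f x \<bullet> g x \<partial>lebesgue_on D)"

definition test_fun :: "(real^'n) set \<Rightarrow> (real^'n \<Rightarrow> real) \<Rightarrow> (real^'n \<Rightarrow> real^'n) \<Rightarrow> bool" where
  "test_fun D \<phi> d\<phi> \<longleftrightarrow> (\<forall>x. (\<phi> has_derivative (\<lambda>h. d\<phi> x \<bullet> h)) (at x)) \<and> continuous_on UNIV d\<phi> \<and>
     compact (closure {x. \<phi> x \<noteq> 0}) \<and> closure {x. \<phi> x \<noteq> 0} \<subseteq> D"

text \<open>H10 D u g: u belongs to H^1_0(D) (closure of test functions in the H^1 norm) with weak gradient g.\<close>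
definition H10 :: "(real^'n) set \<Rightarrow> (real^'n \<Rightarrow> real) \<Rightarrow> (real^'n \<Rightarrow> real^'n) \<Rightarrow> bool" where
  "H10 D u g \<longleftrightarrow> L2 D u \<and> L2 D g \<and>
     (\<exists>\<phi> d\<phi>. (\<forall>j. test_fun D (\<phi> j) (d\<phi> j)) \<and>
        (\<lambda>j. \<integral>x. (\<phi> j x - u x)\<^sup>2 \<partial>lebesgue_on D) \<longlonglongrightarrow> 0 \<and>
        (\<lambda>j. \<integral>x. (norm (d\<phi> j x - g x))\<^sup>2 \<partial>lebesgue_on D) \<longlonglongrightarrow> 0)"

definition Hminus1 :: "(real^'n) set \<Rightarrow> ((real^'n \<Rightarrow> real) \<Rightarrow> real) \<Rightarrow> bool" where
  "Hminus1 D T \<longleftrightarrow>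
     (\<forall>u g v h a b. H10 D u g \<longrightarrow> H10 D v h \<longrightarrow> T (\<lambda>x. a * u x + b * v x) = a * T u + b * T v) \<and>
     (\<exists>C. \<forall>u g. H10 D u g \<longrightarrow> \<bar>T u\<bar> \<le> C * sqrt (l2inner D u u + l2inner D g g))"

definition wsol :: "(real^'n) set \<Rightarrow> (real^'n \<Rightarrow> real^'n^'n) \<Rightarrow> ((real^'n \<Rightarrow> real) \<Rightarrow> real)
     \<Rightarrow> (real^'n \<Rightarrow> real) \<Rightarrow> (real^'n \<Rightarrow> real^'n) \<Rightarrow> bool" where
  "wsol D A T u g \<longleftrightarrow> H10 D u g \<and> (\<forall>v h. H10 D v h \<longrightarrow> l2inner D (\<lambda>x. A x *v g x) h = T v)"

definition H10_weak :: "(real^'n) set \<Rightarrow> (nat \<Rightarrow> real^'n \<Rightarrow> real) \<Rightarrow> (nat \<Rightarrow> real^'n \<Rightarrow> real^'n)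
     \<Rightarrow> (real^'n \<Rightarrow> real) \<Rightarrow> (real^'n \<Rightarrow> real^'n) \<Rightarrow> bool" where
  "H10_weak D u g u0 g0 \<longleftrightarrow> (\<forall>w h. H10 D w h \<longrightarrow>
     (\<lambda>k. l2inner D (u k) w + l2inner D (g k) h) \<longlonglongrightarrow> l2inner D u0 w + l2inner D g0 h)"

definition L2_weak :: "(real^'n) set \<Rightarrow> (nat \<Rightarrow> real^'n \<Rightarrow> real^'n) \<Rightarrow> (real^'n \<Rightarrow> real^'n) \<Rightarrow> bool" where
  "L2_weak D F F0 \<longleftrightarrow> (\<forall>h. L2 D h \<longrightarrow> (\<lambda>k. l2inner D (F k) h) \<longlonglongrightarrow> l2inner D F0 h)"

definition Hconv :: "real \<Rightarrow> (real^'n) set \<Rightarrow> (nat \<Rightarrow> real^'n \<Rightarrow> real^'n^'n) \<Rightarrow> (real^'n \<Rightarrow> real^'n^'n) \<Rightarrow> bool" where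
  "Hconv \<alpha> D Ak A \<longleftrightarrow> (\<exists>\<beta>'. \<beta>' \<ge> \<alpha> \<and> Mab \<alpha> \<beta>' D A) \<and>
     (\<forall>T u g uk gk. Hminus1 D T \<longrightarrow> wsol D A T u g \<longrightarrow> (\<forall>k. wsol D (Ak k) T (uk k) (gk k)) \<longrightarrow>
        H10_weak D uk gk u g \<and> L2_weak D (\<lambda>k x. Ak k x *v gk k x) (\<lambda>x. A x *v g x))"

definition homogenizes_to :: "real \<Rightarrow> (nat \<Rightarrow> real) \<Rightarrow> (real^'n \<Rightarrow> real^'n^'n) \<Rightarrow> real^'n^'n \<Rightarrow> bool" where
  "homogenizes_to \<alpha> eps A Ahom \<longleftrightarrow>
     (\<forall>D. bounded D \<and> open D \<longrightarrow> Hconv \<alpha> D (\<lambda>k x. A ((1 / eps k) *\<^sub>R x)) (\<lambda>x. Ahom))"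

definition homogenizable :: "real \<Rightarrow> (nat \<Rightarrow> real) \<Rightarrow> (real^'n \<Rightarrow> real^'n^'n) \<Rightarrow> bool" where
  "homogenizable \<alpha> eps A \<longleftrightarrow> (\<exists>Ahom. homogenizes_to \<alpha> eps A Ahom)"

end

theory Submission
  imports Defs
begin

text \<open>Let \<open>u\<^sub>k\<close> and \<open>v\<^sub>k\<close> solve the equations with matrices \<open>A\<^sub>k\<close> and \<open>B\<^sub>k\<close> and the same right-hand side.
  Subtracting them gives \<open>\<alpha> \<integral>|\<nabla>(v\<^sub>k - u\<^sub>k)|\<^sup>2 \<le> \<integral>|A\<^sub>k - B\<^sub>k| |\<nabla>u\<^sub>k| |\<nabla>(v\<^sub>k - u\<^sub>k)|\<close>. A Vitali covering turns the
  hypothesis on averages into \<open>A\<^sub>k - B\<^sub>k \<rightarrow> 0\<close> in \<open>L\<^sup>1(D)\<close>; as the matrices are bounded, \<open>v\<^sub>k - u\<^sub>k \<rightarrow> 0\<close> follows once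
  \<open>|\<nabla>u\<^sub>k|\<^sup>2\<close> is equi-integrable. The right-hand side is \<open>v \<mapsto> \<integral>F \<bullet> \<nabla>v\<close> for an \<open>F \<in> L\<^sup>2\<close>, e.g. the limit flux.
  In the interior, Caccioppoli's and Ehrling's inequalities bound the energy on a ball by its \<open>L\<^sup>1\<close> average and
  by \<open>F\<close>, and a stopping-time covering gives higher integrability in the weak form needed. At the boundary,
  convergence of energies, a consequence of H-convergence, excludes concentration.

  For the homogenization statement, rescaling turns the averages over \<open>B\<^sub>R\<close> into the \<open>L\<^sup>1(D)\<close> norm of the rescaled
  difference. Constant limits are unique because the explicit solution on the unit ball determines the matrix.\<close>

section \<open>The Lax--Milgram theorem in a semi-Hilbert space\<close>

text \<open>The obstacle: the matrices are close only in \<open>L\<^sup>1\<close>, while the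
  gradients are bounded only in \<open>L\<^sup>2\<close>. A fixed gain of integrability cannot be
  expected, since every element of \<open>H10\<close> solves such an equation for a suitable square
  integrable \<open>F\<close>. What helps is that one \<open>F\<close> serves all k: the energy of a
  gradient above a level is measured against the energy of \<open>F\<close> above a comparable
  level. Summed over N dyadic levels, the cost of the gradients stays bounded and the part of
  \<open>F\<close> is a small multiple of N, so division by N gives a logarithmic gain that replaces
  a higher exponent. These estimates live on balls inside D. Since D is an arbitrary bounded open
  set, no version up to the boundary is available, which is why the energy argument is needed there.
  Functions are never identified up to null sets: forms are only semidefinite, and a function in
  \<open>H10\<close> comes with a gradient as a second datum.\<close>

lemma linear_coeff_zero:
  fixes x c :: real
  assumes "\<And>t. 0 \<le> t * x + t\<^sup>2 * c"
  shows "x = 0"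
proof -
  \<comment> \<open>\<open>B\<close> exceeds \<open>c\<close>, so at \<open>t = - x / B\<close> the
    linear term outweighs the quadratic one and the value is negative unless \<open>x\<close>
    vanishes. This is later applied to the first variation at a minimizer.\<close>
  define B where "B = \<bar>c\<bar> + 1"
  have B: "B > 0" "c - B \<le> - 1" by (auto simp: B_def)
  have "0 \<le> B\<^sup>2 * ((- x / B) * x + (- x / B)\<^sup>2 * c)" using assms[of "- x / B"] by simp
  also have "\<dots> = x\<^sup>2 * (c - B)" using B by (simp add: power2_eq_square field_simps)
  also have "\<dots> \<le> x\<^sup>2 * (- 1)" using B by (intro mult_left_mono) auto
  finally show ?thesis by simp
qed

text \<open>The elements will be actual functions, not classes, so \<open>ip\<close> is only
  semidefinite and limits are determined only up to norm zero. The linear combination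
  \<open>lc\<close> is a parameter because bilinearity of \<open>ip\<close> is all that the
  arguments use of it.\<close>

locale semi_ip =
  fixes S :: "'v set" and lc :: "real \<Rightarrow> 'v \<Rightarrow> real \<Rightarrow> 'v \<Rightarrow> 'v" and ip :: "'v \<Rightarrow> 'v \<Rightarrow> real"
  assumes lc_in [simp, intro]: "u \<in> S \<Longrightarrow> v \<in> S \<Longrightarrow> lc a u b v \<in> S"
    and ip_lc: "u \<in> S \<Longrightarrow> v \<in> S \<Longrightarrow> w \<in> S \<Longrightarrow> ip (lc a u b v) w = a * ip u w + b * ip v w"
    and ip_sym: "u \<in> S \<Longrightarrow> v \<in> S \<Longrightarrow> ip u v = ip v u"
    and ip_nonneg [simp]: "u \<in> S \<Longrightarrow> 0 \<le> ip u u"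
begin

definition nr :: "'v \<Rightarrow> real" where "nr u = sqrt (ip u u)"

lemma nr_nonneg [simp]: "u \<in> S \<Longrightarrow> 0 \<le> nr u"
  by (simp add: nr_def)

lemma nr_sq: "u \<in> S \<Longrightarrow> (nr u)\<^sup>2 = ip u u"
  by (simp add: nr_def)

lemma ip_lc_right: "u \<in> S \<Longrightarrow> v \<in> S \<Longrightarrow> w \<in> S \<Longrightarrow> ip w (lc a u b v) = a * ip w u + b * ip w v"
  by (metis ip_lc ip_sym lc_in)

lemma ip_lc_self: "u \<in> S \<Longrightarrow> v \<in> S \<Longrightarrow>
    ip (lc a u b v) (lc a u b v) = a\<^sup>2 * ip u u + 2 * a * b * ip u v + b\<^sup>2 * ip v v"
  by (simp add: ip_lc ip_lc_right ip_sym[of v u] power2_eq_square algebra_simps)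

lemma cauchy_schwarz: assumes "u \<in> S" "v \<in> S" shows "\<bar>ip u v\<bar> \<le> nr u * nr v"
proof -
  have q: "0 \<le> a\<^sup>2 * ip u u + 2 * a * b * ip u v + b\<^sup>2 * ip v v" for a b
    using ip_nonneg[OF lc_in[OF assms, of a b]] ip_lc_self[OF assms] by simp
  have "(ip u v)\<^sup>2 \<le> ip u u * ip v v"
  \<comment> \<open>For a semidefinite form this case contains nonzero \<open>v\<close>; there the
    quadratic is affine in the first power of \<open>b\<close> and can stay nonnegative only if
    \<open>ip u v\<close> vanishes.\<close>
  proof (cases "ip v v = 0")
    case True
    have "ip u v = 0"
    proof (rule ccontr)
      assume n: "ip u v \<noteq> 0"
      have "0 \<le> ip u u + 2 * b * ip u v" for b using q[of 1 b] True by simp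
      from this[of "- (ip u u + 1) / (2 * ip u v)"] n show False by (simp add: field_simps)
    qed
    with True show ?thesis by simp
  next
    case False
    then have p: "ip v v > 0" using ip_nonneg[OF assms(2)] by linarith
    have "0 \<le> ip v v * (ip u u * ip v v - (ip u v)\<^sup>2)"
      using q[of "ip v v" "- ip u v"] by (simp add: power2_eq_square algebra_simps)
    with p show ?thesis by (simp add: zero_le_mult_iff)
  qed
  then have "sqrt ((ip u v)\<^sup>2) \<le> sqrt (ip u u * ip v v)" by (rule real_sqrt_le_mono)
  then show ?thesis by (simp add: nr_def real_sqrt_mult)
qed

lemma nr_triangle: assumes "u \<in> S" "v \<in> S" shows "nr (lc a u b v) \<le> \<bar>a\<bar> * nr u + \<bar>b\<bar> * nr v"
proof (rule power2_le_imp_le)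
  have "2 * a * b * ip u v \<le> 2 * \<bar>a\<bar> * \<bar>b\<bar> * (nr u * nr v)"
  proof -
    have "2 * a * b * ip u v \<le> \<bar>2 * a * b\<bar> * \<bar>ip u v\<bar>" by (simp flip: abs_mult)
    also have "\<dots> \<le> \<bar>2 * a * b\<bar> * (nr u * nr v)"
      using cauchy_schwarz[OF assms] by (intro mult_left_mono) auto
    finally show ?thesis by (simp add: abs_mult)
  qed
  then show "(nr (lc a u b v))\<^sup>2 \<le> (\<bar>a\<bar> * nr u + \<bar>b\<bar> * nr v)\<^sup>2"
    using assms by (simp add: nr_sq ip_lc_self power2_sum power_mult_distrib mult_ac)
qed (use assms in simp)

end

locale semi_hilbert = semi_ip +
  assumes complete: "\<And>X. (\<And>n::nat. X n \<in> S) \<Longrightarrow>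
      (\<And>e. e > 0 \<Longrightarrow> \<exists>N. \<forall>m\<ge>N. \<forall>n\<ge>N. ip (lc 1 (X m) (-1) (X n)) (lc 1 (X m) (-1) (X n)) < e) \<Longrightarrow>
      \<exists>w\<in>S. (\<lambda>n. ip (lc 1 (X n) (-1) w) (lc 1 (X n) (-1) w)) \<longlonglongrightarrow> 0"
begin

text \<open>The representing element minimizes \<open>b(u,u)/2 - l(u)\<close>; the parallelogram identity makes minimizing
  sequences Cauchy.\<close>
lemma riesz_symmetric:
  fixes b :: "'a \<Rightarrow> 'a \<Rightarrow> real" and l :: "'a \<Rightarrow> real"
  assumes ne: "z \<in> S"
    and b_lin: "\<And>u v w a c. u \<in> S \<Longrightarrow> v \<in> S \<Longrightarrow> w \<in> S \<Longrightarrow> b (lc a u c v) w = a * b u w + c * b v w"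
    and b_sym: "\<And>u v. u \<in> S \<Longrightarrow> v \<in> S \<Longrightarrow> b u v = b v u"
    and b_bd: "\<And>u v. u \<in> S \<Longrightarrow> v \<in> S \<Longrightarrow> \<bar>b u v\<bar> \<le> M * nr u * nr v"
    and mu: "\<mu> > 0" and coer: "\<And>u. u \<in> S \<Longrightarrow> \<mu> * ip u u \<le> b u u"
    and l_lin: "\<And>u v a c. u \<in> S \<Longrightarrow> v \<in> S \<Longrightarrow> l (lc a u c v) = a * l u + c * l v"
    and l_bd: "\<And>u. u \<in> S \<Longrightarrow> \<bar>l u\<bar> \<le> C * nr u"
  obtains w where "w \<in> S" "\<And>v. v \<in> S \<Longrightarrow> b w v = l v"
proof -
  define J where "J u = b u u / 2 - l u" for u
  have b_self: "b (lc a u c v) (lc a u c v) = a\<^sup>2 * b u u + 2 * a * c * b u v + c\<^sup>2 * b v v"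
    if "u \<in> S" "v \<in> S" for a u c v
  proof -
    have "b u (lc a u c v) = a * b u u + c * b u v" "b v (lc a u c v) = a * b u v + c * b v v"
      using that by (simp_all add: b_sym[of u "lc a u c v"] b_sym[of v "lc a u c v"] b_lin b_sym[of v u])
    then show ?thesis using that by (simp add: b_lin power2_eq_square algebra_simps)
  qed
  have Jlb: "J u \<ge> - (C\<^sup>2 / (2 * \<mu>))" if "u \<in> S" for u
  proof -
    have "0 \<le> (\<mu> * nr u - C)\<^sup>2 / (2 * \<mu>)" using mu by simp
    also have "\<dots> = \<mu> * (nr u)\<^sup>2 / 2 - C * nr u + C\<^sup>2 / (2 * \<mu>)"
      using mu by (simp add: power2_eq_square field_simps)
    also have "\<dots> \<le> b u u / 2 - l u + C\<^sup>2 / (2 * \<mu>)"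
      using coer[OF that] l_bd[OF that] nr_sq[OF that] by simp
    finally show ?thesis by (simp add: J_def)
  qed
  define m where "m = Inf (J ` S)"
  have bdd: "bdd_below (J ` S)" using Jlb by (auto intro!: bdd_belowI)
  have m_le: "m \<le> J u" if "u \<in> S" for u
    unfolding m_def using that bdd by (auto intro: cInf_lower)
  have "\<exists>u\<in>S. J u < m + 1 / real (Suc n)" for n
  proof (rule ccontr)
    assume "\<not> ?thesis"
    then have "m + 1 / real (Suc n) \<le> m" unfolding m_def
      by (intro cInf_greatest) (use ne in \<open>auto simp: m_def not_less\<close>)
    then show False by simp
  qed
  moreover define d where "d n = 1 / real (Suc n)" for n
  ultimately obtain X where X: "\<And>n. X n \<in> S" "\<And>n. J (X n) < m + d n" by metis
  have d: "d \<longlonglongrightarrow> 0" unfolding d_def by (rule LIMSEQ_Suc[OF lim_1_over_n])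
  have par: "\<mu> * ip (lc 1 u (-1) v) (lc 1 u (-1) v) \<le> 4 * (J u + J v - 2 * m)" if uv: "u \<in> S" "v \<in> S" for u v
  proof -
    have "m \<le> J (lc (1/2) u (1/2) v)" using uv by (intro m_le) auto
    then have "b (lc 1 u (-1) v) (lc 1 u (-1) v) \<le> 4 * (J u + J v - 2 * m)"
      using uv by (simp add: J_def b_self l_lin power2_eq_square field_simps)
    then show ?thesis using coer[of "lc 1 u (-1) v"] uv by (auto intro: order_trans)
  qed
  have "\<exists>w\<in>S. (\<lambda>n. ip (lc 1 (X n) (-1) w) (lc 1 (X n) (-1) w)) \<longlonglongrightarrow> 0"
  proof (rule complete)
    fix e :: real assume "e > 0"
    then obtain N where N: "8 * d N < \<mu> * e"
      using reals_Archimedean[of "\<mu> * e / 8"] mu by (auto simp: d_def field_simps)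
    show "\<exists>N. \<forall>m\<ge>N. \<forall>n\<ge>N. ip (lc 1 (X m) (-1) (X n)) (lc 1 (X m) (-1) (X n)) < e"
    proof (intro exI allI impI)
      fix i j assume ij: "N \<le> i" "N \<le> j"
      have le: "d k \<le> d N" if "N \<le> k" for k using that by (simp add: d_def frac_le)
      have "\<mu> * ip (lc 1 (X i) (-1) (X j)) (lc 1 (X i) (-1) (X j)) \<le> 4 * (J (X i) + J (X j) - 2 * m)"
        using X by (intro par)
      also have "\<dots> \<le> 4 * (2 * d N)"
      proof (rule mult_left_mono)
        show "J (X i) + J (X j) - 2 * m \<le> 2 * d N"
          using X(2)[of i] X(2)[of j] le[OF ij(1)] le[OF ij(2)] by linarith
      qed simp
      also have "\<dots> < \<mu> * e" using N by simp
      finally show "ip (lc 1 (X i) (-1) (X j)) (lc 1 (X i) (-1) (X j)) < e" using mu by simp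
    qed
  qed (use X in auto)
  then obtain w where w: "w \<in> S" and lim: "(\<lambda>n. ip (lc 1 (X n) (-1) w) (lc 1 (X n) (-1) w)) \<longlonglongrightarrow> 0" by blast
  define Z where "Z n = lc 1 (X n) (-1) w" for n
  have Z: "Z n \<in> S" for n using X w by (auto simp: Z_def)
  have Zlim: "(\<lambda>n. nr (Z n)) \<longlonglongrightarrow> 0" using tendsto_real_sqrt[OF lim] by (simp add: nr_def Z_def)
  have JX: "J (X n) = J w + (b w (Z n) + b (Z n) (Z n) / 2 - l (Z n))" for n
  proof -
    have "b w (Z n) = b (X n) w - b w w" "l (Z n) = l (X n) - l w"
      using X[of n] w b_sym[of w "Z n"] Z[of n] by (simp_all add: Z_def b_lin l_lin)
    moreover have "b (Z n) (Z n) = b (X n) (X n) - 2 * b (X n) w + b w w"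
      unfolding Z_def using b_self[OF X(1)[of n] w, of 1 "-1"] by simp
    ultimately have "b w (Z n) = b (X n) w - b w w" "b (Z n) (Z n) = b (X n) (X n) - 2 * b (X n) w + b w w"
      "l (Z n) = l (X n) - l w" by auto
    then show ?thesis by (simp add: J_def field_simps)
  qed
  have nr0: "b w (Z n) + b (Z n) (Z n) / 2 - l (Z n) \<ge> - (M * nr w * nr (Z n)) - C * nr (Z n)" for n
  proof -
    have "0 \<le> b (Z n) (Z n)"
      using mu coer[OF Z[of n]] ip_nonneg[OF Z[of n]] by (meson mult_nonneg_nonneg less_imp_le order_trans)
    then show ?thesis using b_bd[OF w Z[of n]] l_bd[OF Z[of n]] by linarith
  qed
  have "J w \<le> m"
  proof (rule LIMSEQ_le_const)
    show "(\<lambda>n. m + d n + (M * nr w * nr (Z n) + C * nr (Z n))) \<longlonglongrightarrow> m"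
      by (rule tendsto_eq_intros d Zlim refl | simp)+
    show "\<exists>N. \<forall>n\<ge>N. J w \<le> m + d n + (M * nr w * nr (Z n) + C * nr (Z n))"
    proof (intro exI allI impI)
      fix n show "J w \<le> m + d n + (M * nr w * nr (Z n) + C * nr (Z n))"
        using X(2)[of n] JX[of n] nr0[of n] by linarith
    qed
  qed
  have "b w v = l v" if v: "v \<in> S" for v
  proof (rule ccontr)
    assume ne: "b w v \<noteq> l v"
    have q: "0 \<le> t * (b w v - l v) + t\<^sup>2 * b v v / 2" for t
    proof -
      have "J w \<le> J (lc 1 w t v)" using m_le[of "lc 1 w t v"] \<open>J w \<le> m\<close> w v by auto
      then show ?thesis using w v by (simp add: J_def b_self l_lin field_simps)
    qed
    from linear_coeff_zero[of "b w v - l v" "b v v / 2"] q ne show False by simp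
  qed
  with w show ?thesis using that by blast
qed

lemma riesz:
  assumes ne: "z \<in> S"
    and l_lin: "\<And>u v a c. u \<in> S \<Longrightarrow> v \<in> S \<Longrightarrow> l (lc a u c v) = a * l u + c * l v"
    and l_bd: "\<And>u. u \<in> S \<Longrightarrow> \<bar>l u\<bar> \<le> C * nr u"
  obtains w where "w \<in> S" "\<And>v. v \<in> S \<Longrightarrow> ip w v = l v"
proof (rule riesz_symmetric[of z ip 1 1 l C])
  show "ip (lc a u c v) w = a * ip u w + c * ip v w" if "u \<in> S" "v \<in> S" "w \<in> S" for u v w a c
    using that by (rule ip_lc)
  show "ip u v = ip v u" if "u \<in> S" "v \<in> S" for u v using that by (rule ip_sym)
qed (use assms in \<open>auto simp: cauchy_schwarz\<close>)

text \<open>With \<open>a(u,v) = \<langle>R u, v\<rangle>\<close>, solving \<open>\<langle>R w, R v\<rangle> = \<langle>f, R v\<rangle>\<close> reduces the nonsymmetric problem to a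
  symmetric one.\<close>
lemma lax_milgram:
  assumes ne: "z \<in> S"
    and a_lin: "\<And>u v w s t. u \<in> S \<Longrightarrow> v \<in> S \<Longrightarrow> w \<in> S \<Longrightarrow> a (lc s u t v) w = s * a u w + t * a v w"
    and a_lin2: "\<And>u v w s t. u \<in> S \<Longrightarrow> v \<in> S \<Longrightarrow> w \<in> S \<Longrightarrow> a w (lc s u t v) = s * a w u + t * a w v"
    and a_bd: "\<And>u v. u \<in> S \<Longrightarrow> v \<in> S \<Longrightarrow> \<bar>a u v\<bar> \<le> M * nr u * nr v"
    and mu: "\<mu> > 0" and coer: "\<And>u. u \<in> S \<Longrightarrow> \<mu> * ip u u \<le> a u u"
    and l_lin: "\<And>u v s t. u \<in> S \<Longrightarrow> v \<in> S \<Longrightarrow> l (lc s u t v) = s * l u + t * l v"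
    and l_bd: "\<And>u. u \<in> S \<Longrightarrow> \<bar>l u\<bar> \<le> C * nr u"
  obtains w where "w \<in> S" "\<And>v. v \<in> S \<Longrightarrow> a w v = l v"
proof -
  have "\<exists>r\<in>S. \<forall>v\<in>S. ip r v = a u v" if u: "u \<in> S" for u
    by (rule riesz[of z "a u" "M * nr u"]) (use u ne a_lin2 a_bd in auto)
  then obtain R where R: "\<And>u. u \<in> S \<Longrightarrow> R u \<in> S" "\<And>u v. u \<in> S \<Longrightarrow> v \<in> S \<Longrightarrow> ip (R u) v = a u v" by metis
  obtain f where f: "f \<in> S" "\<And>v. v \<in> S \<Longrightarrow> ip f v = l v"
    by (rule riesz[of z l C]) (use ne l_lin l_bd in auto)
  have nrR: "nr (R u) \<le> M * nr u" if u: "u \<in> S" for u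
  \<comment> \<open>The sign of \<open>M\<close> is not given, so this case needs
    \<open>\<mu> \<le> M\<close>, which follows by comparing coercivity with boundedness.\<close>
  proof (cases "nr (R u) = 0")
    case True
    show ?thesis
    proof (cases "nr u = 0")
      case False
      have "\<mu> * (nr u * nr u) \<le> M * nr u * nr u"
        using a_bd[OF u u] coer[OF u] nr_sq[OF u] by (simp add: power2_eq_square)
      then have "\<mu> \<le> M" using False nr_nonneg[OF u] by (simp add: mult.assoc mult_le_cancel_right)
      then show ?thesis using True mu u by simp
    qed (use True in simp)
  next
    case False
    then have "nr (R u) > 0" using nr_nonneg[OF R(1)[OF u]] by linarith
    moreover have "nr (R u) * nr (R u) \<le> M * nr u * nr (R u)"
      using a_bd[OF u R(1)[OF u]] R(2)[OF u R(1)[OF u]] nr_sq[OF R(1)[OF u]] by (simp add: power2_eq_square)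
    ultimately show ?thesis by simp
  qed
  \<comment> \<open>Coercivity bounds \<open>R\<close> from below; hence the symmetric form
    \<open>ip (R u) (R v)\<close> is coercive with constant \<open>\<mu> * \<mu>\<close>.\<close>
  have muR: "\<mu> * nr u \<le> nr (R u)" if u: "u \<in> S" for u
  proof (cases "nr u = 0")
    case False
    then have "nr u > 0" using nr_nonneg[OF u] by linarith
    moreover have "\<mu> * nr u * nr u \<le> nr (R u) * nr u"
      using coer[OF u] R(2)[OF u u] cauchy_schwarz[OF R(1)[OF u] u] nr_sq[OF u] by (simp add: power2_eq_square mult.assoc)
    ultimately show ?thesis by simp
  qed (use R(1)[OF u] in simp)
  have R_lin: "ip (R (lc s u t v)) w = s * ip (R u) w + t * ip (R v) w" if "u \<in> S" "v \<in> S" "w \<in> S" for s u t v w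
    using that by (simp add: R a_lin)
  obtain w where w: "w \<in> S" "\<And>v. v \<in> S \<Longrightarrow> ip (R w) (R v) = ip f (R v)"
  proof (rule riesz_symmetric[of z "\<lambda>u v. ip (R u) (R v)" "M * M" "\<mu> * \<mu>" "\<lambda>v. ip f (R v)" "nr f * M"])
    show "\<bar>ip (R u) (R v)\<bar> \<le> M * M * nr u * nr v" if uv: "u \<in> S" "v \<in> S" for u v
    proof -
      have "nr (R u) * nr (R v) \<le> (M * nr u) * (M * nr v)"
        using nrR[OF uv(1)] nrR[OF uv(2)] R(1)[OF uv(1)] R(1)[OF uv(2)] nr_nonneg order_trans
        by (intro mult_mono) (auto intro: order_trans[OF nr_nonneg])
      then show ?thesis using cauchy_schwarz[OF R(1)[OF uv(1)] R(1)[OF uv(2)]] by (simp add: mult_ac)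
    qed
    show "\<mu> * \<mu> * ip u u \<le> ip (R u) (R u)" if u: "u \<in> S" for u
    proof -
      have "(\<mu> * nr u)\<^sup>2 \<le> (nr (R u))\<^sup>2" using muR[OF u] mu u by (intro power_mono) auto
      then show ?thesis using u R(1)[OF u] by (simp add: power_mult_distrib nr_sq power2_eq_square[of \<mu>])
    qed
    show "\<bar>ip f (R u)\<bar> \<le> nr f * M * nr u" if u: "u \<in> S" for u
      using cauchy_schwarz[OF f(1) R(1)[OF u]] nrR[OF u] mult_left_mono[OF nrR[OF u] nr_nonneg[OF f(1)]]
      by (simp add: mult_ac)
    show "ip (R (lc s u t v)) (R w) = s * ip (R u) (R w) + t * ip (R v) (R w)"
      if "u \<in> S" "v \<in> S" "w \<in> S" for s u t v w using that R by (intro R_lin) auto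
    show "ip f (R (lc s u t v)) = s * ip f (R u) + t * ip f (R v)" if "u \<in> S" "v \<in> S" for s u t v
    proof -
      have "ip f (R x) = ip (R x) f" if "x \<in> S" for x using that R(1) f(1) by (intro ip_sym) auto
      then show ?thesis using R_lin[OF that f(1)] that by simp
    qed
    show "ip (R u) (R v) = ip (R v) (R u)" if "u \<in> S" "v \<in> S" for u v
      using that R by (intro ip_sym) auto
  qed (use ne mu in auto)
  \<comment> \<open>\<open>y\<close> is orthogonal to the range of \<open>R\<close>, in particular
    to \<open>R y\<close>, and coercivity applied to \<open>y\<close> itself then gives it norm
    zero.\<close>
  define y where "y = lc 1 (R w) (-1) f"
  have y: "y \<in> S" using R w f by (auto simp: y_def)
  have "\<mu> * ip y y \<le> ip (R y) y" using coer[OF y] R(2)[OF y y] by simp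
  also have "\<dots> = ip y (R y)" using y R by (intro ip_sym) auto
  also have "\<dots> = ip (R w) (R y) - ip f (R y)" using w y f R by (subst y_def) (simp add: ip_lc)
  also have "\<dots> = 0" using w y by simp
  finally have y0: "nr y = 0" using mu ip_nonneg[OF y] nr_sq[OF y] by (simp add: mult_le_0_iff)
  have "a w v = l v" if v: "v \<in> S" for v
  proof -
    have "ip y v = 0" using cauchy_schwarz[OF y v] y0 by simp
    moreover have "ip y v = ip (R w) v - ip f v" using v w(1) f(1) R(1) by (simp add: y_def ip_lc)
    ultimately show ?thesis using v w(1) f(2) R(2) by simp
  qed
  with w(1) show ?thesis using that by blast
qed

end

section \<open>Square integrable fields\<close>

definition l2norm :: "(real^'n) set \<Rightarrow> (real^'n \<Rightarrow> 'b::euclidean_space) \<Rightarrow> real" where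
  "l2norm D f = sqrt (l2inner D f f)"

lemma L2_measurable: "L2 D f \<Longrightarrow> f \<in> borel_measurable (lebesgue_on D)"
  by (simp add: L2_def)

lemma L2_integrable_sq: "L2 D f \<Longrightarrow> integrable (lebesgue_on D) (\<lambda>x. (norm (f x))\<^sup>2)"
  by (simp add: L2_def)

lemma l2inner_self: "l2inner D f f = (\<integral>x. (norm (f x))\<^sup>2 \<partial>lebesgue_on D)"
  by (simp add: l2inner_def power2_norm_eq_inner)

lemma l2norm_nonneg [simp]: "0 \<le> l2norm D f"
  by (simp add: l2norm_def l2inner_self)

lemma l2norm_sq: "(l2norm D f)\<^sup>2 = (\<integral>x. (norm (f x))\<^sup>2 \<partial>lebesgue_on D)"
  by (simp add: l2norm_def l2inner_self)

lemma l2norm_sq_inner: "(l2norm D f)\<^sup>2 = l2inner D f f"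
  by (simp add: l2norm_def l2inner_self)

lemma L2_bound:
  fixes f :: "real^'n \<Rightarrow> 'b::euclidean_space" and g :: "real^'n \<Rightarrow> 'c::euclidean_space"
  assumes g: "L2 D g" and f: "f \<in> borel_measurable (lebesgue_on D)"
    and le: "AE x in lebesgue_on D. norm (f x) \<le> C * norm (g x)" and C: "0 \<le> C"
  shows "L2 D f" "l2norm D f \<le> C * l2norm D g"
proof -
  have le2: "AE x in lebesgue_on D. (norm (f x))\<^sup>2 \<le> C\<^sup>2 * (norm (g x))\<^sup>2"
    using le by eventually_elim (metis norm_ge_zero power_mono power_mult_distrib)
  have ig: "integrable (lebesgue_on D) (\<lambda>x. C\<^sup>2 * (norm (g x))\<^sup>2)"
    using L2_integrable_sq[OF g] by simp
  have if2: "integrable (lebesgue_on D) (\<lambda>x. (norm (f x))\<^sup>2)"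
    by (rule Bochner_Integration.integrable_bound[OF ig]) (use f le2 in auto)
  then show "L2 D f" using f by (simp add: L2_def)
  have "(l2norm D f)\<^sup>2 \<le> (C * l2norm D g)\<^sup>2"
    using integral_mono_AE[OF if2 ig le2] by (simp add: l2norm_sq power_mult_distrib)
  then show "l2norm D f \<le> C * l2norm D g" by (rule power2_le_imp_le) (use C in simp)
qed

lemma L2_lincomb:
  assumes "L2 D f" "L2 D g"
  shows "L2 D (\<lambda>x. a *\<^sub>R f x + b *\<^sub>R g x)"
proof -
  have "integrable (lebesgue_on D) (\<lambda>x. 2 * a\<^sup>2 * (norm (f x))\<^sup>2 + 2 * b\<^sup>2 * (norm (g x))\<^sup>2)"
    using assms by (intro Bochner_Integration.integrable_add integrable_mult_right) (auto simp: L2_def)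
  then have "integrable (lebesgue_on D) (\<lambda>x. (norm (a *\<^sub>R f x + b *\<^sub>R g x))\<^sup>2)"
  proof (rule Bochner_Integration.integrable_bound)
    show "AE x in lebesgue_on D. norm ((norm (a *\<^sub>R f x + b *\<^sub>R g x))\<^sup>2)
        \<le> norm (2 * a\<^sup>2 * (norm (f x))\<^sup>2 + 2 * b\<^sup>2 * (norm (g x))\<^sup>2)"
    proof (rule AE_I2)
      fix x
      have "(norm (a *\<^sub>R f x + b *\<^sub>R g x))\<^sup>2 \<le> (\<bar>a\<bar> * norm (f x) + \<bar>b\<bar> * norm (g x))\<^sup>2"
        by (intro power_mono) (metis norm_scaleR norm_triangle_ineq, simp)
      also have "\<dots> \<le> 2 * (\<bar>a\<bar> * norm (f x))\<^sup>2 + 2 * (\<bar>b\<bar> * norm (g x))\<^sup>2"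
        using zero_le_power2[of "\<bar>a\<bar> * norm (f x) - \<bar>b\<bar> * norm (g x)"]
        unfolding power2_eq_square by (simp add: algebra_simps)
      finally show "norm ((norm (a *\<^sub>R f x + b *\<^sub>R g x))\<^sup>2)
        \<le> norm (2 * a\<^sup>2 * (norm (f x))\<^sup>2 + 2 * b\<^sup>2 * (norm (g x))\<^sup>2)"
        by (simp add: power_mult_distrib)
    qed
  qed (use assms in \<open>auto simp: L2_def intro!: borel_measurable_power borel_measurable_norm borel_measurable_add borel_measurable_scaleR\<close>)
  then show ?thesis using assms
    by (auto simp: L2_def intro!: borel_measurable_add borel_measurable_scaleR)
qed

lemma L2_add: "L2 D f \<Longrightarrow> L2 D g \<Longrightarrow> L2 D (\<lambda>x. f x + g x)"
  using L2_lincomb[of D f g 1 1] by simp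

lemma L2_diff: "L2 D f \<Longrightarrow> L2 D g \<Longrightarrow> L2 D (\<lambda>x. f x - g x)"
  using L2_lincomb[of D f g 1 "-1"] by simp

lemma L2_scaleR: "L2 D f \<Longrightarrow> L2 D (\<lambda>x. a *\<^sub>R f x)"
  using L2_lincomb[of D f f a 0] by simp

lemma L2_inner_integrable:
  assumes "L2 D f" "L2 D g"
  shows "integrable (lebesgue_on D) (\<lambda>x. f x \<bullet> g x)"
proof (rule Bochner_Integration.integrable_bound)
  show "integrable (lebesgue_on D) (\<lambda>x. (norm (f x))\<^sup>2 + (norm (g x))\<^sup>2)"
    using assms by (auto simp: L2_def)
  show "AE x in lebesgue_on D. norm (f x \<bullet> g x) \<le> norm ((norm (f x))\<^sup>2 + (norm (g x))\<^sup>2)"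
  proof (rule AE_I2)
    fix x
    have "\<bar>f x \<bullet> g x\<bar> \<le> norm (f x) * norm (g x)" by (rule Cauchy_Schwarz_ineq2)
    also have "\<dots> \<le> (norm (f x))\<^sup>2 + (norm (g x))\<^sup>2"
      using zero_le_power2[of "norm (f x) - norm (g x)"] zero_le_power2[of "norm (f x)"] zero_le_power2[of "norm (g x)"]
      unfolding power2_diff by linarith
    finally show "norm (f x \<bullet> g x) \<le> norm ((norm (f x))\<^sup>2 + (norm (g x))\<^sup>2)" by simp
  qed
qed (use assms in \<open>auto simp: L2_def intro!: borel_measurable_inner\<close>)

lemma l2inner_commute: "l2inner D f g = l2inner D g f"
  by (simp add: l2inner_def inner_commute)

lemma l2inner_lincomb_left:
  assumes "L2 D f" "L2 D g" "L2 D h"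
  shows "l2inner D (\<lambda>x. a *\<^sub>R f x + b *\<^sub>R g x) h = a * l2inner D f h + b * l2inner D g h"
  using assms by (simp add: l2inner_def inner_add_left L2_inner_integrable)

lemma semi_ip_L2: "semi_ip {f. L2 D f} (\<lambda>a f b g x. a *\<^sub>R f x + b *\<^sub>R g x) (l2inner D)"
  by unfold_locales
    (auto simp: L2_lincomb l2inner_lincomb_left intro: l2inner_commute, simp add: l2inner_self)

lemma l2inner_lincomb_right:
  assumes "L2 D f" "L2 D g" "L2 D h"
  shows "l2inner D h (\<lambda>x. a *\<^sub>R f x + b *\<^sub>R g x) = a * l2inner D h f + b * l2inner D h g"
  using l2inner_lincomb_left[OF assms] by (simp add: l2inner_commute)

lemma l2inner_diff_left: "L2 D f \<Longrightarrow> L2 D g \<Longrightarrow> L2 D h \<Longrightarrow> l2inner D (\<lambda>x. f x - g x) h = l2inner D f h - l2inner D g h"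
  using l2inner_lincomb_left[of D f g h 1 "-1"] by simp

lemma l2inner_diff_right: "L2 D f \<Longrightarrow> L2 D g \<Longrightarrow> L2 D h \<Longrightarrow> l2inner D h (\<lambda>x. f x - g x) = l2inner D h f - l2inner D h g"
  using l2inner_lincomb_right[of D f g h 1 "-1"] by simp

lemma l2inner_add_left: "L2 D f \<Longrightarrow> L2 D g \<Longrightarrow> L2 D h \<Longrightarrow> l2inner D (\<lambda>x. f x + g x) h = l2inner D f h + l2inner D g h"
  using l2inner_lincomb_left[of D f g h 1 1] by simp

lemma l2inner_add_right: "L2 D f \<Longrightarrow> L2 D g \<Longrightarrow> L2 D h \<Longrightarrow> l2inner D h (\<lambda>x. f x + g x) = l2inner D h f + l2inner D h g"
  using l2inner_lincomb_right[of D f g h 1 1] by simp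

lemma semi_ip_nr_L2: "semi_ip.nr (l2inner D) = (l2norm D :: (real^'n \<Rightarrow> 'b::euclidean_space) \<Rightarrow> real)"
  by (rule ext) (simp add: semi_ip.nr_def[OF semi_ip_L2] l2norm_def)

lemma l2_cauchy_schwarz: "L2 D f \<Longrightarrow> L2 D g \<Longrightarrow> \<bar>l2inner D f g\<bar> \<le> l2norm D f * l2norm D g"
  using semi_ip.cauchy_schwarz[OF semi_ip_L2, of f D g] by (simp add: semi_ip_nr_L2)

lemma l2norm_lincomb: "L2 D f \<Longrightarrow> L2 D g \<Longrightarrow>
    l2norm D (\<lambda>x. a *\<^sub>R f x + b *\<^sub>R g x) \<le> \<bar>a\<bar> * l2norm D f + \<bar>b\<bar> * l2norm D g"
  using semi_ip.nr_triangle[OF semi_ip_L2, of f D g a b] by (simp add: semi_ip_nr_L2)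

lemma l2norm_add: "L2 D f \<Longrightarrow> L2 D g \<Longrightarrow> l2norm D (\<lambda>x. f x + g x) \<le> l2norm D f + l2norm D g"
  using l2norm_lincomb[of D f g 1 1] by simp

lemma l2norm_diff: "L2 D f \<Longrightarrow> L2 D g \<Longrightarrow> l2norm D (\<lambda>x. f x - g x) \<le> l2norm D f + l2norm D g"
  using l2norm_lincomb[of D f g 1 "-1"] by simp

lemma l2norm_minus_commute: "l2norm D (\<lambda>x. f x - g x) = l2norm D (\<lambda>x. g x - f x)"
  by (simp add: l2norm_def l2inner_self norm_minus_commute)

lemma l2norm_diff_triangle:
  assumes "L2 D f" "L2 D g" "L2 D h"
  shows "l2norm D (\<lambda>x. f x - h x) \<le> l2norm D (\<lambda>x. f x - g x) + l2norm D (\<lambda>x. g x - h x)"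
  using l2norm_add[OF L2_diff[OF assms(1,2)] L2_diff[OF assms(2,3)]] by simp

lemma l2norm_le_diff: "L2 D f \<Longrightarrow> L2 D g \<Longrightarrow> l2norm D f \<le> l2norm D g + l2norm D (\<lambda>x. f x - g x)"
  using l2norm_add[of D g "\<lambda>x. f x - g x"] by (simp add: L2_diff)

lemma tendsto_zero_l2norm_iff:
  "((\<lambda>n. l2norm D (f n)) \<longlonglongrightarrow> 0) \<longleftrightarrow> ((\<lambda>n. \<integral>x. (norm (f n x))\<^sup>2 \<partial>lebesgue_on D) \<longlonglongrightarrow> 0)"
proof
  assume "(\<lambda>n. l2norm D (f n)) \<longlonglongrightarrow> 0"
  from tendsto_power[OF this, of 2] show "(\<lambda>n. \<integral>x. (norm (f n x))\<^sup>2 \<partial>lebesgue_on D) \<longlonglongrightarrow> 0"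
    by (simp add: l2norm_sq)
next
  assume "(\<lambda>n. \<integral>x. (norm (f n x))\<^sup>2 \<partial>lebesgue_on D) \<longlonglongrightarrow> 0"
  from tendsto_real_sqrt[OF this] show "(\<lambda>n. l2norm D (f n)) \<longlonglongrightarrow> 0"
    by (simp add: l2norm_def l2inner_self)
qed

section \<open>Matrix fields with the bounds \<alpha> and \<beta>\<close>

lemma measurable_matrix_vector_mult:
  assumes "A \<in> borel_measurable M" "g \<in> borel_measurable M"
  shows "(\<lambda>x. (A x :: real^'n^'m) *v g x) \<in> borel_measurable M"
proof -
  have "continuous_on UNIV (\<lambda>p::(real^'n^'m) \<times> (real^'n). fst p *v snd p)"
    unfolding matrix_vector_mult_def
    by (intro continuous_on_vec_lambda continuous_intros)
  then show ?thesis using borel_measurable_continuous_Pair[OF assms] by auto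
qed

lemma Mab_measurable: "Mab \<alpha> \<beta> D A \<Longrightarrow> A \<in> borel_measurable (lebesgue_on D)"
  by (simp add: Mab_def)

lemma norm_matrix_vector_le: "norm (M *v \<xi>) \<le> onorm (\<lambda>\<xi>. (M::real^'n^'m) *v \<xi>) * norm \<xi>"
  by (rule onorm[OF matrix_vector_mul_bounded_linear])

lemma Mab_bounds:
  assumes "Mab \<alpha> \<beta> D A"
  shows "AE x in lebesgue_on D. \<forall>\<xi>. \<alpha> * (norm \<xi>)\<^sup>2 \<le> (A x *v \<xi>) \<bullet> \<xi> \<and> norm (A x *v \<xi>) \<le> \<beta> * norm \<xi>"
proof -
  have "AE x in lebesgue_on D. (\<forall>\<xi>. \<alpha> * (norm \<xi>)\<^sup>2 \<le> (A x *v \<xi>) \<bullet> \<xi>) \<and> onorm (\<lambda>\<xi>. A x *v \<xi>) \<le> \<beta>"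
    using assms by (simp add: Mab_def)
  then show ?thesis
  proof eventually_elim
    case (elim x)
    then show ?case using norm_matrix_vector_le[of "A x"] mult_right_mono[OF conjunct2[OF elim] norm_ge_zero]
      by (blast intro: order_trans)
  qed
qed

lemma Mab_L2:
  assumes A: "Mab \<alpha> \<beta> D A" and g: "L2 D g" and b: "0 \<le> \<beta>"
  shows "L2 D (\<lambda>x. A x *v g x)" "l2norm D (\<lambda>x. A x *v g x) \<le> \<beta> * l2norm D g"
proof -
  have "AE x in lebesgue_on D. norm (A x *v g x) \<le> \<beta> * norm (g x)"
    using Mab_bounds[OF A] by eventually_elim auto
  then show "L2 D (\<lambda>x. A x *v g x)" "l2norm D (\<lambda>x. A x *v g x) \<le> \<beta> * l2norm D g"
    using L2_bound[OF g measurable_matrix_vector_mult[OF Mab_measurable[OF A] L2_measurable[OF g]]] b by auto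
qed

lemma Mab_coercive:
  assumes A: "Mab \<alpha> \<beta> D A" and g: "L2 D g" and b: "0 \<le> \<beta>"
  shows "\<alpha> * (l2norm D g)\<^sup>2 \<le> l2inner D (\<lambda>x. A x *v g x) g"
proof -
  have "(\<integral>x. \<alpha> * (norm (g x))\<^sup>2 \<partial>lebesgue_on D) \<le> (\<integral>x. (A x *v g x) \<bullet> g x \<partial>lebesgue_on D)"
  proof (rule integral_mono_AE)
    show "AE x in lebesgue_on D. \<alpha> * (norm (g x))\<^sup>2 \<le> (A x *v g x) \<bullet> g x"
      using Mab_bounds[OF A] by eventually_elim auto
  qed (use g L2_inner_integrable[OF Mab_L2(1)[OF A g b] g] in \<open>auto simp: L2_def\<close>)
  then show ?thesis by (simp add: l2norm_sq l2inner_def)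
qed

section \<open>Completeness of square integrable fields\<close>

lemma L1_le_l2norm:
  assumes D: "D \<in> lmeasurable" and f: "L2 D f"
  shows "integrable (lebesgue_on D) (\<lambda>x. norm (f x))"
    "(\<integral>x. norm (f x) \<partial>lebesgue_on D) \<le> sqrt (measure lebesgue D) * l2norm D f"
proof -
  have one: "L2 D (\<lambda>x. 1::real)"
    using D by (auto simp: L2_def finite_measure.integrable_const finite_measure_lebesgue_on)
  have nf: "L2 D (\<lambda>x. norm (f x))" using f by (auto simp: L2_def)
  show "integrable (lebesgue_on D) (\<lambda>x. norm (f x))"
    using L2_inner_integrable[OF nf one] by simp
  have "l2norm D (\<lambda>x. 1::real) = sqrt (measure lebesgue D)"
    using D by (simp add: l2norm_def l2inner_def measure_restrict_space fmeasurableD space_restrict_space)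
  moreover have "l2norm D (\<lambda>x. norm (f x)) = l2norm D f" by (simp add: l2norm_def l2inner_self)
  ultimately show "(\<integral>x. norm (f x) \<partial>lebesgue_on D) \<le> sqrt (measure lebesgue D) * l2norm D f"
    using l2_cauchy_schwarz[OF nf one] by (simp add: l2inner_def mult.commute)
qed

lemma l2norm_nn: "L2 D f \<Longrightarrow> (\<integral>\<^sup>+x. ennreal ((norm (f x))\<^sup>2) \<partial>lebesgue_on D) = ennreal ((l2norm D f)\<^sup>2)"
  by (simp add: l2norm_sq nn_integral_eq_integral L2_integrable_sq)

text \<open>Fatou's lemma for the squared norms. Only a bound on a tail is asked for, because that
  is what a Cauchy condition supplies.\<close>

lemma L2_fatou:
  assumes Y: "\<And>i::nat. L2 D (Y i)" and w: "w \<in> borel_measurable (lebesgue_on D)"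
    and lim: "AE x in lebesgue_on D. (\<lambda>i. Y i x) \<longlonglongrightarrow> w x"
    and bd: "\<And>i. i \<ge> N \<Longrightarrow> l2norm D (Y i) \<le> e"
  shows "L2 D w" "l2norm D w \<le> e"
proof -
  have e: "0 \<le> e" using bd[of N] l2norm_nonneg[of D "Y N"] by linarith
  have "(\<integral>\<^sup>+x. ennreal ((norm (w x))\<^sup>2) \<partial>lebesgue_on D) = (\<integral>\<^sup>+x. liminf (\<lambda>i. ennreal ((norm (Y i x))\<^sup>2)) \<partial>lebesgue_on D)"
  proof (rule nn_integral_cong_AE, use lim in eventually_elim)
    case (elim x)
    have "(\<lambda>i. ennreal ((norm (Y i x))\<^sup>2)) \<longlonglongrightarrow> ennreal ((norm (w x))\<^sup>2)"
      using elim by (intro tendsto_ennrealI tendsto_intros)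
    from lim_imp_Liminf[OF trivial_limit_sequentially this] show ?case by simp
  qed
  also have "\<dots> \<le> liminf (\<lambda>i. \<integral>\<^sup>+x. ennreal ((norm (Y i x))\<^sup>2) \<partial>lebesgue_on D)"
    using L2_measurable[OF Y] by (intro nn_integral_liminf) auto
  also have "\<dots> = liminf (\<lambda>i. ennreal ((l2norm D (Y i))\<^sup>2))" by (simp add: l2norm_nn Y)
  also have "\<dots> \<le> limsup (\<lambda>i. ennreal ((l2norm D (Y i))\<^sup>2))" by (rule Liminf_le_Limsup) simp
  also have "\<dots> \<le> ennreal (e\<^sup>2)"
    by (rule Limsup_bounded) (auto simp: eventually_sequentially intro!: exI[of _ N] ennreal_leI power_mono bd)
  finally have le: "(\<integral>\<^sup>+x. ennreal ((norm (w x))\<^sup>2) \<partial>lebesgue_on D) \<le> ennreal (e\<^sup>2)" .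
  then have "(\<integral>\<^sup>+x. ennreal ((norm (w x))\<^sup>2) \<partial>lebesgue_on D) < \<infinity>" by (simp add: le_less_trans)
  then have "integrable (lebesgue_on D) (\<lambda>x. (norm (w x))\<^sup>2)" using w by (intro integrableI_nonneg) auto
  then show L: "L2 D w" using w by (simp add: L2_def)
  from le have "(l2norm D w)\<^sup>2 \<le> e\<^sup>2" unfolding l2norm_nn[OF L] by (simp add: ennreal_le_iff)
  then show "l2norm D w \<le> e" using e by (rule power2_le_imp_le)
qed

text \<open>The finite measure of \<open>D\<close> turns \<open>L\<^sup>2\<close> gaps into
  \<open>L\<^sup>1\<close> gaps. Along a rapidly Cauchy subsequence the increments are then summable
  at almost every point, which gives a pointwise limit.\<close>

lemma L2_complete:
  fixes X :: "nat \<Rightarrow> real^'n \<Rightarrow> 'b::euclidean_space"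
  assumes D: "D \<in> lmeasurable" and X: "\<And>n. L2 D (X n)"
    and cauchy: "\<And>e. e > 0 \<Longrightarrow> \<exists>N. \<forall>m\<ge>N. \<forall>n\<ge>N. l2norm D (\<lambda>x. X m x - X n x) < e"
  obtains w where "L2 D w" "(\<lambda>n. l2norm D (\<lambda>x. X n x - w x)) \<longlonglongrightarrow> 0"
proof -
  have "\<exists>N. \<forall>m\<ge>N. \<forall>n\<ge>N. l2norm D (\<lambda>x. X m x - X n x) < (1/2)^i" for i :: nat by (intro cauchy) simp
  then obtain R where R: "\<And>i m n. m \<ge> R i \<Longrightarrow> n \<ge> R i \<Longrightarrow> l2norm D (\<lambda>x. X m x - X n x) < (1/2)^i" by metis
  \<comment> \<open>The running maximum places both \<open>r i\<close> and \<open>r (Suc i)\<close>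
    beyond \<open>R i\<close>; the summand \<open>i\<close> makes the subsequence pass every
    threshold.\<close>
  define r where "r i = Max (R ` {..i}) + i" for i
  have r: "r i \<ge> R i" "r i \<ge> i" "r (Suc i) \<ge> R i" for i
    by (auto simp: r_def intro!: trans_le_add1 le_SucI Max_ge)
  define Y where "Y i = X (r i)" for i
  have Y: "L2 D (Y i)" for i by (simp add: Y_def X)
  have mY: "(\<lambda>x. Y i x) \<in> borel_measurable (lebesgue_on D)" for i using L2_measurable[OF Y] .
  define c where "c = sqrt (measure lebesgue D)"
  have step: "(\<integral>\<^sup>+x. ennreal (norm (Y (Suc i) x - Y i x)) \<partial>lebesgue_on D) \<le> ennreal (c * (1/2)^i)" for i
  proof -
    have "(\<integral>\<^sup>+x. ennreal (norm (Y (Suc i) x - Y i x)) \<partial>lebesgue_on D) = ennreal (\<integral>x. norm (Y (Suc i) x - Y i x) \<partial>lebesgue_on D)"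
      using L1_le_l2norm(1)[OF D L2_diff[OF Y Y]] by (intro nn_integral_eq_integral) auto
    also have "\<dots> \<le> ennreal (c * l2norm D (\<lambda>x. Y (Suc i) x - Y i x))"
      unfolding c_def by (intro ennreal_leI L1_le_l2norm(2)[OF D] L2_diff Y)
    also have "\<dots> \<le> ennreal (c * (1/2)^i)"
      using R[OF r(3)[of i] r(1)[of i]] by (intro ennreal_leI mult_left_mono) (auto simp: Y_def c_def)
    finally show ?thesis .
  qed
  have "(\<integral>\<^sup>+x. (\<Sum>i. ennreal (norm (Y (Suc i) x - Y i x))) \<partial>lebesgue_on D)
      = (\<Sum>i. \<integral>\<^sup>+x. ennreal (norm (Y (Suc i) x - Y i x)) \<partial>lebesgue_on D)"
    using mY by (intro nn_integral_suminf) auto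
  also have "\<dots> \<le> (\<Sum>i. ennreal (c * (1/2)^i))" by (intro suminf_le step) auto
  also have "\<dots> = ennreal (\<Sum>i. c * (1/2)^i)"
    by (intro suminf_ennreal2) (auto simp: c_def intro!: summable_mult summable_geometric)
  also have "\<dots> < \<infinity>" by simp
  finally have "(\<integral>\<^sup>+x. (\<Sum>i. ennreal (norm (Y (Suc i) x - Y i x))) \<partial>lebesgue_on D) \<noteq> \<infinity>"
    by (rule less_imp_neq)
  then have "AE x in lebesgue_on D. (\<Sum>i. ennreal (norm (Y (Suc i) x - Y i x))) \<noteq> \<infinity>"
    using mY by (intro nn_integral_PInf_AE) auto
  then have conv: "AE x in lebesgue_on D. (\<lambda>i. Y i x) \<longlonglongrightarrow> lim (\<lambda>i. Y i x)"
  proof eventually_elim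
    case (elim x)
    have "summable (\<lambda>i. norm (Y (Suc i) x - Y i x))"
      using elim by (intro summable_suminf_not_top) auto
    then have "summable (\<lambda>i. Y (Suc i) x - Y i x)" by (rule summable_norm_cancel)
    then have "convergent (\<lambda>n. \<Sum>i<n. (Y (Suc i) x - Y i x))" by (simp add: summable_iff_convergent)
    then have "convergent (\<lambda>n. Y n x - Y 0 x)" by (simp only: sum_lessThan_telescope[of "\<lambda>n. Y n x"])
    then have "convergent (\<lambda>n. (Y n x - Y 0 x) + Y 0 x)" by (rule convergent_add[OF _ convergent_const])
    then have "convergent (\<lambda>n. Y n x)" by (simp only: diff_add_cancel)
    then show ?case by (rule convergent_LIMSEQ_iff[THEN iffD1])
  qed
  define w where "w x = lim (\<lambda>i. Y i x)" for x
  have mw: "w \<in> borel_measurable (lebesgue_on D)"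
    unfolding w_def by (rule borel_measurable_lim_metric) (rule mY)
  \<comment> \<open>\<open>X n\<close> is compared with the limit directly: it is close to all late
    members of the subsequence, and Fatou carries that bound to their pointwise limit.\<close>
  have est: "L2 D (\<lambda>x. X n x - w x) \<and> l2norm D (\<lambda>x. X n x - w x) \<le> (1/2)^i" if "n \<ge> R i" for n i
  proof -
    have "AE x in lebesgue_on D. (\<lambda>j. X n x - Y j x) \<longlonglongrightarrow> X n x - w x"
      using conv by eventually_elim (auto simp: w_def intro!: tendsto_intros)
    moreover have "l2norm D (\<lambda>x. X n x - Y j x) \<le> (1/2)^i" if "j \<ge> R i" for j
      using R[of i n "r j"] r(2)[of j] that \<open>n \<ge> R i\<close> by (auto simp: Y_def)
    ultimately show ?thesis
      using L2_fatou[of D "\<lambda>j x. X n x - Y j x" "\<lambda>x. X n x - w x" "R i" "(1/2)^i"] X Y mw L2_measurable[OF X]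
      by (auto intro: L2_diff borel_measurable_diff)
  qed
  have "L2 D w" using L2_diff[OF X[of "R 0"] conjunct1[OF est[of 0 "R 0"]]] by simp
  moreover have "(\<lambda>n. l2norm D (\<lambda>x. X n x - w x)) \<longlonglongrightarrow> 0"
  proof (rule LIMSEQ_I)
    fix e :: real assume "e > 0"
    then obtain i where "(1/2)^i < e" using real_arch_pow_inv[of e "1/2"] by auto
    then show "\<exists>N. \<forall>n\<ge>N. norm (l2norm D (\<lambda>x. X n x - w x) - 0) < e"
      using est by (intro exI[of _ "R i"]) force
  qed
  ultimately show ?thesis using that by blast
qed

section \<open>Poincare and Ehrling inequalities for continuously differentiable functions\<close>

definition C1 :: "('a::euclidean_space \<Rightarrow> real) \<Rightarrow> ('a \<Rightarrow> 'a) \<Rightarrow> bool" where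
  "C1 \<phi> d\<phi> \<longleftrightarrow> (\<forall>x. (\<phi> has_derivative (\<lambda>h. d\<phi> x \<bullet> h)) (at x)) \<and> continuous_on UNIV d\<phi>"

lemma C1_deriv: "C1 \<phi> d\<phi> \<Longrightarrow> (\<phi> has_derivative (\<lambda>h. d\<phi> x \<bullet> h)) (at x)"
  by (simp add: C1_def)

lemma C1_continuous: "C1 \<phi> d\<phi> \<Longrightarrow> continuous_on UNIV \<phi>"
  by (meson C1_deriv has_derivative_continuous continuous_at_imp_continuous_on)

lemma C1_continuous_grad: "C1 \<phi> d\<phi> \<Longrightarrow> continuous_on UNIV d\<phi>"
  by (simp add: C1_def)

lemma C1_borel: "C1 \<phi> d\<phi> \<Longrightarrow> \<phi> \<in> borel_measurable borel" "C1 \<phi> d\<phi> \<Longrightarrow> d\<phi> \<in> borel_measurable borel"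
  by (auto intro: borel_measurable_continuous_onI C1_continuous C1_continuous_grad)

lemma C1_const: "C1 (\<lambda>x. c) (\<lambda>x. 0)"
  by (simp add: C1_def)

lemma C1_mult: "C1 f f' \<Longrightarrow> C1 g g' \<Longrightarrow> C1 (\<lambda>x. f x * g x) (\<lambda>x. g x *\<^sub>R f' x + f x *\<^sub>R g' x)"
  using C1_continuous[of f f'] C1_continuous[of g g'] unfolding C1_def
  by (auto simp: inner_add_left intro!: derivative_eq_intros continuous_intros)

lemma C1_lincomb: "C1 f f' \<Longrightarrow> C1 g g' \<Longrightarrow> C1 (\<lambda>x. a * f x + b * g x) (\<lambda>x. a *\<^sub>R f' x + b *\<^sub>R g' x)"
  unfolding C1_def by (auto simp: inner_add_left intro!: derivative_eq_intros continuous_intros)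

lemma C1_comp:
  assumes "C1 f f'" "\<And>t. (s has_real_derivative s' t) (at t)" "continuous_on UNIV s'"
  shows "C1 (\<lambda>x. s (f x)) (\<lambda>x. s' (f x) *\<^sub>R f' x)"
proof -
  have "((\<lambda>x. s (f x)) has_derivative (\<lambda>h. (s' (f x) *\<^sub>R f' x) \<bullet> h)) (at x)" for x
    using has_derivative_compose[OF C1_deriv[OF assms(1)], of s "(*) (s' (f x))" x] assms(2)[of "f x"]
    by (simp add: has_field_derivative_def)
  moreover have "continuous_on UNIV (\<lambda>x. s' (f x) *\<^sub>R f' x)"
    using continuous_on_compose2[OF assms(3) C1_continuous[OF assms(1)]] C1_continuous_grad[OF assms(1)]
    by (intro continuous_intros) auto
  ultimately show ?thesis by (simp add: C1_def)
qed

text \<open>The fundamental theorem of calculus on a segment, written with nonnegative integrals so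
  that the order of integration can later be changed without integrability conditions.\<close>

lemma C1_increment_L1:
  assumes f: "C1 f f'"
  shows "ennreal \<bar>f (x + h) - f x\<bar> \<le> (\<integral>\<^sup>+t. ennreal (norm (f' (x + t *\<^sub>R h)) * norm h) * indicator {0..1} t \<partial>lborel)"
proof -
  have cont: "continuous_on {0..1} (\<lambda>t. f' (x + t *\<^sub>R h) \<bullet> h)"
    by (rule continuous_on_inner[OF continuous_on_compose2[OF C1_continuous_grad[OF f]]]) (auto intro!: continuous_intros)
  have der: "((\<lambda>t. f (x + t *\<^sub>R h)) has_vector_derivative f' (x + t *\<^sub>R h) \<bullet> h) (at t within {0..1})" for t
  proof -
    have "((\<lambda>t. x + t *\<^sub>R h) has_derivative (\<lambda>t. t *\<^sub>R h)) (at t)" by (auto intro!: derivative_eq_intros)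
    from has_derivative_compose[OF this C1_deriv[OF f]]
    show ?thesis by (simp add: has_vector_derivative_def has_derivative_at_withinI)
  qed
  have eq: "(\<integral>t. indicator {0..1} t *\<^sub>R (f' (x + t *\<^sub>R h) \<bullet> h) \<partial>lborel) = f (x + h) - f x"
    using integral_FTC_Icc[OF _ der cont] by simp
  have "ennreal \<bar>f (x + h) - f x\<bar> \<le> (\<integral>\<^sup>+t. ennreal (norm (indicator {0..1} t *\<^sub>R (f' (x + t *\<^sub>R h) \<bullet> h))) \<partial>lborel)"
    using integral_norm_bound_ennreal[OF borel_integrable_compact[OF _ cont]] eq by simp
  also have "\<dots> \<le> (\<integral>\<^sup>+t. ennreal (norm (f' (x + t *\<^sub>R h)) * norm h) * indicator {0..1} t \<partial>lborel)"
    by (intro nn_integral_mono) (auto simp: indicator_def Cauchy_Schwarz_ineq2 intro!: ennreal_leI)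
  finally show ?thesis .
qed

lemma C1_increment_L2:
  assumes f: "C1 f f'"
  shows "ennreal ((f (x + h) - f x)\<^sup>2) \<le> (\<integral>\<^sup>+t. ennreal ((norm h)\<^sup>2) * ennreal ((norm (f' (x + t *\<^sub>R h)))\<^sup>2) * indicator {0..1} t \<partial>lborel)"
proof -
  note [measurable] = C1_borel[OF f]
  let ?a = "\<lambda>t. ennreal (norm (f' (x + t *\<^sub>R h)) * norm h)"
  have "ennreal ((f (x + h) - f x)\<^sup>2) = (ennreal \<bar>f (x + h) - f x\<bar>)\<^sup>2"
    by (simp add: ennreal_power)
  also have "\<dots> \<le> (\<integral>\<^sup>+t. ?a t * indicator {0..1} t \<partial>lborel)\<^sup>2"
    by (intro power_mono C1_increment_L1 f) auto
  \<comment> \<open>The indicator is duplicated so that one copy can be the second factor in the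
    Cauchy-Schwarz inequality, where it integrates to 1.\<close>
  also have "\<dots> = (\<integral>\<^sup>+t. (?a t * indicator {0..1} t) * indicator {0..1} t \<partial>lborel)\<^sup>2"
    by (intro arg_cong[of _ _ "\<lambda>z. z\<^sup>2"] nn_integral_cong) (auto simp: indicator_def)
  also have "\<dots> \<le> (\<integral>\<^sup>+t. (?a t * indicator {0..1} t)\<^sup>2 \<partial>lborel) * (\<integral>\<^sup>+t. (indicator {0..1::real} t)\<^sup>2 \<partial>lborel)"
    by (rule Cauchy_Schwarz_nn_integral) measurable
  also have "(\<integral>\<^sup>+t. (indicator {0..1::real} t)\<^sup>2 \<partial>lborel) = (\<integral>\<^sup>+t. indicator {0..1::real} t \<partial>lborel)"
    by (intro nn_integral_cong) (auto simp: indicator_def)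
  also have "\<dots> = 1" by simp
  also have "(\<integral>\<^sup>+t. (?a t * indicator {0..1} t)\<^sup>2 \<partial>lborel)
     = (\<integral>\<^sup>+t. ennreal ((norm h)\<^sup>2) * ennreal ((norm (f' (x + t *\<^sub>R h)))\<^sup>2) * indicator {0..1} t \<partial>lborel)"
    by (intro nn_integral_cong) (auto simp: indicator_def ennreal_power power_mult_distrib mult.commute simp flip: ennreal_mult)
  finally show ?thesis by simp
qed

lemma nn_integral_translate:
  fixes f :: "'a::euclidean_space \<Rightarrow> ennreal"
  assumes "f \<in> borel_measurable borel"
  shows "(\<integral>\<^sup>+x. f (x + c) \<partial>lborel) = (\<integral>\<^sup>+x. f x \<partial>lborel)"
proof -
  have "(\<integral>\<^sup>+x. f x \<partial>lborel) = (\<integral>\<^sup>+x. f x \<partial>distr lborel borel ((+) c))" by (simp add: lborel_distr_plus)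
  also have "\<dots> = (\<integral>\<^sup>+x. f (c + x) \<partial>lborel)" using assms by (subst nn_integral_distr) auto
  finally show ?thesis by (simp add: add.commute)
qed

lemma nn_integral_affine:
  fixes f :: "'a::euclidean_space \<Rightarrow> ennreal"
  assumes "f \<in> borel_measurable borel" "c \<noteq> 0"
  shows "(\<integral>\<^sup>+x. f x \<partial>lborel) = ennreal (\<bar>c\<bar> ^ DIM('a)) * (\<integral>\<^sup>+x. f (a + c *\<^sub>R x) \<partial>lborel)"
proof -
  have "(\<integral>\<^sup>+x. f x \<partial>lborel) = (\<integral>\<^sup>+x. f x \<partial>density (distr lborel borel (\<lambda>x. a + c *\<^sub>R x)) (\<lambda>_. \<bar>c\<bar> ^ DIM('a)))"
    using lborel_affine[OF assms(2), of a] by simp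
  also have "\<dots> = ennreal (\<bar>c\<bar> ^ DIM('a)) * (\<integral>\<^sup>+x. f (a + c *\<^sub>R x) \<partial>lborel)"
    using assms(1) by (simp add: nn_integral_density nn_integral_distr nn_integral_cmult)
  finally show ?thesis .
qed

text \<open>After exchanging the integrals, the substitution \<open>y = x + t *\<^sub>R h\<close>
  carries \<open>A\<close> into \<open>B\<close> for each fixed \<open>t\<close>, and the bound no
  longer depends on \<open>t\<close>.\<close>

lemma C1_translate_L2:
  assumes f: "C1 f f'" and A[measurable]: "A \<in> sets borel" and B[measurable]: "B \<in> sets borel"
    and AB: "\<And>t x. 0 \<le> t \<Longrightarrow> t \<le> 1 \<Longrightarrow> x \<in> A \<Longrightarrow> x + t *\<^sub>R h \<in> B"
  shows "(\<integral>\<^sup>+x. ennreal ((f (x + h) - f x)\<^sup>2) * indicator A x \<partial>lborel)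
    \<le> ennreal ((norm h)\<^sup>2) * (\<integral>\<^sup>+x. ennreal ((norm (f' x))\<^sup>2) * indicator B x \<partial>lborel)"
proof -
  note [measurable] = C1_borel[OF f]
  let ?F = "\<lambda>y. ennreal ((norm h)\<^sup>2) * ennreal ((norm (f' y))\<^sup>2)"
  have "(\<integral>\<^sup>+x. ennreal ((f (x + h) - f x)\<^sup>2) * indicator A x \<partial>lborel)
    \<le> (\<integral>\<^sup>+x. (\<integral>\<^sup>+t. ?F (x + t *\<^sub>R h) * indicator {0..1} t \<partial>lborel) * indicator A x \<partial>lborel)"
    by (intro nn_integral_mono mult_right_mono C1_increment_L2 f) auto
  also have "\<dots> = (\<integral>\<^sup>+x. (\<integral>\<^sup>+t. ?F (x + t *\<^sub>R h) * indicator {0..1} t * indicator A x \<partial>lborel) \<partial>lborel)"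
    by (intro nn_integral_cong nn_integral_multc[symmetric]) measurable
  also have "\<dots> = (\<integral>\<^sup>+t. (\<integral>\<^sup>+x. ?F (x + t *\<^sub>R h) * indicator {0..1} t * indicator A x \<partial>lborel) \<partial>lborel)"
    by (rule lborel_pair.Fubini'[of "\<lambda>t x. ?F (x + t *\<^sub>R h) * indicator {0..1} t * indicator A x"]) measurable
  also have "\<dots> \<le> (\<integral>\<^sup>+t. (\<integral>\<^sup>+x. ?F x * indicator B x \<partial>lborel) * indicator {0..1::real} t \<partial>lborel)"
  proof (rule nn_integral_mono)
    fix t :: real
    have "(\<integral>\<^sup>+x. ?F (x + t *\<^sub>R h) * indicator {0..1} t * indicator A x \<partial>lborel)
       \<le> (\<integral>\<^sup>+x. ?F (x + t *\<^sub>R h) * indicator B (x + t *\<^sub>R h) * indicator {0..1} t \<partial>lborel)"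
      using AB by (intro nn_integral_mono) (auto simp: indicator_def)
    also have "\<dots> = (\<integral>\<^sup>+x. ?F (x + t *\<^sub>R h) * indicator B (x + t *\<^sub>R h) \<partial>lborel) * indicator {0..1} t"
      by (intro nn_integral_multc) measurable
    also have "(\<integral>\<^sup>+x. ?F (x + t *\<^sub>R h) * indicator B (x + t *\<^sub>R h) \<partial>lborel) = (\<integral>\<^sup>+x. ?F x * indicator B x \<partial>lborel)"
      by (rule nn_integral_translate) measurable
    finally show "(\<integral>\<^sup>+x. ?F (x + t *\<^sub>R h) * indicator {0..1} t * indicator A x \<partial>lborel)
       \<le> (\<integral>\<^sup>+x. ?F x * indicator B x \<partial>lborel) * indicator {0..1} t" .
  qed
  also have "\<dots> = (\<integral>\<^sup>+x. ?F x * indicator B x \<partial>lborel)"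
    by (subst nn_integral_cmult) auto
  also have "\<dots> = ennreal ((norm h)\<^sup>2) * (\<integral>\<^sup>+x. ennreal ((norm (f' x))\<^sup>2) * indicator B x \<partial>lborel)"
    by (subst nn_integral_cmult[symmetric]) (auto simp: mult.assoc)
  finally show ?thesis .
qed

lemma borel_measurable_midpoint [measurable (raw)]:
  fixes f g :: "'b \<Rightarrow> 'a::euclidean_space"
  shows "f \<in> borel_measurable M \<Longrightarrow> g \<in> borel_measurable M \<Longrightarrow> (\<lambda>x. midpoint (f x) (g x)) \<in> borel_measurable M"
  unfolding midpoint_def by measurable

text \<open>Connecting \<open>y\<close> to the midpoint of \<open>x\<close> and \<open>y\<close> only, the points met have weight at least one half on \<open>y\<close>,
  so that the change of variables in \<open>y\<close> has bounded Jacobian.\<close>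
lemma C1_poincare_L1_double:
  fixes f :: "'a::euclidean_space \<Rightarrow> real"
  assumes f: "C1 f f'" and B[measurable]: "B \<in> sets borel" and cB: "convex B"
    and dB: "\<And>x y. x \<in> B \<Longrightarrow> y \<in> B \<Longrightarrow> norm (x - y) \<le> R"
  shows "(\<integral>\<^sup>+x. (\<integral>\<^sup>+y. ennreal \<bar>f x - f y\<bar> * indicator B y \<partial>lborel) * indicator B x \<partial>lborel)
    \<le> ennreal (2 ^ DIM('a) * R) * emeasure lborel B * (\<integral>\<^sup>+x. ennreal (norm (f' x)) * indicator B x \<partial>lborel)"
proof (cases "B = {}")
  case False
  then have R: "0 \<le> R" using dB by fastforce
  note [measurable] = C1_borel[OF f]
  let ?G = "\<integral>\<^sup>+x. ennreal (norm (f' x)) * indicator B x \<partial>lborel"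
  have half: "(\<integral>\<^sup>+y. ennreal \<bar>f (midpoint x y) - f y\<bar> * indicator B y \<partial>lborel) \<le> ennreal (2 ^ DIM('a) * R / 2) * ?G"
    if x: "x \<in> B" for x
  proof -
    let ?H = "\<lambda>y t. ennreal (norm (f' ((1 - t/2) *\<^sub>R y + (t/2) *\<^sub>R x)))"
    have "(\<integral>\<^sup>+y. ennreal \<bar>f (midpoint x y) - f y\<bar> * indicator B y \<partial>lborel)
      \<le> (\<integral>\<^sup>+y. (\<integral>\<^sup>+t. ennreal (R/2) * (?H y t * indicator B y) * indicator {0..1} t \<partial>lborel) \<partial>lborel)"
    proof (rule nn_integral_mono)
      fix y
      have e: "y + t *\<^sub>R (midpoint x y - y) = (1 - t/2) *\<^sub>R y + (t/2) *\<^sub>R x" for t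
        by (simp add: midpoint_def algebra_simps flip: scaleR_add_left)
      have "ennreal \<bar>f (midpoint x y) - f y\<bar> \<le> (\<integral>\<^sup>+t. ennreal (norm (f' ((1 - t/2) *\<^sub>R y + (t/2) *\<^sub>R x)) * norm (midpoint x y - y)) * indicator {0..1} t \<partial>lborel)"
        using C1_increment_L1[OF f, of y "midpoint x y - y"] by (simp add: e)
      also have "\<dots> \<le> (\<integral>\<^sup>+t. ennreal (R/2) * ?H y t * indicator {0..1} t \<partial>lborel)" if "y \<in> B"
      proof -
        have "midpoint x y - y = (1/2) *\<^sub>R (x - y)" by (simp add: midpoint_def algebra_simps flip: scaleR_add_left)
        then have "norm (midpoint x y - y) \<le> R / 2" using dB[OF x that] by simp
        then show ?thesis using R
          by (intro nn_integral_mono mult_right_mono)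
            (auto simp: ennreal_mult[symmetric] mult.commute[of "R / 2"] simp del: times_divide_eq_left times_divide_eq_right intro!: ennreal_leI mult_left_mono)
      qed
      finally show "ennreal \<bar>f (midpoint x y) - f y\<bar> * indicator B y
        \<le> (\<integral>\<^sup>+t. ennreal (R/2) * (?H y t * indicator B y) * indicator {0..1} t \<partial>lborel)"
        by (cases "y \<in> B") auto
    qed
    also have "\<dots> = (\<integral>\<^sup>+t. (\<integral>\<^sup>+y. ennreal (R/2) * (?H y t * indicator B y) * indicator {0..1} t \<partial>lborel) \<partial>lborel)"
      by (rule lborel_pair.Fubini'[of "\<lambda>t y. ennreal (R/2) * (?H y t * indicator B y) * indicator {0..1} t"]) measurable
    also have "\<dots> \<le> (\<integral>\<^sup>+t. ennreal (R/2) * (ennreal (2 ^ DIM('a)) * ?G) * indicator {0..1::real} t \<partial>lborel)"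
    proof (rule nn_integral_mono)
      fix t :: real
      have "(\<integral>\<^sup>+y. ?H y t * indicator B y \<partial>lborel) \<le> ennreal (2 ^ DIM('a)) * ?G" if t: "t \<in> {0..1}"
      proof -
        have inB: "(1 - t/2) *\<^sub>R y + (t/2) *\<^sub>R x \<in> B" if "y \<in> B" for y
          using convexD[OF cB that x] t by auto
        have "(\<integral>\<^sup>+y. ?H y t * indicator B y \<partial>lborel)
          \<le> (\<integral>\<^sup>+y. ?H y t * indicator B ((1 - t/2) *\<^sub>R y + (t/2) *\<^sub>R x) \<partial>lborel)"
          using inB by (intro nn_integral_mono) (auto simp: indicator_def)
        \<comment> \<open>A factor 1, split so that one part is the Jacobian expected by
          \<open>nn_integral_affine\<close>. The other part is at most \<open>2 ^ DIM('a)\<close>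
          because \<open>1 - t/2\<close> is at least one half.\<close>
        also have "\<dots> = ennreal ((1 / (1 - t/2)) ^ DIM('a)) * (ennreal ((1 - t/2) ^ DIM('a)) *
            (\<integral>\<^sup>+y. ?H y t * indicator B ((1 - t/2) *\<^sub>R y + (t/2) *\<^sub>R x) \<partial>lborel))"
          using t by (simp add: mult.assoc[symmetric] flip: ennreal_mult power_mult_distrib)
        also have "\<dots> = ennreal ((1 / (1 - t/2)) ^ DIM('a)) * ?G"
          using t nn_integral_affine[of "\<lambda>y. ennreal (norm (f' y)) * indicator B y" "1 - t/2" "(t/2) *\<^sub>R x"]
          by (simp add: add.commute)
        also have "\<dots> \<le> ennreal (2 ^ DIM('a)) * ?G"
          using t by (intro mult_right_mono ennreal_leI power_mono) (auto simp: field_simps)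
        finally show ?thesis .
      qed
      moreover have "(\<integral>\<^sup>+y. ennreal (R/2) * (?H y t * indicator B y) * indicator {0..1} t \<partial>lborel)
         = ennreal (R/2) * (\<integral>\<^sup>+y. ?H y t * indicator B y \<partial>lborel) * indicator {0..1} t"
        by (simp add: nn_integral_cmult nn_integral_multc)
      ultimately show "(\<integral>\<^sup>+y. ennreal (R/2) * (?H y t * indicator B y) * indicator {0..1} t \<partial>lborel)
         \<le> ennreal (R/2) * (ennreal (2 ^ DIM('a)) * ?G) * indicator {0..1::real} t"
        by (cases "t \<in> {0..1}") (auto intro!: mult_left_mono)
    qed
    also have "\<dots> = ennreal (R/2) * (ennreal (2 ^ DIM('a)) * ?G)"
      by (subst nn_integral_cmult) auto
    also have "\<dots> = ennreal (2 ^ DIM('a) * R / 2) * ?G"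
      using R by (simp add: mult.assoc[symmetric] ennreal_mult[symmetric] mult.commute)
    finally show ?thesis .
  qed
  let ?J = "\<lambda>x y. ennreal \<bar>f (midpoint x y) - f y\<bar> * indicator B y * indicator B x"
  have "(\<integral>\<^sup>+x. (\<integral>\<^sup>+y. ennreal \<bar>f x - f y\<bar> * indicator B y \<partial>lborel) * indicator B x \<partial>lborel)
     = (\<integral>\<^sup>+x. (\<integral>\<^sup>+y. ennreal \<bar>f x - f y\<bar> * indicator B y * indicator B x \<partial>lborel) \<partial>lborel)"
    by (intro nn_integral_cong nn_integral_multc[symmetric]) measurable
  \<comment> \<open>The triangle inequality through the midpoint. As the midpoint is symmetric in
    its arguments, the second term is the first with \<open>x\<close> and \<open>y\<close>
    exchanged.\<close>
  also have "\<dots> \<le> (\<integral>\<^sup>+x. (\<integral>\<^sup>+y. ?J x y + ?J y x \<partial>lborel) \<partial>lborel)"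
  proof (intro nn_integral_mono)
    fix x y :: 'a
    have "midpoint x y = midpoint y x" by (rule midpoint_sym)
    then have "\<bar>f x - f y\<bar> \<le> \<bar>f (midpoint x y) - f y\<bar> + \<bar>f (midpoint y x) - f x\<bar>" by simp
    then have "ennreal \<bar>f x - f y\<bar> \<le> ennreal \<bar>f (midpoint x y) - f y\<bar> + ennreal \<bar>f (midpoint y x) - f x\<bar>"
      by (simp flip: ennreal_plus)
    then show "ennreal \<bar>f x - f y\<bar> * indicator B y * indicator B x \<le> ?J x y + ?J y x"
      by (auto simp: indicator_def)
  qed
  also have "\<dots> = (\<integral>\<^sup>+x. (\<integral>\<^sup>+y. ?J x y \<partial>lborel) \<partial>lborel) + (\<integral>\<^sup>+x. (\<integral>\<^sup>+y. ?J y x \<partial>lborel) \<partial>lborel)"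
  proof -
    have "(\<integral>\<^sup>+y. ?J x y + ?J y x \<partial>lborel) = (\<integral>\<^sup>+y. ?J x y \<partial>lborel) + (\<integral>\<^sup>+y. ?J y x \<partial>lborel)" for x :: 'a
      by (rule nn_integral_add) measurable
    moreover have "(\<integral>\<^sup>+x. (\<integral>\<^sup>+y. ?J x y \<partial>lborel) + (\<integral>\<^sup>+y. ?J y x \<partial>lborel) \<partial>lborel)
      = (\<integral>\<^sup>+x. (\<integral>\<^sup>+y. ?J x y \<partial>lborel) \<partial>lborel) + (\<integral>\<^sup>+x. (\<integral>\<^sup>+y. ?J y x \<partial>lborel) \<partial>lborel)"
      by (rule nn_integral_add) measurable
    ultimately show ?thesis by simp
  qed
  also have "(\<integral>\<^sup>+x. (\<integral>\<^sup>+y. ?J y x \<partial>lborel) \<partial>lborel) = (\<integral>\<^sup>+x. (\<integral>\<^sup>+y. ?J x y \<partial>lborel) \<partial>lborel)"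
    by (rule lborel_pair.Fubini'[of ?J]) measurable
  also have "(\<integral>\<^sup>+x. (\<integral>\<^sup>+y. ?J x y \<partial>lborel) \<partial>lborel) = (\<integral>\<^sup>+x. (\<integral>\<^sup>+y. ennreal \<bar>f (midpoint x y) - f y\<bar> * indicator B y \<partial>lborel) * indicator B x \<partial>lborel)"
    by (intro nn_integral_cong nn_integral_multc) measurable
  also have "\<dots> \<le> (\<integral>\<^sup>+x. (ennreal (2 ^ DIM('a) * R / 2) * ?G) * indicator B x \<partial>lborel)"
    using half by (intro nn_integral_mono) (auto simp: indicator_def)
  also have "\<dots> = (ennreal (2 ^ DIM('a) * R / 2) * ?G) * emeasure lborel B"
    by (rule nn_integral_cmult_indicator) simp
  finally have "(\<integral>\<^sup>+x. (\<integral>\<^sup>+y. ennreal \<bar>f x - f y\<bar> * indicator B y \<partial>lborel) * indicator B x \<partial>lborel)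
    \<le> (ennreal (2 ^ DIM('a) * R / 2) * ?G) * emeasure lborel B + (ennreal (2 ^ DIM('a) * R / 2) * ?G) * emeasure lborel B"
    by (simp add: add_mono)
  also have "\<dots> = (ennreal (2 ^ DIM('a) * R / 2) + ennreal (2 ^ DIM('a) * R / 2)) * ?G * emeasure lborel B"
    by (simp add: distrib_right)
  also have "(ennreal (2 ^ DIM('a) * R / 2) + ennreal (2 ^ DIM('a) * R / 2)) = ennreal (2 ^ DIM('a) * R)"
    using R by (simp flip: ennreal_plus)
  finally show ?thesis by (simp add: mult_ac)
qed simp

lemma ennreal_power2_sum_le: "((a::ennreal) + b)\<^sup>2 \<le> 2 * a\<^sup>2 + 2 * b\<^sup>2"
proof (cases "a = top \<or> b = top")
  case True
  then show ?thesis by (auto simp: power2_eq_square ennreal_mult_top)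
next
  case False
  then obtain x y where xy: "a = ennreal x" "b = ennreal y" "0 \<le> x" "0 \<le> y"
    by (metis ennreal_cases)
  have "(x + y)\<^sup>2 \<le> 2 * x\<^sup>2 + 2 * y\<^sup>2"
    using zero_le_power2[of "x - y"] by (simp add: power2_eq_square algebra_simps)
  then have "ennreal ((x + y)\<^sup>2) \<le> ennreal (2 * x\<^sup>2 + 2 * y\<^sup>2)" by (rule ennreal_leI)
  moreover have "ennreal (2 * x\<^sup>2 + 2 * y\<^sup>2) = 2 * ennreal (x\<^sup>2) + 2 * ennreal (y\<^sup>2)"
    by (subst ennreal_plus) (auto simp: ennreal_mult)
  ultimately show ?thesis using xy by (simp add: ennreal_power flip: ennreal_plus)
qed

text \<open>The deviation of \<open>f x\<close> from its mean is at most the mean over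
  \<open>y\<close> of the deviation of \<open>f x\<close> from \<open>f y\<close>, so the double
  integral divided by the volume suffices. The factor \<open>2 * r\<close> is the diameter of the
  ball.\<close>

lemma C1_poincare_L1:
  fixes f :: "'a::euclidean_space \<Rightarrow> real"
  assumes f: "C1 f f'" and r: "0 < r"
    and c: "c = (1 / measure lborel (ball x0 r)) * (\<integral>x. indicator (ball x0 r) x * f x \<partial>lborel)"
  shows "(\<integral>\<^sup>+x. ennreal \<bar>f x - c\<bar> * indicator (ball x0 r) x \<partial>lborel)
    \<le> ennreal (2 ^ DIM('a) * (2 * r)) * (\<integral>\<^sup>+x. ennreal (norm (f' x)) * indicator (ball x0 r) x \<partial>lborel)"
proof -
  note [measurable] = C1_borel[OF f]
  let ?B = "ball x0 r"
  define V where "V = measure lborel ?B"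
  have [measurable]: "?B \<in> sets borel" by auto
  have V: "V > 0" using r by (simp add: V_def)
  have eV: "emeasure lborel ?B = ennreal V"
    unfolding V_def using emeasure_lborel_ball_finite[of x0 r] by (intro emeasure_eq_ennreal_measure) auto
  have int: "integrable lborel (\<lambda>x. indicator ?B x * f x)"
  proof -
    have "integrable lborel (\<lambda>x. indicator (cball x0 r) x *\<^sub>R f x)"
      using C1_continuous[OF f] by (intro borel_integrable_compact) (auto intro: continuous_on_subset)
    then have "integrable lborel (\<lambda>x. indicator ?B x *\<^sub>R (indicator (cball x0 r) x *\<^sub>R f x))"
      by (rule integrable_mult_indicator[rotated]) auto
    moreover have e: "(\<lambda>x. indicator ?B x *\<^sub>R (indicator (cball x0 r) x *\<^sub>R f x)) = (\<lambda>x. indicator ?B x * f x)"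
      by (auto simp: fun_eq_iff indicator_def)
    ultimately show ?thesis by (simp only: e)
  qed
  have intc: "integrable lborel (\<lambda>x. indicator ?B x * a)" for a :: real
    using emeasure_lborel_ball_finite[of x0 r] by (intro integrable_mult_left) (auto simp: integrable_indicator_iff)
  have pt: "ennreal \<bar>f x - c\<bar> * ennreal V \<le> (\<integral>\<^sup>+y. ennreal \<bar>f x - f y\<bar> * indicator ?B y \<partial>lborel)" for x
  proof -
    have "(\<integral>y. indicator ?B y * f x - indicator ?B y * f y \<partial>lborel) = V * f x - V * c"
      using int intc V by (subst Bochner_Integration.integral_diff) (auto simp: c V_def)
    then have e: "(\<integral>y. indicator ?B y * (f x - f y) \<partial>lborel) = V * (f x - c)"
      by (simp add: algebra_simps)
    have i2: "integrable lborel (\<lambda>y. indicator ?B y * (f x - f y))"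
      using Bochner_Integration.integrable_diff[OF intc[of "f x"] int] by (simp add: algebra_simps)
    have "ennreal (norm (V * (f x - c))) \<le> (\<integral>\<^sup>+y. ennreal (norm (indicator ?B y * (f x - f y))) \<partial>lborel)"
      using integral_norm_bound_ennreal[OF i2] by (simp add: e)
    also have "\<dots> = (\<integral>\<^sup>+y. ennreal \<bar>f x - f y\<bar> * indicator ?B y \<partial>lborel)"
      by (intro nn_integral_cong) (auto simp: indicator_def)
    finally show ?thesis using V by (simp add: abs_mult ennreal_mult mult.commute)
  qed
  have "(\<integral>\<^sup>+x. ennreal \<bar>f x - c\<bar> * indicator ?B x \<partial>lborel) * ennreal V
      = (\<integral>\<^sup>+x. ennreal \<bar>f x - c\<bar> * ennreal V * indicator ?B x \<partial>lborel)"
    by (subst nn_integral_multc[symmetric]) (auto simp: mult_ac)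
  also have "\<dots> \<le> (\<integral>\<^sup>+x. (\<integral>\<^sup>+y. ennreal \<bar>f x - f y\<bar> * indicator ?B y \<partial>lborel) * indicator ?B x \<partial>lborel)"
    by (intro nn_integral_mono mult_right_mono pt) auto
  also have "\<dots> \<le> ennreal (2 ^ DIM('a) * (2 * r)) * emeasure lborel ?B * (\<integral>\<^sup>+x. ennreal (norm (f' x)) * indicator ?B x \<partial>lborel)"
  proof (rule C1_poincare_L1_double[OF f])
    fix x y assume "x \<in> ?B" "y \<in> ?B"
    then show "norm (x - y) \<le> 2 * r"
      using dist_triangle2[of x y x0] by (simp add: dist_commute dist_norm)
  qed auto
  also have "\<dots> = (ennreal (2 ^ DIM('a) * (2 * r)) * (\<integral>\<^sup>+x. ennreal (norm (f' x)) * indicator ?B x \<partial>lborel)) * ennreal V"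
    by (simp add: eV mult_ac)
  finally have "ennreal V * (\<integral>\<^sup>+x. ennreal \<bar>f x - c\<bar> * indicator ?B x \<partial>lborel)
    \<le> ennreal V * (ennreal (2 ^ DIM('a) * (2 * r)) * (\<integral>\<^sup>+x. ennreal (norm (f' x)) * indicator ?B x \<partial>lborel))"
    by (simp only: mult.commute[of "ennreal V"])
  then show ?thesis using V by (subst (asm) ennreal_mult_le_mult_iff) auto
qed

text \<open>Mollification at scale \<open>\<rho>\<close>: the error is controlled by \<open>\<rho>\<close> times the \<open>L\<^sup>2\<close> norm of the gradient, the
  mollified function only by the \<open>L\<^sup>1\<close> norm.\<close>
lemma C1_ehrling:
  fixes f :: "'a::euclidean_space \<Rightarrow> real"
  assumes f: "C1 f f'" and r: "0 < \<rho>" "\<rho> \<le> r"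
    and c: "c = (1 / measure lborel (ball x0 (3 * r))) * (\<integral>x. indicator (ball x0 (3 * r)) x * f x \<partial>lborel)"
    and V: "V = measure lborel (ball (0::'a) \<rho>)"
  shows "ennreal (V\<^sup>2) * (\<integral>\<^sup>+x. ennreal ((f x - c)\<^sup>2) * indicator (ball x0 (2 * r)) x \<partial>lborel)
    \<le> ennreal (2 * V\<^sup>2 * \<rho>\<^sup>2) * (\<integral>\<^sup>+x. ennreal ((norm (f' x))\<^sup>2) * indicator (ball x0 (3 * r)) x \<partial>lborel)
      + ennreal (2 * measure lborel (ball x0 (2 * r)))
        * (ennreal (2 ^ DIM('a) * (6 * r)) * (\<integral>\<^sup>+x. ennreal (norm (f' x)) * indicator (ball x0 (3 * r)) x \<partial>lborel))\<^sup>2"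
proof -
  note [measurable] = C1_borel[OF f]
  let ?B = "ball x0 (2 * r)" and ?C = "ball x0 (3 * r)" and ?E = "ball (0::'a) \<rho>"
  define P where "P = (\<integral>\<^sup>+x. ennreal \<bar>f x - c\<bar> * indicator ?C x \<partial>lborel)"
  have P: "P \<le> ennreal (2 ^ DIM('a) * (6 * r)) * (\<integral>\<^sup>+x. ennreal (norm (f' x)) * indicator ?C x \<partial>lborel)"
    using C1_poincare_L1[OF f _ c] r by (simp add: P_def)
  have [measurable]: "?B \<in> sets borel" "?C \<in> sets borel" "?E \<in> sets borel" by auto
  have V0: "0 \<le> V" by (simp add: V)
  have eE: "emeasure lborel ?E = ennreal V"
    unfolding V using emeasure_lborel_ball_finite[of "0::'a" \<rho>] by (intro emeasure_eq_ennreal_measure) auto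
  have eB: "emeasure lborel ?B = ennreal (measure lborel ?B)"
    using emeasure_lborel_ball_finite[of x0 "2 * r"] by (intro emeasure_eq_ennreal_measure) auto
  let ?D = "\<lambda>x h. ennreal ((f (x + h) - f x)\<^sup>2)"
  \<comment> \<open>\<open>V * (f x - c)\<close> is the integral over \<open>h\<close> of
    \<open>f x - f (x + h)\<close> plus that of \<open>f (x + h) - c\<close>. The first is an
    increment of length below \<rho>; the second is at most \<open>P\<close>, because \<rho> does
    not exceed \<open>r\<close> and \<open>x + h\<close> stays in the larger ball.\<close>
  have pt: "ennreal (V\<^sup>2) * ennreal ((f x - c)\<^sup>2) \<le> 2 * (ennreal V * (\<integral>\<^sup>+h. ?D x h * indicator ?E h \<partial>lborel)) + 2 * P\<^sup>2"
    if x: "x \<in> ?B" for x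
  proof -
    let ?a = "\<integral>\<^sup>+h. ennreal \<bar>f (x + h) - f x\<bar> * indicator ?E h \<partial>lborel"
    let ?b = "\<integral>\<^sup>+h. ennreal \<bar>f (x + h) - c\<bar> * indicator ?E h \<partial>lborel"
    have "ennreal \<bar>f x - c\<bar> * ennreal V = (\<integral>\<^sup>+h. ennreal \<bar>f x - c\<bar> * indicator ?E h \<partial>lborel)"
      by (simp add: nn_integral_cmult_indicator eE)
    also have "\<dots> \<le> (\<integral>\<^sup>+h. ennreal \<bar>f (x + h) - f x\<bar> * indicator ?E h + ennreal \<bar>f (x + h) - c\<bar> * indicator ?E h \<partial>lborel)"
      by (intro nn_integral_mono) (auto simp: indicator_def simp flip: ennreal_plus)
    also have "\<dots> = ?a + ?b" by (rule nn_integral_add) measurable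
    finally have "ennreal \<bar>f x - c\<bar> * ennreal V \<le> ?a + ?b" .
    moreover have "?b \<le> P"
    proof -
      have "?b \<le> (\<integral>\<^sup>+h. ennreal \<bar>f (h + x) - c\<bar> * indicator ?C (h + x) \<partial>lborel)"
      proof (rule nn_integral_mono)
        fix h :: 'a
        have "h + x \<in> ?C" if "h \<in> ?E"
          using x that r norm_triangle_ineq4[of "x0 - x" h] by (simp add: dist_norm algebra_simps)
        then show "ennreal \<bar>f (x + h) - c\<bar> * indicator ?E h \<le> ennreal \<bar>f (h + x) - c\<bar> * indicator ?C (h + x)"
          by (auto simp: indicator_def add.commute)
      qed
      also have "\<dots> = P" unfolding P_def by (rule nn_integral_translate) measurable
      finally show ?thesis .
    qed
    ultimately have "(ennreal \<bar>f x - c\<bar> * ennreal V)\<^sup>2 \<le> (?a + P)\<^sup>2"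
      by (intro power_mono) (auto intro: order_trans add_left_mono)
    also have "\<dots> \<le> 2 * ?a\<^sup>2 + 2 * P\<^sup>2" by (rule ennreal_power2_sum_le)
    also have "?a\<^sup>2 \<le> ennreal V * (\<integral>\<^sup>+h. ?D x h * indicator ?E h \<partial>lborel)"
    proof -
      have "?a\<^sup>2 = (\<integral>\<^sup>+h. (ennreal \<bar>f (x + h) - f x\<bar> * indicator ?E h) * indicator ?E h \<partial>lborel)\<^sup>2"
        by (intro arg_cong[of _ _ "\<lambda>z. z\<^sup>2"] nn_integral_cong) (auto simp: indicator_def)
      also have "\<dots> \<le> (\<integral>\<^sup>+h. (ennreal \<bar>f (x + h) - f x\<bar> * indicator ?E h)\<^sup>2 \<partial>lborel) * (\<integral>\<^sup>+h. (indicator ?E h)\<^sup>2 \<partial>lborel)"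
        by (rule Cauchy_Schwarz_nn_integral) measurable
      also have "(\<integral>\<^sup>+h. (indicator ?E h)\<^sup>2 \<partial>lborel) = (\<integral>\<^sup>+h. indicator ?E h \<partial>lborel)"
        by (intro nn_integral_cong) (auto simp: indicator_def)
      also have "\<dots> = ennreal V" by (simp add: eE)
      also have "(\<integral>\<^sup>+h. (ennreal \<bar>f (x + h) - f x\<bar> * indicator ?E h)\<^sup>2 \<partial>lborel) = (\<integral>\<^sup>+h. ?D x h * indicator ?E h \<partial>lborel)"
        by (intro nn_integral_cong) (auto simp: indicator_def ennreal_power)
      finally show ?thesis by (simp add: mult.commute)
    qed
    also have "(ennreal \<bar>f x - c\<bar> * ennreal V)\<^sup>2 = ennreal (V\<^sup>2) * ennreal ((f x - c)\<^sup>2)"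
      using V0 by (simp add: power_mult_distrib ennreal_power mult.commute)
    finally show ?thesis by (simp add: add_mono mult_left_mono)
  qed
  have "ennreal (V\<^sup>2) * (\<integral>\<^sup>+x. ennreal ((f x - c)\<^sup>2) * indicator ?B x \<partial>lborel)
     = (\<integral>\<^sup>+x. ennreal (V\<^sup>2) * ennreal ((f x - c)\<^sup>2) * indicator ?B x \<partial>lborel)"
    by (simp add: nn_integral_cmult mult.assoc)
  also have "\<dots> \<le> (\<integral>\<^sup>+x. 2 * ennreal V * (\<integral>\<^sup>+h. ?D x h * indicator ?E h * indicator ?B x \<partial>lborel) + 2 * P\<^sup>2 * indicator ?B x \<partial>lborel)"
  proof (rule nn_integral_mono)
    fix x show "ennreal (V\<^sup>2) * ennreal ((f x - c)\<^sup>2) * indicator ?B x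
      \<le> 2 * ennreal V * (\<integral>\<^sup>+h. ?D x h * indicator ?E h * indicator ?B x \<partial>lborel) + 2 * P\<^sup>2 * indicator ?B x"
      using pt[of x] by (cases "x \<in> ?B") (auto simp: mult.assoc)
  qed
  also have "\<dots> = (\<integral>\<^sup>+x. 2 * ennreal V * (\<integral>\<^sup>+h. ?D x h * indicator ?E h * indicator ?B x \<partial>lborel) \<partial>lborel)
     + (\<integral>\<^sup>+x. 2 * P\<^sup>2 * indicator ?B x \<partial>lborel)"
    by (rule nn_integral_add) measurable
  also have "(\<integral>\<^sup>+x. 2 * P\<^sup>2 * indicator ?B x \<partial>lborel) = 2 * P\<^sup>2 * ennreal (measure lborel ?B)"
    by (simp add: nn_integral_cmult_indicator eB)
  also have "(\<integral>\<^sup>+x. 2 * ennreal V * (\<integral>\<^sup>+h. ?D x h * indicator ?E h * indicator ?B x \<partial>lborel) \<partial>lborel)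
     = 2 * ennreal V * (\<integral>\<^sup>+x. (\<integral>\<^sup>+h. ?D x h * indicator ?E h * indicator ?B x \<partial>lborel) \<partial>lborel)"
    by (rule nn_integral_cmult) measurable
  also have "(\<integral>\<^sup>+x. (\<integral>\<^sup>+h. ?D x h * indicator ?E h * indicator ?B x \<partial>lborel) \<partial>lborel)
     = (\<integral>\<^sup>+h. (\<integral>\<^sup>+x. ?D x h * indicator ?E h * indicator ?B x \<partial>lborel) \<partial>lborel)"
    by (rule lborel_pair.Fubini'[of "\<lambda>h x. ?D x h * indicator ?E h * indicator ?B x"]) measurable
  also have "\<dots> \<le> (\<integral>\<^sup>+h. (ennreal (\<rho>\<^sup>2) * (\<integral>\<^sup>+x. ennreal ((norm (f' x))\<^sup>2) * indicator ?C x \<partial>lborel)) * indicator ?E h \<partial>lborel)"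
  proof (rule nn_integral_mono)
    fix h :: 'a
    have "(\<integral>\<^sup>+x. ?D x h * indicator ?B x \<partial>lborel) \<le> ennreal (\<rho>\<^sup>2) * (\<integral>\<^sup>+x. ennreal ((norm (f' x))\<^sup>2) * indicator ?C x \<partial>lborel)"
      if h: "h \<in> ?E"
    proof -
      have "(\<integral>\<^sup>+x. ?D x h * indicator ?B x \<partial>lborel) \<le> ennreal ((norm h)\<^sup>2) * (\<integral>\<^sup>+x. ennreal ((norm (f' x))\<^sup>2) * indicator ?C x \<partial>lborel)"
      proof (rule C1_translate_L2[OF f])
        fix t x assume t: "0 \<le> t" "t \<le> (1::real)" and x: "x \<in> ?B"
        have "norm (t *\<^sub>R h) \<le> norm h" using t by (simp add: mult_left_le_one_le)
        then have "norm (t *\<^sub>R h) < r" using h r by simp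
        then show "x + t *\<^sub>R h \<in> ?C"
          using x norm_triangle_ineq4[of "x0 - x" "t *\<^sub>R h"] by (simp add: dist_norm algebra_simps)
      qed auto
      also have "\<dots> \<le> ennreal (\<rho>\<^sup>2) * (\<integral>\<^sup>+x. ennreal ((norm (f' x))\<^sup>2) * indicator ?C x \<partial>lborel)"
        using h by (intro mult_right_mono ennreal_leI power_mono) auto
      finally show ?thesis .
    qed
    then show "(\<integral>\<^sup>+x. ?D x h * indicator ?E h * indicator ?B x \<partial>lborel)
       \<le> (ennreal (\<rho>\<^sup>2) * (\<integral>\<^sup>+x. ennreal ((norm (f' x))\<^sup>2) * indicator ?C x \<partial>lborel)) * indicator ?E h"
      by (cases "h \<in> ?E") (simp_all add: indicator_def)
  qed
  also have "\<dots> = (ennreal (\<rho>\<^sup>2) * (\<integral>\<^sup>+x. ennreal ((norm (f' x))\<^sup>2) * indicator ?C x \<partial>lborel)) * ennreal V"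
    by (simp add: nn_integral_cmult_indicator eE)
  finally have "ennreal (V\<^sup>2) * (\<integral>\<^sup>+x. ennreal ((f x - c)\<^sup>2) * indicator ?B x \<partial>lborel)
     \<le> 2 * ennreal V * ((ennreal (\<rho>\<^sup>2) * (\<integral>\<^sup>+x. ennreal ((norm (f' x))\<^sup>2) * indicator ?C x \<partial>lborel)) * ennreal V)
       + 2 * P\<^sup>2 * ennreal (measure lborel ?B)"
    by (simp add: add_mono mult_left_mono)
  also have "\<dots> = ennreal (2 * V\<^sup>2 * \<rho>\<^sup>2) * (\<integral>\<^sup>+x. ennreal ((norm (f' x))\<^sup>2) * indicator ?C x \<partial>lborel)
       + ennreal (2 * measure lborel ?B) * P\<^sup>2"
  proof -
    have "ennreal (2 * V\<^sup>2 * \<rho>\<^sup>2) = 2 * ennreal V * ennreal V * ennreal (\<rho>\<^sup>2)"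
      "ennreal (2 * measure lborel ?B) = 2 * ennreal (measure lborel ?B)"
      using V0 by (simp_all add: ennreal_mult power2_eq_square[of V] mult.assoc)
    then show ?thesis by (simp only: mult_ac)
  qed
  also have "\<dots> \<le> ennreal (2 * V\<^sup>2 * \<rho>\<^sup>2) * (\<integral>\<^sup>+x. ennreal ((norm (f' x))\<^sup>2) * indicator ?C x \<partial>lborel)
       + ennreal (2 * measure lborel ?B) * (ennreal (2 ^ DIM('a) * (6 * r)) * (\<integral>\<^sup>+x. ennreal (norm (f' x)) * indicator ?C x \<partial>lborel))\<^sup>2"
    by (intro add_left_mono mult_left_mono power_mono P) auto
  finally show ?thesis .
qed

section \<open>Compactly supported functions and integration by parts\<close>

lemma C1_compact_support_integrable:
  assumes "C1 f f'" "compact K" "\<And>x. x \<notin> K \<Longrightarrow> f x = 0"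
  shows "integrable lborel f"
proof -
  have "integrable lborel (\<lambda>x. indicator K x *\<^sub>R f x)"
    using assms C1_continuous by (intro borel_integrable_compact) (auto intro: continuous_on_subset)
  moreover have "(\<lambda>x. indicator K x *\<^sub>R f x) = f" using assms(3) by (auto simp: fun_eq_iff indicator_def)
  ultimately show ?thesis by simp
qed

lemma C1_lipschitz_on_compact_support:
  assumes f: "C1 f f'" and K: "compact K" "\<And>x. x \<notin> K \<Longrightarrow> f' x = 0"
  obtains M where "M \<ge> 0" "\<And>x. norm (f' x) \<le> M" "\<And>x h. \<bar>f (x + h) - f x\<bar> \<le> M * norm h"
proof -
  have "bounded (f' ` K)"
    using K C1_continuous_grad[OF f] by (intro compact_imp_bounded compact_continuous_image) (auto intro: continuous_on_subset)
  then obtain M where M: "M > 0" "\<And>x. x \<in> K \<Longrightarrow> norm (f' x) \<le> M" by (auto simp: bounded_pos)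
  have le: "norm (f' x) \<le> M" for x using M K(2)[of x] by (cases "x \<in> K") auto
  have "\<bar>f (x + h) - f x\<bar> \<le> M * norm h" for x h
  proof -
    have "norm (f (x + h) - f x) \<le> M * norm (x + h - x)"
    proof (rule differentiable_bound[of UNIV f "\<lambda>x h. f' x \<bullet> h"])
      show "onorm (\<lambda>h. f' x \<bullet> h) \<le> M" for x
      proof (rule onorm_le)
        fix h show "norm (f' x \<bullet> h) \<le> M * norm h"
          using Cauchy_Schwarz_ineq2[of "f' x" h] mult_right_mono[OF le[of x] norm_ge_zero[of h]] by simp
      qed
    qed (use C1_deriv[OF f] in auto)
    then show ?thesis by simp
  qed
  then show ?thesis using that[of M] M le by auto
qed

text \<open>Every difference quotient in direction \<open>e\<close> has integral zero by translation
  invariance. The Lipschitz bound on a compact set dominates the quotients, so this passes to the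
  derivative.\<close>

lemma C1_integral_gradient_zero:
  fixes f :: "'a::euclidean_space \<Rightarrow> real"
  assumes f: "C1 f f'" and K: "compact K" "\<And>x. x \<notin> K \<Longrightarrow> f x = 0" "\<And>x. x \<notin> K \<Longrightarrow> f' x = 0"
  shows "(\<integral>x. f' x \<bullet> e \<partial>lborel) = 0"
proof -
  note [measurable] = C1_borel[OF f]
  obtain M where M: "M \<ge> 0" "\<And>x. norm (f' x) \<le> M" "\<And>x h. \<bar>f (x + h) - f x\<bar> \<le> M * norm h"
    using C1_lipschitz_on_compact_support[OF f K(1,3)] by metis
  \<comment> \<open>The steps \<open>1 / real (Suc n)\<close> are at most 1, so all quotients vanish
    outside this thickening of \<open>K\<close> by \<open>norm e\<close>.\<close>
  define K' where "K' = {x + y | x y. x \<in> K \<and> y \<in> cball 0 (norm e)}"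
  have K': "compact K'" unfolding K'_def by (rule compact_sums) (use K in auto)
  define q where "q n x = real (Suc n) * (f (x + (1 / real (Suc n)) *\<^sub>R e) - f x)" for n x
  have lim: "(\<lambda>n. q n x) \<longlonglongrightarrow> f' x \<bullet> e" for x
  proof -
    have "((\<lambda>t. x + t *\<^sub>R e) has_derivative (\<lambda>t. t *\<^sub>R e)) (at 0)" by (auto intro!: derivative_eq_intros)
    from has_derivative_compose[OF this C1_deriv[OF f]]
    have "((\<lambda>t. f (x + t *\<^sub>R e)) has_real_derivative f' x \<bullet> e) (at 0)"
      by (simp add: has_field_derivative_def mult_commute_abs)
    then have "((\<lambda>t. (f (x + t *\<^sub>R e) - f x) / t) \<longlongrightarrow> f' x \<bullet> e) (at 0)"
      by (simp add: DERIV_def)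
    moreover have "filterlim (\<lambda>n. 1 / real (Suc n)) (at 0) sequentially"
      using LIMSEQ_Suc[OF lim_1_over_n] by (auto simp: filterlim_at)
    ultimately have "(\<lambda>n. (f (x + (1 / real (Suc n)) *\<^sub>R e) - f x) / (1 / real (Suc n))) \<longlonglongrightarrow> f' x \<bullet> e"
      by (rule filterlim_compose)
    then show ?thesis by (simp add: q_def mult.commute)
  qed
  have bd: "norm (q n x) \<le> M * norm e * indicator K' x" for n x
  proof (cases "x \<in> K'")
    case True
    have "norm (q n x) \<le> real (Suc n) * (M * norm ((1 / real (Suc n)) *\<^sub>R e))"
      using M(3)[of x "(1 / real (Suc n)) *\<^sub>R e"] unfolding q_def by (simp add: abs_mult del: norm_scaleR)
    then show ?thesis using True by simp
  next
    case False
    have z: "x + h \<notin> K" if "norm h \<le> norm e" for h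
    proof
      assume "x + h \<in> K"
      then have "(x + h) + (- h) \<in> K'" unfolding K'_def using that by (intro CollectI exI[of _ "x + h"] exI[of _ "- h"]) auto
      then show False using False by simp
    qed
    have "norm ((1 / real (Suc n)) *\<^sub>R e) \<le> norm e" by (simp add: divide_le_eq mult_left_le mult_le_cancel_left1)
    then have "q n x = 0" using z[of 0] z[of "(1 / real (Suc n)) *\<^sub>R e"] K(2) by (simp add: q_def)
    then show ?thesis using False by simp
  qed
  have "(\<lambda>n. \<integral>x. q n x \<partial>lborel) \<longlonglongrightarrow> (\<integral>x. f' x \<bullet> e \<partial>lborel)"
  proof (rule integral_dominated_convergence)
    show "integrable lborel (\<lambda>x. M * norm e * indicator K' x)"
      using borel_integrable_compact[OF K', of "\<lambda>x. M * norm e"] by (simp add: mult.commute)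
  qed (use lim bd in \<open>auto simp: q_def\<close>)
  moreover have "(\<integral>x. q n x \<partial>lborel) = 0" for n
  proof -
    have i: "integrable lborel f" using C1_compact_support_integrable[OF f K(1,2)] .
    let ?h = "(1 / real (Suc n)) *\<^sub>R e"
    have i2: "integrable (distr lborel borel ((+) ?h)) f" using i by (simp add: lborel_distr_plus)
    then have "integrable lborel (\<lambda>x. f (?h + x))" by (subst (asm) integrable_distr_eq) auto
    moreover have "(\<integral>x. f x \<partial>distr lborel borel ((+) ?h)) = (\<integral>x. f (?h + x) \<partial>lborel)"
      by (rule integral_distr) auto
    ultimately show ?thesis using i by (simp add: q_def lborel_distr_plus add.commute)
  qed
  ultimately show ?thesis by (simp add: LIMSEQ_const_iff)
qed

section \<open>Continuously differentiable cutoffs\<close>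

lemma has_real_derivative_max0_sq: "((\<lambda>t. (max 0 t)\<^sup>2) has_real_derivative 2 * max 0 t) (at t)"
proof -
  consider "t > 0" | "t < 0" | "t = 0" by linarith
  then show ?thesis
  proof cases
    case 1
    have "((\<lambda>t. t\<^sup>2) has_real_derivative 2 * t) (at t)" by (auto intro!: derivative_eq_intros)
    then have "((\<lambda>t. (max 0 t)\<^sup>2) has_real_derivative 2 * t) (at t)"
      by (rule has_field_derivative_transform_within_open[of _ _ _ "{0<..}"]) (use 1 in auto)
    then show ?thesis using 1 by simp
  next
    case 2
    have "((\<lambda>t. 0) has_real_derivative 0) (at t)" by auto
    then have "((\<lambda>t. (max 0 t)\<^sup>2) has_real_derivative 0) (at t)"
      by (rule has_field_derivative_transform_within_open[of _ _ _ "{..<0}"]) (use 2 in auto)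
    then show ?thesis using 2 by simp
  next
    case 3
    have "((\<lambda>h::real. max 0 h) \<longlongrightarrow> max 0 0) (at 0)" by (intro tendsto_intros)
    moreover have "(\<lambda>h::real. (max 0 h)\<^sup>2 / h) = (\<lambda>h. max 0 h)"
      by (auto simp: fun_eq_iff max_def power2_eq_square)
    ultimately show ?thesis using 3 by (simp add: DERIV_def)
  qed
qed

lemma C1_max0_sq: "C1 f f' \<Longrightarrow> C1 (\<lambda>x. (max 0 (f x))\<^sup>2) (\<lambda>x. (2 * max 0 (f x)) *\<^sub>R f' x)"
  by (rule C1_comp[OF _ has_real_derivative_max0_sq]) (auto intro!: continuous_intros)

lemma C1_norm_sq: "C1 (\<lambda>y. a + b * (norm (y - x))\<^sup>2) (\<lambda>y. (2 * b) *\<^sub>R (y - x))"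
  unfolding C1_def power2_norm_eq_inner
  by (auto intro!: derivative_eq_intros continuous_intros simp: inner_commute algebra_simps)

text \<open>Test functions need only be continuously differentiable, so the square of a positive
  part is smooth enough. The square also bounds the gradient by the square root of the function, the
  form in which Caccioppoli's inequality absorbs it. The factor 4 puts the edge of the support at
  distance \<open>2 * r\<close> and leaves the value at least \<open>(3/4)\<^sup>2\<close> at
  distance \<open>r\<close>.\<close>

definition bump :: "'a::euclidean_space \<Rightarrow> real \<Rightarrow> 'a \<Rightarrow> real" where
  "bump x r y = (max 0 (1 - (norm (y - x))\<^sup>2 / (4 * r\<^sup>2)))\<^sup>2"

definition bump_grad :: "'a::euclidean_space \<Rightarrow> real \<Rightarrow> 'a \<Rightarrow> 'a" where
  "bump_grad x r y = - ((max 0 (1 - (norm (y - x))\<^sup>2 / (4 * r\<^sup>2))) / r\<^sup>2) *\<^sub>R (y - x)"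

lemma C1_bump: "C1 (bump x r) (bump_grad x r)"
proof -
  have "C1 (\<lambda>y. 1 - (norm (y - x))\<^sup>2 / (4 * r\<^sup>2)) (\<lambda>y. - (1 / (2 * r\<^sup>2)) *\<^sub>R (y - x))"
    using C1_norm_sq[of 1 "- 1 / (4 * r\<^sup>2)" x] by simp
  from C1_max0_sq[OF this] show ?thesis
    unfolding bump_def[abs_def] bump_grad_def[abs_def] by (simp add: mult.commute)
qed

lemma bump_nonneg [simp]: "0 \<le> bump x r y"
  by (simp add: bump_def)

lemma bump_le_1: "bump x r y \<le> 1"
  unfolding bump_def by (intro power_le_one) (auto intro!: divide_nonneg_nonneg)

lemma bump_ge: "0 < r \<Longrightarrow> y \<in> ball x r \<Longrightarrow> 9/16 \<le> bump x r y"
proof -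
  assume r: "0 < r" and y: "y \<in> ball x r"
  have "(norm (y - x))\<^sup>2 \<le> r\<^sup>2" using y by (intro power_mono) (auto simp: dist_norm norm_minus_commute)
  then have "(norm (y - x))\<^sup>2 / (4 * r\<^sup>2) \<le> 1/4" using r by (simp add: divide_le_eq)
  then have "3/4 \<le> max 0 (1 - (norm (y - x))\<^sup>2 / (4 * r\<^sup>2))" by simp
  then have "(3/4)\<^sup>2 \<le> bump x r y" unfolding bump_def by (rule power_mono) simp
  then show ?thesis by (simp add: power2_eq_square)
qed

lemma bump_outside:
  assumes r: "0 < r" and y: "y \<notin> ball x (2 * r)"
  shows "bump x r y = 0" "bump_grad x r y = 0"
proof -
  have "(2 * r)\<^sup>2 \<le> (norm (y - x))\<^sup>2" using r y by (intro power_mono) (auto simp: dist_norm norm_minus_commute)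
  then have "1 \<le> (norm (y - x))\<^sup>2 / (4 * r\<^sup>2)" using r by (simp add: power_mult_distrib)
  then show "bump x r y = 0" "bump_grad x r y = 0" by (auto simp: bump_def bump_grad_def)
qed

text \<open>This replaces the usual squared cutoff: with \<open>bump\<close> as weight, the product
  of its gradient with the gradient of the solution splits by Young's inequality into an absorbable
  and a lower order term.\<close>

lemma bump_grad_le:
  assumes r: "0 < r"
  shows "norm (bump_grad x r y) \<le> (2 / r) * sqrt (bump x r y)"
proof (cases "y \<in> ball x (2 * r)")
  case True
  have s: "sqrt (bump x r y) = max 0 (1 - (norm (y - x))\<^sup>2 / (4 * r\<^sup>2))" by (simp add: bump_def)
  have "norm (bump_grad x r y) = (max 0 (1 - (norm (y - x))\<^sup>2 / (4 * r\<^sup>2)) / r\<^sup>2) * norm (y - x)"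
    by (simp add: bump_grad_def)
  also have "\<dots> \<le> (max 0 (1 - (norm (y - x))\<^sup>2 / (4 * r\<^sup>2)) / r\<^sup>2) * (2 * r)"
    using True by (intro mult_left_mono) (auto simp: dist_norm norm_minus_commute)
  also have "\<dots> = (2 / r) * sqrt (bump x r y)" unfolding s using r by (simp add: power2_eq_square)
  finally show ?thesis .
next
  case False
  then show ?thesis using r by (simp add: bump_outside[OF r])
qed

section \<open>The space \<open>H\<^sup>1\<^sub>0\<close>\<close>

text \<open>Any compact set containing the support serves as well as the support itself, which makes
  products and sums easy. The gradient vanishes off the support because its complement is
  open.\<close>

lemma test_fun_iff:
  "test_fun D \<phi> d\<phi> \<longleftrightarrow> C1 \<phi> d\<phi> \<and> (\<exists>K. compact K \<and> K \<subseteq> D \<and> (\<forall>x. x \<notin> K \<longrightarrow> \<phi> x = 0 \<and> d\<phi> x = 0))"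
proof
  assume t: "test_fun D \<phi> d\<phi>"
  then have c: "C1 \<phi> d\<phi>" by (simp add: test_fun_def C1_def)
  let ?K = "closure {x. \<phi> x \<noteq> 0}"
  have "\<phi> x = 0 \<and> d\<phi> x = 0" if x: "x \<notin> ?K" for x
  proof -
    have z: "\<phi> y = 0" if "y \<in> - ?K" for y using that closure_subset[of "{x. \<phi> x \<noteq> 0}"] by blast
    have "((\<lambda>y. 0) has_derivative (\<lambda>h. d\<phi> x \<bullet> h)) (at x)"
    proof (rule has_derivative_transform_within_open[OF C1_deriv[OF c]])
      show "open (- ?K)" by (rule open_Compl[OF closed_closure])
      show "x \<in> - ?K" using x by blast
      show "\<phi> y = 0" if "y \<in> - ?K" for y using that by (rule z)
    qed
    then have "(\<lambda>h. d\<phi> x \<bullet> h) = (\<lambda>h. 0)" using has_derivative_const by (rule has_derivative_unique)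
    from fun_cong[OF this, of "d\<phi> x"] have "d\<phi> x = 0" by (simp only: inner_eq_zero_iff)
    moreover have "\<phi> x = 0" by (rule z) (use x in blast)
    ultimately show ?thesis by blast
  qed
  then show "C1 \<phi> d\<phi> \<and> (\<exists>K. compact K \<and> K \<subseteq> D \<and> (\<forall>x. x \<notin> K \<longrightarrow> \<phi> x = 0 \<and> d\<phi> x = 0))"
    using t c unfolding test_fun_def by blast
next
  assume "C1 \<phi> d\<phi> \<and> (\<exists>K. compact K \<and> K \<subseteq> D \<and> (\<forall>x. x \<notin> K \<longrightarrow> \<phi> x = 0 \<and> d\<phi> x = 0))"
  then obtain K where c: "C1 \<phi> d\<phi>" and K: "compact K" "K \<subseteq> D" "\<And>x. x \<notin> K \<Longrightarrow> \<phi> x = 0" by auto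
  have sub: "closure {x. \<phi> x \<noteq> 0} \<subseteq> K"
    using K by (intro closure_minimal) (auto intro: compact_imp_closed)
  moreover from this have "compact (closure {x. \<phi> x \<noteq> 0})"
    using K(1) compact_Int_closed[OF K(1), of "closure {x. \<phi> x \<noteq> 0}"] by (simp add: Int_absorb1)
  ultimately show "test_fun D \<phi> d\<phi>" using c K(2) unfolding test_fun_def C1_def by blast
qed

lemma test_fun_C1: "test_fun D \<phi> d\<phi> \<Longrightarrow> C1 \<phi> d\<phi>"
  by (simp add: test_fun_iff)

lemma test_fun_support:
  assumes "test_fun D \<phi> d\<phi>"
  obtains K where "compact K" "K \<subseteq> D" "\<And>x. x \<notin> K \<Longrightarrow> \<phi> x = 0" "\<And>x. x \<notin> K \<Longrightarrow> d\<phi> x = 0"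
proof -
  from assms obtain K where "compact K" "K \<subseteq> D" "\<forall>x. x \<notin> K \<longrightarrow> \<phi> x = 0 \<and> d\<phi> x = 0"
    unfolding test_fun_iff by blast
  then show ?thesis using that[of K] by blast
qed

lemma test_funI: "C1 \<phi> d\<phi> \<Longrightarrow> compact K \<Longrightarrow> K \<subseteq> D \<Longrightarrow> (\<And>x. x \<notin> K \<Longrightarrow> \<phi> x = 0) \<Longrightarrow> (\<And>x. x \<notin> K \<Longrightarrow> d\<phi> x = 0)
    \<Longrightarrow> test_fun D \<phi> d\<phi>"
  unfolding test_fun_iff by blast

lemma test_fun_outside: "test_fun D \<phi> d\<phi> \<Longrightarrow> x \<notin> D \<Longrightarrow> \<phi> x = 0" "test_fun D \<phi> d\<phi> \<Longrightarrow> x \<notin> D \<Longrightarrow> d\<phi> x = 0"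
  unfolding test_fun_iff by blast+

lemma test_fun_zero: "test_fun D (\<lambda>x. 0) (\<lambda>x. 0)"
  by (rule test_funI[of _ _ "{}"]) (auto simp: C1_const)

lemma test_fun_mult:
  assumes z: "test_fun D \<zeta> d\<zeta>" and f: "C1 f f'"
  shows "test_fun D (\<lambda>x. \<zeta> x * f x) (\<lambda>x. f x *\<^sub>R d\<zeta> x + \<zeta> x *\<^sub>R f' x)"
proof -
  obtain K where K: "compact K" "K \<subseteq> D" "\<And>x. x \<notin> K \<Longrightarrow> \<zeta> x = 0" "\<And>x. x \<notin> K \<Longrightarrow> d\<zeta> x = 0"
    by (rule test_fun_support[OF z]) blast
  show ?thesis by (rule test_funI[OF C1_mult[OF test_fun_C1[OF z] f] K(1,2)]) (simp_all add: K(3,4))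
qed

lemma test_fun_lincomb:
  assumes "test_fun D f f'" "test_fun D g g'"
  shows "test_fun D (\<lambda>x. a * f x + b * g x) (\<lambda>x. a *\<^sub>R f' x + b *\<^sub>R g' x)"
proof -
  obtain K where K: "compact K" "K \<subseteq> D" "\<And>x. x \<notin> K \<Longrightarrow> f x = 0" "\<And>x. x \<notin> K \<Longrightarrow> f' x = 0"
    by (rule test_fun_support[OF assms(1)]) blast
  obtain L where L: "compact L" "L \<subseteq> D" "\<And>x. x \<notin> L \<Longrightarrow> g x = 0" "\<And>x. x \<notin> L \<Longrightarrow> g' x = 0"
    by (rule test_fun_support[OF assms(2)]) blast
  show ?thesis
    by (rule test_funI[OF C1_lincomb[OF test_fun_C1[OF assms(1)] test_fun_C1[OF assms(2)]] compact_Un[OF K(1) L(1)]])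
      (simp_all add: K L)
qed

lemma test_fun_bounded:
  assumes "test_fun D \<phi> d\<phi>"
  obtains M where "M > 0" "\<And>x. \<bar>\<phi> x\<bar> \<le> M" "\<And>x. norm (d\<phi> x) \<le> M"
proof -
  obtain K where K: "compact K" "K \<subseteq> D" "\<And>x. x \<notin> K \<Longrightarrow> \<phi> x = 0" "\<And>x. x \<notin> K \<Longrightarrow> d\<phi> x = 0"
    by (rule test_fun_support[OF assms]) blast
  have "bounded (\<phi> ` K)" "bounded (d\<phi> ` K)"
    using K(1) C1_continuous[OF test_fun_C1[OF assms]] C1_continuous_grad[OF test_fun_C1[OF assms]]
    by (auto intro!: compact_imp_bounded compact_continuous_image intro: continuous_on_subset)
  then obtain M N where M: "M > 0" "\<And>x. x \<in> K \<Longrightarrow> norm (\<phi> x) \<le> M" and N: "N > 0" "\<And>x. x \<in> K \<Longrightarrow> norm (d\<phi> x) \<le> N"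
    unfolding bounded_pos by auto
  have "\<bar>\<phi> x\<bar> \<le> max M N" "norm (d\<phi> x) \<le> max M N" for x
    using M N K(3,4)[of x] by (cases "x \<in> K"; force)+
  then show ?thesis using that[of "max M N"] M(1) by auto
qed

lemma borel_imp_lebesgue_on: "f \<in> borel_measurable borel \<Longrightarrow> f \<in> borel_measurable (lebesgue_on D)"
  by (simp add: measurable_completion measurable_restrict_space1)

text \<open>The bridge from integrals over \<open>D\<close> to integrals over the whole space with
  the Borel measure, where translations and Fubini's theorem are applied to test functions.\<close>

lemma lebesgue_on_zero_outside:
  fixes f :: "'a::euclidean_space \<Rightarrow> 'b::euclidean_space"
  assumes D: "D \<in> sets lebesgue" and f: "f \<in> borel_measurable borel" and z: "\<And>x. x \<notin> D \<Longrightarrow> f x = 0"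
  shows "integrable (lebesgue_on D) f \<longleftrightarrow> integrable lborel f" "integral\<^sup>L (lebesgue_on D) f = integral\<^sup>L lborel f"
proof -
  have e: "(\<lambda>x. indicator D x *\<^sub>R f x) = f" using z by (auto simp: fun_eq_iff indicator_def)
  show "integrable (lebesgue_on D) f \<longleftrightarrow> integrable lborel f" "integral\<^sup>L (lebesgue_on D) f = integral\<^sup>L lborel f"
    using D f by (simp_all add: integrable_restrict_space integral_restrict_space e integrable_completion integral_completion)
qed

lemma nn_lebesgue_on:
  assumes D: "D \<in> sets borel" and f: "f \<in> borel_measurable borel"
  shows "(\<integral>\<^sup>+x. f x \<partial>lebesgue_on D) = (\<integral>\<^sup>+x. f x * indicator D x \<partial>lborel)"
  using D f by (simp add: nn_integral_restrict_space nn_integral_completion)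

lemma C1_L2:
  fixes D :: "(real^'n) set"
  assumes "bounded D" "open D" "C1 \<phi> d\<phi>"
  shows "L2 D \<phi>" "L2 D d\<phi>"
proof -
  have D: "D \<in> lmeasurable" using assms by (intro lmeasurable_open) auto
  have c: "compact (closure D)" using assms by (simp add: compact_closure)
  have gen: "L2 D f" if f: "continuous_on UNIV f" for f :: "real^'n \<Rightarrow> 'c::euclidean_space"
  proof -
    have "bounded (f ` closure D)"
      using c f by (intro compact_imp_bounded compact_continuous_image) (auto intro: continuous_on_subset)
    then obtain M where M: "M > 0" "\<And>x. x \<in> closure D \<Longrightarrow> norm (f x) \<le> M" by (auto simp: bounded_pos)
    have one: "L2 D (\<lambda>x. 1::real)"
      using D by (auto simp: L2_def finite_measure.integrable_const finite_measure_lebesgue_on)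
    have "AE x in lebesgue_on D. norm (f x) \<le> M * norm (1::real)"
      using M(2) closure_subset[of D] by (intro AE_I2) auto
    then show ?thesis
      using L2_bound(1)[OF one borel_imp_lebesgue_on[OF borel_measurable_continuous_onI[OF f]]] M(1) by auto
  qed
  show "L2 D \<phi>" "L2 D d\<phi>" using gen C1_continuous[OF assms(3)] C1_continuous_grad[OF assms(3)] by auto
qed

lemma test_fun_L2:
  assumes "bounded D" "open D" "test_fun D \<phi> d\<phi>"
  shows "L2 D \<phi>" "L2 D d\<phi>"
  using C1_L2[OF assms(1,2) test_fun_C1[OF assms(3)]] by auto

lemma l2norm_ennreal_lborel:
  assumes "open D" "L2 D f" "f \<in> borel_measurable borel"
  shows "ennreal ((l2norm D f)\<^sup>2) = (\<integral>\<^sup>+x. ennreal ((norm (f x))\<^sup>2) * indicator D x \<partial>lborel)"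
  using nn_lebesgue_on[of D "\<lambda>x. ennreal ((norm (f x))\<^sup>2)"] assms l2norm_nn[OF assms(2)] by simp

text \<open>Translating by a vector longer than the diameter of \<open>D\<close> moves the support of a test function off \<open>D\<close>.\<close>
lemma test_fun_poincare:
  fixes D :: "(real^'n) set"
  assumes D: "bounded D" "open D"
  obtains C where "C > 0" "\<And>\<phi> d\<phi>. test_fun D \<phi> d\<phi> \<Longrightarrow> l2norm D \<phi> \<le> C * l2norm D d\<phi>"
proof -
  obtain b where b: "b > 0" "\<And>x. x \<in> D \<Longrightarrow> norm x \<le> b" using D(1) by (auto simp: bounded_pos)
  obtain e :: "real^'n" where e: "norm e = 1" using norm_axis_1 by blast
  define h where "h = (2 * b + 1) *\<^sub>R e"
  have nh: "norm h = 2 * b + 1" using b e by (simp add: h_def)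
  have "l2norm D \<phi> \<le> (2 * b + 1) * l2norm D d\<phi>" if t: "test_fun D \<phi> d\<phi>" for \<phi> d\<phi>
  proof -
    note c = test_fun_C1[OF t]
    have "ennreal ((l2norm D \<phi>)\<^sup>2) = (\<integral>\<^sup>+x. ennreal ((norm (\<phi> x))\<^sup>2) * indicator D x \<partial>lborel)"
      by (rule l2norm_ennreal_lborel) (use D t C1_borel[OF c] test_fun_L2[OF D t] in auto)
    also have "\<dots> \<le> (\<integral>\<^sup>+x. ennreal ((\<phi> (x + h) - \<phi> x)\<^sup>2) * indicator UNIV x \<partial>lborel)"
    proof (rule nn_integral_mono)
      fix x
      show "ennreal ((norm (\<phi> x))\<^sup>2) * indicator D x \<le> ennreal ((\<phi> (x + h) - \<phi> x)\<^sup>2) * indicator UNIV x"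
      proof (cases "x \<in> D")
        case True
        have "x + h \<notin> D" using b(2)[of "x + h"] b(2)[OF True] nh norm_triangle_ineq4[of "x + h" x] b(1) by auto
        then have "\<phi> (x + h) = 0" by (rule test_fun_outside(1)[OF t])
        then show ?thesis using True by simp
      qed simp
    qed
    also have "\<dots> \<le> ennreal ((norm h)\<^sup>2) * (\<integral>\<^sup>+x. ennreal ((norm (d\<phi> x))\<^sup>2) * indicator UNIV x \<partial>lborel)"
      by (rule C1_translate_L2[OF c]) auto
    also have "(\<integral>\<^sup>+x. ennreal ((norm (d\<phi> x))\<^sup>2) * indicator UNIV x \<partial>lborel) = (\<integral>\<^sup>+x. ennreal ((norm (d\<phi> x))\<^sup>2) * indicator D x \<partial>lborel)"
      using test_fun_outside(2)[OF t] by (intro nn_integral_cong) (auto simp: indicator_def)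
    also have "\<dots> = ennreal ((l2norm D d\<phi>)\<^sup>2)"
      by (rule l2norm_ennreal_lborel[symmetric]) (use D t C1_borel[OF c] test_fun_L2[OF D t] in auto)
    also have "ennreal ((norm h)\<^sup>2) * \<dots> = ennreal (((2 * b + 1) * l2norm D d\<phi>)\<^sup>2)"
      by (simp add: nh power_mult_distrib flip: ennreal_mult)
    finally have "(l2norm D \<phi>)\<^sup>2 \<le> ((2 * b + 1) * l2norm D d\<phi>)\<^sup>2" by (simp add: ennreal_le_iff)
    then show ?thesis by (rule power2_le_imp_le) (use b in auto)
  qed
  then show ?thesis using that[of "2 * b + 1"] b(1) by auto
qed

text \<open>With one approximation for every accuracy, closure properties need no sequences and no
  rates.\<close>

lemma H10_iff_approx:
  fixes D :: "(real^'n) set"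
  shows "H10 D u g \<longleftrightarrow> L2 D u \<and> L2 D g \<and>
    (\<forall>e>0. \<exists>\<phi> d\<phi>. test_fun D \<phi> d\<phi> \<and> l2norm D (\<lambda>x. \<phi> x - u x) < e \<and> l2norm D (\<lambda>x. d\<phi> x - g x) < e)" (is "?L \<longleftrightarrow> ?R")
proof
  assume L: ?L
  then obtain \<phi> d\<phi> where t: "\<And>j. test_fun D (\<phi> j) (d\<phi> j)"
    and "(\<lambda>j. \<integral>x. (\<phi> j x - u x)\<^sup>2 \<partial>lebesgue_on D) \<longlonglongrightarrow> 0" "(\<lambda>j. \<integral>x. (norm (d\<phi> j x - g x))\<^sup>2 \<partial>lebesgue_on D) \<longlonglongrightarrow> 0"
    by (auto simp: H10_def)
  then have lim: "(\<lambda>j. l2norm D (\<lambda>x. \<phi> j x - u x)) \<longlonglongrightarrow> 0" "(\<lambda>j. l2norm D (\<lambda>x. d\<phi> j x - g x)) \<longlonglongrightarrow> 0"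
    by (simp_all add: tendsto_zero_l2norm_iff)
  have "\<exists>\<phi> d\<phi>. test_fun D \<phi> d\<phi> \<and> l2norm D (\<lambda>x. \<phi> x - u x) < e \<and> l2norm D (\<lambda>x. d\<phi> x - g x) < e" if "e > 0" for e
  proof -
    have "eventually (\<lambda>j. l2norm D (\<lambda>x. \<phi> j x - u x) < e \<and> l2norm D (\<lambda>x. d\<phi> j x - g x) < e) sequentially"
      using order_tendstoD(2)[OF lim(1) that] order_tendstoD(2)[OF lim(2) that] by eventually_elim simp
    then show ?thesis using t by (auto simp: eventually_sequentially)
  qed
  then show ?R using L by (auto simp: H10_def)
next
  assume R: ?R
  have "\<exists>\<phi> d\<phi>. test_fun D \<phi> d\<phi> \<and> l2norm D (\<lambda>x. \<phi> x - u x) < 1 / real (Suc j) \<and> l2norm D (\<lambda>x. d\<phi> x - g x) < 1 / real (Suc j)" for j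
    using R by simp
  then obtain \<phi> d\<phi> where t: "\<And>j. test_fun D (\<phi> j) (d\<phi> j)" "\<And>j. l2norm D (\<lambda>x. \<phi> j x - u x) < 1 / real (Suc j)"
    "\<And>j. l2norm D (\<lambda>x. d\<phi> j x - g x) < 1 / real (Suc j)" by metis
  have "(\<lambda>j. l2norm D (\<lambda>x. \<phi> j x - u x)) \<longlonglongrightarrow> 0"
    by (rule tendsto_sandwich[OF _ _ tendsto_const LIMSEQ_Suc[OF lim_1_over_n]])
      (use t(2) in \<open>auto intro!: always_eventually less_imp_le simp del: of_nat_Suc\<close>)
  moreover have "(\<lambda>j. l2norm D (\<lambda>x. d\<phi> j x - g x)) \<longlonglongrightarrow> 0"
    by (rule tendsto_sandwich[OF _ _ tendsto_const LIMSEQ_Suc[OF lim_1_over_n]])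
      (use t(3) in \<open>auto intro!: always_eventually less_imp_le simp del: of_nat_Suc\<close>)
  ultimately show ?L using R t(1) unfolding H10_def tendsto_zero_l2norm_iff
    by (auto intro!: exI[of _ \<phi>] exI[of _ d\<phi>])
qed

lemma H10_L2: "H10 D u g \<Longrightarrow> L2 D u" "H10 D u g \<Longrightarrow> L2 D g"
  by (auto simp: H10_def)

lemma H10_approx:
  assumes "H10 D u g" "e > 0"
  obtains \<phi> d\<phi> where "test_fun D \<phi> d\<phi>" "l2norm D (\<lambda>x. \<phi> x - u x) < e" "l2norm D (\<lambda>x. d\<phi> x - g x) < e"
  using assms by (auto simp: H10_iff_approx)

lemma H10_test_fun: "bounded D \<Longrightarrow> open D \<Longrightarrow> test_fun D \<phi> d\<phi> \<Longrightarrow> H10 D \<phi> d\<phi>"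
  unfolding H10_iff_approx by (auto simp: test_fun_L2 l2norm_def l2inner_def intro!: exI[of _ \<phi>] exI[of _ d\<phi>])

lemma H10_lincomb:
  fixes D :: "(real^'n) set"
  assumes D: "bounded D" "open D" and u: "H10 D u g" and v: "H10 D v h"
  shows "H10 D (\<lambda>x. a * u x + b * v x) (\<lambda>x. a *\<^sub>R g x + b *\<^sub>R h x)"
  unfolding H10_iff_approx
proof (intro conjI allI impI)
  show "L2 D (\<lambda>x. a * u x + b * v x)" "L2 D (\<lambda>x. a *\<^sub>R g x + b *\<^sub>R h x)"
    using L2_lincomb[of D u v a b] L2_lincomb[of D g h a b] H10_L2[OF u] H10_L2[OF v] by auto
  fix e :: real assume e: "e > 0"
  define \<epsilon> where "\<epsilon> = e / (\<bar>a\<bar> + \<bar>b\<bar> + 1)"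
  have \<epsilon>: "\<epsilon> > 0" using e by (simp add: \<epsilon>_def add_nonneg_pos)
  have small: "\<bar>a\<bar> * s + \<bar>b\<bar> * t < e" if "s < \<epsilon>" "t < \<epsilon>" for s t
  proof -
    have "\<bar>a\<bar> * s + \<bar>b\<bar> * t \<le> \<bar>a\<bar> * \<epsilon> + \<bar>b\<bar> * \<epsilon>" using that by (intro add_mono mult_left_mono) auto
    also have "\<dots> < (\<bar>a\<bar> + \<bar>b\<bar> + 1) * \<epsilon>" using \<epsilon> by (simp add: algebra_simps)
    also have "\<dots> = e" by (simp add: \<epsilon>_def add_nonneg_pos)
    finally show ?thesis .
  qed
  obtain \<phi> d\<phi> where \<phi>: "test_fun D \<phi> d\<phi>" "l2norm D (\<lambda>x. \<phi> x - u x) < \<epsilon>" "l2norm D (\<lambda>x. d\<phi> x - g x) < \<epsilon>"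
    by (rule H10_approx[OF u \<epsilon>])
  obtain \<psi> d\<psi> where \<psi>: "test_fun D \<psi> d\<psi>" "l2norm D (\<lambda>x. \<psi> x - v x) < \<epsilon>" "l2norm D (\<lambda>x. d\<psi> x - h x) < \<epsilon>"
    by (rule H10_approx[OF v \<epsilon>])
  have "l2norm D (\<lambda>x. a *\<^sub>R (\<phi> x - u x) + b *\<^sub>R (\<psi> x - v x)) < e"
    using l2norm_lincomb[of D "\<lambda>x. \<phi> x - u x" "\<lambda>x. \<psi> x - v x" a b] small[OF \<phi>(2) \<psi>(2)]
      H10_L2[OF u] H10_L2[OF v] test_fun_L2[OF D \<phi>(1)] test_fun_L2[OF D \<psi>(1)] by (simp add: L2_diff)
  moreover have "l2norm D (\<lambda>x. a *\<^sub>R (d\<phi> x - g x) + b *\<^sub>R (d\<psi> x - h x)) < e"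
    using l2norm_lincomb[of D "\<lambda>x. d\<phi> x - g x" "\<lambda>x. d\<psi> x - h x" a b] small[OF \<phi>(3) \<psi>(3)]
      H10_L2[OF u] H10_L2[OF v] test_fun_L2[OF D \<phi>(1)] test_fun_L2[OF D \<psi>(1)] by (simp add: L2_diff)
  ultimately show "\<exists>\<phi> d\<phi>. test_fun D \<phi> d\<phi> \<and> l2norm D (\<lambda>x. \<phi> x - (a * u x + b * v x)) < e \<and>
      l2norm D (\<lambda>x. d\<phi> x - (a *\<^sub>R g x + b *\<^sub>R h x)) < e"
    using test_fun_lincomb[OF \<phi>(1) \<psi>(1), of a b]
    by (intro exI[of _ "\<lambda>x. a * \<phi> x + b * \<psi> x"] exI[of _ "\<lambda>x. a *\<^sub>R d\<phi> x + b *\<^sub>R d\<psi> x"]) (simp add: algebra_simps)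
qed

lemma H10_diff:
  assumes "bounded D" "open D" "H10 D u g" "H10 D v h"
  shows "H10 D (\<lambda>x. u x - v x) (\<lambda>x. g x - h x)"
  using H10_lincomb[OF assms, of 1 "-1"] by simp

lemma H10_closed:
  fixes D :: "(real^'n) set"
  assumes D: "bounded D" "open D" and H: "\<And>n::nat. H10 D (u n) (g n)" and L: "L2 D v" "L2 D h"
    and lim: "(\<lambda>n. l2norm D (\<lambda>x. u n x - v x)) \<longlonglongrightarrow> 0" "(\<lambda>n. l2norm D (\<lambda>x. g n x - h x)) \<longlonglongrightarrow> 0"
  shows "H10 D v h"
  unfolding H10_iff_approx
proof (intro conjI allI impI L)
  fix e :: real assume "e > 0"
  then have e2: "e / 2 > 0" by simp
  have "eventually (\<lambda>n. l2norm D (\<lambda>x. u n x - v x) < e/2 \<and> l2norm D (\<lambda>x. g n x - h x) < e/2) sequentially"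
    using order_tendstoD(2)[OF lim(1) e2] order_tendstoD(2)[OF lim(2) e2] by eventually_elim simp
  then obtain n where n: "l2norm D (\<lambda>x. u n x - v x) < e/2" "l2norm D (\<lambda>x. g n x - h x) < e/2"
    by (auto simp: eventually_sequentially)
  obtain \<phi> d\<phi> where \<phi>: "test_fun D \<phi> d\<phi>" "l2norm D (\<lambda>x. \<phi> x - u n x) < e/2" "l2norm D (\<lambda>x. d\<phi> x - g n x) < e/2"
    by (rule H10_approx[OF H[of n] e2])
  have "l2norm D (\<lambda>x. \<phi> x - v x) < e" "l2norm D (\<lambda>x. d\<phi> x - h x) < e"
    using l2norm_diff_triangle[of D \<phi> "u n" v] l2norm_diff_triangle[of D d\<phi> "g n" h] n \<phi> test_fun_L2[OF D \<phi>(1)] H10_L2[OF H] L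
    by fastforce+
  then show "\<exists>\<phi> d\<phi>. test_fun D \<phi> d\<phi> \<and> l2norm D (\<lambda>x. \<phi> x - v x) < e \<and> l2norm D (\<lambda>x. d\<phi> x - h x) < e"
    using \<phi>(1) by blast
qed

lemma L2_const: "bounded D \<Longrightarrow> open D \<Longrightarrow> L2 D (\<lambda>x. c::real)"
  using C1_L2(1)[OF _ _ C1_const] by blast

text \<open>Subtracting a constant leads out of \<open>H10\<close>; multiplication by a compactly
  supported function leads back. This is the test function of Caccioppoli's inequality, where the
  constant must be free.\<close>

lemma H10_cutoff:
  fixes D :: "(real^'n) set"
  assumes D: "bounded D" "open D" and u: "H10 D u g" and z: "test_fun D \<zeta> d\<zeta>"
  shows "H10 D (\<lambda>x. \<zeta> x * (u x - c)) (\<lambda>x. (u x - c) *\<^sub>R d\<zeta> x + \<zeta> x *\<^sub>R g x)"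
proof -
  obtain M where M: "M > 0" "\<And>x. \<bar>\<zeta> x\<bar> \<le> M" "\<And>x. norm (d\<zeta> x) \<le> M" by (rule test_fun_bounded[OF z]) blast
  have meas: "\<zeta> \<in> borel_measurable (lebesgue_on D)" "d\<zeta> \<in> borel_measurable (lebesgue_on D)"
    using C1_borel[OF test_fun_C1[OF z]] by (auto intro: borel_imp_lebesgue_on)
  have mult: "L2 D (\<lambda>x. \<zeta> x *\<^sub>R f x) \<and> l2norm D (\<lambda>x. \<zeta> x *\<^sub>R f x) \<le> M * l2norm D f" if "L2 D f" for f :: "real^'n \<Rightarrow> 'c::euclidean_space"
  proof -
    have "AE x in lebesgue_on D. norm (\<zeta> x *\<^sub>R f x) \<le> M * norm (f x)"
      using M(2) by (intro AE_I2) (auto intro: mult_right_mono)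
    then show ?thesis using L2_bound[OF that, of "\<lambda>x. \<zeta> x *\<^sub>R f x" M] M(1) meas L2_measurable[OF that]
      by (blast intro: borel_measurable_scaleR less_imp_le)
  qed
  have multd: "L2 D (\<lambda>x. f x *\<^sub>R d\<zeta> x) \<and> l2norm D (\<lambda>x. f x *\<^sub>R d\<zeta> x) \<le> M * l2norm D f" if "L2 D f" for f :: "real^'n \<Rightarrow> real"
  proof -
    have "AE x in lebesgue_on D. norm (f x *\<^sub>R d\<zeta> x) \<le> M * norm (f x)"
      using M(3) by (intro AE_I2) (auto intro: mult_left_mono simp: mult.commute[of M])
    then show ?thesis using L2_bound[OF that, of "\<lambda>x. f x *\<^sub>R d\<zeta> x" M] M(1) meas L2_measurable[OF that]
      by (blast intro: borel_measurable_scaleR less_imp_le)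
  qed
  note uc = L2_diff[OF H10_L2(1)[OF u] L2_const[OF D, of c]]
  show ?thesis unfolding H10_iff_approx
  proof (intro conjI allI impI)
    show "L2 D (\<lambda>x. \<zeta> x * (u x - c))" using mult[OF uc] by simp
    show "L2 D (\<lambda>x. (u x - c) *\<^sub>R d\<zeta> x + \<zeta> x *\<^sub>R g x)" using mult[OF H10_L2(2)[OF u]] multd[OF uc] by (auto intro: L2_add)
    fix e :: real assume e: "e > 0"
    define \<epsilon> where "\<epsilon> = e / (2 * M)"
    have \<epsilon>: "\<epsilon> > 0" "M * \<epsilon> + M * \<epsilon> = e" using e M by (auto simp: \<epsilon>_def)
    obtain \<phi> d\<phi> where \<phi>: "test_fun D \<phi> d\<phi>" "l2norm D (\<lambda>x. \<phi> x - u x) < \<epsilon>" "l2norm D (\<lambda>x. d\<phi> x - g x) < \<epsilon>"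
      by (rule H10_approx[OF u \<epsilon>(1)])
    have sm: "M * l2norm D (\<lambda>x. \<phi> x - u x) < M * \<epsilon>" "M * l2norm D (\<lambda>x. d\<phi> x - g x) < M * \<epsilon>" "M * \<epsilon> > 0" using \<phi> M \<epsilon> by auto
    note d1 = L2_diff[OF test_fun_L2(1)[OF D \<phi>(1)] H10_L2(1)[OF u]] and d2 = L2_diff[OF test_fun_L2(2)[OF D \<phi>(1)] H10_L2(2)[OF u]]
    have C: "C1 (\<lambda>x. \<phi> x - c) d\<phi>" using C1_lincomb[OF test_fun_C1[OF \<phi>(1)] C1_const[of c], of 1 "-1"] by simp
    have "l2norm D (\<lambda>x. \<zeta> x *\<^sub>R (\<phi> x - u x)) < e" using mult[OF d1] sm \<epsilon>(2) by linarith
    moreover have "l2norm D (\<lambda>x. (\<phi> x - u x) *\<^sub>R d\<zeta> x + \<zeta> x *\<^sub>R (d\<phi> x - g x)) < e"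
      using l2norm_add[OF conjunct1[OF multd[OF d1]] conjunct1[OF mult[OF d2]]] multd[OF d1] mult[OF d2] sm \<epsilon>(2) by linarith
    ultimately show "\<exists>\<phi> d\<phi>. test_fun D \<phi> d\<phi> \<and> l2norm D (\<lambda>x. \<phi> x - \<zeta> x * (u x - c)) < e \<and>
        l2norm D (\<lambda>x. d\<phi> x - ((u x - c) *\<^sub>R d\<zeta> x + \<zeta> x *\<^sub>R g x)) < e"
      using test_fun_mult[OF z C]
      by (intro exI[of _ "\<lambda>x. \<zeta> x * (\<phi> x - c)"] exI[of _ "\<lambda>x. (\<phi> x - c) *\<^sub>R d\<zeta> x + \<zeta> x *\<^sub>R d\<phi> x"])
        (simp add: algebra_simps)
  qed
qed

lemma H10_poincare:
  fixes D :: "(real^'n) set"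
  assumes D: "bounded D" "open D"
  obtains C where "C > 0" "\<And>u g. H10 D u g \<Longrightarrow> l2norm D u \<le> C * l2norm D g"
proof -
  obtain C where C: "C > 0" "\<And>\<phi> d\<phi>. test_fun D \<phi> d\<phi> \<Longrightarrow> l2norm D \<phi> \<le> C * l2norm D d\<phi>"
    by (rule test_fun_poincare[OF D]) blast
  have "l2norm D u \<le> C * l2norm D g" if u: "H10 D u g" for u g
  proof (rule field_le_epsilon)
    fix e :: real assume e: "e > 0"
    then have e': "e / (C + 1) > 0" using C by auto
    obtain \<phi> d\<phi> where \<phi>: "test_fun D \<phi> d\<phi>" "l2norm D (\<lambda>x. \<phi> x - u x) < e / (C + 1)" "l2norm D (\<lambda>x. d\<phi> x - g x) < e / (C + 1)"
      by (rule H10_approx[OF u e'])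
    have "l2norm D u \<le> l2norm D \<phi> + l2norm D (\<lambda>x. \<phi> x - u x)"
      using l2norm_le_diff[OF H10_L2(1)[OF u] test_fun_L2(1)[OF D \<phi>(1)]] by (simp add: l2norm_minus_commute[of D u])
    also have "l2norm D \<phi> \<le> C * l2norm D d\<phi>" using C(2)[OF \<phi>(1)] .
    also have "l2norm D d\<phi> \<le> l2norm D g + l2norm D (\<lambda>x. d\<phi> x - g x)"
      by (rule l2norm_le_diff[OF test_fun_L2(2)[OF D \<phi>(1)] H10_L2(2)[OF u]])
    finally have "l2norm D u \<le> C * (l2norm D g + l2norm D (\<lambda>x. d\<phi> x - g x)) + l2norm D (\<lambda>x. \<phi> x - u x)"
      using C(1) by (simp add: mult_left_mono)
    also have "\<dots> \<le> C * (l2norm D g + e / (C + 1)) + e / (C + 1)"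
      using \<phi> C(1) by (intro add_mono mult_left_mono) auto
    also have "\<dots> = C * l2norm D g + (C + 1) * (e / (C + 1))" by (simp only: distrib_left distrib_right mult_1_left add.assoc)
    also have "\<dots> = C * l2norm D g + e" using C(1) by simp
    finally show "l2norm D u \<le> C * l2norm D g + e" .
  qed
  then show ?thesis using that C(1) by blast
qed

section \<open>Functions paired with gradients, and existence of solutions\<close>

lemma L2_fst_snd: "L2 D U \<longleftrightarrow> L2 D (\<lambda>x. fst (U x)) \<and> L2 D (\<lambda>x. snd (U x))"
  for U :: "real^'n \<Rightarrow> 'b::euclidean_space \<times> 'c::euclidean_space"
proof
  assume U: "L2 D U"
  have "(\<lambda>x. fst (U x)) \<in> borel_measurable (lebesgue_on D)" "(\<lambda>x. snd (U x)) \<in> borel_measurable (lebesgue_on D)"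
    by (rule measurable_compose[OF L2_measurable[OF U] borel_measurable_continuous_onI], rule continuous_intros, rule continuous_intros)+
  then show "L2 D (\<lambda>x. fst (U x)) \<and> L2 D (\<lambda>x. snd (U x))"
    using L2_bound(1)[OF U, of "\<lambda>x. fst (U x)" 1] L2_bound(1)[OF U, of "\<lambda>x. snd (U x)" 1]
    by (simp add: norm_fst_le[of "fst (U x)" "snd (U x)" for x, simplified] norm_snd_le[of "snd (U x)" "fst (U x)" for x, simplified])
next
  assume *: "L2 D (\<lambda>x. fst (U x)) \<and> L2 D (\<lambda>x. snd (U x))"
  then have "(\<lambda>x. (fst (U x), snd (U x))) \<in> borel_measurable (lebesgue_on D)"
    by (intro borel_measurable_Pair) (auto dest: L2_measurable)
  moreover have "integrable (lebesgue_on D) (\<lambda>x. (norm (fst (U x)))\<^sup>2 + (norm (snd (U x)))\<^sup>2)"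
    using * by (auto simp: L2_def)
  ultimately show "L2 D U" by (simp add: L2_def norm_prod_def)
qed

lemma l2inner_fst_snd:
  fixes U V :: "real^'n \<Rightarrow> 'b::euclidean_space \<times> 'c::euclidean_space"
  assumes "L2 D U" "L2 D V"
  shows "l2inner D U V = l2inner D (\<lambda>x. fst (U x)) (\<lambda>x. fst (V x)) + l2inner D (\<lambda>x. snd (U x)) (\<lambda>x. snd (V x))"
  using assms unfolding L2_fst_snd[of D U] L2_fst_snd[of D V]
  by (simp add: l2inner_def inner_prod_def L2_inner_integrable)

lemma l2norm_fst_snd_le:
  fixes U :: "real^'n \<Rightarrow> 'b::euclidean_space \<times> 'c::euclidean_space"
  assumes "L2 D U"
  shows "l2norm D (\<lambda>x. fst (U x)) \<le> l2norm D U" "l2norm D (\<lambda>x. snd (U x)) \<le> l2norm D U"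
    "l2norm D U \<le> l2norm D (\<lambda>x. fst (U x)) + l2norm D (\<lambda>x. snd (U x))"
proof -
  note e = l2inner_fst_snd[OF assms assms]
  have "0 \<le> l2inner D (\<lambda>x. fst (U x)) (\<lambda>x. fst (U x))" "0 \<le> l2inner D (\<lambda>x. snd (U x)) (\<lambda>x. snd (U x))"
    by (simp_all add: l2inner_self)
  then show "l2norm D (\<lambda>x. fst (U x)) \<le> l2norm D U" "l2norm D (\<lambda>x. snd (U x)) \<le> l2norm D U"
    "l2norm D U \<le> l2norm D (\<lambda>x. fst (U x)) + l2norm D (\<lambda>x. snd (U x))"
    by (simp_all add: l2norm_def e sqrt_add_le_add_sqrt)
qed

text \<open>For pairs of a function and its gradient the \<open>H\<^sup>1\<close> inner product is
  the \<open>L\<^sup>2\<close> inner product in the product space. Completeness is then inherited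
  from \<open>L2_complete\<close> and \<open>H10_closed\<close>.\<close>

abbreviation H10_pairs :: "(real^'n) set \<Rightarrow> (real^'n \<Rightarrow> real \<times> (real^'n)) set" where
  "H10_pairs D \<equiv> {U. H10 D (\<lambda>x. fst (U x)) (\<lambda>x. snd (U x))}"

lemma H10_pairs_L2: "U \<in> H10_pairs D \<Longrightarrow> L2 D U"
  by (auto simp: L2_fst_snd[of D U] dest: H10_L2)

lemma semi_hilbert_H10:
  fixes D :: "(real^'n) set"
  assumes D: "bounded D" "open D"
  shows "semi_hilbert (H10_pairs D) (\<lambda>a U b V x. a *\<^sub>R U x + b *\<^sub>R V x) (l2inner D)"
proof
  show "(\<lambda>x. a *\<^sub>R U x + b *\<^sub>R V x) \<in> H10_pairs D" if "U \<in> H10_pairs D" "V \<in> H10_pairs D" for U V a b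
    using H10_lincomb[OF D, of "\<lambda>x. fst (U x)" "\<lambda>x. snd (U x)" "\<lambda>x. fst (V x)" "\<lambda>x. snd (V x)" a b] that
    by simp
  show "l2inner D (\<lambda>x. a *\<^sub>R U x + b *\<^sub>R V x) W = a * l2inner D U W + b * l2inner D V W"
    if "U \<in> H10_pairs D" "V \<in> H10_pairs D" "W \<in> H10_pairs D" for U V W a b
    using that by (intro l2inner_lincomb_left H10_pairs_L2)
  show "l2inner D U V = l2inner D V U" for U V :: "real^'n \<Rightarrow> real \<times> (real^'n)" by (rule l2inner_commute)
  show "0 \<le> l2inner D U U" for U :: "real^'n \<Rightarrow> real \<times> (real^'n)" by (simp add: l2inner_self)
  fix X :: "nat \<Rightarrow> real^'n \<Rightarrow> real \<times> (real^'n)"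
  assume X: "\<And>n. X n \<in> H10_pairs D"
    and c: "\<And>e. e > 0 \<Longrightarrow> \<exists>N. \<forall>m\<ge>N. \<forall>n\<ge>N. l2inner D (\<lambda>x. 1 *\<^sub>R X m x + - 1 *\<^sub>R X n x) (\<lambda>x. 1 *\<^sub>R X m x + - 1 *\<^sub>R X n x) < e"
  have DL: "D \<in> lmeasurable" using D by (intro lmeasurable_open)
  have XL: "L2 D (X n)" for n by (rule H10_pairs_L2[OF X])
  have cauchy: "\<exists>N. \<forall>m\<ge>N. \<forall>n\<ge>N. l2norm D (\<lambda>x. X m x - X n x) < e" if "e > 0" for e
  proof -
    obtain N where "\<forall>m\<ge>N. \<forall>n\<ge>N. l2inner D (\<lambda>x. X m x - X n x) (\<lambda>x. X m x - X n x) < e\<^sup>2"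
      using c[of "e\<^sup>2"] \<open>e > 0\<close> by auto
    then have "\<forall>m\<ge>N. \<forall>n\<ge>N. l2norm D (\<lambda>x. X m x - X n x) < e"
      using \<open>e > 0\<close> by (auto simp: l2norm_def intro!: real_less_lsqrt)
    then show ?thesis by blast
  qed
  obtain w where w: "L2 D w" and lim: "(\<lambda>n. l2norm D (\<lambda>x. X n x - w x)) \<longlonglongrightarrow> 0"
    by (rule L2_complete[OF DL XL cauchy])
  have d: "L2 D (\<lambda>x. X n x - w x)" for n by (rule L2_diff[OF XL w])
  have l1: "(\<lambda>n. l2norm D (\<lambda>x. fst (X n x) - fst (w x))) \<longlonglongrightarrow> 0"
    by (rule tendsto_sandwich[OF _ _ tendsto_const lim]) (use l2norm_fst_snd_le(1)[OF d] in auto)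
  have l2: "(\<lambda>n. l2norm D (\<lambda>x. snd (X n x) - snd (w x))) \<longlonglongrightarrow> 0"
    by (rule tendsto_sandwich[OF _ _ tendsto_const lim]) (use l2norm_fst_snd_le(2)[OF d] in auto)
  have "w \<in> H10_pairs D"
    using H10_closed[OF D, of "\<lambda>n x. fst (X n x)" "\<lambda>n x. snd (X n x)", OF _ _ _ l1 l2] X w
    by (simp add: L2_fst_snd[of D w])
  moreover have "(\<lambda>n. l2inner D (\<lambda>x. X n x - w x) (\<lambda>x. X n x - w x)) \<longlonglongrightarrow> 0"
    using lim by (simp add: tendsto_zero_l2norm_iff l2inner_self)
  ultimately show "\<exists>w\<in>H10_pairs D. (\<lambda>n. l2inner D (\<lambda>x. 1 *\<^sub>R X n x + - 1 *\<^sub>R w x) (\<lambda>x. 1 *\<^sub>R X n x + - 1 *\<^sub>R w x)) \<longlonglongrightarrow> 0"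
    by auto
qed

lemma H10_pairs_nr: "semi_ip.nr (l2inner D) = (l2norm D :: (real^'n \<Rightarrow> real \<times> (real^'n)) \<Rightarrow> real)"
  by (rule semi_ip_nr_L2)

lemma zero_in_H10_pairs: "bounded D \<Longrightarrow> open D \<Longrightarrow> (\<lambda>x. 0) \<in> H10_pairs D"
  using H10_test_fun[OF _ _ test_fun_zero] by simp

text \<open>The functional has the gradient as a second argument because \<open>H10\<close> is a
  relation between functions and gradients. The constant doubles since each of the two norms is
  bounded by the norm of the pair.\<close>

lemma H10_riesz:
  fixes D :: "(real^'n) set" and l :: "(real^'n \<Rightarrow> real) \<Rightarrow> (real^'n \<Rightarrow> real^'n) \<Rightarrow> real"
  assumes D: "bounded D" "open D"
    and lin: "\<And>u g v h a b. H10 D u g \<Longrightarrow> H10 D v h \<Longrightarrow> l (\<lambda>x. a * u x + b * v x) (\<lambda>x. a *\<^sub>R g x + b *\<^sub>R h x) = a * l u g + b * l v h"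
    and bd: "\<And>u g. H10 D u g \<Longrightarrow> \<bar>l u g\<bar> \<le> C * (l2norm D u + l2norm D g)" and C: "0 \<le> C"
  obtains w k where "H10 D w k" "\<And>v h. H10 D v h \<Longrightarrow> l v h = l2inner D w v + l2inner D k h"
proof -
  interpret semi_hilbert "H10_pairs D" "\<lambda>a U b V x. a *\<^sub>R U x + b *\<^sub>R V x" "l2inner D"
    by (rule semi_hilbert_H10[OF D])
  let ?l = "\<lambda>U. l (\<lambda>x. fst (U x)) (\<lambda>x. snd (U x))"
  obtain W where W: "W \<in> H10_pairs D" "\<And>V. V \<in> H10_pairs D \<Longrightarrow> l2inner D W V = ?l V"
  proof (rule riesz[of "\<lambda>x. 0" ?l "2 * C"])
    show "\<bar>?l U\<bar> \<le> 2 * C * nr U" if U: "U \<in> H10_pairs D" for U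
    proof -
      have "\<bar>?l U\<bar> \<le> C * (l2norm D (\<lambda>x. fst (U x)) + l2norm D (\<lambda>x. snd (U x)))" using bd U by auto
      also have "\<dots> \<le> C * (l2norm D U + l2norm D U)"
        using l2norm_fst_snd_le[OF H10_pairs_L2[OF U]] C by (intro mult_left_mono add_mono)
      finally show ?thesis by (simp add: H10_pairs_nr)
    qed
  qed (use zero_in_H10_pairs[OF D] lin in auto)
  have "l v h = l2inner D (\<lambda>x. fst (W x)) v + l2inner D (\<lambda>x. snd (W x)) h" if "H10 D v h" for v h
    using W(2)[of "\<lambda>x. (v x, h x)"] that l2inner_fst_snd[OF H10_pairs_L2[OF W(1)] H10_pairs_L2[of "\<lambda>x. (v x, h x)"]]
    by simp
  then show ?thesis using that[of "\<lambda>x. fst (W x)" "\<lambda>x. snd (W x)"] W(1) by blast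
qed

lemma wsol_exists:
  fixes D :: "(real^'n) set"
  assumes D: "bounded D" "open D" and A: "Mab \<alpha> \<beta> D A" and al: "0 < \<alpha>" and be: "0 \<le> \<beta>" and T: "Hminus1 D T"
  obtains u g where "wsol D A T u g"
proof -
  interpret semi_hilbert "H10_pairs D" "\<lambda>a U b V x. a *\<^sub>R U x + b *\<^sub>R V x" "l2inner D"
    by (rule semi_hilbert_H10[OF D])
  let ?G = "\<lambda>U x. snd (U x) :: real^'n"
  let ?a = "\<lambda>U V. l2inner D (\<lambda>x. A x *v ?G U x) (?G V)"
  obtain C where C: "C > 0" "\<And>u g. H10 D u g \<Longrightarrow> l2norm D u \<le> C * l2norm D g"
    by (rule H10_poincare[OF D]) blast
  obtain c where c: "\<And>u g. H10 D u g \<Longrightarrow> \<bar>T u\<bar> \<le> c * sqrt (l2inner D u u + l2inner D g g)"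
    using T unfolding Hminus1_def by blast
  have T_lin: "T (\<lambda>x. a * u x + b * v x) = a * T u + b * T v" if "H10 D u g" "H10 D v h" for u g v h a b
    using T that unfolding Hminus1_def by blast
  have GL: "L2 D (?G U)" if "U \<in> H10_pairs D" for U using that H10_L2 by auto
  have AL: "L2 D (\<lambda>x. A x *v ?G U x)" if "U \<in> H10_pairs D" for U by (rule Mab_L2(1)[OF A GL[OF that] be])
  obtain W where W: "W \<in> H10_pairs D" "\<And>V. V \<in> H10_pairs D \<Longrightarrow> ?a W V = T (\<lambda>x. fst (V x))"
  \<comment> \<open>The form controls only the gradient. Poincare's inequality bounds the full
    squared norm by \<open>C\<^sup>2 + 1\<close> times the squared gradient norm, whence the
    coercivity constant.\<close>
  proof (rule lax_milgram[of "\<lambda>x. 0" ?a \<beta> "\<alpha> / (C\<^sup>2 + 1)" "\<lambda>V. T (\<lambda>x. fst (V x))" c])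
    show "?a (\<lambda>x. s *\<^sub>R U x + t *\<^sub>R V x) Z = s * ?a U Z + t * ?a V Z"
      if "U \<in> H10_pairs D" "V \<in> H10_pairs D" "Z \<in> H10_pairs D" for U V Z s t
      using l2inner_lincomb_left[OF AL[OF that(1)] AL[OF that(2)] GL[OF that(3)]]
      by (simp add: matrix_vector_right_distrib matrix_vector_mult_scaleR)
    show "?a Z (\<lambda>x. s *\<^sub>R U x + t *\<^sub>R V x) = s * ?a Z U + t * ?a Z V"
      if "U \<in> H10_pairs D" "V \<in> H10_pairs D" "Z \<in> H10_pairs D" for U V Z s t
      using l2inner_lincomb_right[OF GL[OF that(1)] GL[OF that(2)] AL[OF that(3)]] by simp
    show "\<bar>?a U V\<bar> \<le> \<beta> * nr U * nr V" if U: "U \<in> H10_pairs D" and V: "V \<in> H10_pairs D" for U V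
    proof -
      have "\<bar>?a U V\<bar> \<le> l2norm D (\<lambda>x. A x *v ?G U x) * l2norm D (?G V)"
        by (rule l2_cauchy_schwarz[OF AL[OF U] GL[OF V]])
      also have "\<dots> \<le> (\<beta> * l2norm D U) * l2norm D V"
      proof (rule mult_mono)
        show "l2norm D (\<lambda>x. A x *v ?G U x) \<le> \<beta> * l2norm D U"
          using Mab_L2(2)[OF A GL[OF U] be] mult_left_mono[OF l2norm_fst_snd_le(2)[OF H10_pairs_L2[OF U]] be] by linarith
      qed (use l2norm_fst_snd_le(2)[OF H10_pairs_L2[OF V]] be in auto)
      finally show ?thesis by (simp add: H10_pairs_nr)
    qed
    show "\<alpha> / (C\<^sup>2 + 1) * l2inner D U U \<le> ?a U U" if U: "U \<in> H10_pairs D" for U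
    proof -
      have "l2inner D U U = (l2norm D (\<lambda>x. fst (U x)))\<^sup>2 + (l2norm D (?G U))\<^sup>2"
        using l2inner_fst_snd[OF H10_pairs_L2[OF U] H10_pairs_L2[OF U]] by (simp add: l2norm_sq_inner)
      also have "\<dots> \<le> (C * l2norm D (?G U))\<^sup>2 + (l2norm D (?G U))\<^sup>2"
        using C U by (intro add_right_mono power_mono) auto
      also have "\<dots> = (C\<^sup>2 + 1) * (l2norm D (?G U))\<^sup>2" by (simp add: power_mult_distrib algebra_simps)
      finally have "\<alpha> / (C\<^sup>2 + 1) * l2inner D U U \<le> \<alpha> / (C\<^sup>2 + 1) * ((C\<^sup>2 + 1) * (l2norm D (?G U))\<^sup>2)"
        using al by (intro mult_left_mono) auto
      also have "\<dots> = \<alpha> * (l2norm D (?G U))\<^sup>2"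
        using sum_power2_gt_zero_iff[of C 1] by (simp add: add_nonneg_eq_0_iff)
      also have "\<dots> \<le> ?a U U" by (rule Mab_coercive[OF A GL[OF U] be])
      finally show ?thesis .
    qed
    show "\<bar>T (\<lambda>x. fst (U x))\<bar> \<le> c * nr U" if U: "U \<in> H10_pairs D" for U
      using c[of "\<lambda>x. fst (U x)" "?G U"] U l2inner_fst_snd[OF H10_pairs_L2[OF U] H10_pairs_L2[OF U]]
      by (simp add: H10_pairs_nr l2norm_def)
    show "T (\<lambda>x. fst (s *\<^sub>R U x + t *\<^sub>R V x)) = s * T (\<lambda>x. fst (U x)) + t * T (\<lambda>x. fst (V x))"
      if "U \<in> H10_pairs D" "V \<in> H10_pairs D" for U V s t
      using T_lin[of "\<lambda>x. fst (U x)" "?G U" "\<lambda>x. fst (V x)" "?G V" s t] that by simp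
    show "0 < \<alpha> / (C\<^sup>2 + 1)" using al by (simp add: add_nonneg_pos)
  qed (use zero_in_H10_pairs[OF D] in auto)
  have "wsol D A T (\<lambda>x. fst (W x)) (?G W)"
    unfolding wsol_def using W(1) W(2)[of "\<lambda>x. (v x, h x)" for v h] by auto
  then show ?thesis by (rule that)
qed

section \<open>Caccioppoli's inequality\<close>

text \<open>The local norm is a norm on all of \<open>D\<close> of a truncated field, so the global
  lemmas on norms, inner products and limits apply to it unchanged.\<close>

definition l2on :: "(real^'n) set \<Rightarrow> (real^'n) set \<Rightarrow> (real^'n \<Rightarrow> 'b::euclidean_space) \<Rightarrow> real" where
  "l2on D B f = l2norm D (\<lambda>x. indicator B x *\<^sub>R f x)"

definition l1on :: "(real^'n) set \<Rightarrow> (real^'n) set \<Rightarrow> (real^'n \<Rightarrow> 'b::euclidean_space) \<Rightarrow> real" where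
  "l1on D B f = (\<integral>x. indicator B x * norm (f x) \<partial>lebesgue_on D)"

lemma indicator_lebesgue_on: "B \<in> sets borel \<Longrightarrow> (indicator B :: real^'n \<Rightarrow> real) \<in> borel_measurable (lebesgue_on D)"
  by (intro borel_imp_lebesgue_on borel_measurable_indicator)

lemma L2_indicator:
  assumes "L2 D f" "B \<in> sets borel"
  shows "L2 D (\<lambda>x. indicator B x *\<^sub>R f x)" "l2on D B f \<le> l2norm D f"
proof -
  have "AE x in lebesgue_on D. norm (indicator B x *\<^sub>R f x) \<le> 1 * norm (f x)"
    by (intro AE_I2) (auto simp: indicator_def)
  then show "L2 D (\<lambda>x. indicator B x *\<^sub>R f x)" "l2on D B f \<le> l2norm D f"
    using L2_bound[OF assms(1), of "\<lambda>x. indicator B x *\<^sub>R f x" 1] L2_measurable[OF assms(1)]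
      indicator_lebesgue_on[OF assms(2), of D] by (auto simp: l2on_def intro: borel_measurable_scaleR)
qed

lemma l2on_sq: "(l2on D B f)\<^sup>2 = (\<integral>x. indicator B x * (norm (f x))\<^sup>2 \<partial>lebesgue_on D)"
  unfolding l2on_def l2norm_sq by (intro Bochner_Integration.integral_cong) (auto simp: indicator_def)

lemma integrable_indicator_sq: "L2 D f \<Longrightarrow> B \<in> sets borel \<Longrightarrow> integrable (lebesgue_on D) (\<lambda>x. indicator B x * (norm (f x))\<^sup>2)"
  using L2_integrable_sq[OF L2_indicator(1)[of D f B]]
  by (rule Bochner_Integration.integrable_cong[THEN iffD1, rotated -1]) (auto simp: indicator_def)

lemma integrable_indicator_norm: "D \<in> lmeasurable \<Longrightarrow> L2 D f \<Longrightarrow> B \<in> sets borel \<Longrightarrow> integrable (lebesgue_on D) (\<lambda>x. indicator B x * norm (f x))"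
  using L1_le_l2norm(1)[OF _ L2_indicator(1)[of D f B]] by simp

lemma l2on_nonneg [simp]: "0 \<le> l2on D B f"
  by (simp add: l2on_def)

lemma l1on_nonneg [simp]: "0 \<le> l1on D B f"
  by (simp add: l1on_def)

lemma l2on_mono:
  assumes "L2 D f" "B \<in> sets borel" "C \<in> sets borel" "B \<subseteq> C"
  shows "l2on D B f \<le> l2on D C f"
proof (rule power2_le_imp_le)
  show "(l2on D B f)\<^sup>2 \<le> (l2on D C f)\<^sup>2" unfolding l2on_sq
    by (intro integral_mono integrable_indicator_sq assms mult_right_mono) (use assms(4) in \<open>auto simp: indicator_def\<close>)
qed simp

lemma l2on_ennreal:
  assumes D: "open D" and B: "B \<in> sets borel" "B \<subseteq> D" and f: "L2 D f" "f \<in> borel_measurable borel"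
  shows "(\<integral>\<^sup>+x. ennreal ((norm (f x))\<^sup>2) * indicator B x \<partial>lborel) = ennreal ((l2on D B f)\<^sup>2)"
proof -
  have "ennreal ((l2on D B f)\<^sup>2) = (\<integral>\<^sup>+x. ennreal ((norm (indicator B x *\<^sub>R f x))\<^sup>2) * indicator D x \<partial>lborel)"
    unfolding l2on_def using f B by (intro l2norm_ennreal_lborel D L2_indicator(1)) auto
  also have "\<dots> = (\<integral>\<^sup>+x. ennreal ((norm (f x))\<^sup>2) * indicator B x \<partial>lborel)"
    using B(2) by (intro nn_integral_cong) (auto simp: indicator_def)
  finally show ?thesis ..
qed

lemma l1on_ennreal:
  assumes D: "bounded D" "open D" and B: "B \<in> sets borel" "B \<subseteq> D" and f: "L2 D f" "f \<in> borel_measurable borel"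
  shows "(\<integral>\<^sup>+x. ennreal (norm (f x)) * indicator B x \<partial>lborel) = ennreal (l1on D B f)"
proof -
  have "ennreal (l1on D B f) = (\<integral>\<^sup>+x. ennreal (indicator B x * norm (f x)) \<partial>lebesgue_on D)"
    unfolding l1on_def using integrable_indicator_norm[OF lmeasurable_open[OF D] f(1) B(1)]
    by (intro nn_integral_eq_integral[symmetric]) auto
  also have "\<dots> = (\<integral>\<^sup>+x. ennreal (indicator B x * norm (f x)) * indicator D x \<partial>lborel)"
    using D f B by (intro nn_lebesgue_on) auto
  also have "\<dots> = (\<integral>\<^sup>+x. ennreal (norm (f x)) * indicator B x \<partial>lborel)"
    using B(2) by (intro nn_integral_cong) (auto simp: indicator_def)
  finally show ?thesis ..
qed

lemma test_fun_ehrling: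
  fixes D :: "(real^'n) set"
  assumes D: "bounded D" "open D" and t: "test_fun D \<phi> d\<phi>" and r: "0 < \<rho>" "\<rho> \<le> r" and B3: "ball x0 (3 * r) \<subseteq> D"
    and c: "c = (1 / measure lborel (ball x0 (3 * r))) * (\<integral>x. indicator (ball x0 (3 * r)) x * \<phi> x \<partial>lebesgue_on D)"
    and V: "V = measure lborel (ball (0::real^'n) \<rho>)"
  shows "V\<^sup>2 * (l2on D (ball x0 (2 * r)) (\<lambda>x. \<phi> x - c))\<^sup>2 \<le> 2 * V\<^sup>2 * \<rho>\<^sup>2 * (l2on D (ball x0 (3 * r)) d\<phi>)\<^sup>2
     + 2 * measure lborel (ball x0 (2 * r)) * (2 ^ CARD('n) * (6 * r) * l1on D (ball x0 (3 * r)) d\<phi>)\<^sup>2"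
proof -
  note C = test_fun_C1[OF t]
  note [measurable] = C1_borel[OF C]
  have B2: "ball x0 (2 * r) \<subseteq> D" using B3 r subset_ball[of "2 * r" "3 * r" x0] by auto
  have "(\<integral>x. indicator (ball x0 (3 * r)) x * \<phi> x \<partial>lebesgue_on D) = (\<integral>x. indicator (ball x0 (3 * r)) x * \<phi> x \<partial>lborel)"
    using B3 D by (intro lebesgue_on_zero_outside(2)) (auto simp: indicator_def)
  then have c': "c = (1 / measure lborel (ball x0 (3 * r))) * (\<integral>x. indicator (ball x0 (3 * r)) x * \<phi> x \<partial>lborel)"
    using c by simp
  note L = test_fun_L2[OF D t]
  have "ennreal (V\<^sup>2) * ennreal ((l2on D (ball x0 (2 * r)) (\<lambda>x. \<phi> x - c))\<^sup>2)
    \<le> ennreal (2 * V\<^sup>2 * \<rho>\<^sup>2) * ennreal ((l2on D (ball x0 (3 * r)) d\<phi>)\<^sup>2)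
     + ennreal (2 * measure lborel (ball x0 (2 * r))) * (ennreal (2 ^ CARD('n) * (6 * r)) * ennreal (l1on D (ball x0 (3 * r)) d\<phi>))\<^sup>2"
    using C1_ehrling[OF C r c' V]
      l2on_ennreal[OF D(2) _ B2 L2_diff[OF L(1) L2_const[OF D, of c]]] l2on_ennreal[OF D(2) _ B3 L(2)] l1on_ennreal[OF D _ B3 L(2)]
    by simp
  also have "\<dots> = ennreal (2 * V\<^sup>2 * \<rho>\<^sup>2 * (l2on D (ball x0 (3 * r)) d\<phi>)\<^sup>2
     + 2 * measure lborel (ball x0 (2 * r)) * (2 ^ CARD('n) * (6 * r) * l1on D (ball x0 (3 * r)) d\<phi>)\<^sup>2)"
    using r by (subst ennreal_plus) (auto simp: ennreal_mult[symmetric] ennreal_power)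
  finally have "ennreal (V\<^sup>2 * (l2on D (ball x0 (2 * r)) (\<lambda>x. \<phi> x - c))\<^sup>2)
    \<le> ennreal (2 * V\<^sup>2 * \<rho>\<^sup>2 * (l2on D (ball x0 (3 * r)) d\<phi>)\<^sup>2
     + 2 * measure lborel (ball x0 (2 * r)) * (2 ^ CARD('n) * (6 * r) * l1on D (ball x0 (3 * r)) d\<phi>)\<^sup>2)"
    by (simp only: ennreal_mult[symmetric] zero_le_power2)
  then show ?thesis by (rule ennreal_le_iff[THEN iffD1, rotated]) auto
qed

lemma l2norm_tendsto:
  assumes "\<And>n::nat. L2 D (f n)" "L2 D g" "(\<lambda>n. l2norm D (\<lambda>x. f n x - g x)) \<longlonglongrightarrow> 0"
  shows "(\<lambda>n. l2norm D (f n)) \<longlonglongrightarrow> l2norm D g"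
proof -
  have "\<bar>l2norm D (f n) - l2norm D g\<bar> \<le> l2norm D (\<lambda>x. f n x - g x)" for n
    using l2norm_le_diff[OF assms(1)[of n] assms(2)] l2norm_le_diff[OF assms(2) assms(1)[of n]]
    by (simp add: l2norm_minus_commute[of D g])
  then have "(\<lambda>n. l2norm D (f n) - l2norm D g) \<longlonglongrightarrow> 0"
    by (intro Lim_null_comparison[OF _ assms(3)]) auto
  then show "(\<lambda>n. l2norm D (f n)) \<longlonglongrightarrow> l2norm D g" by (rule LIM_zero_cancel)
qed

lemma L1_tendsto:
  assumes D: "D \<in> lmeasurable" and "\<And>n::nat. L2 D (f n)" "L2 D g" "(\<lambda>n. l2norm D (\<lambda>x. f n x - g x)) \<longlonglongrightarrow> 0"
  shows "(\<lambda>n. \<integral>x. f n x \<partial>lebesgue_on D) \<longlonglongrightarrow> (\<integral>x. g x \<partial>lebesgue_on D)"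
    "(\<lambda>n. \<integral>x. norm (f n x) \<partial>lebesgue_on D) \<longlonglongrightarrow> (\<integral>x. norm (g x) \<partial>lebesgue_on D)"
proof -
  note d = L2_diff[OF assms(2,3)]
  have int: "integrable (lebesgue_on D) h" if "L2 D h" for h :: "real^'a \<Rightarrow> 'b"
    using L1_le_l2norm(1)[OF D that] L2_measurable[OF that] by (rule integrable_norm_cancel)
  have lim: "(\<lambda>n. sqrt (measure lebesgue D) * l2norm D (\<lambda>x. f n x - g x)) \<longlonglongrightarrow> 0"
    using tendsto_mult_left[OF assms(4)] by simp
  have 1: "norm ((\<integral>x. f n x \<partial>lebesgue_on D) - (\<integral>x. g x \<partial>lebesgue_on D)) \<le> sqrt (measure lebesgue D) * l2norm D (\<lambda>x. f n x - g x)" for n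
    using integral_norm_bound[of "lebesgue_on D" "\<lambda>x. f n x - g x"] L1_le_l2norm(2)[OF D d[of n]]
    by (simp add: int assms)
  show "(\<lambda>n. \<integral>x. f n x \<partial>lebesgue_on D) \<longlonglongrightarrow> (\<integral>x. g x \<partial>lebesgue_on D)"
    by (rule LIM_zero_cancel, rule Lim_null_comparison[OF _ lim]) (use 1 in auto)
  have 2: "norm ((\<integral>x. norm (f n x) \<partial>lebesgue_on D) - (\<integral>x. norm (g x) \<partial>lebesgue_on D)) \<le> sqrt (measure lebesgue D) * l2norm D (\<lambda>x. f n x - g x)" for n
  proof -
    have "norm (\<integral>x. norm (f n x) - norm (g x) \<partial>lebesgue_on D) \<le> (\<integral>x. norm (norm (f n x) - norm (g x)) \<partial>lebesgue_on D)"
      by (rule integral_norm_bound)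
    also have "\<dots> \<le> (\<integral>x. norm (f n x - g x) \<partial>lebesgue_on D)"
      by (intro integral_mono Bochner_Integration.integrable_norm Bochner_Integration.integrable_diff int assms d)
        (simp add: norm_triangle_ineq3)
    also have "\<dots> \<le> sqrt (measure lebesgue D) * l2norm D (\<lambda>x. f n x - g x)" by (rule L1_le_l2norm(2)[OF D d])
    finally show ?thesis by (simp add: int assms)
  qed
  show "(\<lambda>n. \<integral>x. norm (f n x) \<partial>lebesgue_on D) \<longlonglongrightarrow> (\<integral>x. norm (g x) \<partial>lebesgue_on D)"
    by (rule LIM_zero_cancel, rule Lim_null_comparison[OF _ lim]) (use 2 in auto)
qed

lemma l2norm_indicator_diff_tendsto:
  assumes "\<And>n::nat. L2 D (f n)" "L2 D g" "(\<lambda>n. l2norm D (\<lambda>x. f n x - g x)) \<longlonglongrightarrow> 0" and B: "B \<in> sets borel"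
  shows "(\<lambda>n. l2norm D (\<lambda>x. indicator B x *\<^sub>R f n x - indicator B x *\<^sub>R g x)) \<longlonglongrightarrow> 0"
proof (rule tendsto_sandwich[OF _ _ tendsto_const assms(3)])
  show "\<forall>\<^sub>F n in sequentially. l2norm D (\<lambda>x. indicator B x *\<^sub>R f n x - indicator B x *\<^sub>R g x) \<le> l2norm D (\<lambda>x. f n x - g x)"
    using L2_indicator(2)[OF L2_diff[OF assms(1,2)] B] by (auto simp: l2on_def scaleR_diff_right)
qed auto

text \<open>Density of test functions. All terms are continuous along an approximating sequence,
  including the means, because \<open>L\<^sup>2\<close> convergence on a bounded set implies
  \<open>L\<^sup>1\<close> convergence.\<close>

lemma H10_ehrling:
  fixes D :: "(real^'n) set"
  assumes D: "bounded D" "open D" and w: "H10 D w g" and r: "0 < \<rho>" "\<rho> \<le> r" and B3: "ball x0 (3 * r) \<subseteq> D"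
    and V: "V = measure lborel (ball (0::real^'n) \<rho>)"
  obtains c where "V\<^sup>2 * (l2on D (ball x0 (2 * r)) (\<lambda>x. w x - c))\<^sup>2 \<le> 2 * V\<^sup>2 * \<rho>\<^sup>2 * (l2on D (ball x0 (3 * r)) g)\<^sup>2
     + 2 * measure lborel (ball x0 (2 * r)) * (2 ^ CARD('n) * (6 * r) * l1on D (ball x0 (3 * r)) g)\<^sup>2"
proof -
  obtain \<phi> d\<phi> where t: "\<And>j::nat. test_fun D (\<phi> j) (d\<phi> j)"
    and "(\<lambda>j. \<integral>x. (\<phi> j x - w x)\<^sup>2 \<partial>lebesgue_on D) \<longlonglongrightarrow> 0" "(\<lambda>j. \<integral>x. (norm (d\<phi> j x - g x))\<^sup>2 \<partial>lebesgue_on D) \<longlonglongrightarrow> 0"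
    using w unfolding H10_def by blast
  then have lim: "(\<lambda>j. l2norm D (\<lambda>x. \<phi> j x - w x)) \<longlonglongrightarrow> 0" "(\<lambda>j. l2norm D (\<lambda>x. d\<phi> j x - g x)) \<longlonglongrightarrow> 0"
    by (simp_all add: tendsto_zero_l2norm_iff)
  note L = test_fun_L2[OF D t] and wL = H10_L2[OF w]
  note DL = lmeasurable_open[OF D]
  let ?B = "ball x0 (2 * r)" and ?C = "ball x0 (3 * r)"
  define c where "c j = (1 / measure lborel ?C) * (\<integral>x. indicator ?C x * \<phi> j x \<partial>lebesgue_on D)" for j
  define c0 where "c0 = (1 / measure lborel ?C) * (\<integral>x. indicator ?C x * w x \<partial>lebesgue_on D)"
  have ind: "L2 D (\<lambda>x. indicator B x *\<^sub>R f x)" if "L2 D f" "B \<in> sets borel" for B and f :: "real^'n \<Rightarrow> 'c::euclidean_space"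
    using L2_indicator(1)[OF that] .
  have climit: "c \<longlonglongrightarrow> c0" unfolding c_def c0_def
    using L1_tendsto(1)[OF DL ind[OF L(1)] ind[OF wL(1)] l2norm_indicator_diff_tendsto[OF L(1) wL(1) lim(1)], of ?C]
    by (intro tendsto_mult_left) simp
  \<comment> \<open>The subtracted means vary with \<open>j\<close>, so their convergence is part of
    the limit passage.\<close>
  have cl: "(\<lambda>j. l2norm D (\<lambda>x. (\<phi> j x - c j) - (w x - c0))) \<longlonglongrightarrow> 0"
  proof (rule tendsto_sandwich[OF _ _ tendsto_const])
    show "\<forall>\<^sub>F j in sequentially. l2norm D (\<lambda>x. (\<phi> j x - c j) - (w x - c0)) \<le> l2norm D (\<lambda>x. \<phi> j x - w x) + \<bar>c j - c0\<bar> * l2norm D (\<lambda>x. 1::real)"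
    proof (intro always_eventually allI)
      fix j
      have "l2norm D (\<lambda>x. 1 *\<^sub>R (\<phi> j x - w x) + (- (c j - c0)) *\<^sub>R 1) \<le> \<bar>1\<bar> * l2norm D (\<lambda>x. \<phi> j x - w x) + \<bar>- (c j - c0)\<bar> * l2norm D (\<lambda>x. 1::real)"
        by (intro l2norm_lincomb L2_diff L wL L2_const D)
      then show "l2norm D (\<lambda>x. (\<phi> j x - c j) - (w x - c0)) \<le> l2norm D (\<lambda>x. \<phi> j x - w x) + \<bar>c j - c0\<bar> * l2norm D (\<lambda>x. 1::real)"
        by (simp add: algebra_simps abs_minus_commute[of "c j"])
    qed
    have "(\<lambda>j. l2norm D (\<lambda>x. \<phi> j x - w x) + \<bar>c j - c0\<bar> * l2norm D (\<lambda>x. 1::real)) \<longlonglongrightarrow> 0 + \<bar>c0 - c0\<bar> * l2norm D (\<lambda>x. 1::real)"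
      by (intro tendsto_intros lim climit)
    then show "(\<lambda>j. l2norm D (\<lambda>x. \<phi> j x - w x) + \<bar>c j - c0\<bar> * l2norm D (\<lambda>x. 1::real)) \<longlonglongrightarrow> 0" by simp
  qed auto
  have 1: "(\<lambda>j. l2on D ?B (\<lambda>x. \<phi> j x - c j)) \<longlonglongrightarrow> l2on D ?B (\<lambda>x. w x - c0)"
    unfolding l2on_def
    by (rule l2norm_tendsto[OF ind ind l2norm_indicator_diff_tendsto[OF _ _ cl]]) (auto intro!: L2_diff L wL L2_const D)
  have 2: "(\<lambda>j. l2on D ?C (d\<phi> j)) \<longlonglongrightarrow> l2on D ?C g"
    unfolding l2on_def
    by (rule l2norm_tendsto[OF ind ind l2norm_indicator_diff_tendsto[OF _ _ lim(2)]]) (auto intro!: L wL)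
  have 3: "(\<lambda>j. l1on D ?C (d\<phi> j)) \<longlonglongrightarrow> l1on D ?C g"
    using L1_tendsto(2)[OF DL ind[OF L(2)] ind[OF wL(2)] l2norm_indicator_diff_tendsto[OF L(2) wL(2) lim(2)], of ?C]
    by (simp add: l1on_def)
  show ?thesis
  proof (rule that[of c0], rule LIMSEQ_le)
    show "(\<lambda>j. V\<^sup>2 * (l2on D ?B (\<lambda>x. \<phi> j x - c j))\<^sup>2) \<longlonglongrightarrow> V\<^sup>2 * (l2on D ?B (\<lambda>x. w x - c0))\<^sup>2"
      by (intro tendsto_intros 1)
    show "(\<lambda>j. 2 * V\<^sup>2 * \<rho>\<^sup>2 * (l2on D ?C (d\<phi> j))\<^sup>2 + 2 * measure lborel ?B * (2 ^ CARD('n) * (6 * r) * l1on D ?C (d\<phi> j))\<^sup>2)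
      \<longlonglongrightarrow> 2 * V\<^sup>2 * \<rho>\<^sup>2 * (l2on D ?C g)\<^sup>2 + 2 * measure lborel ?B * (2 ^ CARD('n) * (6 * r) * l1on D ?C g)\<^sup>2"
      by (intro tendsto_intros 2 3)
    show "\<exists>N. \<forall>j\<ge>N. V\<^sup>2 * (l2on D ?B (\<lambda>x. \<phi> j x - c j))\<^sup>2
      \<le> 2 * V\<^sup>2 * \<rho>\<^sup>2 * (l2on D ?C (d\<phi> j))\<^sup>2 + 2 * measure lborel ?B * (2 ^ CARD('n) * (6 * r) * l1on D ?C (d\<phi> j))\<^sup>2"
      using test_fun_ehrling[OF D t r B3 c_def V] by blast
  qed
qed

text \<open>The right-hand side is a field \<open>F\<close> and not an abstract functional, because
  a field can be restricted to balls and cut at levels.\<close>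

definition weak_eq :: "(real^'n) set \<Rightarrow> (real^'n \<Rightarrow> real^'n^'n) \<Rightarrow> (real^'n \<Rightarrow> real^'n)
    \<Rightarrow> (real^'n \<Rightarrow> real) \<Rightarrow> (real^'n \<Rightarrow> real^'n) \<Rightarrow> bool" where
  "weak_eq D A F w g \<longleftrightarrow> H10 D w g \<and> L2 D F \<and>
     (\<forall>v h. H10 D v h \<longrightarrow> l2inner D (\<lambda>x. A x *v g x) h = l2inner D F h)"

text \<open>Here \<open>z\<close> is the cutoff, \<open>p\<close> the function minus a
  constant, and \<open>dz\<close> the gradient of the cutoff.\<close>
lemma caccioppoli_pointwise:
  fixes G F a dz :: "'a::euclidean_space"
  assumes al: "0 < \<alpha>" and be: "0 \<le> \<beta>" and r: "0 < r" and z: "0 \<le> z" "z \<le> 1"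
    and coer: "\<alpha> * (norm G)\<^sup>2 \<le> a \<bullet> G" and bd: "norm a \<le> \<beta> * norm G"
    and dz: "norm dz \<le> (2 / r) * sqrt z"
    and K: "K = 1 + 1 / \<alpha> + 4 * \<beta>\<^sup>2 / \<alpha>"
  shows "(\<alpha> / 2) * (z * (norm G)\<^sup>2) - K * ((norm F)\<^sup>2 + p\<^sup>2 / r\<^sup>2) \<le> (a - F) \<bullet> (p *\<^sub>R dz + z *\<^sub>R G)"
proof -
  define s where "s = sqrt z"
  define m where "m = \<bar>p\<bar> / r"
  have s: "0 \<le> s" "s * s = z" "s \<le> 1" using z by (auto simp: s_def)
  have m: "0 \<le> m" "m * m = p\<^sup>2 / r\<^sup>2" using r by (auto simp: m_def power2_eq_square field_simps)
  have t1: "z * (\<alpha> * (norm G)\<^sup>2) \<le> z * (a \<bullet> G)" using coer z(1) by (rule mult_left_mono)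
  \<comment> \<open>Young's inequality is used here and in \<open>t3\<close>, each time spending a
    quarter of \<alpha>; half of the coercive term survives.\<close>
  have t2: "z * (F \<bullet> G) \<le> (\<alpha> / 4) * (z * (norm G)\<^sup>2) + (1 / \<alpha>) * (norm F)\<^sup>2"
  proof -
    have "F \<bullet> G \<le> norm F * norm G" by (rule norm_cauchy_schwarz)
    also have "\<dots> \<le> (\<alpha> / 4) * (norm G)\<^sup>2 + (1 / \<alpha>) * (norm F)\<^sup>2"
      using zero_le_power2[of "\<alpha> * norm G - 2 * norm F"] al by (simp add: power2_eq_square field_simps)
    finally have "z * (F \<bullet> G) \<le> z * ((\<alpha> / 4) * (norm G)\<^sup>2 + (1 / \<alpha>) * (norm F)\<^sup>2)"
      using z(1) by (rule mult_left_mono)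
    also have "\<dots> = (\<alpha> / 4) * (z * (norm G)\<^sup>2) + z * ((1 / \<alpha>) * (norm F)\<^sup>2)" by (simp add: algebra_simps)
    also have "z * ((1 / \<alpha>) * (norm F)\<^sup>2) \<le> (1 / \<alpha>) * (norm F)\<^sup>2" using z al by (intro mult_left_le_one_le) auto
    finally show ?thesis by simp
  qed
  have mult: "norm (p *\<^sub>R dz) \<le> 2 * m * s"
  proof -
    have "\<bar>p\<bar> * norm dz \<le> \<bar>p\<bar> * ((2 / r) * s)" using dz by (intro mult_left_mono) (auto simp: s_def)
    also have "\<dots> = 2 * m * s" by (simp add: m_def)
    finally show ?thesis by simp
  qed
  have t3: "- (a \<bullet> (p *\<^sub>R dz)) \<le> (\<alpha> / 4) * (z * (norm G)\<^sup>2) + (4 * \<beta>\<^sup>2 / \<alpha>) * (p\<^sup>2 / r\<^sup>2)"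
  proof -
    have "- (a \<bullet> (p *\<^sub>R dz)) \<le> norm a * norm (p *\<^sub>R dz)"
      using Cauchy_Schwarz_ineq2[of a "p *\<^sub>R dz"] by simp
    also have "\<dots> \<le> (\<beta> * norm G) * (2 * m * s)" using bd mult be by (intro mult_mono) auto
    also have "\<dots> \<le> (\<alpha> / 4) * (s * s * (norm G)\<^sup>2) + (4 * \<beta>\<^sup>2 / \<alpha>) * (m * m)"
      using zero_le_power2[of "\<alpha> * (s * norm G) - 4 * \<beta> * m"] al by (simp add: power2_eq_square field_simps)
    finally show ?thesis by (simp add: s m)
  qed
  have t4: "F \<bullet> (p *\<^sub>R dz) \<le> (norm F)\<^sup>2 + p\<^sup>2 / r\<^sup>2"
  proof -
    have "F \<bullet> (p *\<^sub>R dz) \<le> norm F * norm (p *\<^sub>R dz)" by (rule norm_cauchy_schwarz)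
    also have "\<dots> \<le> norm F * (2 * m * s)" using mult by (intro mult_left_mono) auto
    also have "\<dots> \<le> norm F * (2 * m)" using s m(1) by (intro mult_left_mono) (auto simp: mult_left_le)
    also have "\<dots> \<le> (norm F)\<^sup>2 + m * m"
      using zero_le_power2[of "norm F - m"] by (simp add: power2_eq_square algebra_simps)
    finally show ?thesis by (simp add: m)
  qed
  \<comment> \<open>\<open>K\<close> is the sum of all constants and multiplies both terms. These
    two products are the surplus.\<close>
  have nn: "0 \<le> (1 / \<alpha>) * (p\<^sup>2 / r\<^sup>2)" "0 \<le> (4 * \<beta>\<^sup>2 / \<alpha>) * (norm F)\<^sup>2" using al by auto
  have "K * ((norm F)\<^sup>2 + p\<^sup>2 / r\<^sup>2) = (norm F)\<^sup>2 + p\<^sup>2 / r\<^sup>2 + (1 / \<alpha>) * (norm F)\<^sup>2 + (1 / \<alpha>) * (p\<^sup>2 / r\<^sup>2)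
      + (4 * \<beta>\<^sup>2 / \<alpha>) * (norm F)\<^sup>2 + (4 * \<beta>\<^sup>2 / \<alpha>) * (p\<^sup>2 / r\<^sup>2)"
    unfolding K by (simp only: distrib_left distrib_right mult_1_left add_ac)
  moreover have "(a - F) \<bullet> (p *\<^sub>R dz + z *\<^sub>R G) = z * (a \<bullet> G) - z * (F \<bullet> G) + a \<bullet> (p *\<^sub>R dz) - F \<bullet> (p *\<^sub>R dz)"
    by (simp add: inner_diff_left inner_add_right algebra_simps)
  moreover have "z * (\<alpha> * (norm G)\<^sup>2) = (\<alpha> / 2) * (z * (norm G)\<^sup>2) + (\<alpha> / 4) * (z * (norm G)\<^sup>2) + (\<alpha> / 4) * (z * (norm G)\<^sup>2)"
    by (simp add: field_simps)
  ultimately show ?thesis using t1 t2 t3 t4 nn by linarith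
qed

text \<open>The equation is tested with the bump times \<open>w - c\<close>. It is used to the first
  power, being already a square. The constant \<open>c\<close> stays free so that the right side can
  be made small by a Poincare type inequality.\<close>

lemma caccioppoli:
  fixes D :: "(real^'n) set"
  assumes D: "bounded D" "open D" and A: "Mab \<alpha> \<beta> D A" and al: "0 < \<alpha>" and be: "0 \<le> \<beta>"
    and w: "weak_eq D A F w g" and r: "0 < r" and B3: "ball x0 (3 * r) \<subseteq> D"
  shows "(l2on D (ball x0 r) g)\<^sup>2 \<le> (4 / \<alpha>) * (1 + 1 / \<alpha> + 4 * \<beta>\<^sup>2 / \<alpha>) *
     ((l2on D (ball x0 (2 * r)) F)\<^sup>2 + (l2on D (ball x0 (2 * r)) (\<lambda>x. w x - c))\<^sup>2 / r\<^sup>2)"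
proof -
  define K where "K = 1 + 1 / \<alpha> + 4 * \<beta>\<^sup>2 / \<alpha>"
  have K: "0 \<le> K" using al by (simp add: K_def)
  let ?B = "ball x0 (2 * r)" and ?z = "bump x0 r" and ?dz = "bump_grad x0 r"
  have H: "H10 D w g" and F: "L2 D F" using w by (auto simp: weak_eq_def)
  have t: "test_fun D ?z ?dz"
  proof (rule test_funI[OF C1_bump, of "cball x0 (2 * r)"])
    show "cball x0 (2 * r) \<subseteq> D" using B3 r by (auto simp: subset_iff)
  qed (auto intro!: bump_outside[OF r])
  let ?h = "\<lambda>x. (w x - c) *\<^sub>R ?dz x + ?z x *\<^sub>R g x"
  have Hh: "H10 D (\<lambda>x. ?z x * (w x - c)) ?h" by (rule H10_cutoff[OF D H t])
  note L = H10_L2[OF H] and hL = H10_L2(2)[OF Hh]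
  note AL = Mab_L2(1)[OF A L(2) be]
  note pL = L2_diff[OF L(1) L2_const[OF D, of c]]
  have eq: "(\<integral>x. (A x *v g x - F x) \<bullet> ?h x \<partial>lebesgue_on D) = 0"
  proof -
    have "l2inner D (\<lambda>x. A x *v g x) ?h = l2inner D F ?h" using w Hh unfolding weak_eq_def by blast
    then have "l2inner D (\<lambda>x. A x *v g x - F x) ?h = 0" by (simp add: l2inner_diff_left AL F hL)
    then show ?thesis by (simp add: l2inner_def)
  qed
  let ?lo = "\<lambda>x. (\<alpha> / 2) * (9/16 * (indicator (ball x0 r) x * (norm (g x))\<^sup>2))
      - K * (indicator ?B x * (norm (F x))\<^sup>2 + (indicator ?B x * (norm (w x - c))\<^sup>2) / r\<^sup>2)"
  have i1: "integrable (lebesgue_on D) (\<lambda>x. indicator (ball x0 r) x * (norm (g x))\<^sup>2)" by (rule integrable_indicator_sq[OF L(2)]) simp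
  have i2: "integrable (lebesgue_on D) (\<lambda>x. indicator ?B x * (norm (F x))\<^sup>2)" by (rule integrable_indicator_sq[OF F]) simp
  have i3: "integrable (lebesgue_on D) (\<lambda>x. indicator ?B x * (norm (w x - c))\<^sup>2)" by (rule integrable_indicator_sq[OF pL]) simp
  have "(\<integral>x. ?lo x \<partial>lebesgue_on D) \<le> (\<integral>x. (A x *v g x - F x) \<bullet> ?h x \<partial>lebesgue_on D)"
  proof (rule integral_mono_AE)
    show "integrable (lebesgue_on D) ?lo"
      by (intro Bochner_Integration.integrable_diff Bochner_Integration.integrable_add integrable_mult_right integrable_divide_zero i1 i2 i3)
    show "integrable (lebesgue_on D) (\<lambda>x. (A x *v g x - F x) \<bullet> ?h x)"
      by (rule L2_inner_integrable[OF L2_diff[OF AL F] hL])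
    show "AE x in lebesgue_on D. ?lo x \<le> (A x *v g x - F x) \<bullet> ?h x"
      using Mab_bounds[OF A]
    proof eventually_elim
      case (elim x)
      show ?case
      proof (cases "x \<in> ?B")
        case True
        have "(\<alpha> / 2) * (?z x * (norm (g x))\<^sup>2) - K * ((norm (F x))\<^sup>2 + (w x - c)\<^sup>2 / r\<^sup>2) \<le> (A x *v g x - F x) \<bullet> ?h x"
          using elim by (intro caccioppoli_pointwise[OF al be r _ _ _ _ bump_grad_le[OF r] K_def]) (auto simp: bump_le_1)
        moreover have "9/16 * (indicator (ball x0 r) x * (norm (g x))\<^sup>2) \<le> ?z x * (norm (g x))\<^sup>2"
        proof (cases "x \<in> ball x0 r")
          case True
          from mult_right_mono[OF bump_ge[OF r True], of "(norm (g x))\<^sup>2"] True show ?thesis by simp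
        qed simp
        then have "(\<alpha> / 2) * (9/16 * (indicator (ball x0 r) x * (norm (g x))\<^sup>2)) \<le> (\<alpha> / 2) * (?z x * (norm (g x))\<^sup>2)"
          using al by (intro mult_left_mono) auto
        ultimately have "(\<alpha> / 2) * (9/16 * (indicator (ball x0 r) x * (norm (g x))\<^sup>2)) - K * ((norm (F x))\<^sup>2 + (w x - c)\<^sup>2 / r\<^sup>2)
          \<le> (A x *v g x - F x) \<bullet> ?h x" by linarith
        then show ?thesis using True by simp
      next
        case False
        then have "x \<notin> ball x0 r" using r by auto
        then show ?thesis using False by (simp add: bump_outside[OF r False])
      qed
    qed
  qed
  also have "\<dots> = 0" by (rule eq)
  also have "(\<integral>x. ?lo x \<partial>lebesgue_on D) = (\<alpha> / 2) * (9/16 * (l2on D (ball x0 r) g)\<^sup>2)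
      - K * ((l2on D ?B F)\<^sup>2 + (l2on D ?B (\<lambda>x. w x - c))\<^sup>2 / r\<^sup>2)"
    using i1 i2 i3 by (simp add: l2on_sq)
  finally have *: "(\<alpha> / 2) * (9/16 * (l2on D (ball x0 r) g)\<^sup>2) \<le> K * ((l2on D ?B F)\<^sup>2 + (l2on D ?B (\<lambda>x. w x - c))\<^sup>2 / r\<^sup>2)" by simp
  \<comment> \<open>Half of \<alpha> times the lower bound 9/16 of the bump exceeds \<alpha> / 4,
    which leads to the factor \<open>4 / \<alpha>\<close>.\<close>
  have "(\<alpha> / 4) * (l2on D (ball x0 r) g)\<^sup>2 \<le> (\<alpha> / 2) * (9/16 * (l2on D (ball x0 r) g)\<^sup>2)"
    using al by (simp add: mult_right_mono)
  from order_trans[OF this *] have "(4 / \<alpha>) * ((\<alpha> / 4) * (l2on D (ball x0 r) g)\<^sup>2) \<le> (4 / \<alpha>) * (K * ((l2on D ?B F)\<^sup>2 + (l2on D ?B (\<lambda>x. w x - c))\<^sup>2 / r\<^sup>2))"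
    by (rule mult_left_mono) (use al in auto)
  then show ?thesis using al unfolding K_def[symmetric] by (simp add: mult.assoc)
qed

section \<open>Interior equi-integrability of gradients\<close>

lemma integral_indicator_lebesgue_on:
  assumes D: "D \<in> sets lebesgue" and B: "B \<in> sets borel" "B \<subseteq> D"
  shows "(\<integral>x. indicator B x \<partial>lebesgue_on D) = measure lborel B"
proof -
  have "(\<integral>x. (indicator B x :: real) \<partial>lebesgue_on D) = (\<integral>x. indicator B x \<partial>lborel)"
  proof (rule lebesgue_on_zero_outside(2)[OF D])
    show "(indicator B x :: real) = 0" if "x \<notin> D" for x
    proof -
      have "x \<notin> B" using that B(2) by blast
      then show ?thesis by simp
    qed
  qed (use B(1) in simp)
  then show ?thesis using B(1) by simp
qed

lemma l1on_le:
  fixes D :: "(real^'n) set"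
  assumes D: "bounded D" "open D" and g: "L2 D g" and B: "B \<in> sets borel" "B \<subseteq> D"
  shows "l1on D B g \<le> sqrt (measure lborel B) * l2on D B g"
proof -
  have o: "L2 D (\<lambda>x. indicator B x *\<^sub>R (1::real))" by (rule L2_indicator(1)[OF L2_const[OF D] B(1)])
  have n: "L2 D (\<lambda>x. indicator B x * norm (g x))"
    using L2_bound(1)[OF L2_indicator(1)[OF g B(1)], of "\<lambda>x. indicator B x * norm (g x)" 1]
      L2_measurable[OF g] indicator_lebesgue_on[OF B(1), of D] by (simp add: borel_measurable_times borel_measurable_norm)
  have "l1on D B g = l2inner D (\<lambda>x. indicator B x *\<^sub>R (1::real)) (\<lambda>x. indicator B x * norm (g x))"
    unfolding l1on_def l2inner_def by (intro Bochner_Integration.integral_cong) (auto simp: indicator_def)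
  also have "\<dots> \<le> l2norm D (\<lambda>x. indicator B x *\<^sub>R (1::real)) * l2norm D (\<lambda>x. indicator B x * norm (g x))"
    using l2_cauchy_schwarz[OF o n] by simp
  also have "l2norm D (\<lambda>x. indicator B x *\<^sub>R (1::real)) = sqrt (measure lborel B)"
  proof -
    have "(l2norm D (\<lambda>x. indicator B x *\<^sub>R (1::real)))\<^sup>2 = (\<integral>x. indicator B x \<partial>lebesgue_on D)"
      unfolding l2norm_sq by (intro Bochner_Integration.integral_cong) (auto simp: indicator_def)
    then have "(l2norm D (\<lambda>x. indicator B x *\<^sub>R (1::real)))\<^sup>2 = measure lborel B"
      using integral_indicator_lebesgue_on[OF _ B] D by simp
    then show ?thesis by (metis l2norm_nonneg real_sqrt_abs abs_of_nonneg)
  qed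
  also have "l2norm D (\<lambda>x. indicator B x * norm (g x)) = l2on D B g"
    by (simp add: l2norm_def l2on_def l2inner_self power_mult_distrib)
  finally show ?thesis .
qed

text \<open>What remains on the right after everything below level \<open>\<kappa> * l\<close> has
  been absorbed. The gradient enters as \<open>l\<close> times its norm and not squared: summed over
  dyadic \<open>l\<close>, this is bounded by a multiple of its squared norm.\<close>

definition excess :: "real \<Rightarrow> real \<Rightarrow> (real^'n \<Rightarrow> real^'n) \<Rightarrow> (real^'n \<Rightarrow> real^'n) \<Rightarrow> real^'n \<Rightarrow> real" where
  "excess \<kappa> l F g x = (if \<kappa> * l < norm (F x) then (norm (F x))\<^sup>2 else 0) + l * (if \<kappa> * l < norm (g x) then norm (g x) else 0)"

lemma excess_parts_integrable:
  fixes D :: "(real^'n) set"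
  assumes D: "bounded D" "open D" and F: "L2 D F" and g: "L2 D g" and B: "B \<in> sets borel"
  shows "integrable (lebesgue_on D) (\<lambda>x. indicator B x * (if t < norm (F x) then (norm (F x))\<^sup>2 else 0))"
    "integrable (lebesgue_on D) (\<lambda>x. indicator B x * (if t < norm (g x) then norm (g x) else 0))"
proof -
  note [measurable] = L2_measurable[OF F] L2_measurable[OF g] indicator_lebesgue_on[OF B, of D]
  show "integrable (lebesgue_on D) (\<lambda>x. indicator B x * (if t < norm (F x) then (norm (F x))\<^sup>2 else 0))"
    by (rule Bochner_Integration.integrable_bound[OF L2_integrable_sq[OF F]]) (measurable, auto simp: indicator_def)
  show "integrable (lebesgue_on D) (\<lambda>x. indicator B x * (if t < norm (g x) then norm (g x) else 0))"
    by (rule Bochner_Integration.integrable_bound[OF L1_le_l2norm(1)[OF lmeasurable_open[OF D] g]]) (measurable, auto simp: indicator_def)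
qed

lemma content_ball_scale:
  "0 \<le> r \<Longrightarrow> 0 \<le> a \<Longrightarrow> measure lborel (ball (x::real^'n) (a * r)) = a ^ CARD('n) * measure lborel (ball (y::real^'n) r)"
  using content_ball_conv_unit_ball[of "a * r" x] content_ball_conv_unit_ball[of r y]
  by (simp add: power_mult_distrib)

text \<open>Caccioppoli and Ehrling bound the energy on the ball by three terms: a small multiple of
  the energy on the tripled ball, the squared \<open>L\<^sup>1\<close> norm of the gradient there,
  and the energy of \<open>F\<close>. The stopping condition on the large ball makes the first
  absorbable, and a low level \<kappa> does so for the parts of the other two below
  \<open>\<kappa> * l\<close>. The factor 15 is 3 for Ehrling's ball times 5 for Vitali's
  covering.\<close>

lemma stopping_estimate:
  fixes \<alpha> \<beta> :: real
  assumes al: "0 < \<alpha>" and be: "0 \<le> \<beta>"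
  shows "\<exists>\<kappa>>0. \<exists>C>0. \<forall>(D::(real^'n) set) A F w g x0 r l. bounded D \<longrightarrow> open D \<longrightarrow> Mab \<alpha> \<beta> D A \<longrightarrow> weak_eq D A F w g \<longrightarrow>
    0 < r \<longrightarrow> ball x0 (15 * r) \<subseteq> D \<longrightarrow> 0 < l \<longrightarrow> l\<^sup>2 * measure lborel (ball x0 r) < (l2on D (ball x0 r) g)\<^sup>2 \<longrightarrow>
    (l2on D (ball x0 (15 * r)) g)\<^sup>2 \<le> l\<^sup>2 * measure lborel (ball x0 (15 * r)) \<longrightarrow>
    l\<^sup>2 * measure lborel (ball x0 r) \<le> C * (\<integral>x. indicator (ball x0 (3 * r)) x * excess \<kappa> l F g x \<partial>lebesgue_on D)"
proof -
  define d where "d = CARD('n)"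
  define c1 where "c1 = (4 / \<alpha>) * (1 + 1 / \<alpha> + 4 * \<beta>\<^sup>2 / \<alpha>)"
  have "0 < 1 + 1 / \<alpha> + 4 * \<beta>\<^sup>2 / \<alpha>" using al by (intro add_pos_nonneg) auto
  then have c1: "c1 > 0" unfolding c1_def using al by (intro mult_pos_pos) auto
  \<comment> \<open>Relative mollification scale in Ehrling's inequality. The energy on the tripled
    ball is at most \<open>15 ^ d\<close> times the stopping energy, and \<delta> reduces its
    contribution to a quarter.\<close>
  define \<delta> where "\<delta> = 1 / (8 * c1 * 15 ^ d + 1)"
  have dl: "0 < \<delta>" "\<delta> \<le> 1" "c1 * (2 * \<delta>\<^sup>2) * 15 ^ d \<le> 1 / 4"
  proof -
    have p: "0 < 8 * c1 * 15 ^ d" using c1 by simp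
    then show "0 < \<delta>" "\<delta> \<le> 1" by (auto simp: \<delta>_def)
    then have "\<delta>\<^sup>2 \<le> \<delta>" by (simp add: power2_eq_square mult_left_le)
    then have "(8 * c1 * 15 ^ d) * \<delta>\<^sup>2 \<le> (8 * c1 * 15 ^ d) * \<delta>" using p by (intro mult_left_mono) auto
    also have "\<dots> \<le> 1" using p by (simp add: \<delta>_def)
    finally show "c1 * (2 * \<delta>\<^sup>2) * 15 ^ d \<le> 1 / 4" by (simp add: mult_ac)
  qed
  \<comment> \<open>Ehrling's \<open>L\<^sup>1\<close> term after division by the squared
    mollification volume and \<open>r\<^sup>2\<close>: 72 is twice the square of 6, and
    \<open>8 ^ d\<close> comes from a doubled ball and a squared \<open>2 ^ d\<close>.\<close>
  define M where "M = 72 * 8 ^ d / (\<delta> ^ d)\<^sup>2"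
  have M: "M > 0" using dl by (simp add: M_def)
  \<comment> \<open>So low that the parts of \<open>F\<close> and of the gradient below
    \<open>\<kappa> * l\<close> together contribute at most another quarter.\<close>
  define \<kappa> where "\<kappa> = 1 / (4 * (c1 * 3 ^ d + c1 * M * 7 ^ d * 3 ^ d) + 1)"
  have kp: "0 < \<kappa>" "c1 * \<kappa>\<^sup>2 * 3 ^ d + c1 * M * 7 ^ d * \<kappa> * 3 ^ d \<le> 1 / 4"
  proof -
    define q where "q = c1 * 3 ^ d + c1 * M * 7 ^ d * 3 ^ d"
    have q: "q > 0" using c1 M by (auto simp: q_def intro!: add_pos_pos mult_pos_pos)
    have k: "0 < \<kappa>" "\<kappa> \<le> 1" "4 * q * \<kappa> \<le> 1" using q by (auto simp: \<kappa>_def q_def[symmetric])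
    then have "\<kappa>\<^sup>2 \<le> \<kappa>" by (simp add: power2_eq_square mult_left_le)
    then have "c1 * 3 ^ d * \<kappa>\<^sup>2 \<le> c1 * 3 ^ d * \<kappa>" using c1 by (intro mult_left_mono) auto
    then have "c1 * \<kappa>\<^sup>2 * 3 ^ d + c1 * M * 7 ^ d * \<kappa> * 3 ^ d \<le> q * \<kappa>" by (simp add: q_def algebra_simps)
    then show "c1 * \<kappa>\<^sup>2 * 3 ^ d + c1 * M * 7 ^ d * \<kappa> * 3 ^ d \<le> 1 / 4" using k by linarith
    show "0 < \<kappa>" by fact
  qed
  define C where "C = 2 * c1 * (1 + M * 7 ^ d)"
  have C: "C > 0" using c1 M by (auto simp: C_def intro!: mult_pos_pos add_pos_pos)
  have "l\<^sup>2 * measure lborel (ball x0 r) \<le> C * (\<integral>x. indicator (ball x0 (3 * r)) x * excess \<kappa> l F g x \<partial>lebesgue_on D)"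
    if D: "bounded D" "open D" and A: "Mab \<alpha> \<beta> D A" and w: "weak_eq D A F w g" and r: "0 < r" and B15: "ball x0 (15 * r) \<subseteq> D"
      and l: "0 < l" and lo: "l\<^sup>2 * measure lborel (ball x0 r) < (l2on D (ball x0 r) g)\<^sup>2"
      and hi: "(l2on D (ball x0 (15 * r)) g)\<^sup>2 \<le> l\<^sup>2 * measure lborel (ball x0 (15 * r))"
    for D :: "(real^'n) set" and A F w g x0 r l
  proof -
    define U where "U = measure lborel (ball x0 r)"
    have U: "U > 0" using r by (simp add: U_def)
    have vol: "measure lborel (ball x0 (a * r)) = a ^ d * U" "measure lborel (ball (0::real^'n) (a * r)) = a ^ d * U" if "0 \<le> a" for a
      using content_ball_scale[of r a x0 x0] content_ball_scale[of r a 0 x0] that r by (simp_all add: U_def d_def)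
    have H: "H10 D w g" and F: "L2 D F" using w by (auto simp: weak_eq_def)
    note g = H10_L2(2)[OF H]
    have B3: "ball x0 (3 * r) \<subseteq> D" using B15 r by (auto simp: subset_iff)
    define G where "G = l2on D (ball x0 (3 * r)) g"
    define L where "L = l1on D (ball x0 (3 * r)) g"
    have GL: "0 \<le> G" "0 \<le> L" by (simp_all add: G_def L_def)
    have G15: "G\<^sup>2 \<le> l\<^sup>2 * (15 ^ d * U)"
    proof -
      have "G\<^sup>2 \<le> (l2on D (ball x0 (15 * r)) g)\<^sup>2"
        unfolding G_def using r by (intro power_mono l2on_mono g) auto
      then show ?thesis using hi vol[of 15] by simp
    qed
    have e45: "(45::real) ^ d = 3 ^ d * 15 ^ d" and e49: "(49::real) ^ d = 7 ^ d * 7 ^ d"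
      by (simp_all flip: power_mult_distrib)
    \<comment> \<open>Cauchy-Schwarz on the tripled ball with the stopping bound gives the base 3
      times 15; it is rounded up from 45 to 49 to have an exact root.\<close>
    have L7: "L \<le> 7 ^ d * l * U"
    proof (rule power2_le_imp_le)
      have "L\<^sup>2 \<le> (sqrt (measure lborel (ball x0 (3 * r))) * G)\<^sup>2"
        unfolding L_def G_def by (intro power_mono l1on_le D g B3) auto
      also have "\<dots> = 3 ^ d * U * G\<^sup>2" using vol[of 3] U by (simp add: power_mult_distrib)
      also have "\<dots> \<le> 3 ^ d * U * (l\<^sup>2 * (15 ^ d * U))" using G15 U by (intro mult_left_mono) auto
      also have "\<dots> = 45 ^ d * (l * U)\<^sup>2"
        by (simp add: e45 power2_eq_square mult_ac)
      also have "\<dots> \<le> 49 ^ d * (l * U)\<^sup>2" by (intro mult_right_mono power_mono) auto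
      also have "\<dots> = (7 ^ d * l * U)\<^sup>2"
        by (simp add: e49 power2_eq_square mult_ac)
      finally show "L\<^sup>2 \<le> (7 ^ d * l * U)\<^sup>2" .
    qed (use l U in auto)
    obtain c where ehr: "(\<delta> ^ d * U)\<^sup>2 * (l2on D (ball x0 (2 * r)) (\<lambda>x. w x - c))\<^sup>2 \<le> 2 * (\<delta> ^ d * U)\<^sup>2 * (\<delta> * r)\<^sup>2 * G\<^sup>2
       + 2 * (2 ^ d * U) * (2 ^ d * (6 * r) * L)\<^sup>2"
    proof (rule H10_ehrling[OF D H, of "\<delta> * r" r x0 "\<delta> ^ d * U"])
      fix c assume "(\<delta> ^ d * U)\<^sup>2 * (l2on D (ball x0 (2 * r)) (\<lambda>x. w x - c))\<^sup>2
           \<le> 2 * (\<delta> ^ d * U)\<^sup>2 * (\<delta> * r)\<^sup>2 * (l2on D (ball x0 (3 * r)) g)\<^sup>2 +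
              2 * measure lborel (ball x0 (2 * r)) * (2 ^ CARD('n) * (6 * r) * l1on D (ball x0 (3 * r)) g)\<^sup>2"
      then show thesis using that[of c] vol(1)[of 2] by (simp add: G_def L_def d_def)
    qed (use dl r B3 vol(2)[of \<delta>] in \<open>auto simp: mult_left_le_one_le\<close>)
    define P where "P = (l2on D (ball x0 (2 * r)) (\<lambda>x. w x - c))\<^sup>2"
    define V where "V = \<delta> ^ d * U"
    have V: "V > 0" using dl U by (simp add: V_def)
    have P: "P / r\<^sup>2 \<le> 2 * \<delta>\<^sup>2 * G\<^sup>2 + M * L\<^sup>2 / U"
    proof -
      have "V\<^sup>2 * P \<le> V\<^sup>2 * (r\<^sup>2 * (2 * \<delta>\<^sup>2 * G\<^sup>2 + M * L\<^sup>2 / U))"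
      proof -
        have "8 ^ d = 2 ^ d * (2 ^ d * 2 ^ d :: real)" by (simp flip: power_mult_distrib)
        then have "V\<^sup>2 * (r\<^sup>2 * (M * L\<^sup>2 / U)) = 2 * (2 ^ d * U) * (2 ^ d * (6 * r) * L)\<^sup>2"
          using U dl by (simp add: V_def M_def power2_eq_square field_simps)
        moreover have "V\<^sup>2 * (r\<^sup>2 * (2 * \<delta>\<^sup>2 * G\<^sup>2)) = 2 * V\<^sup>2 * (\<delta> * r)\<^sup>2 * G\<^sup>2" by (simp add: power_mult_distrib)
        ultimately show ?thesis using ehr unfolding P_def V_def[symmetric] by (simp only: distrib_left)
      qed
      then have "P \<le> r\<^sup>2 * (2 * \<delta>\<^sup>2 * G\<^sup>2 + M * L\<^sup>2 / U)" using V by simp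
      then show ?thesis using r by (simp add: divide_le_eq mult.commute)
    qed
    define Ft where "Ft = (\<integral>x. indicator (ball x0 (3 * r)) x * (if \<kappa> * l < norm (F x) then (norm (F x))\<^sup>2 else 0) \<partial>lebesgue_on D)"
    define Lt where "Lt = (\<integral>x. indicator (ball x0 (3 * r)) x * (if \<kappa> * l < norm (g x) then norm (g x) else 0) \<partial>lebesgue_on D)"
    have FLt: "0 \<le> Ft" "0 \<le> Lt" unfolding Ft_def Lt_def by (intro Bochner_Integration.integral_nonneg; simp)+
    note exc = excess_parts_integrable[OF D F g, of "ball x0 (3 * r)" "\<kappa> * l", simplified]
    have ib: "integrable (lebesgue_on D) (indicator (ball x0 (3 * r)) :: real^'n \<Rightarrow> real)"
      using integrable_indicator_sq[OF L2_const[OF D, of 1], of "ball x0 (3 * r)"] by simp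
    have vB: "(\<integral>x. indicator (ball x0 (3 * r)) x \<partial>lebesgue_on D) = 3 ^ d * U"
      using integral_indicator_lebesgue_on[OF _ _ B3] D vol(1)[of 3] by simp
    have Fsplit: "(l2on D (ball x0 (3 * r)) F)\<^sup>2 \<le> \<kappa>\<^sup>2 * l\<^sup>2 * (3 ^ d * U) + Ft"
    proof -
      have "(l2on D (ball x0 (3 * r)) F)\<^sup>2 \<le> (\<integral>x. (\<kappa> * l)\<^sup>2 * indicator (ball x0 (3 * r)) x + indicator (ball x0 (3 * r)) x * (if \<kappa> * l < norm (F x) then (norm (F x))\<^sup>2 else 0) \<partial>lebesgue_on D)"
        unfolding l2on_sq
      proof (rule integral_mono)
        fix x show "indicator (ball x0 (3 * r)) x * (norm (F x))\<^sup>2 \<le> (\<kappa> * l)\<^sup>2 * indicator (ball x0 (3 * r)) x + indicator (ball x0 (3 * r)) x * (if \<kappa> * l < norm (F x) then (norm (F x))\<^sup>2 else 0)"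
          using power_mono[of "norm (F x)" "\<kappa> * l" 2] by (auto simp: indicator_def)
      qed (use ib exc integrable_indicator_sq[OF F] in auto)
      also have "\<dots> = \<kappa>\<^sup>2 * l\<^sup>2 * (3 ^ d * U) + Ft" using ib exc vB by (simp add: Ft_def power_mult_distrib)
      finally show ?thesis .
    qed
    have Lsplit: "L \<le> \<kappa> * l * (3 ^ d * U) + Lt"
    proof -
      have "L \<le> (\<integral>x. (\<kappa> * l) * indicator (ball x0 (3 * r)) x + indicator (ball x0 (3 * r)) x * (if \<kappa> * l < norm (g x) then norm (g x) else 0) \<partial>lebesgue_on D)"
        unfolding L_def l1on_def
      proof (rule integral_mono)
        fix x show "indicator (ball x0 (3 * r)) x * norm (g x) \<le> (\<kappa> * l) * indicator (ball x0 (3 * r)) x + indicator (ball x0 (3 * r)) x * (if \<kappa> * l < norm (g x) then norm (g x) else 0)"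
          using kp(1) l by (auto simp: indicator_def)
      qed (use ib exc integrable_indicator_norm[OF lmeasurable_open[OF D] g] in auto)
      also have "\<dots> = \<kappa> * l * (3 ^ d * U) + Lt" using ib exc vB by (simp add: Lt_def)
      finally show ?thesis .
    qed
    have "l\<^sup>2 * U \<le> (l2on D (ball x0 r) g)\<^sup>2" using lo by (simp add: U_def)
    also have "\<dots> \<le> c1 * ((l2on D (ball x0 (2 * r)) F)\<^sup>2 + P / r\<^sup>2)"
      unfolding c1_def P_def by (rule caccioppoli[OF D A al be w r B3])
    also have "\<dots> \<le> c1 * ((\<kappa>\<^sup>2 * l\<^sup>2 * (3 ^ d * U) + Ft) + (2 * \<delta>\<^sup>2 * (l\<^sup>2 * (15 ^ d * U)) + M * (7 ^ d * l * (\<kappa> * l * (3 ^ d * U) + Lt))))"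
    proof (intro mult_left_mono add_mono)
      have "(l2on D (ball x0 (2 * r)) F)\<^sup>2 \<le> (l2on D (ball x0 (3 * r)) F)\<^sup>2"
        using r by (intro power_mono l2on_mono F) auto
      then show "(l2on D (ball x0 (2 * r)) F)\<^sup>2 \<le> \<kappa>\<^sup>2 * l\<^sup>2 * (3 ^ d * U) + Ft" using Fsplit by linarith
      \<comment> \<open>The square is made linear: one factor is bounded by the stopping level, the
        other is split at \<open>\<kappa> * l\<close>. Hence only a first power of the gradient
        reaches \<open>excess\<close>.\<close>
      have "L\<^sup>2 / U \<le> 7 ^ d * l * L"
      proof -
        have "L * L \<le> (7 ^ d * l * U) * L" using L7 GL(2) by (rule mult_right_mono)
        then show ?thesis using U by (simp add: power2_eq_square divide_le_eq mult_ac)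
      qed
      also have "\<dots> \<le> 7 ^ d * l * (\<kappa> * l * (3 ^ d * U) + Lt)" using Lsplit l by (intro mult_left_mono) auto
      finally have "M * (L\<^sup>2 / U) \<le> M * (7 ^ d * l * (\<kappa> * l * (3 ^ d * U) + Lt))" using M by (intro mult_left_mono) auto
      moreover have "2 * \<delta>\<^sup>2 * G\<^sup>2 \<le> 2 * \<delta>\<^sup>2 * (l\<^sup>2 * (15 ^ d * U))" using G15 by (intro mult_left_mono) auto
      ultimately show "P / r\<^sup>2 \<le> 2 * \<delta>\<^sup>2 * (l\<^sup>2 * (15 ^ d * U)) + M * (7 ^ d * l * (\<kappa> * l * (3 ^ d * U) + Lt))"
        using P by simp
    qed (use c1 in simp)
    also have "\<dots> = (c1 * \<kappa>\<^sup>2 * 3 ^ d + c1 * M * 7 ^ d * \<kappa> * 3 ^ d) * (l\<^sup>2 * U) + (c1 * (2 * \<delta>\<^sup>2) * 15 ^ d) * (l\<^sup>2 * U)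
        + c1 * Ft + c1 * (M * 7 ^ d) * (l * Lt)"
      by (simp add: algebra_simps power2_eq_square)
    \<comment> \<open>The two quarters move to the left side, which doubles the constants of the
      remaining terms.\<close>
    also have "\<dots> \<le> (1/4) * (l\<^sup>2 * U) + (1/4) * (l\<^sup>2 * U) + c1 * Ft + c1 * (M * 7 ^ d) * (l * Lt)"
      using U by (intro add_mono order_refl mult_right_mono kp(2) dl(3)) auto
    finally have "l\<^sup>2 * U \<le> 2 * c1 * Ft + 2 * c1 * (M * 7 ^ d) * (l * Lt)" by linarith
    also have "\<dots> \<le> C * Ft + C * (l * Lt)"
      using FLt l c1 M by (intro add_mono mult_right_mono) (auto simp: C_def)
    also have "\<dots> = C * (Ft + l * Lt)" by (simp add: algebra_simps)
    also have "Ft + l * Lt = (\<integral>x. indicator (ball x0 (3 * r)) x * excess \<kappa> l F g x \<partial>lebesgue_on D)"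
    proof -
      have "(\<integral>x. indicator (ball x0 (3 * r)) x * excess \<kappa> l F g x \<partial>lebesgue_on D)
        = (\<integral>x. indicator (ball x0 (3 * r)) x * (if \<kappa> * l < norm (F x) then (norm (F x))\<^sup>2 else 0)
           + l * (indicator (ball x0 (3 * r)) x * (if \<kappa> * l < norm (g x) then norm (g x) else 0)) \<partial>lebesgue_on D)"
        by (intro Bochner_Integration.integral_cong) (auto simp: excess_def algebra_simps)
      also have "\<dots> = Ft + l * Lt"
        using exc unfolding Ft_def Lt_def by (subst Bochner_Integration.integral_add) auto
      finally show ?thesis ..
    qed
    finally show ?thesis by (simp add: U_def)
  qed
  then show ?thesis using kp(1) C by blast
qed

section \<open>Covering and stopping time arguments\<close>

lemma nn_integral_countable_disjoint_UN:
  assumes f: "f \<in> borel_measurable M" and X: "\<And>i. i \<in> C \<Longrightarrow> X i \<in> sets M" and C: "countable C" "disjoint_family_on X C"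
  shows "(\<integral>\<^sup>+i. (\<integral>\<^sup>+x. f x * indicator (X i) x \<partial>M) \<partial>count_space C) = (\<integral>\<^sup>+x. f x * indicator (\<Union>i\<in>C. X i) x \<partial>M)"
proof -
  have U: "(\<Union>i\<in>C. X i) \<in> sets M" using X C(1) by (intro sets.countable_UN') auto
  have "emeasure (density M f) (\<Union>i\<in>C. X i) = (\<integral>\<^sup>+i. emeasure (density M f) (X i) \<partial>count_space C)"
    using X C by (intro emeasure_UN_countable) auto
  moreover have "(\<integral>\<^sup>+i. emeasure (density M f) (X i) \<partial>count_space C) = (\<integral>\<^sup>+i. (\<integral>\<^sup>+x. f x * indicator (X i) x \<partial>M) \<partial>count_space C)"
    using X f by (intro nn_integral_cong) (auto simp: emeasure_density)
  ultimately show ?thesis using U f by (simp add: emeasure_density)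
qed

text \<open>Sums over a countable family are integrals for the counting measure, so a family indexed
  by the centers of its balls needs no enumeration.\<close>

lemma nn_integral_countable_UN_le:
  assumes f: "f \<in> borel_measurable M" and X: "\<And>i. i \<in> C \<Longrightarrow> X i \<in> sets M" and C: "countable C"
  shows "(\<integral>\<^sup>+x. f x * indicator (\<Union>i\<in>C. X i) x \<partial>M) \<le> (\<integral>\<^sup>+i. (\<integral>\<^sup>+x. f x * indicator (X i) x \<partial>M) \<partial>count_space C)"
proof -
  have "(\<integral>\<^sup>+x. f x * indicator (\<Union>i\<in>C. X i) x \<partial>M) \<le> (\<integral>\<^sup>+x. (\<integral>\<^sup>+i. f x * indicator (X i) x \<partial>count_space C) \<partial>M)"
  proof (rule nn_integral_mono)
    fix x show "f x * indicator (\<Union>i\<in>C. X i) x \<le> (\<integral>\<^sup>+i. f x * indicator (X i) x \<partial>count_space C)"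
    proof (cases "x \<in> (\<Union>i\<in>C. X i)")
      case True
      then obtain i where i: "i \<in> C" "x \<in> X i" by blast
      have "f x * indicator (X i) x \<le> (\<integral>\<^sup>+i. f x * indicator (X i) x \<partial>count_space C)" by (rule nn_integral_ge_point[OF i(1)])
      then show ?thesis using True i by simp
    qed simp
  qed
  also have "\<dots> = (\<integral>\<^sup>+i. (\<integral>\<^sup>+x. f x * indicator (X i) x \<partial>M) \<partial>count_space C)"
    using f X by (intro nn_integral_count_space_nn_integral C) auto
  finally show ?thesis .
qed

lemma negligible_AE_lebesgue_on:
  assumes "D \<in> sets lebesgue" "negligible Z"
  shows "AE x in lebesgue_on D. x \<notin> Z"
proof -
  have "AE x in lebesgue. x \<notin> Z" using assms(2) by (intro AE_not_in) (simp add: negligible_iff_null_sets)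
  then show ?thesis using assms(1) by (subst AE_restrict_space_iff) auto
qed

lemma open_in_lebesgue_on: "open D \<Longrightarrow> open B \<Longrightarrow> B \<subseteq> D \<Longrightarrow> B \<in> sets (lebesgue_on D)"
  by (simp add: sets_restrict_space_iff)

lemma emeasure_lborel_ball: "emeasure lborel (ball x r) = ennreal (measure lborel (ball (x::'a::euclidean_space) r))"
  using emeasure_lborel_ball_finite[of x r] by (intro emeasure_eq_ennreal_measure) auto

text \<open>Proved by a Vitali covering of \<open>Z\<close> inside an open set of almost the same measure.\<close>
lemma small_averages_negligible:
  fixes D :: "(real^'n) set"
  assumes D: "bounded D" "open D" and f: "integrable (lebesgue_on D) f" "\<And>x. 0 \<le> f x" and t: "0 \<le> t"
    and Z: "Z \<subseteq> D" "\<And>x. x \<in> Z \<Longrightarrow> t < f x"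
    and avg: "\<And>x e. x \<in> Z \<Longrightarrow> 0 < e \<Longrightarrow>
       \<exists>r>0. r < e \<and> (\<integral>y. indicator (ball x r) y * f y \<partial>lebesgue_on D) \<le> t * measure lborel (ball x r)"
  shows "negligible Z"
proof -
  \<comment> \<open>A fixed gap above \<open>t\<close> makes the comparison of measures
    quantitative; \<open>Z\<close> is the countable union of these sets.\<close>
  define Zn where "Zn n = {x \<in> Z. t + 1 / real (Suc n) < f x}" for n
  have "negligible (Zn n)" for n
    unfolding negligible_outer
  proof (intro allI impI)
    fix e :: real assume e: "0 < e"
    define s where "s = 1 / real (Suc n)"
    have s: "s > 0" by (simp add: s_def)
    define G where "G = {x \<in> D. t + s < f x}"
    have mf: "f \<in> borel_measurable (lebesgue_on D)" using f(1) by (rule borel_measurable_integrable)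
    have "{x \<in> space (lebesgue_on D). t + s < f x} \<in> sets (lebesgue_on D)" using mf by measurable
    then have Gs: "G \<in> sets (lebesgue_on D)" "G \<in> sets lebesgue"
      using D by (auto simp: G_def sets_restrict_space_iff)
    \<comment> \<open>For the union \<open>W\<close> of the covering balls, \<open>(t + s)\<close>
      times the measure of \<open>W \<inter> G\<close> is at most \<open>t\<close> times that of
      \<open>W\<close>, while \<open>W\<close> minus \<open>G\<close> has measure below
      \<open>e'\<close>. Together the measure of \<open>W\<close> is below
      \<open>(t + s) * e' / s\<close>, which is \<open>e\<close>.\<close>
    define e' where "e' = s * e / (t + s)"
    have e': "e' > 0" using s t e by (simp add: e'_def)
    obtain T where T: "open T" "G \<subseteq> T" "T - G \<in> lmeasurable" "emeasure lebesgue (T - G) < ennreal e'"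
      by (rule sets_lebesgue_outer_open[OF Gs(2) e'])
    define U where "U = T \<inter> D"
    have U: "open U" "U \<subseteq> D" using T D by (auto simp: U_def)
    have ZG: "Zn n \<subseteq> G" "Zn n \<subseteq> U" using Z(1) T(2) by (auto simp: Zn_def G_def U_def s_def)
    define I where "I = {(x, r). x \<in> Zn n \<and> 0 < r \<and> ball x r \<subseteq> U \<and>
        (\<integral>y. indicator (ball x r) y * f y \<partial>lebesgue_on D) \<le> t * measure lborel (ball x r)}"
    obtain C where C: "countable C" "C \<subseteq> I" "pairwise (\<lambda>i j. disjnt (ball (fst i) (snd i)) (ball (fst j) (snd j))) C"
      "negligible (Zn n - (\<Union>i\<in>C. ball (fst i) (snd i)))"
    proof (rule Vitali_covering_theorem_balls[of "Zn n" I fst snd])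
      fix x d assume x: "x \<in> Zn n" and d: "0 < (d::real)"
      obtain \<epsilon> where \<epsilon>: "\<epsilon> > 0" "ball x \<epsilon> \<subseteq> U" using U(1) ZG(2) x open_contains_ball by blast
      obtain r where r: "r > 0" "r < min \<epsilon> d" "(\<integral>y. indicator (ball x r) y * f y \<partial>lebesgue_on D) \<le> t * measure lborel (ball x r)"
        using avg[of x "min \<epsilon> d"] x \<epsilon> d by (auto simp: Zn_def)
      have "(x, r) \<in> I" using x r \<epsilon>(2) subset_ball[of r \<epsilon> x] by (auto simp: I_def)
      then show "\<exists>i. i \<in> I \<and> x \<in> ball (fst i) (snd i) \<and> snd i < d" using r by (intro exI[of _ "(x, r)"]) auto
    qed blast
    define W where "W = (\<Union>i\<in>C. ball (fst i) (snd i))"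
    have Ci: "ball (fst i) (snd i) \<subseteq> U" "(\<integral>y. indicator (ball (fst i) (snd i)) y * f y \<partial>lebesgue_on D) \<le> t * measure lborel (ball (fst i) (snd i))"
      if "i \<in> C" for i
    proof -
      have "i \<in> I" using that C(2) by blast
      then show "ball (fst i) (snd i) \<subseteq> U" "(\<integral>y. indicator (ball (fst i) (snd i)) y * f y \<partial>lebesgue_on D) \<le> t * measure lborel (ball (fst i) (snd i))"
        by (cases i; simp add: I_def)+
    qed
    have W: "open W" "W \<subseteq> U" using Ci by (auto simp: W_def)
    have Wl: "W \<in> lmeasurable" using W U D by (intro lmeasurable_open) (auto intro: bounded_subset)
    have Ws: "W \<in> sets (lebesgue_on D)" using W U D by (intro open_in_lebesgue_on) auto
    have dis: "disjoint_family_on (\<lambda>i. ball (fst i) (snd i)) C"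
      using C(3) by (auto simp: disjoint_family_on_def pairwise_def disjnt_def)
    let ?N = "\<lambda>B. \<integral>\<^sup>+x. ennreal (f x) * indicator B x \<partial>lebesgue_on D"
    have "?N W = (\<integral>\<^sup>+i. ?N (ball (fst i) (snd i)) \<partial>count_space C)"
      unfolding W_def using mf Ci(1) U D dis C(1)
      by (intro nn_integral_countable_disjoint_UN[symmetric] open_in_lebesgue_on) auto
    also have "\<dots> \<le> (\<integral>\<^sup>+i. ennreal t * emeasure lborel (ball (fst i) (snd i)) \<partial>count_space C)"
    proof (rule nn_integral_mono)
      fix i assume "i \<in> space (count_space C)"
      then have i: "i \<in> C" by simp
      let ?B = "ball (fst i) (snd i)"
      have int: "integrable (lebesgue_on D) (\<lambda>y. indicator ?B y * f y)"
        using Ci(1)[OF i] U D integrable_mult_indicator[OF _ f(1), of ?B] open_in_lebesgue_on[of D ?B] by simp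
      have "?N ?B = (\<integral>\<^sup>+y. ennreal (indicator ?B y * f y) \<partial>lebesgue_on D)"
        by (intro nn_integral_cong) (auto simp: indicator_def)
      also have "\<dots> = ennreal (\<integral>y. indicator ?B y * f y \<partial>lebesgue_on D)"
        using f(2) by (intro nn_integral_eq_integral int) auto
      also have "\<dots> \<le> ennreal (t * measure lborel ?B)" using Ci(2)[OF i] by (rule ennreal_leI)
      also have "\<dots> = ennreal t * emeasure lborel ?B" using t by (simp add: ennreal_mult emeasure_lborel_ball)
      finally show "?N ?B \<le> ennreal t * emeasure lborel ?B" .
    qed
    also have "\<dots> = ennreal t * (\<integral>\<^sup>+i. emeasure lborel (ball (fst i) (snd i)) \<partial>count_space C)" by (rule nn_integral_cmult) simp
    also have "(\<integral>\<^sup>+i. emeasure lborel (ball (fst i) (snd i)) \<partial>count_space C) = emeasure lborel W"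
      unfolding W_def using dis C(1) by (intro emeasure_UN_countable[symmetric]) auto
    also have "\<dots> = ennreal (measure lebesgue W)" 
    proof -
      have "emeasure lebesgue W = emeasure lborel W" using W(1) by simp
      then show ?thesis using emeasure_eq_measure2[OF Wl] by simp
    qed
    finally have up: "?N W \<le> ennreal (t * measure lebesgue W)" using t by (simp add: ennreal_mult)
    have WG: "W \<inter> G \<in> lmeasurable" using Wl Gs(2) by (rule fmeasurable_Int_fmeasurable)
    have "ennreal ((t + s) * measure lebesgue (W \<inter> G)) = ennreal (t + s) * emeasure (lebesgue_on D) (W \<inter> G)"
      using WG t s D U W by (subst emeasure_restrict_space) (auto simp: ennreal_mult emeasure_eq_measure2)
    also have "\<dots> = (\<integral>\<^sup>+x. ennreal (t + s) * indicator (W \<inter> G) x \<partial>lebesgue_on D)"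
      using Ws Gs(1) by (intro nn_integral_cmult_indicator[symmetric]) auto
    also have "\<dots> \<le> ?N W"
      by (intro nn_integral_mono) (auto simp: indicator_def G_def intro!: ennreal_leI)
    also note up
    finally have 1: "(t + s) * measure lebesgue (W \<inter> G) \<le> t * measure lebesgue W"
      using t by (subst (asm) ennreal_le_iff) auto
    have "measure lebesgue W \<le> measure lebesgue ((W \<inter> G) \<union> (T - G))"
      using W U_def WG T(3) by (intro measure_mono_fmeasurable) (auto intro: fmeasurable.Un Wl fmeasurableD)
    also have "\<dots> \<le> measure lebesgue (W \<inter> G) + measure lebesgue (T - G)"
      using WG T(3) by (intro measure_Un_le) (auto intro: fmeasurableD)
    finally have 2: "measure lebesgue W \<le> measure lebesgue (W \<inter> G) + measure lebesgue (T - G)" .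
    have 3: "measure lebesgue (T - G) < e'"
      using T(3,4) e' by (simp add: emeasure_eq_measure2 ennreal_less_iff)
    have "(t + s) * measure lebesgue W \<le> (t + s) * (measure lebesgue (W \<inter> G) + measure lebesgue (T - G))"
      using 2 t s by (intro mult_left_mono) auto
    with 1 have "s * measure lebesgue W \<le> (t + s) * measure lebesgue (T - G)" by (simp add: algebra_simps)
    also have "\<dots> < (t + s) * e'" using 3 t s by (intro mult_strict_left_mono) auto
    also have "\<dots> = s * e" using t s by (simp add: e'_def)
    finally have We: "measure lebesgue W < e" using s by simp
    let ?Q = "Zn n - W"
    have Q: "negligible ?Q" using C(4) by (simp add: W_def)
    have "measure lebesgue (W \<union> ?Q) \<le> measure lebesgue W + measure lebesgue ?Q"
      using Wl negligible_imp_measurable[OF Q] by (intro measure_Un_le) (auto intro: fmeasurableD)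
    also have "\<dots> < e" using We negligible_imp_measure0[OF Q] by simp
    finally have lt: "measure lebesgue (W \<union> ?Q) < e" .
    show "\<exists>T. Zn n \<subseteq> T \<and> T \<in> lmeasurable \<and> measure lebesgue T < e"
    proof (intro exI conjI)
      show "Zn n \<subseteq> W \<union> ?Q" by blast
      show "W \<union> ?Q \<in> lmeasurable" by (rule fmeasurable.Un[OF Wl negligible_imp_measurable[OF Q]])
    qed (rule lt)
  qed
  then have "negligible (\<Union>n. Zn n)" by (intro negligible_countable_Union) auto
  moreover have "Z \<subseteq> (\<Union>n. Zn n)"
  proof
    fix x assume x: "x \<in> Z"
    obtain n where "1 / real (Suc n) < f x - t"
      using reals_Archimedean[of "f x - t"] Z(2)[OF x] by (auto simp: inverse_eq_divide)
    then show "x \<in> (\<Union>n. Zn n)" using x by (auto simp: Zn_def intro!: exI[of _ n])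
  qed
  ultimately show ?thesis by (rule negligible_subset)
qed

text \<open>A stopping time in the radius. The bound on the total energy rules out stopping at
  radius \<open>R\<close>; almost every point where the gradient exceeds \<open>l\<close> stops at
  some smaller one, and the first such radius satisfies both conditions of
  \<open>stopping_estimate\<close>. The fivefold enlargements of the disjoint tripled balls cover.
  The energy on each enlargement is bounded by its stopping level, and the excess is summed over the
  disjoint balls.\<close>

lemma superlevel_estimate:
  fixes \<alpha> \<beta> :: real
  assumes al: "0 < \<alpha>" and be: "0 \<le> \<beta>"
  shows "\<exists>\<kappa>>0. \<exists>C>0. \<forall>(D::(real^'n) set) A F w g K R l. bounded D \<longrightarrow> open D \<longrightarrow> Mab \<alpha> \<beta> D A \<longrightarrow> weak_eq D A F w g \<longrightarrow>
    0 < R \<longrightarrow> K \<subseteq> D \<longrightarrow> (\<forall>x\<in>K. ball x R \<subseteq> D) \<longrightarrow> 0 < l \<longrightarrow> (l2norm D g)\<^sup>2 \<le> l\<^sup>2 * measure lborel (ball (0::real^'n) R) \<longrightarrow>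
    (\<integral>\<^sup>+x. ennreal ((norm (g x))\<^sup>2) * indicator {x\<in>K. l < norm (g x)} x \<partial>lebesgue_on D)
      \<le> ennreal C * (\<integral>\<^sup>+x. ennreal (excess \<kappa> l F g x) \<partial>lebesgue_on D)"
proof -
  obtain \<kappa> C where \<kappa>: "\<kappa> > 0" and C: "C > 0" and stop: "\<And>(D::(real^'n) set) A F w g x0 r l. bounded D \<Longrightarrow> open D \<Longrightarrow> Mab \<alpha> \<beta> D A \<Longrightarrow> weak_eq D A F w g \<Longrightarrow>
    0 < r \<Longrightarrow> ball x0 (15 * r) \<subseteq> D \<Longrightarrow> 0 < l \<Longrightarrow> l\<^sup>2 * measure lborel (ball x0 r) < (l2on D (ball x0 r) g)\<^sup>2 \<Longrightarrow>
    (l2on D (ball x0 (15 * r)) g)\<^sup>2 \<le> l\<^sup>2 * measure lborel (ball x0 (15 * r)) \<Longrightarrow>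
    l\<^sup>2 * measure lborel (ball x0 r) \<le> C * (\<integral>x. indicator (ball x0 (3 * r)) x * excess \<kappa> l F g x \<partial>lebesgue_on D)"
    using stopping_estimate[OF al be, where 'n = 'n] by blast
  have main: "(\<integral>\<^sup>+x. ennreal ((norm (g x))\<^sup>2) * indicator {x\<in>K. l < norm (g x)} x \<partial>lebesgue_on D)
      \<le> ennreal (15 ^ CARD('n) * C) * (\<integral>\<^sup>+x. ennreal (excess \<kappa> l F g x) \<partial>lebesgue_on D)"
    if D: "bounded D" "open D" and A: "Mab \<alpha> \<beta> D A" and w: "weak_eq D A F w g" and R: "0 < R" and K: "K \<subseteq> D" "\<forall>x\<in>K. ball x R \<subseteq> D"
      and l: "0 < l" and gl: "(l2norm D g)\<^sup>2 \<le> l\<^sup>2 * measure lborel (ball (0::real^'n) R)"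
    for D :: "(real^'n) set" and A F w g K R l
  proof -
    have g: "L2 D g" and F: "L2 D F" using w by (auto simp: weak_eq_def dest: H10_L2)
    note mg = L2_measurable[OF g] and mF = L2_measurable[OF F]
    define S where "S = {x\<in>K. l < norm (g x)}"
    define J where "J x r = (l2on D (ball x r) g)\<^sup>2" for x r
    \<comment> \<open>Radii shrink by 15, so the last radius before stopping is exactly the enlarged
      radius on which the upper bound is required.\<close>
    define rad where "rad m = R / 15 ^ m" for m :: nat
    have rad: "rad m > 0" "15 * rad (Suc m) = rad m" "rad m \<le> R" for m
      using R by (auto simp: rad_def divide_le_eq mult_le_cancel_left1)
    \<comment> \<open>The points that never stop: arbitrarily small balls around them have mean
      energy at most \<open>l\<^sup>2\<close>, although the value there is larger.\<close>
    define Z where "Z = {x\<in>S. \<forall>m. J x (rad m) \<le> l\<^sup>2 * measure lborel (ball x (rad m))}"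
    have "negligible Z"
    proof (rule small_averages_negligible[OF D L2_integrable_sq[OF g], of "l\<^sup>2"])
      show "Z \<subseteq> D" using K by (auto simp: Z_def S_def)
      show "l\<^sup>2 < (norm (g x))\<^sup>2" if "x \<in> Z" for x
        using that l by (auto simp: Z_def S_def intro!: power_strict_mono)
      fix x and e :: real assume x: "x \<in> Z" and e: "0 < e"
      have "(\<lambda>m. R * (1/15) ^ m) \<longlonglongrightarrow> R * 0" by (intro tendsto_mult_left LIMSEQ_realpow_zero) auto
      then have "eventually (\<lambda>m. rad m < e) sequentially"
        using order_tendstoD(2)[of "\<lambda>m. R * (1/15) ^ m" 0 sequentially e] e by (simp add: rad_def power_one_over divide_simps)
      then obtain m where "rad m < e" by (auto simp: eventually_sequentially)
      then show "\<exists>r>0. r < e \<and> (\<integral>y. indicator (ball x r) y * (norm (g y))\<^sup>2 \<partial>lebesgue_on D) \<le> l\<^sup>2 * measure lborel (ball x r)"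
        using x rad(1)[of m] by (intro exI[of _ "rad m"]) (auto simp: Z_def J_def l2on_sq)
    qed auto
    define good where "good x r \<longleftrightarrow> 0 < r \<and> 15 * r \<le> R \<and> l\<^sup>2 * measure lborel (ball x r) < J x r
      \<and> J x (15 * r) \<le> l\<^sup>2 * measure lborel (ball x (15 * r))" for x r
    have ex: "\<exists>r. good x r"
      if x: "x \<in> S - Z" for x
    proof -
      let ?P = "\<lambda>m. l\<^sup>2 * measure lborel (ball x (rad m)) < J x (rad m)"
      have "\<exists>m. ?P m" using x by (auto simp: Z_def not_le)
      define k where "k = (LEAST m. ?P m)"
      have P: "?P k" unfolding k_def by (rule LeastI_ex) fact
      \<comment> \<open>Stopping does not occur at the initial radius, so the least stopping index
        has a predecessor.\<close>
      have "\<not> ?P 0"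
      proof -
        have "J x (rad 0) \<le> (l2norm D g)\<^sup>2" unfolding J_def by (intro power_mono L2_indicator(2) g) auto
        also have "\<dots> \<le> l\<^sup>2 * measure lborel (ball x (rad 0))"
          using gl content_ball_scale[of R 1 x 0] R by (simp add: rad_def)
        finally show ?thesis by simp
      qed
      with P have "k \<noteq> 0" by (intro notI) simp
      then obtain m where m: "k = Suc m" by (cases k) auto
      have "\<not> ?P m" by (rule not_less_Least) (simp add: m flip: k_def)
      then have "good x (rad (Suc m))" using P rad(1)[of "Suc m"] rad(2,3)[of m] unfolding m by (simp add: good_def)
      then show ?thesis ..
    qed
    define r where "r x = (SOME r. good x r)" for x
    have gr: "good x (r x)" if "x \<in> S - Z" for x unfolding r_def by (rule someI_ex[OF ex[OF that]])
    have r: "0 < r x" "15 * r x \<le> R" "l\<^sup>2 * measure lborel (ball x (r x)) < J x (r x)"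
      "J x (15 * r x) \<le> l\<^sup>2 * measure lborel (ball x (15 * r x))" if "x \<in> S - Z" for x
      using gr[OF that] by (simp_all add: good_def)
    \<comment> \<open>Vitali's lemma is applied to the tripled balls, since these carry the excess
      and must be disjoint.\<close>
    obtain Q where Q: "countable Q" "Q \<subseteq> S - Z" "pairwise (\<lambda>i j. disjnt (ball i (3 * r i)) (ball j (3 * r j))) Q"
      "S - Z \<subseteq> (\<Union>i\<in>Q. ball i (5 * (3 * r i)))"
    proof (rule Vitali_covering_lemma_balls[where S="S - Z" and K="S - Z" and a="\<lambda>x. x" and r="\<lambda>x. 3 * r x" and B=R])
      show "S - Z \<subseteq> (\<Union>i\<in>S - Z. ball i (3 * r i))" using r(1) by force
      show "0 < 3 * r i \<and> 3 * r i \<le> R" if "i \<in> S - Z" for i using r(1,2)[OF that] by linarith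
    qed blast
    have QD: "ball i (15 * r i) \<subseteq> D" "ball i (3 * r i) \<subseteq> D" if "i \<in> Q" for i
    proof -
      have i: "i \<in> S - Z" using Q(2) that by blast
      then have "ball i R \<subseteq> D" using K by (auto simp: S_def)
      then show "ball i (15 * r i) \<subseteq> D" using r(2)[OF i] subset_ball[of "15 * r i" R i] by blast
      then show "ball i (3 * r i) \<subseteq> D" using r(1)[OF i] subset_ball[of "3 * r i" "15 * r i" i] by auto
    qed
    let ?e = "\<lambda>x. ennreal (excess \<kappa> l F g x)"
    have me: "?e \<in> borel_measurable (lebesgue_on D)" unfolding excess_def using mg mF by measurable
    have ball: "(\<integral>\<^sup>+x. ennreal ((norm (g x))\<^sup>2) * indicator (ball i (15 * r i)) x \<partial>lebesgue_on D)
       \<le> ennreal (15 ^ CARD('n) * C) * (\<integral>\<^sup>+x. ?e x * indicator (ball i (3 * r i)) x \<partial>lebesgue_on D)" if iQ: "i \<in> Q" for i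
    proof -
      have i: "i \<in> S - Z" using Q(2) iQ by blast
      have "(\<integral>\<^sup>+x. ennreal ((norm (g x))\<^sup>2) * indicator (ball i (15 * r i)) x \<partial>lebesgue_on D)
        = (\<integral>\<^sup>+x. ennreal (indicator (ball i (15 * r i)) x * (norm (g x))\<^sup>2) \<partial>lebesgue_on D)"
        by (intro nn_integral_cong) (auto simp: indicator_def)
      also have "\<dots> = ennreal (J i (15 * r i))"
        unfolding J_def l2on_sq by (intro nn_integral_eq_integral integrable_indicator_sq g) auto
      also have "\<dots> \<le> ennreal (15 ^ CARD('n) * (l\<^sup>2 * measure lborel (ball i (r i))))"
        using r(4)[OF i] content_ball_scale[of "r i" 15 i i] r(1)[OF i] by (intro ennreal_leI) (simp add: mult_ac)
      also have "\<dots> \<le> ennreal (15 ^ CARD('n) * (C * (\<integral>x. indicator (ball i (3 * r i)) x * excess \<kappa> l F g x \<partial>lebesgue_on D)))"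
        using stop[OF D A w r(1)[OF i] QD(1)[OF iQ] l] r(3,4)[OF i] by (intro ennreal_leI mult_left_mono) (auto simp: J_def)
      also have "\<dots> = ennreal (15 ^ CARD('n) * C) * ennreal (\<integral>x. indicator (ball i (3 * r i)) x * excess \<kappa> l F g x \<partial>lebesgue_on D)"
        using C by (simp add: ennreal_mult' mult.assoc[symmetric])
      also have "ennreal (\<integral>x. indicator (ball i (3 * r i)) x * excess \<kappa> l F g x \<partial>lebesgue_on D)
        = (\<integral>\<^sup>+x. ennreal (indicator (ball i (3 * r i)) x * excess \<kappa> l F g x) \<partial>lebesgue_on D)"
      proof (rule nn_integral_eq_integral[symmetric])
        have "integrable (lebesgue_on D) (\<lambda>x. indicator (ball i (3 * r i)) x * (if \<kappa> * l < norm (F x) then (norm (F x))\<^sup>2 else 0)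
           + l * (indicator (ball i (3 * r i)) x * (if \<kappa> * l < norm (g x) then norm (g x) else 0)))"
          using excess_parts_integrable[OF D F g, of "ball i (3 * r i)" "\<kappa> * l"] by auto
        then show "integrable (lebesgue_on D) (\<lambda>x. indicator (ball i (3 * r i)) x * excess \<kappa> l F g x)"
          by (simp add: excess_def algebra_simps)
        show "AE x in lebesgue_on D. 0 \<le> indicator (ball i (3 * r i)) x * excess \<kappa> l F g x"
          using l by (auto simp: excess_def)
      qed
      also have "\<dots> = (\<integral>\<^sup>+x. ?e x * indicator (ball i (3 * r i)) x \<partial>lebesgue_on D)"
        by (intro nn_integral_cong) (auto simp: indicator_def)
      finally show ?thesis .
    qed
    have "AE x in lebesgue_on D. x \<notin> Z" using \<open>negligible Z\<close> D by (intro negligible_AE_lebesgue_on) auto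
    then have "AE x in lebesgue_on D. ennreal ((norm (g x))\<^sup>2) * indicator S x \<le> ennreal ((norm (g x))\<^sup>2) * indicator (\<Union>i\<in>Q. ball i (15 * r i)) x"
    proof eventually_elim
      case (elim x)
      show ?case
      proof (cases "x \<in> S")
        case True
        with elim Q(4) obtain i where "i \<in> Q" "x \<in> ball i (5 * (3 * r i))" by blast
        then have "x \<in> (\<Union>i\<in>Q. ball i (15 * r i))" by auto
        then show ?thesis using True by simp
      qed simp
    qed
    then have "(\<integral>\<^sup>+x. ennreal ((norm (g x))\<^sup>2) * indicator S x \<partial>lebesgue_on D)
      \<le> (\<integral>\<^sup>+x. ennreal ((norm (g x))\<^sup>2) * indicator (\<Union>i\<in>Q. ball i (15 * r i)) x \<partial>lebesgue_on D)"
      by (rule nn_integral_mono_AE)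
    also have "\<dots> \<le> (\<integral>\<^sup>+i. (\<integral>\<^sup>+x. ennreal ((norm (g x))\<^sup>2) * indicator (ball i (15 * r i)) x \<partial>lebesgue_on D) \<partial>count_space Q)"
      using mg QD D Q(1) by (intro nn_integral_countable_UN_le open_in_lebesgue_on) auto
    also have "\<dots> \<le> (\<integral>\<^sup>+i. ennreal (15 ^ CARD('n) * C) * (\<integral>\<^sup>+x. ?e x * indicator (ball i (3 * r i)) x \<partial>lebesgue_on D) \<partial>count_space Q)"
      using ball by (intro nn_integral_mono) auto
    also have "\<dots> = ennreal (15 ^ CARD('n) * C) * (\<integral>\<^sup>+i. (\<integral>\<^sup>+x. ?e x * indicator (ball i (3 * r i)) x \<partial>lebesgue_on D) \<partial>count_space Q)"
      by (rule nn_integral_cmult) simp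
    also have "(\<integral>\<^sup>+i. (\<integral>\<^sup>+x. ?e x * indicator (ball i (3 * r i)) x \<partial>lebesgue_on D) \<partial>count_space Q)
       = (\<integral>\<^sup>+x. ?e x * indicator (\<Union>i\<in>Q. ball i (3 * r i)) x \<partial>lebesgue_on D)"
    proof (rule nn_integral_countable_disjoint_UN[OF me _ Q(1)])
      show "disjoint_family_on (\<lambda>i. ball i (3 * r i)) Q" using Q(3) by (auto simp: disjoint_family_on_def pairwise_def disjnt_def)
      show "ball i (3 * r i) \<in> sets (lebesgue_on D)" if "i \<in> Q" for i
        by (rule open_in_lebesgue_on[OF D(2) open_ball QD(2)[OF that]])
    qed
    also have "\<dots> \<le> (\<integral>\<^sup>+x. ?e x \<partial>lebesgue_on D)" by (intro nn_integral_mono) (auto simp: indicator_def)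
    finally show ?thesis by (simp add: S_def mult_left_mono)
  qed
  have "15 ^ CARD('n) * C > 0" using C by simp
  with \<kappa> main show ?thesis by blast
qed

text \<open>A geometric sum is less than twice its last term, and the last term that counts is below
  \<open>a\<close>. With \<open>a = norm (g x) / \<kappa>\<close> this bounds the sum of the
  gradient excesses over all levels, uniformly in their number.\<close>

lemma geometric_below_sum:
  fixes a l :: real
  assumes "0 \<le> a" "0 < l"
  shows "(\<Sum>j<n. if l * 2 ^ j < a then l * 2 ^ j else 0) \<le> 2 * a"
proof (induction n)
  case (Suc n)
  show ?case
  proof (cases "l * 2 ^ n < a")
    case True
    have "(\<Sum>j<n. if l * 2 ^ j < a then l * 2 ^ j else 0) \<le> (\<Sum>j<n. l * 2 ^ j)"
      using assms by (intro sum_mono) auto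
    also have "\<dots> = l * (2 ^ n - 1)" by (simp add: sum_distrib_left[symmetric] geometric_sum)
    finally show ?thesis using True assms by (simp add: algebra_simps)
  qed (use Suc in simp)
qed (use assms in simp)

text \<open>Summing the superlevel estimate over dyadic levels makes the right-hand side telescope into
  \<open>N \<integral>|F|\<^sup>2 + C \<integral>|g|\<^sup>2\<close>, while the left-hand side is at least \<open>N\<close> times its last term.\<close>
lemma interior_equiintegrability:
  fixes D :: "(real^'n) set"
  assumes D: "bounded D" "open D" and al: "0 < \<alpha>" and be: "0 \<le> \<beta>" and K: "compact K" "K \<subseteq> D" and F: "L2 D F" and \<epsilon>: "\<epsilon> > 0"
  obtains \<Lambda> where "\<Lambda> > 0" "\<And>A w g. Mab \<alpha> \<beta> D A \<Longrightarrow> weak_eq D A F w g \<Longrightarrow> l2norm D g \<le> \<Gamma> \<Longrightarrow>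
    (\<integral>\<^sup>+x. ennreal ((norm (g x))\<^sup>2) * indicator {x\<in>K. \<Lambda> < norm (g x)} x \<partial>lebesgue_on D) \<le> ennreal \<epsilon>"
proof -
  obtain \<kappa> C where \<kappa>: "\<kappa> > 0" and C: "C > 0" and sup: "\<And>(D::(real^'n) set) A F w g K R l. bounded D \<Longrightarrow> open D \<Longrightarrow> Mab \<alpha> \<beta> D A \<Longrightarrow> weak_eq D A F w g \<Longrightarrow>
    0 < R \<Longrightarrow> K \<subseteq> D \<Longrightarrow> (\<forall>x\<in>K. ball x R \<subseteq> D) \<Longrightarrow> 0 < l \<Longrightarrow> (l2norm D g)\<^sup>2 \<le> l\<^sup>2 * measure lborel (ball (0::real^'n) R) \<Longrightarrow>
    (\<integral>\<^sup>+x. ennreal ((norm (g x))\<^sup>2) * indicator {x\<in>K. l < norm (g x)} x \<partial>lebesgue_on D)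
      \<le> ennreal C * (\<integral>\<^sup>+x. ennreal (excess \<kappa> l F g x) \<partial>lebesgue_on D)"
    using superlevel_estimate[OF al be, where 'n = 'n] by blast
  obtain R where R: "R > 0" "(\<Union>x\<in>K. ball x R) \<subseteq> D"
    using compact_subset_open_imp_ball_epsilon_subset[OF K(1) D(2) K(2)] by blast
  define b where "b = measure lborel (ball (0::real^'n) R)"
  have b: "b > 0" using R by (simp add: b_def)
  note [measurable] = L2_measurable[OF F]
  note mF = L2_measurable[OF F]
  let ?T = "\<lambda>t x. if t < norm (F x) then (norm (F x))\<^sup>2 else 0"
  have mT: "?T t \<in> borel_measurable (lebesgue_on D)" for t by measurable
  \<comment> \<open>The starting level is fixed by \<open>F\<close> and the energy bound alone. This
    is why the final threshold is uniform over all matrix fields and solutions.\<close>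
  have "(\<lambda>n. \<integral>x. ?T (\<kappa> * real n) x \<partial>lebesgue_on D) \<longlonglongrightarrow> (\<integral>x. 0 \<partial>lebesgue_on D)"
  proof (rule integral_dominated_convergence[OF _ _ L2_integrable_sq[OF F]])
    show "AE x in lebesgue_on D. (\<lambda>n. ?T (\<kappa> * real n) x) \<longlonglongrightarrow> 0"
    proof (intro AE_I2 tendsto_eventually)
      fix x
      obtain N :: nat where N: "norm (F x) < real N * \<kappa>" using reals_Archimedean3[OF \<kappa>] by blast
      have "\<not> \<kappa> * real n < norm (F x)" if "n \<ge> N" for n
      proof -
        have "real N * \<kappa> \<le> real n * \<kappa>" using that \<kappa> by (intro mult_right_mono) auto
        then show ?thesis using N by (simp add: mult.commute)
      qed
      then show "\<forall>\<^sub>F n in sequentially. ?T (\<kappa> * real n) x = 0" by (auto simp: eventually_sequentially)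
    qed
  qed (auto intro: mT)
  then have "\<forall>\<^sub>F n in sequentially. (\<integral>x. ?T (\<kappa> * real n) x \<partial>lebesgue_on D) < \<epsilon> / (2 * C)"
    using \<epsilon> C by (intro order_tendstoD(2)) auto
  moreover have "\<forall>\<^sub>F n in sequentially. \<Gamma>\<^sup>2 / b + 1 < real n" using filterlim_real_sequentially by (simp add: filterlim_at_top_dense)
  ultimately have "\<forall>\<^sub>F n in sequentially. (\<integral>x. ?T (\<kappa> * real n) x \<partial>lebesgue_on D) < \<epsilon> / (2 * C) \<and> \<Gamma>\<^sup>2 / b + 1 < real n" by (rule eventually_conj)
  then obtain n where n: "(\<integral>x. ?T (\<kappa> * real n) x \<partial>lebesgue_on D) < \<epsilon> / (2 * C)" "\<Gamma>\<^sup>2 / b + 1 < real n"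
    by (auto simp: eventually_sequentially)
  \<comment> \<open>Since \<open>l\<close> exceeds 1, it is at most the square of every
    \<open>l * 2 ^ j\<close>; the single condition \<open>\<Gamma>\<^sup>2 \<le> l * b\<close> thus
    gives the energy condition at all levels.\<close>
  define l where "l = real n"
  have l1: "l > 1" "\<Gamma>\<^sup>2 \<le> l * b"
  proof -
    have "0 \<le> \<Gamma>\<^sup>2 / b" using b by simp
    then show "l > 1" using n(2) unfolding l_def by linarith
    have "\<Gamma>\<^sup>2 / b \<le> l" using n(2) unfolding l_def by linarith
    then show "\<Gamma>\<^sup>2 \<le> l * b" using b by (simp add: divide_le_eq)
  qed
  \<comment> \<open>The gradients contribute \<open>2 * C * \<Gamma>\<^sup>2 / \<kappa>\<close> in
    total, whatever the number of levels; this \<open>N\<close> makes it at most half of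
    \<open>real N * \<epsilon>\<close>. The other half is for \<open>F\<close>.\<close>
  obtain N :: nat where "max 1 (4 * C * \<Gamma>\<^sup>2 / (\<kappa> * \<epsilon>)) < real N"
    using reals_Archimedean2 by blast
  then have N: "N > 0" "4 * C * \<Gamma>\<^sup>2 / (\<kappa> * \<epsilon>) < real N" by auto
  show ?thesis
  proof (rule that[of "l * 2 ^ N"])
    show "l * 2 ^ N > 0" using l1 by simp
    fix A w g assume A: "Mab \<alpha> \<beta> D A" and w: "weak_eq D A F w g" and gG: "l2norm D g \<le> \<Gamma>"
    have g: "L2 D g" using w by (auto simp: weak_eq_def dest: H10_L2)
    note mg = L2_measurable[OF g]
    have G2: "(l2norm D g)\<^sup>2 \<le> \<Gamma>\<^sup>2" using gG by (intro power_mono) auto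
    let ?h = "\<lambda>t. \<integral>\<^sup>+x. ennreal ((norm (g x))\<^sup>2) * indicator {x\<in>K. t < norm (g x)} x \<partial>lebesgue_on D"
    have lev: "?h (l * 2 ^ j) \<le> ennreal C * (\<integral>\<^sup>+x. ennreal (excess \<kappa> (l * 2 ^ j) F g x) \<partial>lebesgue_on D)" for j
    proof (rule sup[OF D A w R(1) K(2)])
      have "l \<le> (l * 2 ^ j)\<^sup>2"
      proof -
        have "1 \<le> l * 2 ^ j" using l1 one_le_power[of "2::real" j] by (intro order_trans[OF _ mult_mono[of 1 l 1 "2 ^ j"]]) auto
        then have "l * 2 ^ j \<le> (l * 2 ^ j)\<^sup>2" by (simp add: power2_eq_square mult_le_cancel_left1)
        moreover have "l \<le> l * 2 ^ j" using l1 by (simp add: mult_le_cancel_left1)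
        ultimately show ?thesis by linarith
      qed
      then have "l * b \<le> (l * 2 ^ j)\<^sup>2 * b" using b by (intro mult_right_mono) auto
      then show "(l2norm D g)\<^sup>2 \<le> (l * 2 ^ j)\<^sup>2 * measure lborel (ball (0::real^'n) R)"
        using G2 l1 by (simp add: b_def)
    qed (use R l1 in auto)
    have "of_nat N * ?h (l * 2 ^ N) = (\<Sum>j<N. ?h (l * 2 ^ N))" by simp
    also have "\<dots> \<le> (\<Sum>j<N. ?h (l * 2 ^ j))"
    proof (intro sum_mono nn_integral_mono mult_left_mono)
      fix j x assume "j \<in> {..<N}"
      then have "l * 2 ^ j \<le> l * 2 ^ N" using l1 by (intro mult_left_mono power_increasing) auto
      then show "indicator {x \<in> K. l * 2 ^ N < norm (g x)} x \<le> (indicator {x \<in> K. l * 2 ^ j < norm (g x)} x :: ennreal)"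
        by (auto simp: indicator_def)
    qed auto
    also have "\<dots> \<le> (\<Sum>j<N. ennreal C * (\<integral>\<^sup>+x. ennreal (excess \<kappa> (l * 2 ^ j) F g x) \<partial>lebesgue_on D))"
      by (intro sum_mono lev)
    also have "\<dots> = ennreal C * (\<integral>\<^sup>+x. (\<Sum>j<N. ennreal (excess \<kappa> (l * 2 ^ j) F g x)) \<partial>lebesgue_on D)"
    proof -
      have "(\<integral>\<^sup>+x. (\<Sum>j<N. ennreal (excess \<kappa> (l * 2 ^ j) F g x)) \<partial>lebesgue_on D) = (\<Sum>j<N. \<integral>\<^sup>+x. ennreal (excess \<kappa> (l * 2 ^ j) F g x) \<partial>lebesgue_on D)"
        using mF mg by (intro nn_integral_sum) (auto simp: excess_def)
      then show ?thesis by (simp add: sum_distrib_left)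
    qed
    also have "\<dots> \<le> ennreal C * (\<integral>\<^sup>+x. ennreal (real N * ?T (\<kappa> * l) x + (2 / \<kappa>) * (norm (g x))\<^sup>2) \<partial>lebesgue_on D)"
    proof (intro mult_left_mono nn_integral_mono)
      fix x
      have "(\<Sum>j<N. ennreal (excess \<kappa> (l * 2 ^ j) F g x)) = ennreal (\<Sum>j<N. excess \<kappa> (l * 2 ^ j) F g x)"
        using l1 by (intro sum_ennreal) (auto simp: excess_def)
      also have "(\<Sum>j<N. excess \<kappa> (l * 2 ^ j) F g x) \<le> real N * ?T (\<kappa> * l) x + (2 / \<kappa>) * (norm (g x))\<^sup>2"
      proof -
        have "(\<Sum>j<N. ?T (\<kappa> * (l * 2 ^ j)) x) \<le> (\<Sum>j<N. ?T (\<kappa> * l) x)"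
        proof (rule sum_mono)
          fix j
          have "\<kappa> * l \<le> \<kappa> * (l * 2 ^ j)" using \<kappa> l1 by (simp add: mult_le_cancel_left1)
          then show "?T (\<kappa> * (l * 2 ^ j)) x \<le> ?T (\<kappa> * l) x" by auto
        qed
        moreover have "(\<Sum>j<N. (l * 2 ^ j) * (if \<kappa> * (l * 2 ^ j) < norm (g x) then norm (g x) else 0)) \<le> (2 / \<kappa>) * (norm (g x))\<^sup>2"
        proof -
          have "(\<Sum>j<N. (l * 2 ^ j) * (if \<kappa> * (l * 2 ^ j) < norm (g x) then norm (g x) else 0))
            = norm (g x) * (\<Sum>j<N. if l * 2 ^ j < norm (g x) / \<kappa> then l * 2 ^ j else 0)"
            unfolding sum_distrib_left using \<kappa> by (intro sum.cong) (auto simp: field_simps)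
          also have "\<dots> \<le> norm (g x) * (2 * (norm (g x) / \<kappa>))"
            using \<kappa> l1 by (intro mult_left_mono geometric_below_sum) auto
          finally show ?thesis by (simp add: power2_eq_square mult_ac)
        qed
        ultimately show ?thesis by (simp add: excess_def sum.distrib)
      qed
      finally show "(\<Sum>j<N. ennreal (excess \<kappa> (l * 2 ^ j) F g x)) \<le> ennreal (real N * ?T (\<kappa> * l) x + (2 / \<kappa>) * (norm (g x))\<^sup>2)"
        by (simp add: ennreal_leI)
    qed simp
    also have "(\<integral>\<^sup>+x. ennreal (real N * ?T (\<kappa> * l) x + (2 / \<kappa>) * (norm (g x))\<^sup>2) \<partial>lebesgue_on D)
      = ennreal (real N * (\<integral>x. ?T (\<kappa> * l) x \<partial>lebesgue_on D) + (2 / \<kappa>) * (l2norm D g)\<^sup>2)"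
    proof -
      have i: "integrable (lebesgue_on D) (?T (\<kappa> * l))"
        using excess_parts_integrable(1)[OF D F g, of UNIV "\<kappa> * l"] by simp
      show ?thesis unfolding l2norm_sq using \<kappa>
        by (subst nn_integral_eq_integral) (auto simp: i L2_integrable_sq[OF g])
    qed
    also have "\<dots> \<le> ennreal (real N * (\<epsilon> / (2 * C)) + (2 / \<kappa>) * \<Gamma>\<^sup>2)"
      using n(1) G2 \<kappa> by (intro ennreal_leI add_mono mult_left_mono) (auto simp: l_def)
    also have "ennreal C * \<dots> = ennreal (real N * \<epsilon> / 2 + 2 * C * \<Gamma>\<^sup>2 / \<kappa>)"
      using C \<epsilon> \<kappa> by (subst ennreal_mult[symmetric]) (auto simp: field_simps)
    also have "\<dots> \<le> ennreal (real N * \<epsilon>)"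
    proof (rule ennreal_leI)
      have "4 * C * \<Gamma>\<^sup>2 < real N * (\<kappa> * \<epsilon>)" using N(2) \<kappa> \<epsilon> by (simp add: divide_less_eq)
      then have "2 * C * \<Gamma>\<^sup>2 / \<kappa> \<le> real N * \<epsilon> / 2" using \<kappa> by (simp add: divide_le_eq mult_ac)
      then show "real N * \<epsilon> / 2 + 2 * C * \<Gamma>\<^sup>2 / \<kappa> \<le> real N * \<epsilon>" by simp
    qed
    finally have "of_nat N * ?h (l * 2 ^ N) \<le> of_nat N * ennreal \<epsilon>"
      using C \<epsilon> by (simp add: ennreal_mult ennreal_of_nat_eq_real_of_nat mult_left_mono)
    then show "?h (l * 2 ^ N) \<le> ennreal \<epsilon>" using N(1) by (subst (asm) ennreal_mult_le_mult_iff) auto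
  qed
qed

section \<open>Rellich's theorem\<close>

text \<open>The indicator of a moving ball becomes a condition on the distance, whose joint
  measurability in center and point is evident.\<close>

lemma measurable_ball_average:
  fixes \<phi> :: "'a::euclidean_space \<Rightarrow> real"
  assumes [measurable]: "\<phi> \<in> borel_measurable borel"
  shows "(\<lambda>x. \<integral>y. indicator (ball x \<rho>) y * \<phi> y \<partial>lborel) \<in> borel_measurable borel"
proof -
  have "(\<lambda>x. \<integral>y. (if dist x y < \<rho> then \<phi> y else 0) \<partial>lborel) \<in> borel_measurable lborel" by measurable
  moreover have "(\<integral>y. (if dist x y < \<rho> then \<phi> y else 0) \<partial>lborel) = (\<integral>y. indicator (ball x \<rho>) y * \<phi> y \<partial>lborel)" for x
    by (intro Bochner_Integration.integral_cong) (auto simp: indicator_def)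
  ultimately show ?thesis by simp
qed

lemma test_fun_integrable:
  assumes "test_fun D \<phi> d\<phi>" shows "integrable lborel \<phi>"
proof -
  obtain K where K: "compact K" "K \<subseteq> D" "\<And>x. x \<notin> K \<Longrightarrow> \<phi> x = 0" "\<And>x. x \<notin> K \<Longrightarrow> d\<phi> x = 0"
    by (rule test_fun_support[OF assms]) blast
  show ?thesis by (rule C1_compact_support_integrable[OF test_fun_C1[OF assms] K(1,3)])
qed

text \<open>As in Ehrling's inequality the function is compared with its averages, but on all of
  \<open>D\<close>: a test function vanishes outside, so its translates are controlled by the
  gradient on \<open>D\<close> alone. The averages stay on the right, to be made small by weak
  convergence.\<close>

lemma test_fun_average_estimate:
  fixes D :: "(real^'n) set"
  assumes D: "bounded D" "open D" and t: "test_fun D \<phi> d\<phi>" and r: "0 < \<rho>"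
    and V: "V = measure lborel (ball (0::real^'n) \<rho>)"
    and M: "M = (\<lambda>x. \<integral>y. indicator (ball x \<rho>) y * \<phi> y \<partial>lborel)" and iM: "integrable (lebesgue_on D) (\<lambda>x. (M x)\<^sup>2)"
  shows "V\<^sup>2 * (l2norm D \<phi>)\<^sup>2 \<le> 2 * V\<^sup>2 * \<rho>\<^sup>2 * (l2norm D d\<phi>)\<^sup>2 + 2 * (\<integral>x. (M x)\<^sup>2 \<partial>lebesgue_on D)"
proof -
  note C = test_fun_C1[OF t] and L = test_fun_L2[OF D t]
  note [measurable] = C1_borel[OF C]
  have [measurable]: "M \<in> borel_measurable borel" unfolding M by (rule measurable_ball_average) measurable
  let ?E = "ball (0::real^'n) \<rho>"
  have [measurable]: "?E \<in> sets borel" "D \<in> sets borel" "ball x \<rho> \<in> sets borel" for x :: "real^'n" using D by auto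
  have V0: "0 < V" using r by (simp add: V)
  have eE: "emeasure lborel ?E = ennreal V" unfolding V by (rule emeasure_lborel_ball)
  let ?D = "\<lambda>x h. ennreal ((\<phi> (x + h) - \<phi> x)\<^sup>2)"
  have pt: "ennreal (V\<^sup>2) * ennreal ((norm (\<phi> x))\<^sup>2) \<le> 2 * (ennreal V * (\<integral>\<^sup>+h. ?D x h * indicator ?E h \<partial>lborel)) + 2 * ennreal ((M x)\<^sup>2)" for x
  proof -
    let ?a = "\<integral>\<^sup>+h. ennreal \<bar>\<phi> (x + h) - \<phi> x\<bar> * indicator ?E h \<partial>lborel"
    have i1: "integrable lborel (\<lambda>h. indicator ?E h * \<phi> x)"
      using emeasure_lborel_ball_finite[of "0::real^'n" \<rho>] by (intro integrable_mult_left) (auto simp: integrable_indicator_iff)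
    have "integrable (distr lborel borel ((+) x)) \<phi>" using test_fun_integrable[OF t] by (simp add: lborel_distr_plus)
    then have "integrable lborel (\<lambda>h. \<phi> (x + h))" by (subst (asm) integrable_distr_eq) auto
    then have i2: "integrable lborel (\<lambda>h. indicator ?E h * \<phi> (x + h))"
      using integrable_mult_indicator[of ?E lborel "\<lambda>h. \<phi> (x + h)"] by simp
    have "M x = (\<integral>y. indicator (ball x \<rho>) y * \<phi> y \<partial>distr lborel borel ((+) x))" by (simp add: M lborel_distr_plus)
    also have "\<dots> = (\<integral>h. indicator (ball x \<rho>) (x + h) * \<phi> (x + h) \<partial>lborel)" by (rule integral_distr) auto
    also have "\<dots> = (\<integral>h. indicator ?E h * \<phi> (x + h) \<partial>lborel)"
      by (intro Bochner_Integration.integral_cong) (auto simp: indicator_def dist_norm)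
    finally have Mx: "M x = (\<integral>h. indicator ?E h * \<phi> (x + h) \<partial>lborel)" .
    have "(\<integral>h. indicator ?E h * \<phi> x - indicator ?E h * \<phi> (x + h) \<partial>lborel) = V * \<phi> x - M x"
      using i1 i2 by (simp add: Mx V)
    then have "ennreal (norm (V * \<phi> x - M x)) \<le> (\<integral>\<^sup>+h. ennreal (norm (indicator ?E h * \<phi> x - indicator ?E h * \<phi> (x + h))) \<partial>lborel)"
      using integral_norm_bound_ennreal[OF Bochner_Integration.integrable_diff[OF i1 i2]] by simp
    also have "\<dots> = ?a" by (intro nn_integral_cong) (auto simp: indicator_def abs_minus_commute)
    finally have "ennreal \<bar>V * \<phi> x - M x\<bar> \<le> ?a" by simp
    then have 1: "(ennreal \<bar>V * \<phi> x - M x\<bar>)\<^sup>2 \<le> ?a\<^sup>2" by (rule power_mono) simp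
    have 2: "?a\<^sup>2 \<le> ennreal V * (\<integral>\<^sup>+h. ?D x h * indicator ?E h \<partial>lborel)"
    proof -
      have "?a\<^sup>2 = (\<integral>\<^sup>+h. (ennreal \<bar>\<phi> (x + h) - \<phi> x\<bar> * indicator ?E h) * indicator ?E h \<partial>lborel)\<^sup>2"
        by (intro arg_cong[of _ _ "\<lambda>z. z\<^sup>2"] nn_integral_cong) (auto simp: indicator_def)
      also have "\<dots> \<le> (\<integral>\<^sup>+h. (ennreal \<bar>\<phi> (x + h) - \<phi> x\<bar> * indicator ?E h)\<^sup>2 \<partial>lborel) * (\<integral>\<^sup>+h. (indicator ?E h)\<^sup>2 \<partial>lborel)"
        by (rule Cauchy_Schwarz_nn_integral) measurable
      also have "(\<integral>\<^sup>+h. (indicator ?E h)\<^sup>2 \<partial>lborel) = (\<integral>\<^sup>+h. indicator ?E h \<partial>lborel)"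
        by (intro nn_integral_cong) (auto simp: indicator_def)
      also have "\<dots> = ennreal V" by (simp add: eE)
      also have "(\<integral>\<^sup>+h. (ennreal \<bar>\<phi> (x + h) - \<phi> x\<bar> * indicator ?E h)\<^sup>2 \<partial>lborel) = (\<integral>\<^sup>+h. ?D x h * indicator ?E h \<partial>lborel)"
        by (intro nn_integral_cong) (auto simp: indicator_def ennreal_power)
      finally show ?thesis by (simp add: mult.commute)
    qed
    have "ennreal (V\<^sup>2) * ennreal ((norm (\<phi> x))\<^sup>2) = (ennreal \<bar>V * \<phi> x\<bar>)\<^sup>2"
      by (simp add: ennreal_power power_mult_distrib ennreal_mult abs_mult)
    also have "\<dots> \<le> (ennreal \<bar>V * \<phi> x - M x\<bar> + ennreal \<bar>M x\<bar>)\<^sup>2"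
      by (intro power_mono) (auto simp flip: ennreal_plus intro!: ennreal_leI)
    also have "\<dots> \<le> 2 * (ennreal \<bar>V * \<phi> x - M x\<bar>)\<^sup>2 + 2 * (ennreal \<bar>M x\<bar>)\<^sup>2" by (rule ennreal_power2_sum_le)
    also have "\<dots> \<le> 2 * (ennreal V * (\<integral>\<^sup>+h. ?D x h * indicator ?E h \<partial>lborel)) + 2 * ennreal ((M x)\<^sup>2)"
      using order_trans[OF 1 2] by (intro add_mono mult_left_mono) (auto simp: ennreal_power)
    finally show ?thesis .
  qed
  have "ennreal (V\<^sup>2) * ennreal ((l2norm D \<phi>)\<^sup>2) = (\<integral>\<^sup>+x. ennreal (V\<^sup>2) * ennreal ((norm (\<phi> x))\<^sup>2) * indicator D x \<partial>lborel)"
    unfolding l2norm_ennreal_lborel[OF D(2) L(1) C1_borel(1)[OF C]] by (simp add: nn_integral_cmult mult.assoc)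
  also have "\<dots> \<le> (\<integral>\<^sup>+x. 2 * ennreal V * (\<integral>\<^sup>+h. ?D x h * indicator ?E h \<partial>lborel) + 2 * (ennreal ((M x)\<^sup>2) * indicator D x) \<partial>lborel)"
  proof (rule nn_integral_mono)
    fix x show "ennreal (V\<^sup>2) * ennreal ((norm (\<phi> x))\<^sup>2) * indicator D x
      \<le> 2 * ennreal V * (\<integral>\<^sup>+h. ?D x h * indicator ?E h \<partial>lborel) + 2 * (ennreal ((M x)\<^sup>2) * indicator D x)"
      using pt[of x] by (cases "x \<in> D") (auto simp: mult.assoc)
  qed
  also have "\<dots> = (\<integral>\<^sup>+x. 2 * ennreal V * (\<integral>\<^sup>+h. ?D x h * indicator ?E h \<partial>lborel) \<partial>lborel) + (\<integral>\<^sup>+x. 2 * (ennreal ((M x)\<^sup>2) * indicator D x) \<partial>lborel)"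
    by (rule nn_integral_add) measurable
  also have "(\<integral>\<^sup>+x. 2 * (ennreal ((M x)\<^sup>2) * indicator D x) \<partial>lborel) = 2 * (\<integral>\<^sup>+x. ennreal ((M x)\<^sup>2) * indicator D x \<partial>lborel)"
    by (rule nn_integral_cmult) measurable
  also have "(\<integral>\<^sup>+x. ennreal ((M x)\<^sup>2) * indicator D x \<partial>lborel) = (\<integral>\<^sup>+x. ennreal ((M x)\<^sup>2) \<partial>lebesgue_on D)"
    by (rule nn_lebesgue_on[symmetric]) measurable
  also have "\<dots> = ennreal (\<integral>x. (M x)\<^sup>2 \<partial>lebesgue_on D)" using iM by (intro nn_integral_eq_integral) auto
  also have "(\<integral>\<^sup>+x. 2 * ennreal V * (\<integral>\<^sup>+h. ?D x h * indicator ?E h \<partial>lborel) \<partial>lborel)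
     = 2 * ennreal V * (\<integral>\<^sup>+x. (\<integral>\<^sup>+h. ?D x h * indicator ?E h \<partial>lborel) \<partial>lborel)"
    by (rule nn_integral_cmult) measurable
  also have "(\<integral>\<^sup>+x. (\<integral>\<^sup>+h. ?D x h * indicator ?E h \<partial>lborel) \<partial>lborel) = (\<integral>\<^sup>+h. (\<integral>\<^sup>+x. ?D x h * indicator ?E h \<partial>lborel) \<partial>lborel)"
    by (rule lborel_pair.Fubini'[of "\<lambda>h x. ?D x h * indicator ?E h"]) measurable
  also have "\<dots> \<le> (\<integral>\<^sup>+h. (ennreal (\<rho>\<^sup>2) * ennreal ((l2norm D d\<phi>)\<^sup>2)) * indicator ?E h \<partial>lborel)"
  proof (rule nn_integral_mono)
    fix h :: "real^'n"
    have "(\<integral>\<^sup>+x. ?D x h \<partial>lborel) \<le> ennreal (\<rho>\<^sup>2) * ennreal ((l2norm D d\<phi>)\<^sup>2)" if h: "h \<in> ?E"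
    proof -
      have "(\<integral>\<^sup>+x. ?D x h * indicator UNIV x \<partial>lborel) \<le> ennreal ((norm h)\<^sup>2) * (\<integral>\<^sup>+x. ennreal ((norm (d\<phi> x))\<^sup>2) * indicator UNIV x \<partial>lborel)"
        by (rule C1_translate_L2[OF C]) auto
      also have "(\<integral>\<^sup>+x. ennreal ((norm (d\<phi> x))\<^sup>2) * indicator UNIV x \<partial>lborel) = (\<integral>\<^sup>+x. ennreal ((norm (d\<phi> x))\<^sup>2) * indicator D x \<partial>lborel)"
        using test_fun_outside(2)[OF t] by (intro nn_integral_cong) (auto simp: indicator_def)
      also have "\<dots> = ennreal ((l2norm D d\<phi>)\<^sup>2)"
        by (rule l2norm_ennreal_lborel[symmetric, OF D(2) L(2) C1_borel(2)[OF C]])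
      also have "ennreal ((norm h)\<^sup>2) * \<dots> \<le> ennreal (\<rho>\<^sup>2) * ennreal ((l2norm D d\<phi>)\<^sup>2)"
        using h by (intro mult_right_mono ennreal_leI power_mono) auto
      finally show ?thesis by simp
    qed
    then show "(\<integral>\<^sup>+x. ?D x h * indicator ?E h \<partial>lborel) \<le> (ennreal (\<rho>\<^sup>2) * ennreal ((l2norm D d\<phi>)\<^sup>2)) * indicator ?E h"
      by (cases "h \<in> ?E") simp_all
  qed
  also have "\<dots> = (ennreal (\<rho>\<^sup>2) * ennreal ((l2norm D d\<phi>)\<^sup>2)) * ennreal V" by (simp add: nn_integral_cmult_indicator eE)
  finally have "ennreal (V\<^sup>2) * ennreal ((l2norm D \<phi>)\<^sup>2) \<le> 2 * ennreal V * ((ennreal (\<rho>\<^sup>2) * ennreal ((l2norm D d\<phi>)\<^sup>2)) * ennreal V)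
       + 2 * ennreal (\<integral>x. (M x)\<^sup>2 \<partial>lebesgue_on D)"
    by (simp add: add_mono mult_left_mono)
  also have "\<dots> = ennreal (2 * V\<^sup>2 * \<rho>\<^sup>2 * (l2norm D d\<phi>)\<^sup>2 + 2 * (\<integral>x. (M x)\<^sup>2 \<partial>lebesgue_on D))"
  proof -
    have "2 * ennreal V * ((ennreal (\<rho>\<^sup>2) * ennreal ((l2norm D d\<phi>)\<^sup>2)) * ennreal V) = ennreal (2 * V\<^sup>2 * \<rho>\<^sup>2 * (l2norm D d\<phi>)\<^sup>2)"
      using V0 by (simp add: ennreal_mult power2_eq_square[of V] mult_ac)
    moreover have "2 * ennreal (\<integral>x. (M x)\<^sup>2 \<partial>lebesgue_on D) = ennreal (2 * (\<integral>x. (M x)\<^sup>2 \<partial>lebesgue_on D))"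
      by (simp add: ennreal_mult)
    ultimately show ?thesis by (simp add: ennreal_plus)
  qed
  finally have "ennreal (V\<^sup>2 * (l2norm D \<phi>)\<^sup>2) \<le> ennreal (2 * V\<^sup>2 * \<rho>\<^sup>2 * (l2norm D d\<phi>)\<^sup>2 + 2 * (\<integral>x. (M x)\<^sup>2 \<partial>lebesgue_on D))"
    by (simp only: ennreal_mult[symmetric] zero_le_power2)
  then show ?thesis by (rule ennreal_le_iff[THEN iffD1, rotated]) (auto intro!: add_nonneg_nonneg Bochner_Integration.integral_nonneg)
qed

text \<open>\<open>H10_weak\<close> tests only against the \<open>H\<^sup>1\<close> inner product.
  The Riesz representation extends this to every bounded functional, in particular to inner products
  with fields that are not gradients.\<close>

lemma H10_weak_functional:
  fixes D :: "(real^'n) set" and l :: "(real^'n \<Rightarrow> real) \<Rightarrow> (real^'n \<Rightarrow> real^'n) \<Rightarrow> real"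
  assumes D: "bounded D" "open D" and H: "\<And>k. H10 D (u k) (g k)" "H10 D u0 g0" and w: "H10_weak D u g u0 g0"
    and lin: "\<And>u g v h a b. H10 D u g \<Longrightarrow> H10 D v h \<Longrightarrow> l (\<lambda>x. a * u x + b * v x) (\<lambda>x. a *\<^sub>R g x + b *\<^sub>R h x) = a * l u g + b * l v h"
    and bd: "\<And>u g. H10 D u g \<Longrightarrow> \<bar>l u g\<bar> \<le> C * (l2norm D u + l2norm D g)" and C: "0 \<le> C"
  shows "(\<lambda>k. l (u k) (g k)) \<longlonglongrightarrow> l u0 g0"
proof -
  obtain w0 k0 where r: "H10 D w0 k0" "\<And>v h. H10 D v h \<Longrightarrow> l v h = l2inner D w0 v + l2inner D k0 h"
  proof (rule H10_riesz[where l = l, OF D lin bd C])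
    fix w k assume a: "H10 D w k" "\<And>v h. H10 D v h \<Longrightarrow> l v h = l2inner D w v + l2inner D k h"
    show thesis by (rule that[OF a])
  qed
  have "(\<lambda>k. l2inner D (u k) w0 + l2inner D (g k) k0) \<longlonglongrightarrow> l2inner D u0 w0 + l2inner D g0 k0"
    using w r(1) unfolding H10_weak_def by blast
  then show ?thesis using H by (simp add: r(2) l2inner_commute[of D w0] l2inner_commute[of D k0])
qed

text \<open>The averages on balls of a fixed radius converge pointwise and boundedly.\<close>
lemma H10_rellich_zero:
  fixes D :: "(real^'n) set"
  assumes D: "bounded D" "open D" and H: "\<And>k. H10 D (u k) (g k)" and bd: "\<And>k. l2norm D (g k) \<le> \<Gamma>"
    and w: "H10_weak D u g (\<lambda>x. 0) (\<lambda>x. 0)"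
  shows "(\<lambda>k. l2norm D (u k)) \<longlonglongrightarrow> 0"
proof -
  note DL = lmeasurable_open[OF D]
  obtain C where C: "C > 0" "\<And>u g. H10 D u g \<Longrightarrow> l2norm D u \<le> C * l2norm D g"
    by (rule H10_poincare[OF D]) blast
  \<comment> \<open>The estimate on averages is for test functions, so each \<open>u k\<close> is
    replaced by one at a distance that vanishes as k grows.\<close>
  define near where "near k p \<longleftrightarrow> test_fun D (fst p) (snd p) \<and> l2norm D (\<lambda>x. fst p x - u k x) < 1 / real (Suc k)
    \<and> l2norm D (\<lambda>x. snd p x - g k x) < 1 / real (Suc k)" for k p
  have "\<exists>p. near k p" for k
  proof -
    have "0 < 1 / real (Suc k)" by simp
    then obtain \<phi> d\<phi> where "test_fun D \<phi> d\<phi>" "l2norm D (\<lambda>x. \<phi> x - u k x) < 1 / real (Suc k)"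
      "l2norm D (\<lambda>x. d\<phi> x - g k x) < 1 / real (Suc k)" by (rule H10_approx[OF H])
    then show ?thesis unfolding near_def by (intro exI[of _ "(\<phi>, d\<phi>)"]) simp
  qed
  then obtain p where p: "\<And>k. near k (p k)" by metis
  define \<phi> d\<phi> where "\<phi> k = fst (p k)" and "d\<phi> k = snd (p k)" for k
  have t: "test_fun D (\<phi> k) (d\<phi> k)" "l2norm D (\<lambda>x. \<phi> k x - u k x) < 1 / real (Suc k)"
    "l2norm D (\<lambda>x. d\<phi> k x - g k x) < 1 / real (Suc k)" for k
    using p[of k] by (simp_all add: near_def \<phi>_def d\<phi>_def)
  note tL = test_fun_L2[OF D t(1)] and uL = H10_L2[OF H]
  have d0: "(\<lambda>k. l2norm D (\<lambda>x. \<phi> k x - u k x)) \<longlonglongrightarrow> 0"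
    by (rule tendsto_sandwich[OF _ _ tendsto_const LIMSEQ_Suc[OF lim_1_over_n]])
      (use t(2) in \<open>auto intro!: always_eventually less_imp_le simp del: of_nat_Suc\<close>)
  define \<Gamma>' where "\<Gamma>' = \<Gamma> + 1"
  have gb: "l2norm D (d\<phi> k) \<le> \<Gamma>'" for k
  proof -
    have "1 / real (Suc k) \<le> 1" by simp
    then show ?thesis using l2norm_le_diff[OF tL(2)[of k] uL(2)[of k]] t(3)[of k] bd[of k] unfolding \<Gamma>'_def by linarith
  qed
  have G0: "0 \<le> \<Gamma>'" using gb[of 0] l2norm_nonneg[of D "d\<phi> 0"] by linarith
  have pb: "l2norm D (\<phi> k) \<le> C * \<Gamma>'" for k
    using C(2)[OF H10_test_fun[OF D t(1)], of k] gb[of k] C(1) mult_left_mono[of "l2norm D (d\<phi> k)" \<Gamma>' C] by linarith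
  have ind: "L2 D (\<lambda>x. indicator B x *\<^sub>R (1::real))" if "B \<in> sets borel" for B by (rule L2_indicator(1)[OF L2_const[OF D] that])
  have wk: "(\<lambda>k. l2inner D f (\<phi> k)) \<longlonglongrightarrow> 0" if f: "L2 D f" for f
  proof -
    have "(\<lambda>k. l2inner D f (u k)) \<longlonglongrightarrow> l2inner D f (\<lambda>x. 0)"
    proof (rule H10_weak_functional[where l = "\<lambda>v h. l2inner D f v" and C = "l2norm D f", OF D H _ w])
      show "H10 D (\<lambda>x. 0) (\<lambda>x. 0)" by (rule H10_test_fun[OF D test_fun_zero])
      show "l2inner D f (\<lambda>x. a * u x + b * v x) = a * l2inner D f u + b * l2inner D f v" if "H10 D u g" "H10 D v h" for u g v h a b
        using l2inner_lincomb_right[OF H10_L2(1)[OF that(1)] H10_L2(1)[OF that(2)] f] by simp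
      show "\<bar>l2inner D f u\<bar> \<le> l2norm D f * (l2norm D u + l2norm D g)" if "H10 D u g" for u g
        using l2_cauchy_schwarz[OF f H10_L2(1)[OF that]] mult_left_mono[of "l2norm D u" "l2norm D u + l2norm D g" "l2norm D f"] by simp
    qed simp
    then have 1: "(\<lambda>k. l2inner D f (u k)) \<longlonglongrightarrow> 0" by (simp add: l2inner_def)
    have "(\<lambda>k. l2inner D f (\<lambda>x. \<phi> k x - u k x)) \<longlonglongrightarrow> 0"
    proof (rule Lim_null_comparison)
      show "\<forall>\<^sub>F k in sequentially. norm (l2inner D f (\<lambda>x. \<phi> k x - u k x)) \<le> l2norm D f * l2norm D (\<lambda>x. \<phi> k x - u k x)"
        using l2_cauchy_schwarz[OF f L2_diff[OF tL(1) uL(1)]] by simp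
      show "(\<lambda>k. l2norm D f * l2norm D (\<lambda>x. \<phi> k x - u k x)) \<longlonglongrightarrow> 0" using tendsto_mult_left[OF d0] by simp
    qed
    then have "(\<lambda>k. l2inner D f (\<phi> k) - l2inner D f (u k)) \<longlonglongrightarrow> 0" by (simp add: l2inner_diff_right[OF tL(1) uL(1) f])
    from tendsto_add[OF this 1] show ?thesis by simp
  qed
  have phi0: "(\<lambda>k. l2norm D (\<phi> k)) \<longlonglongrightarrow> 0"
  proof -
    have "(\<lambda>k. (l2norm D (\<phi> k))\<^sup>2) \<longlonglongrightarrow> 0"
    proof (rule LIMSEQ_I)
      fix e :: real assume e: "0 < e"
      \<comment> \<open>The radius is fixed first, making the gradient term at most a quarter of
        \<open>e\<close> for all k at once; only then is k taken large for the averages.\<close>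
      define q where "q = \<Gamma>'\<^sup>2 + 1"
      define \<rho> where "\<rho> = sqrt (e / (8 * q))"
      have rp: "0 < \<rho>" "2 * \<rho>\<^sup>2 * \<Gamma>'\<^sup>2 < e / 2"
      proof -
        have p: "0 < q" by (simp add: q_def add_nonneg_pos)
        then show "0 < \<rho>" using e by (simp add: \<rho>_def)
        have "2 * \<rho>\<^sup>2 * q = e / 4" using p e by (simp add: \<rho>_def)
        moreover have "2 * \<rho>\<^sup>2 * \<Gamma>'\<^sup>2 \<le> 2 * \<rho>\<^sup>2 * q" by (intro mult_left_mono) (auto simp: q_def)
        ultimately show "2 * \<rho>\<^sup>2 * \<Gamma>'\<^sup>2 < e / 2" using e by linarith
      qed
      define V where "V = measure lborel (ball (0::real^'n) \<rho>)"
      have V: "V > 0" using rp by (simp add: V_def)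
      define M where "M k x = (\<integral>y. indicator (ball x \<rho>) y * \<phi> k y \<partial>lborel)" for k x
      have Mm: "M k \<in> borel_measurable (lebesgue_on D)" for k
        unfolding M_def by (intro borel_imp_lebesgue_on measurable_ball_average C1_borel(1)[OF test_fun_C1[OF t(1)]])
      \<comment> \<open>An average is an inner product with an indicator, so weak convergence gives
        its limit at each single center.\<close>
      have Mi: "M k x = l2inner D (\<lambda>y. indicator (ball x \<rho>) y *\<^sub>R 1) (\<phi> k)" for k x
        unfolding M_def l2inner_def using D C1_borel(1)[OF test_fun_C1[OF t(1)], of k] test_fun_outside(1)[OF t(1), of _ k]
        by (subst lebesgue_on_zero_outside(2)) (auto intro!: borel_measurable_times borel_measurable_indicator)
      have Mb: "(M k x)\<^sup>2 \<le> (l2norm D (\<lambda>x. 1::real) * (C * \<Gamma>'))\<^sup>2" for k x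
      proof -
        have "\<bar>M k x\<bar> \<le> l2norm D (\<lambda>y. indicator (ball x \<rho>) y *\<^sub>R (1::real)) * l2norm D (\<phi> k)"
          unfolding Mi by (rule l2_cauchy_schwarz[OF ind tL(1)]) simp
        also have "\<dots> \<le> l2norm D (\<lambda>x. 1::real) * (C * \<Gamma>')"
          using L2_indicator(2)[OF L2_const[OF D, of 1], of "ball x \<rho>"] pb[of k] by (intro mult_mono) (auto simp: l2on_def)
        finally show ?thesis by (rule abs_le_square_iff[THEN iffD1, OF order_trans]) simp
      qed
      have const: "integrable (lebesgue_on D) (\<lambda>x. (l2norm D (\<lambda>x. 1::real) * (C * \<Gamma>'))\<^sup>2)"
        using DL by (intro finite_measure.integrable_const finite_measure_lebesgue_on)
      have iM: "integrable (lebesgue_on D) (\<lambda>x. (M k x)\<^sup>2)" for k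
        by (rule Bochner_Integration.integrable_bound[OF const]) (use Mm Mb in auto)
      have "(\<lambda>k. \<integral>x. (M k x)\<^sup>2 \<partial>lebesgue_on D) \<longlonglongrightarrow> (\<integral>x. 0 \<partial>lebesgue_on D)"
      proof (rule integral_dominated_convergence[OF _ _ const])
        show "AE x in lebesgue_on D. (\<lambda>k. (M k x)\<^sup>2) \<longlonglongrightarrow> 0"
        proof (rule AE_I2)
          fix x
          have "(\<lambda>k. M k x) \<longlonglongrightarrow> 0" unfolding Mi by (rule wk[OF ind]) simp
          from tendsto_power[OF this, of 2] show "(\<lambda>k. (M k x)\<^sup>2) \<longlonglongrightarrow> 0" by simp
        qed
      qed (use Mm Mb in auto)
      then have "\<forall>\<^sub>F k in sequentially. (\<integral>x. (M k x)\<^sup>2 \<partial>lebesgue_on D) < V\<^sup>2 * e / 4"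
        using e V by (intro order_tendstoD(2)) auto
      then obtain N where N: "\<And>k. k \<ge> N \<Longrightarrow> (\<integral>x. (M k x)\<^sup>2 \<partial>lebesgue_on D) < V\<^sup>2 * e / 4" by (auto simp: eventually_sequentially)
      show "\<exists>N. \<forall>k\<ge>N. norm ((l2norm D (\<phi> k))\<^sup>2 - 0) < e"
      proof (intro exI allI impI)
        fix k assume k: "k \<ge> N"
        have "V\<^sup>2 * (l2norm D (\<phi> k))\<^sup>2 \<le> 2 * V\<^sup>2 * \<rho>\<^sup>2 * (l2norm D (d\<phi> k))\<^sup>2 + 2 * (\<integral>x. (M k x)\<^sup>2 \<partial>lebesgue_on D)"
          by (rule test_fun_average_estimate[OF D t(1) rp(1) V_def _ iM]) (simp add: M_def fun_eq_iff)
        also have "\<dots> \<le> 2 * V\<^sup>2 * \<rho>\<^sup>2 * \<Gamma>'\<^sup>2 + 2 * (\<integral>x. (M k x)\<^sup>2 \<partial>lebesgue_on D)"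
          using gb[of k] by (intro add_right_mono mult_left_mono power_mono) auto
        also have "\<dots> < V\<^sup>2 * (2 * \<rho>\<^sup>2 * \<Gamma>'\<^sup>2) + V\<^sup>2 * (e / 2)" using N[OF k] by simp
        also have "\<dots> \<le> V\<^sup>2 * (e / 2) + V\<^sup>2 * (e / 2)" using rp(2) by (intro add_right_mono mult_left_mono) auto
        also have "\<dots> = V\<^sup>2 * e" by simp
        finally show "norm ((l2norm D (\<phi> k))\<^sup>2 - 0) < e" using V by simp
      qed
    qed
    from tendsto_real_sqrt[OF this] show ?thesis by simp
  qed
  show ?thesis
  proof (rule tendsto_sandwich[OF _ _ tendsto_const])
    show "\<forall>\<^sub>F k in sequentially. l2norm D (u k) \<le> l2norm D (\<phi> k) + l2norm D (\<lambda>x. \<phi> k x - u k x)"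
      using l2norm_le_diff[OF uL(1) tL(1)] by (simp add: l2norm_minus_commute[of D "u _"])
    show "(\<lambda>k. l2norm D (\<phi> k) + l2norm D (\<lambda>x. \<phi> k x - u k x)) \<longlonglongrightarrow> 0" using tendsto_add[OF phi0 d0] by simp
  qed auto
qed

section \<open>Stability of H-convergence\<close>

lemma test_fun_sum:
  assumes "finite X" "\<And>x. x \<in> X \<Longrightarrow> test_fun D (f x) (f' x)"
  shows "test_fun D (\<lambda>y. \<Sum>x\<in>X. f x y) (\<lambda>y. \<Sum>x\<in>X. f' x y)"
  using assms
proof (induction X rule: finite_induct)
  case empty
  then show ?case by (simp add: test_fun_zero)
next
  case (insert x X)
  then have "test_fun D (\<lambda>y. 1 * f x y + 1 * (\<Sum>x\<in>X. f x y)) (\<lambda>y. 1 *\<^sub>R f' x y + 1 *\<^sub>R (\<Sum>x\<in>X. f' x y))"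
    by (intro test_fun_lincomb) auto
  then show ?case using insert.hyps by simp
qed

text \<open>Finitely many bumps sum to at least 9/16 on the compact set. A profile that vanishes at
  0 and is constantly 1 from 1/2 on turns the sum into a cutoff.\<close>

lemma cutoff_exists:
  fixes D :: "(real^'n) set"
  assumes K: "compact K" "K \<subseteq> D" and D: "open D"
  obtains \<zeta> d\<zeta> where "test_fun D \<zeta> d\<zeta>" "\<forall>x. 0 \<le> \<zeta> x \<and> \<zeta> x \<le> 1" "\<forall>x\<in>K. \<zeta> x = 1"
proof -
  obtain R where R: "R > 0" "(\<Union>x\<in>K. ball x R) \<subseteq> D"
    using compact_subset_open_imp_ball_epsilon_subset[OF K(1) D K(2)] by blast
  define r where "r = R / 3"
  have r: "r > 0" using R by (simp add: r_def)
  have cov: "K \<subseteq> (\<Union>x\<in>K. ball x r)" using r by force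
  obtain X where X: "X \<subseteq> K" "finite X" "K \<subseteq> (\<Union>x\<in>X. ball x r)"
    by (rule compactE_image[OF K(1) _ cov]) auto
  define s where "s y = (\<Sum>x\<in>X. bump x r y)" for y
  define s' where "s' y = (\<Sum>x\<in>X. bump_grad x r y)" for y
  have "test_fun D (bump x r) (bump_grad x r)" if x: "x \<in> X" for x
  proof (rule test_funI[OF C1_bump, of "cball x (2 * r)"])
    have "cball x (2 * r) \<subseteq> ball x R" using R r by (auto simp: r_def)
    then show "cball x (2 * r) \<subseteq> D" using R(2) x X(1) by blast
  qed (auto intro!: bump_outside[OF r])
  then have t: "test_fun D s s'" unfolding s_def[abs_def] s'_def[abs_def] by (intro test_fun_sum X)
  obtain L where L: "compact L" "L \<subseteq> D" "\<And>x. x \<notin> L \<Longrightarrow> s x = 0" "\<And>x. x \<notin> L \<Longrightarrow> s' x = 0"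
    by (rule test_fun_support[OF t]) blast
  have s0: "0 \<le> s y" for y by (simp add: s_def sum_nonneg)
  have s1: "9/16 \<le> s y" if y: "y \<in> K" for y
  proof -
    obtain x where x: "x \<in> X" "y \<in> ball x r" using X(3) y by blast
    have "bump x r y \<le> s y" unfolding s_def using X(2) x(1) by (intro member_le_sum) auto
    then show ?thesis using bump_ge[OF r x(2)] by linarith
  qed
  \<comment> \<open>The profile \<open>1 - (max 0 (1 - 2 * s))\<^sup>2\<close> is continuously
    differentiable, with derivative \<open>4 * max 0 (1 - 2 * s)\<close>.\<close>
  define \<zeta> where "\<zeta> y = 1 - (max 0 (1 - 2 * s y))\<^sup>2" for y
  define d\<zeta> where "d\<zeta> y = (4 * max 0 (1 - 2 * s y)) *\<^sub>R s' y" for y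
  have "C1 (\<lambda>y. 1 - 2 * s y) (\<lambda>y. - (2 *\<^sub>R s' y))"
    using C1_lincomb[OF C1_const[of 1] test_fun_C1[OF t], of 1 "-2"] by simp
  from C1_lincomb[OF C1_const[of 1] C1_max0_sq[OF this], of 1 "-1"]
  have C: "C1 \<zeta> d\<zeta>" unfolding \<zeta>_def[abs_def] d\<zeta>_def[abs_def] by (simp add: mult.commute)
  have "test_fun D \<zeta> d\<zeta>"
    by (rule test_funI[OF C L(1,2)]) (simp_all add: \<zeta>_def d\<zeta>_def L(3,4))
  moreover have "0 \<le> \<zeta> x \<and> \<zeta> x \<le> 1" for x
  proof -
    have "(max 0 (1 - 2 * s x))\<^sup>2 \<le> 1" using s0[of x] by (intro power_le_one) auto
    then show ?thesis by (simp add: \<zeta>_def)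
  qed
  moreover have "\<zeta> x = 1" if "x \<in> K" for x using s1[OF that] by (simp add: \<zeta>_def)
  ultimately show ?thesis using that by blast
qed

lemma L2_mult_bounded:
  fixes f :: "real^'n \<Rightarrow> 'b::euclidean_space"
  assumes f: "L2 D f" and z: "z \<in> borel_measurable borel" "\<And>x. \<bar>z x\<bar> \<le> M" and M: "0 \<le> M"
  shows "L2 D (\<lambda>x. z x *\<^sub>R f x)" "l2norm D (\<lambda>x. z x *\<^sub>R f x) \<le> M * l2norm D f"
proof -
  have "AE x in lebesgue_on D. norm (z x *\<^sub>R f x) \<le> M * norm (f x)"
    using z(2) by (intro AE_I2) (auto intro: mult_right_mono)
  then show "L2 D (\<lambda>x. z x *\<^sub>R f x)" "l2norm D (\<lambda>x. z x *\<^sub>R f x) \<le> M * l2norm D f"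
    using L2_bound[OF f _ _ M, of "\<lambda>x. z x *\<^sub>R f x"] borel_measurable_scaleR[OF borel_imp_lebesgue_on[OF z(1)] L2_measurable[OF f]] by blast+
qed

lemma L2_mult_vec_bounded:
  fixes f :: "real^'n \<Rightarrow> real" and z :: "real^'n \<Rightarrow> real^'n"
  assumes f: "L2 D f" and z: "z \<in> borel_measurable borel" "\<And>x. norm (z x) \<le> M" and M: "0 \<le> M"
  shows "L2 D (\<lambda>x. f x *\<^sub>R z x)" "l2norm D (\<lambda>x. f x *\<^sub>R z x) \<le> M * l2norm D f"
proof -
  have "AE x in lebesgue_on D. norm (f x *\<^sub>R z x) \<le> M * norm (f x)"
    using z(2) by (intro AE_I2) (auto intro: mult_left_mono simp: mult.commute[of M])
  then show "L2 D (\<lambda>x. f x *\<^sub>R z x)" "l2norm D (\<lambda>x. f x *\<^sub>R z x) \<le> M * l2norm D f"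
    using L2_bound[OF f _ _ M, of "\<lambda>x. f x *\<^sub>R z x"] borel_measurable_scaleR[OF L2_measurable[OF f] borel_imp_lebesgue_on[OF z(1)]] by blast+
qed

text \<open>Testing with \<open>(1 - \<zeta>) u\<^sub>k\<close>: the energy density converges up to the boundary, so it cannot
  concentrate there.\<close>
lemma energy_convergence:
  fixes D :: "(real^'n) set"
  assumes D: "bounded D" "open D" and be: "0 \<le> \<beta>" and A: "\<And>k. Mab \<alpha> \<beta> D (Ak k)"
    and eq: "\<And>k. weak_eq D (Ak k) F (u k) (g k)" and H0: "H10 D u0 g0"
    and bd: "\<And>k. l2norm D (g k) \<le> \<Gamma>" and w: "H10_weak D u g u0 g0"
    and fl: "L2_weak D (\<lambda>k x. Ak k x *v g k x) F" and t: "test_fun D \<zeta> d\<zeta>"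
  shows "(\<lambda>k. l2inner D (\<lambda>x. Ak k x *v g k x) (\<lambda>x. (1 - \<zeta> x) *\<^sub>R g k x)) \<longlonglongrightarrow> l2inner D F (\<lambda>x. (1 - \<zeta> x) *\<^sub>R g0 x)"
proof -
  have H: "H10 D (u k) (g k)" and F: "L2 D F" for k using eq[of k] by (auto simp: weak_eq_def)
  obtain M where M: "M > 0" "\<And>x. \<bar>\<zeta> x\<bar> \<le> M" "\<And>x. norm (d\<zeta> x) \<le> M" by (rule test_fun_bounded[OF t]) blast
  note [measurable] = C1_borel[OF test_fun_C1[OF t]]
  have zb: "\<bar>1 - \<zeta> x\<bar> \<le> 1 + M" for x using M(2)[of x] by linarith
  note zd = L2_mult_vec_bounded[OF _ C1_borel(2)[OF test_fun_C1[OF t]] M(3) less_imp_le[OF M(1)]]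
  have zz: "L2 D (\<lambda>x. (1 - \<zeta> x) *\<^sub>R f x)" "l2norm D (\<lambda>x. (1 - \<zeta> x) *\<^sub>R f x) \<le> (1 + M) * l2norm D f"
    if "L2 D f" for f :: "real^'n \<Rightarrow> real^'n"
    using that M(1) by (auto intro!: L2_mult_bounded[where z = "\<lambda>x. 1 - \<zeta> x"] zb)
  define h where "h v q x = (1 - \<zeta> x) *\<^sub>R q x - v x *\<^sub>R d\<zeta> x" for v :: "real^'n \<Rightarrow> real" and q :: "real^'n \<Rightarrow> real^'n" and x
  have hL: "L2 D (h v q)" "l2norm D (h v q) \<le> (1 + M) * l2norm D q + M * l2norm D v" if "L2 D v" "L2 D q" for v q
    using L2_diff[OF zz(1)[OF that(2)] zd(1)[OF that(1)]] l2norm_diff[OF zz(1)[OF that(2)] zd(1)[OF that(1)]] zz(2)[OF that(2)] zd(2)[OF that(1)]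
    unfolding h_def[abs_def] by auto
  have AL: "L2 D (\<lambda>x. Ak k x *v g k x)" "l2norm D (\<lambda>x. Ak k x *v g k x) \<le> \<beta> * \<Gamma>" for k
  proof -
    show "L2 D (\<lambda>x. Ak k x *v g k x)" by (rule Mab_L2(1)[OF A H10_L2(2)[OF H] be])
    show "l2norm D (\<lambda>x. Ak k x *v g k x) \<le> \<beta> * \<Gamma>"
      using Mab_L2(2)[OF A H10_L2(2)[OF H] be, of k k] mult_left_mono[OF bd[of k] be] by linarith
  qed
  have e: "l2inner D (\<lambda>x. Ak k x *v g k x) (h (u k) (g k)) = l2inner D F (h (u k) (g k))" for k
  proof -
    have "H10 D (\<lambda>x. u k x - \<zeta> x * (u k x - 0)) (\<lambda>x. g k x - ((u k x - 0) *\<^sub>R d\<zeta> x + \<zeta> x *\<^sub>R g k x))"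
      by (rule H10_diff[OF D H H10_cutoff[OF D H t]])
    moreover have "(\<lambda>x. g k x - ((u k x - 0) *\<^sub>R d\<zeta> x + \<zeta> x *\<^sub>R g k x)) = h (u k) (g k)"
      by (auto simp: h_def fun_eq_iff algebra_simps)
    ultimately show ?thesis using eq[of k] unfolding weak_eq_def by metis
  qed
  have split: "l2inner D f (h v q) = l2inner D f (\<lambda>x. (1 - \<zeta> x) *\<^sub>R q x) - l2inner D f (\<lambda>x. v x *\<^sub>R d\<zeta> x)" if "L2 D f" "L2 D v" "L2 D q" for f v q
    unfolding h_def[abs_def] by (rule l2inner_diff_right[OF zz(1)[OF that(3)] zd(1)[OF that(2)] that(1)])
  have lim1: "(\<lambda>k. l2inner D F (h (u k) (g k))) \<longlonglongrightarrow> l2inner D F (h u0 g0)"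
  proof (rule H10_weak_functional[where l = "\<lambda>v q. l2inner D F (h v q)" and C = "l2norm D F * (1 + M)", OF D H H0 w])
    show "l2inner D F (h (\<lambda>x. a * u x + b * v x) (\<lambda>x. a *\<^sub>R g x + b *\<^sub>R q x)) = a * l2inner D F (h u g) + b * l2inner D F (h v q)"
      if "H10 D u g" "H10 D v q" for u g v q a b
    proof -
      have "h (\<lambda>x. a * u x + b * v x) (\<lambda>x. a *\<^sub>R g x + b *\<^sub>R q x) = (\<lambda>x. a *\<^sub>R h u g x + b *\<^sub>R h v q x)"
        by (auto simp: h_def fun_eq_iff algebra_simps)
      then show ?thesis using l2inner_lincomb_right[OF hL(1)[OF H10_L2[OF that(1)]] hL(1)[OF H10_L2[OF that(2)]] F] by simp
    qed
    show "\<bar>l2inner D F (h u g)\<bar> \<le> l2norm D F * (1 + M) * (l2norm D u + l2norm D g)" if "H10 D u g" for u g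
    proof -
      have "\<bar>l2inner D F (h u g)\<bar> \<le> l2norm D F * l2norm D (h u g)" by (rule l2_cauchy_schwarz[OF F hL(1)[OF H10_L2[OF that]]])
      also have "l2norm D (h u g) \<le> (1 + M) * l2norm D g + M * l2norm D u" by (rule hL(2)[OF H10_L2[OF that]])
      also have "\<dots> \<le> (1 + M) * (l2norm D u + l2norm D g)" by (simp add: algebra_simps)
      finally show ?thesis by (simp add: mult_left_mono mult.assoc)
    qed
  qed (use M in simp)
  \<comment> \<open>The term with \<open>d\<zeta>\<close> pairs \<open>u k\<close> with a flux that
    converges only weakly, so strong convergence of \<open>u k\<close> is needed.\<close>
  have rell: "(\<lambda>k. l2norm D (\<lambda>x. u k x - u0 x)) \<longlonglongrightarrow> 0"
  proof (rule H10_rellich_zero[OF D])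
    show "H10 D (\<lambda>x. u k x - u0 x) (\<lambda>x. g k x - g0 x)" for k by (rule H10_diff[OF D H H0])
    show "l2norm D (\<lambda>x. g k x - g0 x) \<le> \<Gamma> + l2norm D g0" for k
      using l2norm_diff[OF H10_L2(2)[OF H] H10_L2(2)[OF H0], of k] bd[of k] by linarith
    show "H10_weak D (\<lambda>k x. u k x - u0 x) (\<lambda>k x. g k x - g0 x) (\<lambda>x. 0) (\<lambda>x. 0)"
      unfolding H10_weak_def
    proof (intro allI impI)
      fix v q assume v: "H10 D v q"
      have "(\<lambda>k. (l2inner D (u k) v + l2inner D (g k) q) - (l2inner D u0 v + l2inner D g0 q)) \<longlonglongrightarrow> 0"
        using w v unfolding H10_weak_def by (intro LIM_zero) blast
      moreover have "l2inner D (\<lambda>x. u k x - u0 x) v + l2inner D (\<lambda>x. g k x - g0 x) q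
        = (l2inner D (u k) v + l2inner D (g k) q) - (l2inner D u0 v + l2inner D g0 q)" for k
        using H10_L2[OF H, of k] H10_L2[OF H0] H10_L2[OF v] by (simp add: l2inner_diff_left)
      ultimately show "(\<lambda>k. l2inner D (\<lambda>x. u k x - u0 x) v + l2inner D (\<lambda>x. g k x - g0 x) q) \<longlonglongrightarrow> l2inner D (\<lambda>x. 0) v + l2inner D (\<lambda>x. 0) q"
        by (simp add: l2inner_def)
    qed
  qed
  have lim2: "(\<lambda>k. l2inner D (\<lambda>x. Ak k x *v g k x) (\<lambda>x. u k x *\<^sub>R d\<zeta> x)) \<longlonglongrightarrow> l2inner D F (\<lambda>x. u0 x *\<^sub>R d\<zeta> x)"
  proof -
    have 1: "(\<lambda>k. l2inner D (\<lambda>x. Ak k x *v g k x) (\<lambda>x. u0 x *\<^sub>R d\<zeta> x)) \<longlonglongrightarrow> l2inner D F (\<lambda>x. u0 x *\<^sub>R d\<zeta> x)"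
      using fl zd(1)[OF H10_L2(1)[OF H0]] unfolding L2_weak_def by blast
    have 2: "(\<lambda>k. l2inner D (\<lambda>x. Ak k x *v g k x) (\<lambda>x. (u k x - u0 x) *\<^sub>R d\<zeta> x)) \<longlonglongrightarrow> 0"
    proof (rule Lim_null_comparison)
      show "\<forall>\<^sub>F k in sequentially. norm (l2inner D (\<lambda>x. Ak k x *v g k x) (\<lambda>x. (u k x - u0 x) *\<^sub>R d\<zeta> x)) \<le> (\<beta> * \<Gamma> * M) * l2norm D (\<lambda>x. u k x - u0 x)"
      proof (intro always_eventually allI)
        fix k
        note d = L2_diff[OF H10_L2(1)[OF H[of k]] H10_L2(1)[OF H0]]
        have "norm (l2inner D (\<lambda>x. Ak k x *v g k x) (\<lambda>x. (u k x - u0 x) *\<^sub>R d\<zeta> x)) \<le> l2norm D (\<lambda>x. Ak k x *v g k x) * l2norm D (\<lambda>x. (u k x - u0 x) *\<^sub>R d\<zeta> x)"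
          using l2_cauchy_schwarz[OF AL(1)[of k] zd(1)[OF d]] by simp
        also have "\<dots> \<le> (\<beta> * \<Gamma>) * (M * l2norm D (\<lambda>x. u k x - u0 x))"
          using AL(2)[of k] zd(2)[OF d] order_trans[OF l2norm_nonneg AL(2)[of k]] by (intro mult_mono) auto
        finally show "norm (l2inner D (\<lambda>x. Ak k x *v g k x) (\<lambda>x. (u k x - u0 x) *\<^sub>R d\<zeta> x)) \<le> (\<beta> * \<Gamma> * M) * l2norm D (\<lambda>x. u k x - u0 x)"
          by (simp add: mult.assoc)
      qed
      show "(\<lambda>k. (\<beta> * \<Gamma> * M) * l2norm D (\<lambda>x. u k x - u0 x)) \<longlonglongrightarrow> 0" using tendsto_mult_left[OF rell] by simp
    qed
    have "l2inner D (\<lambda>x. Ak k x *v g k x) (\<lambda>x. u k x *\<^sub>R d\<zeta> x) = l2inner D (\<lambda>x. Ak k x *v g k x) (\<lambda>x. u0 x *\<^sub>R d\<zeta> x)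
       + l2inner D (\<lambda>x. Ak k x *v g k x) (\<lambda>x. (u k x - u0 x) *\<^sub>R d\<zeta> x)" for k
      using l2inner_add_right[OF zd(1)[OF H10_L2(1)[OF H0]] zd(1)[OF L2_diff[OF H10_L2(1)[OF H[of k]] H10_L2(1)[OF H0]]] AL(1)[of k]]
      by (simp add: scaleR_diff_left)
    then show ?thesis using tendsto_add[OF 1 2] by simp
  qed
  have "l2inner D (\<lambda>x. Ak k x *v g k x) (\<lambda>x. (1 - \<zeta> x) *\<^sub>R g k x) = l2inner D F (h (u k) (g k)) + l2inner D (\<lambda>x. Ak k x *v g k x) (\<lambda>x. u k x *\<^sub>R d\<zeta> x)" for k
    using split[OF AL(1)[of k] H10_L2[OF H[of k]]] e[of k] by simp
  moreover have "l2inner D F (\<lambda>x. (1 - \<zeta> x) *\<^sub>R g0 x) = l2inner D F (h u0 g0) + l2inner D F (\<lambda>x. u0 x *\<^sub>R d\<zeta> x)"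
    using split[OF F H10_L2[OF H0]] by simp
  ultimately show ?thesis using tendsto_add[OF lim1 lim2] by simp
qed

text \<open>Dominated convergence along cutoffs that equal 1 on an exhaustion by compact sets. It
  provides the cutoff for which the energy of the limit near the boundary is small.\<close>

lemma cutoff_small_tail:
  fixes D :: "(real^'n) set"
  assumes D: "bounded D" "open D" and f: "L2 D F" "L2 D g" and e: "0 < e"
  obtains \<zeta> d\<zeta> where "test_fun D \<zeta> d\<zeta>" "\<forall>x. 0 \<le> \<zeta> x \<and> \<zeta> x \<le> 1" "l2inner D F (\<lambda>x. (1 - \<zeta> x) *\<^sub>R g x) < e"
proof -
  obtain C where C: "\<And>n. compact (C n)" "\<And>n. C n \<subseteq> D" "\<And>n. C n \<subseteq> interior (C (Suc n))" "\<Union>(range C) = D"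
    "\<And>K. \<lbrakk>compact K; K \<subseteq> D\<rbrakk> \<Longrightarrow> \<exists>N. \<forall>n\<ge>N. K \<subseteq> C n"
    by (rule open_Union_compact_subsets[OF D(2)]) blast
  have "\<exists>\<zeta> d\<zeta>. test_fun D \<zeta> d\<zeta> \<and> (\<forall>x. 0 \<le> \<zeta> x \<and> \<zeta> x \<le> 1) \<and> (\<forall>x\<in>C n. \<zeta> x = 1)" for n
    by (rule cutoff_exists[OF C(1)[of n] C(2)[of n] D(2)]) blast
  then obtain \<zeta> d\<zeta> where z: "\<And>n. test_fun D (\<zeta> n) (d\<zeta> n)" "\<And>n x. 0 \<le> \<zeta> n x \<and> \<zeta> n x \<le> 1" "\<And>n x. x \<in> C n \<Longrightarrow> \<zeta> n x = 1"
    by metis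
  have "(\<lambda>n. \<integral>x. F x \<bullet> ((1 - \<zeta> n x) *\<^sub>R g x) \<partial>lebesgue_on D) \<longlonglongrightarrow> (\<integral>x. 0 \<partial>lebesgue_on D)"
  proof (rule integral_dominated_convergence)
    show "integrable (lebesgue_on D) (\<lambda>x. norm (F x \<bullet> g x))" using L2_inner_integrable[OF f] by simp
    show "(\<lambda>x. F x \<bullet> ((1 - \<zeta> n x) *\<^sub>R g x)) \<in> borel_measurable (lebesgue_on D)" for n
      using L2_measurable[OF f(1)] L2_measurable[OF f(2)] borel_imp_lebesgue_on[OF C1_borel(1)[OF test_fun_C1[OF z(1)[of n]]], of D]
      by measurable
    show "AE x in lebesgue_on D. (\<lambda>n. F x \<bullet> ((1 - \<zeta> n x) *\<^sub>R g x)) \<longlonglongrightarrow> 0"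
    proof (rule AE_I2)
      fix x assume "x \<in> space (lebesgue_on D)"
      then have "compact {x}" "{x} \<subseteq> D" by auto
      then obtain N where "\<forall>n\<ge>N. {x} \<subseteq> C n" using C(5) by blast
      then have "\<forall>\<^sub>F n in sequentially. F x \<bullet> ((1 - \<zeta> n x) *\<^sub>R g x) = 0"
        using z(3) by (auto simp: eventually_sequentially intro!: exI[of _ N])
      then show "(\<lambda>n. F x \<bullet> ((1 - \<zeta> n x) *\<^sub>R g x)) \<longlonglongrightarrow> 0" by (rule tendsto_eventually)
    qed
    show "AE x in lebesgue_on D. norm (F x \<bullet> ((1 - \<zeta> n x) *\<^sub>R g x)) \<le> norm (F x \<bullet> g x)" for n
      using z(2)[of n] by (intro AE_I2) (auto simp: abs_mult intro!: mult_left_le_one_le)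
  qed simp
  then have "\<forall>\<^sub>F n in sequentially. l2inner D F (\<lambda>x. (1 - \<zeta> n x) *\<^sub>R g x) < e"
    using e unfolding l2inner_def by (intro order_tendstoD(2)) auto
  then obtain n where "l2inner D F (\<lambda>x. (1 - \<zeta> n x) *\<^sub>R g x) < e" by (auto simp: eventually_sequentially)
  then show ?thesis using z(1,2) that by blast
qed

section \<open>Operator norm of the difference of two matrix fields\<close>

lemma continuous_onorm: "continuous_on UNIV (\<lambda>M::real^'n^'m. onorm (\<lambda>\<xi>. M *v \<xi>))"
proof -
  have bl: "bounded_linear (\<lambda>\<xi>. M *v \<xi>)" for M :: "real^'n^'m" by (rule matrix_vector_mul_bounded_linear)
  have le: "onorm (\<lambda>\<xi>. M *v \<xi>) \<le> norm M" for M :: "real^'n^'m"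
  proof (rule onorm_le)
    fix \<xi>
    have "norm (M *v \<xi>) \<le> L2_set (\<lambda>i. norm (M $ i) * norm \<xi>) UNIV"
      unfolding norm_vec_def[of "M *v \<xi>"]
      by (intro L2_set_mono) (auto simp: matrix_vector_mul_component Cauchy_Schwarz_ineq2)
    then show "norm (M *v \<xi>) \<le> norm M * norm \<xi>"
      by (simp add: norm_vec_def[of M] L2_set_left_distrib)
  qed
  \<comment> \<open>The operator norm is bounded by the Euclidean norm of the entries, hence
    Lipschitz with constant 1 for it; measurability follows from continuity.\<close>
  have tri: "onorm (\<lambda>\<xi>. M *v \<xi>) \<le> onorm (\<lambda>\<xi>. N *v \<xi>) + norm (M - N)" for M N :: "real^'n^'m"
  proof -
    have "(\<lambda>\<xi>. M *v \<xi>) = (\<lambda>\<xi>. N *v \<xi> + (M - N) *v \<xi>)" by (simp add: matrix_vector_mult_diff_rdistrib)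
    then have "onorm (\<lambda>\<xi>. M *v \<xi>) \<le> onorm (\<lambda>\<xi>. N *v \<xi>) + onorm (\<lambda>\<xi>. (M - N) *v \<xi>)"
      using onorm_triangle[OF bl[of N] bl[of "M - N"]] by simp
    then show ?thesis using le[of "M - N"] by linarith
  qed
  show ?thesis
  proof (rule continuous_on_iff[THEN iffD2], intro ballI allI impI)
    fix M :: "real^'n^'m" and e :: real assume e: "0 < e"
    show "\<exists>d>0. \<forall>N\<in>UNIV. dist N M < d \<longrightarrow> dist (onorm (\<lambda>\<xi>. N *v \<xi>)) (onorm (\<lambda>\<xi>. M *v \<xi>)) < e"
    proof (intro exI[of _ e] conjI ballI impI)
      fix N assume "dist N M < e"
      then have "norm (N - M) < e" by (simp add: dist_norm)
      then show "dist (onorm (\<lambda>\<xi>. N *v \<xi>)) (onorm (\<lambda>\<xi>. M *v \<xi>)) < e"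
        using tri[of N M] tri[of M N] by (simp add: dist_real_def norm_minus_commute abs_less_iff)
    qed (rule e)
  qed
qed

lemma onorm_diff_measurable:
  assumes "A \<in> borel_measurable M" "B \<in> borel_measurable M"
  shows "(\<lambda>x. onorm (\<lambda>\<xi>. (A x - B x :: real^'n^'m) *v \<xi>)) \<in> borel_measurable M"
  using measurable_compose[OF borel_measurable_diff[OF assms] borel_measurable_continuous_onI[OF continuous_onorm]] by simp

lemma onorm_diff_le:
  assumes "onorm (\<lambda>\<xi>. A *v \<xi>) \<le> \<beta>" "onorm (\<lambda>\<xi>. B *v \<xi>) \<le> \<beta>"
  shows "onorm (\<lambda>\<xi>. (A - B :: real^'n^'m) *v \<xi>) \<le> 2 * \<beta>"
proof (rule onorm_le)
  fix \<xi>
  have "norm ((A - B) *v \<xi>) \<le> norm (A *v \<xi>) + norm (B *v \<xi>)"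
    by (simp add: matrix_vector_mult_diff_rdistrib norm_triangle_ineq4)
  also have "\<dots> \<le> \<beta> * norm \<xi> + \<beta> * norm \<xi>"
    by (intro add_mono order_trans[OF norm_matrix_vector_le] mult_right_mono assms norm_ge_zero)
  finally show "norm ((A - B) *v \<xi>) \<le> 2 * \<beta> * norm \<xi>" by simp
qed

lemma onorm_matrix_nonneg: "0 \<le> onorm (\<lambda>\<xi>. (M::real^'n^'m) *v \<xi>)"
  by (rule onorm_pos_le[OF matrix_vector_mul_bounded_linear])

lemma Mab_diff_bounds:
  assumes "Mab \<alpha> \<beta> D A" "Mab \<alpha> \<beta> D B"
  shows "AE x in lebesgue_on D. onorm (\<lambda>\<xi>. (A x - B x) *v \<xi>) \<le> 2 * \<beta>"
proof -
  have "AE x in lebesgue_on D. onorm (\<lambda>\<xi>. A x *v \<xi>) \<le> \<beta>" "AE x in lebesgue_on D. onorm (\<lambda>\<xi>. B x *v \<xi>) \<le> \<beta>"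
    using assms unfolding Mab_def by auto
  then show ?thesis by eventually_elim (rule onorm_diff_le)
qed

lemma Mab_diff_integrable:
  fixes D :: "(real^'n) set"
  assumes D: "D \<in> lmeasurable" and A: "Mab \<alpha> \<beta> D A" "Mab \<alpha> \<beta> D B"
  shows "integrable (lebesgue_on D) (\<lambda>x. onorm (\<lambda>\<xi>. (A x - B x) *v \<xi>))"
proof (rule Bochner_Integration.integrable_bound)
  show "integrable (lebesgue_on D) (\<lambda>x. 2 * \<beta>)"
    using D by (intro finite_measure.integrable_const finite_measure_lebesgue_on)
  show "AE x in lebesgue_on D. norm (onorm (\<lambda>\<xi>. (A x - B x) *v \<xi>)) \<le> norm (2 * \<beta>)"
    using Mab_diff_bounds[OF A]
  proof eventually_elim
    case (elim x)
    then show ?case using onorm_matrix_nonneg[of "A x - B x"] by simp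
  qed
qed (rule onorm_diff_measurable[OF Mab_measurable[OF A(1)] Mab_measurable[OF A(2)]])

text \<open>Three regions: near the boundary the gradients carry little energy for large k; inside,
  where they are large, equi-integrability applies; where they are at most \<Lambda>, convergence in
  \<open>L\<^sup>1\<close> of the matrices suffices.\<close>

lemma flux_perturbation_vanishes:
  fixes D :: "(real^'n) set"
  assumes D: "bounded D" "open D" and al: "0 < \<alpha>" and be: "0 \<le> \<beta>" and A: "\<And>k. Mab \<alpha> \<beta> D (Ak k)" and B: "\<And>k. Mab \<alpha> \<beta> D (Bk k)"
    and eq: "\<And>k. weak_eq D (Ak k) F (u k) (g k)" and H0: "H10 D u0 g0"
    and bd: "\<And>k. l2norm D (g k) \<le> \<Gamma>" and w: "H10_weak D u g u0 g0"
    and fl: "L2_weak D (\<lambda>k x. Ak k x *v g k x) F"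
    and d: "(\<lambda>k. \<integral>x. onorm (\<lambda>\<xi>. (Ak k x - Bk k x) *v \<xi>) \<partial>lebesgue_on D) \<longlonglongrightarrow> 0"
  shows "(\<lambda>k. l2norm D (\<lambda>x. (Ak k x - Bk k x) *v g k x)) \<longlonglongrightarrow> 0"
proof -
  have H: "H10 D (u k) (g k)" and F: "L2 D F" for k using eq[of k] by (auto simp: weak_eq_def)
  note g = H10_L2(2)[OF H] and DL = lmeasurable_open[OF D]
  let ?m = "\<lambda>k x. onorm (\<lambda>\<xi>. (Ak k x - Bk k x) *v \<xi>)"
  \<comment> \<open>The summand 1 keeps the divisor positive. Each of the three regions is allotted
    \<open>e / 4\<close>.\<close>
  define p where "p = 4 * \<beta>\<^sup>2 + 1"
  have p: "p > 0" "4 * \<beta>\<^sup>2 \<le> p" by (auto simp: p_def add_nonneg_pos)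
  have "(\<lambda>k. (l2norm D (\<lambda>x. (Ak k x - Bk k x) *v g k x))\<^sup>2) \<longlonglongrightarrow> 0"
  proof (rule LIMSEQ_I)
    fix e :: real assume e: "0 < e"
    have e1: "0 < \<alpha> * (e / (4 * p))" using e p al by simp
    obtain \<zeta> d\<zeta> where t: "test_fun D \<zeta> d\<zeta>" and z: "\<forall>x. 0 \<le> \<zeta> x \<and> \<zeta> x \<le> 1"
      and small: "l2inner D F (\<lambda>x. (1 - \<zeta> x) *\<^sub>R g0 x) < \<alpha> * (e / (4 * p))"
      by (rule cutoff_small_tail[OF D F H10_L2(2)[OF H0] e1]) blast
    obtain K where K: "compact K" "K \<subseteq> D" "\<And>x. x \<notin> K \<Longrightarrow> \<zeta> x = 0" "\<And>x. x \<notin> K \<Longrightarrow> d\<zeta> x = 0"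
      by (rule test_fun_support[OF t]) blast
    have e2: "0 < e / (4 * p)" using e p by simp
    obtain \<Lambda> where L: "\<Lambda> > 0" "\<And>A w g. Mab \<alpha> \<beta> D A \<Longrightarrow> weak_eq D A F w g \<Longrightarrow> l2norm D g \<le> \<Gamma> \<Longrightarrow>
      (\<integral>\<^sup>+x. ennreal ((norm (g x))\<^sup>2) * indicator {x\<in>K. \<Lambda> < norm (g x)} x \<partial>lebesgue_on D) \<le> ennreal (e / (4 * p))"
      by (rule interior_equiintegrability[OF D al be K(1,2) F e2, of \<Gamma>]) blast
    define q where "q = 2 * \<beta> * \<Lambda>\<^sup>2 + 1"
    have q: "q > 0" "2 * \<beta> * \<Lambda>\<^sup>2 \<le> q" using be by (auto simp: q_def add_nonneg_pos)
    have "\<forall>\<^sub>F k in sequentially. l2inner D (\<lambda>x. Ak k x *v g k x) (\<lambda>x. (1 - \<zeta> x) *\<^sub>R g k x) < \<alpha> * (e / (4 * p))"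
      by (rule order_tendstoD(2)[OF energy_convergence[OF D be A eq H0 bd w fl t] small])
    moreover have "\<forall>\<^sub>F k in sequentially. (\<integral>x. ?m k x \<partial>lebesgue_on D) < e / (4 * q)"
      using e q by (intro order_tendstoD(2)[OF d]) auto
    ultimately have ev: "\<forall>\<^sub>F k in sequentially. l2inner D (\<lambda>x. Ak k x *v g k x) (\<lambda>x. (1 - \<zeta> x) *\<^sub>R g k x) < \<alpha> * (e / (4 * p))
       \<and> (\<integral>x. ?m k x \<partial>lebesgue_on D) < e / (4 * q)" by (rule eventually_conj)
    have est: "(l2norm D (\<lambda>x. (Ak k x - Bk k x) *v g k x))\<^sup>2 < e"
      if k1: "l2inner D (\<lambda>x. Ak k x *v g k x) (\<lambda>x. (1 - \<zeta> x) *\<^sub>R g k x) < \<alpha> * (e / (4 * p))"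
        and k2: "(\<integral>x. ?m k x \<partial>lebesgue_on D) < e / (4 * q)" for k
    proof -
      have mz: "(\<lambda>x. 1 - \<zeta> x) \<in> borel_measurable borel" using C1_borel(1)[OF test_fun_C1[OF t]] by measurable
      have zb: "\<bar>1 - \<zeta> x\<bar> \<le> 1" for x using z[rule_format, of x] by linarith
      have zg: "L2 D (\<lambda>x. (1 - \<zeta> x) *\<^sub>R g k x)" by (rule L2_mult_bounded(1)[OF g mz zb]) simp
      let ?T1 = "\<lambda>x. (1 - \<zeta> x) * (norm (g k x))\<^sup>2"
      let ?T2 = "\<lambda>x. indicator K x * (if \<Lambda> < norm (g k x) then (norm (g k x))\<^sup>2 else 0)"
      have i1: "integrable (lebesgue_on D) ?T1"
        using L2_inner_integrable[OF zg g[of k]] by (simp add: power2_norm_eq_inner)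
      have i2: "integrable (lebesgue_on D) ?T2"
        using excess_parts_integrable(1)[OF D g[of k] g[of k], of K \<Lambda>] K(1) by (simp add: borel_compact)
      have i3: "integrable (lebesgue_on D) (?m k)" by (rule Mab_diff_integrable[OF DL A B])
      \<comment> \<open>Coercivity with the weight \<open>1 - \<zeta>\<close> bounds the gradient
        energy near the boundary by the weighted energy that is known to converge.\<close>
      have I1: "(\<integral>x. ?T1 x \<partial>lebesgue_on D) \<le> e / (4 * p)"
      proof -
        have "(\<integral>x. \<alpha> * ?T1 x \<partial>lebesgue_on D) \<le> l2inner D (\<lambda>x. Ak k x *v g k x) (\<lambda>x. (1 - \<zeta> x) *\<^sub>R g k x)"
          unfolding l2inner_def
        proof (rule integral_mono_AE)
          show "integrable (lebesgue_on D) (\<lambda>x. \<alpha> * ?T1 x)" by (rule integrable_mult_right[OF i1])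
          show "integrable (lebesgue_on D) (\<lambda>x. (Ak k x *v g k x) \<bullet> (1 - \<zeta> x) *\<^sub>R g k x)"
            by (rule L2_inner_integrable[OF Mab_L2(1)[OF A g be] zg])
          show "AE x in lebesgue_on D. \<alpha> * ?T1 x \<le> (Ak k x *v g k x) \<bullet> (1 - \<zeta> x) *\<^sub>R g k x"
            using Mab_bounds[OF A[of k]]
          proof eventually_elim
            case (elim x)
            have "(1 - \<zeta> x) * (\<alpha> * (norm (g k x))\<^sup>2) \<le> (1 - \<zeta> x) * ((Ak k x *v g k x) \<bullet> g k x)"
              using elim z by (intro mult_left_mono) auto
            then show ?case by (simp add: mult_ac)
          qed
        qed
        then have "\<alpha> * (\<integral>x. ?T1 x \<partial>lebesgue_on D) \<le> \<alpha> * (e / (4 * p))" using k1 by simp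
        then show ?thesis using al by (simp only: mult_le_cancel_left_pos)
      qed
      have I2: "(\<integral>x. ?T2 x \<partial>lebesgue_on D) \<le> e / (4 * p)"
      proof -
        have "ennreal (\<integral>x. ?T2 x \<partial>lebesgue_on D) = (\<integral>\<^sup>+x. ennreal (?T2 x) \<partial>lebesgue_on D)"
          using i2 by (intro nn_integral_eq_integral[symmetric]) auto
        also have "\<dots> = (\<integral>\<^sup>+x. ennreal ((norm (g k x))\<^sup>2) * indicator {x\<in>K. \<Lambda> < norm (g k x)} x \<partial>lebesgue_on D)"
          by (intro nn_integral_cong) (auto simp: indicator_def)
        also have "\<dots> \<le> ennreal (e / (4 * p))" by (rule L(2)[OF A eq bd])
        finally show ?thesis using e2 by (subst (asm) ennreal_le_iff) auto
      qed
      have "(l2norm D (\<lambda>x. (Ak k x - Bk k x) *v g k x))\<^sup>2 \<le> (\<integral>x. 4 * \<beta>\<^sup>2 * ?T1 x + 4 * \<beta>\<^sup>2 * ?T2 x + 2 * \<beta> * \<Lambda>\<^sup>2 * ?m k x \<partial>lebesgue_on D)"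
        unfolding l2norm_sq
      proof (rule integral_mono_AE)
        have "L2 D (\<lambda>x. Ak k x *v g k x - Bk k x *v g k x)" by (intro L2_diff Mab_L2(1)[OF A g be] Mab_L2(1)[OF B g be])
        then show "integrable (lebesgue_on D) (\<lambda>x. (norm ((Ak k x - Bk k x) *v g k x))\<^sup>2)"
          using L2_integrable_sq by (simp add: matrix_vector_mult_diff_rdistrib)
        show "integrable (lebesgue_on D) (\<lambda>x. 4 * \<beta>\<^sup>2 * ?T1 x + 4 * \<beta>\<^sup>2 * ?T2 x + 2 * \<beta> * \<Lambda>\<^sup>2 * ?m k x)"
          by (intro Bochner_Integration.integrable_add integrable_mult_right i1 i2 i3)
        show "AE x in lebesgue_on D. (norm ((Ak k x - Bk k x) *v g k x))\<^sup>2 \<le> 4 * \<beta>\<^sup>2 * ?T1 x + 4 * \<beta>\<^sup>2 * ?T2 x + 2 * \<beta> * \<Lambda>\<^sup>2 * ?m k x"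
          using Mab_diff_bounds[OF A[of k] B[of k]]
        proof eventually_elim
          case (elim x)
          define m where "m = ?m k x"
          have m: "0 \<le> m" "m \<le> 2 * \<beta>" using elim onorm_matrix_nonneg[of "Ak k x - Bk k x"] by (auto simp: m_def)
          have "norm ((Ak k x - Bk k x) *v g k x) \<le> m * norm (g k x)" unfolding m_def by (rule norm_matrix_vector_le)
          then have le: "(norm ((Ak k x - Bk k x) *v g k x))\<^sup>2 \<le> m\<^sup>2 * (norm (g k x))\<^sup>2"
            using power_mono[of _ "m * norm (g k x)" 2] by (simp add: power_mult_distrib)
          have m2: "m\<^sup>2 \<le> 4 * \<beta>\<^sup>2" using power_mono[OF m(2) m(1), of 2] by (simp add: power_mult_distrib)
          have t1: "0 \<le> 4 * \<beta>\<^sup>2 * ?T1 x" using z by simp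
          have t2: "0 \<le> 4 * \<beta>\<^sup>2 * ?T2 x" by simp
          have t3: "0 \<le> 2 * \<beta> * \<Lambda>\<^sup>2 * m" using be m by simp
          \<comment> \<open>Outside \<open>K\<close> the weight \<open>1 - \<zeta>\<close> equals 1.
            In the last case one factor \<open>m\<close> is replaced by its bound
            \<open>2 * \<beta>\<close>, so the difference of the matrices remains to the first power
            only.\<close>
          consider "x \<notin> K" | "x \<in> K" "\<Lambda> < norm (g k x)" | "norm (g k x) \<le> \<Lambda>" by linarith
          then have "m\<^sup>2 * (norm (g k x))\<^sup>2 \<le> 4 * \<beta>\<^sup>2 * ?T1 x + 4 * \<beta>\<^sup>2 * ?T2 x + 2 * \<beta> * \<Lambda>\<^sup>2 * m"
          proof cases
            case 1
            then have e: "?T1 x = (norm (g k x))\<^sup>2" by (simp add: K(3))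
            show ?thesis unfolding e using mult_right_mono[OF m2 zero_le_power2[of "norm (g k x)"]] t2 t3 by linarith
          next
            case 2
            then have e: "?T2 x = (norm (g k x))\<^sup>2" by simp
            show ?thesis unfolding e using mult_right_mono[OF m2 zero_le_power2[of "norm (g k x)"]] t1 t3 by linarith
          next
            case 3
            have "m\<^sup>2 * (norm (g k x))\<^sup>2 \<le> m\<^sup>2 * \<Lambda>\<^sup>2" using 3 by (intro mult_left_mono power_mono) auto
            also have "\<dots> = m * (m * \<Lambda>\<^sup>2)" by (simp add: power2_eq_square)
            also have "\<dots> \<le> (2 * \<beta>) * (m * \<Lambda>\<^sup>2)" using m by (intro mult_right_mono) auto
            also have "\<dots> = 2 * \<beta> * \<Lambda>\<^sup>2 * m" by simp
            finally show ?thesis using t1 t2 by linarith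
          qed
          with le show ?case unfolding m_def by linarith
        qed
      qed
      also have "\<dots> = 4 * \<beta>\<^sup>2 * (\<integral>x. ?T1 x \<partial>lebesgue_on D) + 4 * \<beta>\<^sup>2 * (\<integral>x. ?T2 x \<partial>lebesgue_on D) + 2 * \<beta> * \<Lambda>\<^sup>2 * (\<integral>x. ?m k x \<partial>lebesgue_on D)"
        using i1 i2 i3 by (simp only: Bochner_Integration.integral_add Bochner_Integration.integrable_add integrable_mult_right integral_mult_right_zero)
      also have "\<dots> \<le> 4 * \<beta>\<^sup>2 * (e / (4 * p)) + 4 * \<beta>\<^sup>2 * (e / (4 * p)) + 2 * \<beta> * \<Lambda>\<^sup>2 * (e / (4 * q))"
        using I1 I2 k2 be by (intro add_mono mult_left_mono) auto
      also have "\<dots> \<le> p * (e / (4 * p)) + p * (e / (4 * p)) + q * (e / (4 * q))"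
        using p q e by (intro add_mono mult_right_mono) auto
      also have "\<dots> < e" using p q e by simp
      finally show ?thesis .
    qed
    from ev show "\<exists>N. \<forall>k\<ge>N. norm ((l2norm D (\<lambda>x. (Ak k x - Bk k x) *v g k x))\<^sup>2 - 0) < e"
      using est by (auto simp: eventually_sequentially)
  qed
  from tendsto_real_sqrt[OF this] show ?thesis by simp
qed

text \<open>Since the perturbed flux difference vanishes strongly, so do the differences of
  gradients, functions and fluxes. Both weak limits are then the same for the two sequences.\<close>

lemma Hconv_L1_perturbation:
  fixes D :: "(real^'n) set"
  assumes D: "bounded D" "open D" and al: "0 < \<alpha>" and ab: "\<alpha> \<le> \<beta>" and A: "\<And>k. Mab \<alpha> \<beta> D (Ak k)" and B: "\<And>k. Mab \<alpha> \<beta> D (Bk k)"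
    and hc: "Hconv \<alpha> D Ak A"
    and d: "(\<lambda>k. \<integral>x. onorm (\<lambda>\<xi>. (Ak k x - Bk k x) *v \<xi>) \<partial>lebesgue_on D) \<longlonglongrightarrow> 0"
  shows "Hconv \<alpha> D Bk A"
proof -
  have be: "0 \<le> \<beta>" using al ab by linarith
  obtain \<beta>' where b': "\<beta>' \<ge> \<alpha>" "Mab \<alpha> \<beta>' D A" using hc unfolding Hconv_def by blast
  have b0: "0 \<le> \<beta>'" using b' al by linarith
  have "H10_weak D vk hk u g \<and> L2_weak D (\<lambda>k x. Bk k x *v hk k x) (\<lambda>x. A x *v g x)"
    if T: "Hminus1 D T" and s0: "wsol D A T u g" and sB: "\<forall>k. wsol D (Bk k) T (vk k) (hk k)" for T u g vk hk
  proof -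
    \<comment> \<open>\<open>Hconv\<close> speaks about given solutions. Those for \<open>Bk\<close>
      are given; those for \<open>Ak\<close> have to be produced, by the Lax-Milgram
      theorem.\<close>
    have "\<exists>p. wsol D (Ak k) T (fst p) (snd p)" for k
    proof -
      obtain u g where "wsol D (Ak k) T u g" by (rule wsol_exists[OF D A al be T])
      then show ?thesis by (intro exI[of _ "(u, g)"]) simp
    qed
    then obtain pk where pk: "\<And>k. wsol D (Ak k) T (fst (pk k)) (snd (pk k))" by metis
    define uk gk where "uk k = fst (pk k)" and "gk k = snd (pk k)" for k
    have sA: "wsol D (Ak k) T (uk k) (gk k)" for k using pk[of k] by (simp add: uk_def gk_def)
    have conv: "H10_weak D uk gk u g" "L2_weak D (\<lambda>k x. Ak k x *v gk k x) (\<lambda>x. A x *v g x)"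
      using hc T s0 sA unfolding Hconv_def by blast+
    have H0: "H10 D u g" and HA: "H10 D (uk k) (gk k)" and HB: "H10 D (vk k) (hk k)" for k
      using s0 sA sB unfolding wsol_def by blast+
    \<comment> \<open>This one field has both roles: it represents the functional for every k, and
      it is the weak limit of the fluxes, as \<open>energy_convergence\<close> requires.\<close>
    let ?F = "\<lambda>x. A x *v g x"
    have F: "L2 D ?F" by (rule Mab_L2(1)[OF b'(2) H10_L2(2)[OF H0] b0])
    have eq: "weak_eq D (Ak k) ?F (uk k) (gk k)" for k
      using sA[of k] s0 F unfolding weak_eq_def wsol_def by simp
    have bd: "l2norm D (gk k) \<le> l2norm D ?F / \<alpha>" for k
    proof -
      have "\<alpha> * (l2norm D (gk k))\<^sup>2 \<le> l2inner D (\<lambda>x. Ak k x *v gk k x) (gk k)" by (rule Mab_coercive[OF A H10_L2(2)[OF HA] be])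
      also have "\<dots> = l2inner D ?F (gk k)" using eq[of k] HA[of k] unfolding weak_eq_def by blast
      also have "\<dots> \<le> l2norm D ?F * l2norm D (gk k)" using l2_cauchy_schwarz[OF F H10_L2(2)[OF HA[of k]]] by simp
      finally have *: "(\<alpha> * l2norm D (gk k)) * l2norm D (gk k) \<le> l2norm D ?F * l2norm D (gk k)" by (simp add: power2_eq_square mult.assoc)
      have "\<alpha> * l2norm D (gk k) \<le> l2norm D ?F"
      proof (cases "l2norm D (gk k) = 0")
        case False
        then have "0 < l2norm D (gk k)" using l2norm_nonneg[of D "gk k"] by linarith
        with * show ?thesis by (simp only: mult_le_cancel_right_pos)
      qed simp
      then show ?thesis using al by (simp add: pos_le_divide_eq mult.commute)
    qed
    define r where "r k = l2norm D (\<lambda>x. (Ak k x - Bk k x) *v gk k x)" for k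
    have r: "r \<longlonglongrightarrow> 0" unfolding r_def by (rule flux_perturbation_vanishes[OF D al be A B eq H0 bd conv d])
    have RL: "L2 D (\<lambda>x. (Ak k x - Bk k x) *v gk k x)" for k
      using L2_diff[OF Mab_L2(1)[OF A H10_L2(2)[OF HA] be] Mab_L2(1)[OF B H10_L2(2)[OF HA] be]]
      by (simp add: matrix_vector_mult_diff_rdistrib)
    let ?d = "\<lambda>k x. hk k x - gk k x"
    have Hd: "H10 D (\<lambda>x. vk k x - uk k x) (?d k)" for k by (rule H10_diff[OF D HB HA])
    note dL = H10_L2[OF Hd]
    have db: "l2norm D (?d k) \<le> r k / \<alpha>" for k
    proof -
      have "\<alpha> * (l2norm D (?d k))\<^sup>2 \<le> l2inner D (\<lambda>x. Bk k x *v ?d k x) (?d k)" by (rule Mab_coercive[OF B dL(2) be])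
      also have "\<dots> = l2inner D (\<lambda>x. Bk k x *v hk k x) (?d k) - l2inner D (\<lambda>x. Bk k x *v gk k x) (?d k)"
        using l2inner_diff_left[OF Mab_L2(1)[OF B H10_L2(2)[OF HB] be] Mab_L2(1)[OF B H10_L2(2)[OF HA] be] dL(2), of k k k k k]
        by (simp add: matrix_vector_mult_diff_distrib)
      \<comment> \<open>Both fluxes represent \<open>T\<close>, so they agree when tested with a
        gradient from \<open>H10\<close>.\<close>
      also have "l2inner D (\<lambda>x. Bk k x *v hk k x) (?d k) = l2inner D (\<lambda>x. Ak k x *v gk k x) (?d k)"
        using sA[of k] sB[rule_format, of k] Hd[of k] unfolding wsol_def by simp
      also have "l2inner D (\<lambda>x. Ak k x *v gk k x) (?d k) - l2inner D (\<lambda>x. Bk k x *v gk k x) (?d k) = l2inner D (\<lambda>x. (Ak k x - Bk k x) *v gk k x) (?d k)"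
        using l2inner_diff_left[OF Mab_L2(1)[OF A H10_L2(2)[OF HA] be] Mab_L2(1)[OF B H10_L2(2)[OF HA] be] dL(2), of k k k k k]
        by (simp add: matrix_vector_mult_diff_rdistrib)
      also have "\<dots> \<le> r k * l2norm D (?d k)" using l2_cauchy_schwarz[OF RL[of k] dL(2)[of k]] by (simp add: r_def)
      finally have *: "(\<alpha> * l2norm D (?d k)) * l2norm D (?d k) \<le> r k * l2norm D (?d k)" by (simp add: power2_eq_square mult.assoc)
      have "\<alpha> * l2norm D (?d k) \<le> r k"
      proof (cases "l2norm D (?d k) = 0")
        case False
        then have "0 < l2norm D (?d k)" using l2norm_nonneg[of D "?d k"] by linarith
        with * show ?thesis by (simp only: mult_le_cancel_right_pos)
      qed (simp add: r_def)
      then show ?thesis using al by (simp add: pos_le_divide_eq mult.commute)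
    qed
    have d0: "(\<lambda>k. l2norm D (?d k)) \<longlonglongrightarrow> 0"
    proof (rule tendsto_sandwich[OF _ _ tendsto_const])
      show "(\<lambda>k. r k / \<alpha>) \<longlonglongrightarrow> 0" using tendsto_divide_zero[OF r] by simp
    qed (use db in auto)
    obtain C where C: "C > 0" "\<And>u g. H10 D u g \<Longrightarrow> l2norm D u \<le> C * l2norm D g"
      by (rule H10_poincare[OF D]) blast
    have v0: "(\<lambda>k. l2norm D (\<lambda>x. vk k x - uk k x)) \<longlonglongrightarrow> 0"
    proof (rule tendsto_sandwich[OF _ _ tendsto_const])
      show "(\<lambda>k. C * l2norm D (?d k)) \<longlonglongrightarrow> 0" using tendsto_mult_left[OF d0] by simp
    qed (use C(2)[OF Hd] in auto)
    have inner0: "(\<lambda>k. l2inner D (f k) q) \<longlonglongrightarrow> 0" if "(\<lambda>k. l2norm D (f k)) \<longlonglongrightarrow> 0" "\<And>k. L2 D (f k)" "L2 D q"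
      for f :: "nat \<Rightarrow> real^'n \<Rightarrow> 'c::euclidean_space" and q
    proof (rule Lim_null_comparison)
      show "\<forall>\<^sub>F k in sequentially. norm (l2inner D (f k) q) \<le> l2norm D (f k) * l2norm D q"
        using l2_cauchy_schwarz[OF that(2,3)] by simp
      show "(\<lambda>k. l2norm D (f k) * l2norm D q) \<longlonglongrightarrow> 0" using tendsto_mult_right[OF that(1)] by simp
    qed
    have "H10_weak D vk hk u g" unfolding H10_weak_def
    proof (intro allI impI)
      fix w q assume w: "H10 D w q"
      have "(\<lambda>k. (l2inner D (uk k) w + l2inner D (gk k) q) + (l2inner D (\<lambda>x. vk k x - uk k x) w + l2inner D (?d k) q))
        \<longlonglongrightarrow> (l2inner D u w + l2inner D g q) + (0 + 0)"
        using conv(1) w unfolding H10_weak_def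
        by (intro tendsto_add[of _ _ _ "\<lambda>k. l2inner D (\<lambda>x. vk k x - uk k x) w + l2inner D (?d k) q"] tendsto_add[OF inner0 inner0] v0 d0 dL H10_L2[OF w]) auto
      moreover have "l2inner D (vk k) w + l2inner D (hk k) q
        = (l2inner D (uk k) w + l2inner D (gk k) q) + (l2inner D (\<lambda>x. vk k x - uk k x) w + l2inner D (?d k) q)" for k
        using H10_L2[OF HA, of k] H10_L2[OF HB, of k] H10_L2[OF w] by (simp add: l2inner_diff_left)
      ultimately show "(\<lambda>k. l2inner D (vk k) w + l2inner D (hk k) q) \<longlonglongrightarrow> l2inner D u w + l2inner D g q" by simp
    qed
    moreover have "L2_weak D (\<lambda>k x. Bk k x *v hk k x) (\<lambda>x. A x *v g x)" unfolding L2_weak_def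
    proof (intro allI impI)
      fix q :: "real^'n \<Rightarrow> real^'n" assume q: "L2 D q"
      have bd0: "(\<lambda>k. l2norm D (\<lambda>x. Bk k x *v ?d k x)) \<longlonglongrightarrow> 0"
      proof (rule tendsto_sandwich[OF _ _ tendsto_const])
        show "(\<lambda>k. \<beta> * l2norm D (?d k)) \<longlonglongrightarrow> 0" using tendsto_mult_left[OF d0] by simp
      qed (use Mab_L2(2)[OF B dL(2) be] in auto)
      have 1: "(\<lambda>k. l2inner D (\<lambda>x. Ak k x *v gk k x) q) \<longlonglongrightarrow> l2inner D ?F q" using conv(2) q unfolding L2_weak_def by blast
      have 2: "(\<lambda>k. l2inner D (\<lambda>x. Bk k x *v ?d k x) q) \<longlonglongrightarrow> 0" by (rule inner0[OF bd0 Mab_L2(1)[OF B dL(2) be] q])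
      have 3: "(\<lambda>k. l2inner D (\<lambda>x. (Ak k x - Bk k x) *v gk k x) q) \<longlonglongrightarrow> 0" by (rule inner0[OF r[unfolded r_def] RL q])
      have "l2inner D (\<lambda>x. Bk k x *v hk k x) q = l2inner D (\<lambda>x. Ak k x *v gk k x) q + l2inner D (\<lambda>x. Bk k x *v ?d k x) q - l2inner D (\<lambda>x. (Ak k x - Bk k x) *v gk k x) q" for k
      proof -
        \<comment> \<open>The flux of the second problem is that of the first plus two errors, both
          of which vanish in norm.\<close>
        have "(\<lambda>x. Bk k x *v hk k x) = (\<lambda>x. (Ak k x *v gk k x + Bk k x *v ?d k x) - (Ak k x - Bk k x) *v gk k x)"
          by (simp add: matrix_vector_mult_diff_rdistrib matrix_vector_mult_diff_distrib)
        then show ?thesis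
          using l2inner_diff_left[OF L2_add[OF Mab_L2(1)[OF A H10_L2(2)[OF HA] be] Mab_L2(1)[OF B dL(2) be]] RL q, of k k k k k]
            l2inner_add_left[OF Mab_L2(1)[OF A H10_L2(2)[OF HA] be] Mab_L2(1)[OF B dL(2) be] q, of k k k k] by simp
      qed
      then show "(\<lambda>k. l2inner D (\<lambda>x. Bk k x *v hk k x) q) \<longlonglongrightarrow> l2inner D (\<lambda>x. A x *v g x) q"
        using tendsto_diff[OF tendsto_add[OF 1 2] 3] by simp
    qed
    ultimately show ?thesis by blast
  qed
  then show ?thesis unfolding Hconv_def using b' by blast
qed

section \<open>From small averages to \<open>L\<^sup>1\<close> convergence\<close>

lemma AE_lebesgue_on_negligible:
  assumes D: "D \<in> sets lebesgue" and ae: "AE x in lebesgue_on D. P x"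
  shows "negligible {x \<in> D. \<not> P x}"
proof -
  obtain N where N: "N \<in> null_sets (lebesgue_on D)" "{x \<in> space (lebesgue_on D). \<not> P x} \<subseteq> N"
    using ae by (auto simp: eventually_ae_filter)
  have "N \<in> null_sets lebesgue" using N(1) D by (simp add: null_sets_restrict_space)
  then have "negligible N" by (simp add: negligible_iff_null_sets)
  then show ?thesis by (rule negligible_subset) (use N(2) D in auto)
qed

lemma countable_exhaust:
  assumes "countable C"
  obtains F :: "nat \<Rightarrow> 'a set" where "\<And>n. finite (F n)" "incseq F" "(\<Union>n. F n) = C"
proof (rule that[of "\<lambda>n. {i \<in> C. to_nat_on C i < n}"])
  show "finite {i \<in> C. to_nat_on C i < n}" for n
  proof (rule inj_on_finite[of "to_nat_on C" _ "{..<n}"])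
    show "inj_on (to_nat_on C) {i \<in> C. to_nat_on C i < n}"
      by (rule inj_on_subset[OF inj_on_to_nat_on[OF assms]]) auto
  qed auto
qed (auto simp: incseq_def)

text \<open>The index from which an average is small depends on the ball, so only finitely many
  balls can be used at once. Vitali's theorem provides disjoint balls of which finitely many cover
  \<open>D\<close> up to measure \<delta>; on the rest the uniform bound \<open>b\<close> is
  enough.\<close>

lemma L1_convergence_from_averages:
  fixes D :: "(real^'n) set" and m :: "nat \<Rightarrow> real^'n \<Rightarrow> real"
  assumes D: "bounded D" "open D" and mi: "\<And>k. integrable (lebesgue_on D) (m k)" and m0: "\<And>k x. 0 \<le> m k x"
    and mb: "\<And>k. AE x in lebesgue_on D. m k x \<le> b" and b: "0 \<le> b"
    and S: "S \<subseteq> D" "negligible (D - S)"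
    and avg: "\<And>x \<eta> d. x \<in> S \<Longrightarrow> 0 < \<eta> \<Longrightarrow> 0 < d \<Longrightarrow> \<exists>\<rho>>0. \<rho> < d \<and>
      (\<forall>\<^sub>F k in sequentially. (\<integral>y. indicator (ball x \<rho>) y * m k y \<partial>lebesgue_on D) < \<eta> * \<rho> ^ CARD('n))"
  shows "(\<lambda>k. \<integral>x. m k x \<partial>lebesgue_on D) \<longlonglongrightarrow> 0"
proof (rule LIMSEQ_I)
  fix e :: real assume e: "0 < e"
  note DL = lmeasurable_open[OF D]
  define \<omega> where "\<omega> = measure lborel (ball (0::real^'n) 1)"
  have om: "\<omega> > 0" by (simp add: \<omega>_def)
  define \<mu> where "\<mu> = measure lebesgue D"
  have mu: "\<mu> \<ge> 0" by (simp add: \<mu>_def)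
  \<comment> \<open>Disjoint balls in \<open>D\<close> have radii whose powers sum to at most
    \<open>\<mu> / \<omega>\<close>. The choice makes their total contribution less than
    \<open>e / 2\<close>.\<close>
  define \<eta> where "\<eta> = e * \<omega> / (4 * (\<mu> + 1))"
  have eta: "\<eta> > 0" "\<eta> * (\<mu> / \<omega>) < e / 2"
  proof -
    show "\<eta> > 0" using e om mu by (simp add: \<eta>_def)
    have "\<eta> * (\<mu> / \<omega>) = (e / 4) * (\<mu> / (\<mu> + 1))" using om mu by (simp add: \<eta>_def)
    also have "\<dots> \<le> (e / 4) * 1" using e mu by (intro mult_left_mono) auto
    also have "\<dots> < e / 2" using e by simp
    finally show "\<eta> * (\<mu> / \<omega>) < e / 2" .
  qed
  \<comment> \<open>Larger than \<open>b\<close> and positive, so that \<delta> is defined also for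
    \<open>b = 0\<close>.\<close>
  define c where "c = b + 1"
  have c: "c > 0" "b \<le> c" using b by (auto simp: c_def)
  define \<delta> where "\<delta> = e / 2 / c"
  have del: "\<delta> > 0" "b * \<delta> \<le> e / 2"
  proof -
    show "\<delta> > 0" using e c by (simp add: \<delta>_def)
    have "b * \<delta> \<le> c * \<delta>" using e c by (intro mult_right_mono) (auto simp: \<delta>_def)
    also have "\<dots> = e / 2" using c by (simp add: \<delta>_def)
    finally show "b * \<delta> \<le> e / 2" .
  qed
  define good where "good x \<rho> \<longleftrightarrow> (\<forall>\<^sub>F k in sequentially. (\<integral>y. indicator (ball x \<rho>) y * m k y \<partial>lebesgue_on D) < \<eta> * \<rho> ^ CARD('n))" for x \<rho>
  define I where "I = {p. 0 < snd p \<and> ball (fst p) (snd p) \<subseteq> D \<and> good (fst p) (snd p)}"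
  obtain C where C: "countable C" "C \<subseteq> I" "pairwise (\<lambda>i j. disjnt (ball (fst i) (snd i)) (ball (fst j) (snd j))) C"
    "negligible (S - (\<Union>i\<in>C. ball (fst i) (snd i)))"
  proof (rule Vitali_covering_theorem_balls[of S I fst snd])
    fix x d assume x: "x \<in> S" and d: "0 < (d::real)"
    obtain \<epsilon> where \<epsilon>: "\<epsilon> > 0" "ball x \<epsilon> \<subseteq> D" using D(2) S(1) x open_contains_ball by blast
    obtain \<rho> where r: "\<rho> > 0" "\<rho> < min \<epsilon> d" "good x \<rho>"
      using avg[OF x eta(1), of "min \<epsilon> d"] \<epsilon> d unfolding good_def by auto
    have "ball x \<rho> \<subseteq> D" using r(2) \<epsilon>(2) subset_ball[of \<rho> \<epsilon> x] by auto
    then have "(x, \<rho>) \<in> I" using r by (simp add: I_def)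
    then show "\<exists>i. i \<in> I \<and> x \<in> ball (fst i) (snd i) \<and> snd i < d" using r by (intro exI[of _ "(x, \<rho>)"]) auto
  qed blast
  let ?b = "\<lambda>i. ball (fst i) (snd i) :: (real^'n) set"
  have CI: "0 < snd i" "?b i \<subseteq> D" "good (fst i) (snd i)" if "i \<in> C" for i
  proof -
    have "i \<in> I" using that C(2) by blast
    then show "0 < snd i" "?b i \<subseteq> D" "good (fst i) (snd i)" by (simp_all add: I_def)
  qed
  obtain F where F: "\<And>n. finite (F n)" "incseq F" "(\<Union>n. F n) = C" by (rule countable_exhaust[OF C(1)]) blast
  define W where "W n = (\<Union>i\<in>F n. ?b i)" for n
  have FC: "F n \<subseteq> C" for n using F(3) by blast
  have Wo: "open (W n)" "W n \<subseteq> D" for n using CI(2) FC[of n] by (auto simp: W_def)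
  have Wl: "W n \<in> lmeasurable" for n using Wo D by (intro lmeasurable_open) (auto intro: bounded_subset)
  have UW: "(\<Union>n. W n) = (\<Union>i\<in>C. ?b i)" unfolding W_def using F(3) by blast
  have incW: "incseq W" unfolding incseq_def W_def using F(2) unfolding incseq_def by blast
  have "(\<lambda>n. measure lebesgue (W n)) \<longlonglongrightarrow> measure lebesgue (\<Union>n. W n)"
  proof (rule Lim_measure_incseq[OF _ incW])
    show "range W \<subseteq> sets lebesgue" using Wl by (auto intro: fmeasurableD)
    have "(\<Union>n. W n) \<in> lmeasurable" using Wo D by (intro lmeasurable_open) (auto intro: bounded_subset[of D])
    from fmeasurableD2[OF this] show "emeasure lebesgue (\<Union>n. W n) \<noteq> \<infinity>" unfolding infinity_ennreal_def .
  qed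
  moreover have "measure lebesgue (\<Union>n. W n) = \<mu>"
  proof -
    have "negligible ((D - S) \<union> (S - (\<Union>i\<in>C. ?b i)))" using S(2) C(4) by (rule negligible_Un)
    then have "negligible (D - (\<Union>n. W n))" unfolding UW by (rule negligible_subset) blast
    moreover have "(\<Union>n. W n) \<subseteq> D" using Wo(2) by blast
    ultimately have "negligible (((\<Union>n. W n) - D) \<union> (D - (\<Union>n. W n)))" by (simp add: Diff_eq_empty_iff[THEN iffD2])
    then show ?thesis unfolding \<mu>_def by (intro measure_negligible_symdiff) (use DL in \<open>auto simp: Un_commute\<close>)
  qed
  ultimately have "\<forall>\<^sub>F n in sequentially. \<mu> - \<delta> < measure lebesgue (W n)"
    using del(1) by (intro order_tendstoD(1)[of _ \<mu>]) auto
  then obtain n where n: "\<mu> - \<delta> < measure lebesgue (W n)" by (auto simp: eventually_sequentially)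
  have Fn: "finite (F n)" by (rule F(1))
  have small: "measure lebesgue (D - W n) < \<delta>"
    using n Wl[of n] Wo(2)[of n] DL measurable_measure_Diff[OF DL, of "W n"] unfolding \<mu>_def by (auto dest: fmeasurableD)
  have vol: "(\<Sum>i\<in>F n. snd i ^ CARD('n)) \<le> \<mu> / \<omega>"
  proof -
    have dis: "disjoint_family_on ?b (F n)"
      using C(3) FC[of n] unfolding disjoint_family_on_def pairwise_def disjnt_def by blast
    have "\<omega> * (\<Sum>i\<in>F n. snd i ^ CARD('n)) = (\<Sum>i\<in>F n. measure lborel (?b i))"
      unfolding sum_distrib_left
    proof (rule sum.cong)
      fix i assume "i \<in> F n"
      then have "0 < snd i" using CI(1) FC by blast
      then show "\<omega> * snd i ^ CARD('n) = measure lborel (?b i)"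
        using content_ball_conv_unit_ball[of "snd i" "fst i"] by (simp add: \<omega>_def)
    qed simp
    also have "\<dots> = measure lebesgue (W n)"
    proof -
      have "measure lebesgue (W n) = (\<Sum>i\<in>F n. measure lebesgue (?b i))"
        unfolding W_def by (rule measure_finite_Union[OF Fn _ dis]) (auto simp: emeasure_lborel_ball)
      then show ?thesis by simp
    qed
    also have "\<dots> \<le> \<mu>" unfolding \<mu>_def using Wl Wo(2) DL by (intro measure_mono_fmeasurable) (auto dest: fmeasurableD)
    finally show ?thesis using om by (simp add: pos_le_divide_eq mult.commute)
  qed
  \<comment> \<open>Finiteness of the subfamily allows a common index for all its balls.\<close>
  have "\<forall>\<^sub>F k in sequentially. \<forall>i\<in>F n. (\<integral>y. indicator (?b i) y * m k y \<partial>lebesgue_on D) < \<eta> * snd i ^ CARD('n)"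
    using CI(3) FC[of n] unfolding good_def by (intro eventually_ball_finite Fn) blast
  then obtain N where N: "\<And>k i. k \<ge> N \<Longrightarrow> i \<in> F n \<Longrightarrow> (\<integral>y. indicator (?b i) y * m k y \<partial>lebesgue_on D) < \<eta> * snd i ^ CARD('n)"
    unfolding eventually_sequentially by blast
  show "\<exists>N. \<forall>k\<ge>N. norm ((\<integral>x. m k x \<partial>lebesgue_on D) - 0) < e"
  proof (intro exI allI impI)
    fix k assume k: "k \<ge> N"
    have ib: "integrable (lebesgue_on D) (\<lambda>x. indicator B x * m k x)" if "B \<in> sets (lebesgue_on D)" for B
      using integrable_mult_indicator[OF that mi[of k]] by simp
    have sb: "?b i \<in> sets (lebesgue_on D)" if "i \<in> F n" for i
    proof -
      have "i \<in> C" using FC[of n] that by blast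
      then show ?thesis by (intro open_in_lebesgue_on[OF D(2) open_ball] CI(2))
    qed
    have DW: "D - W n \<in> sets (lebesgue_on D)" using Wl[of n] DL by (auto simp: sets_restrict_space_iff dest: fmeasurableD)
    have DWl: "D - W n \<in> lmeasurable" using Wl[of n] DL by (intro fmeasurable.Diff) (auto dest: fmeasurableD)
    have DWD [simp]: "(D - W n) \<inter> D = D - W n" by blast
    have iDW: "integrable (lebesgue_on D) (\<lambda>x. b * indicator (D - W n) x)"
      using DW DWl DL by (intro integrable_mult_right) (auto simp: integrable_indicator_iff emeasure_restrict_space fmeasurable_def)
    have "(\<integral>x. m k x \<partial>lebesgue_on D) \<le> (\<integral>x. (\<Sum>i\<in>F n. indicator (?b i) x * m k x) + b * indicator (D - W n) x \<partial>lebesgue_on D)"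
    proof (rule integral_mono_AE[OF mi])
      show "integrable (lebesgue_on D) (\<lambda>x. (\<Sum>i\<in>F n. indicator (?b i) x * m k x) + b * indicator (D - W n) x)"
        by (intro Bochner_Integration.integrable_add Bochner_Integration.integrable_sum ib sb iDW)
      have "AE x in lebesgue_on D. x \<in> D" using DL by (intro AE_I2) auto
      with mb[of k] show "AE x in lebesgue_on D. m k x \<le> (\<Sum>i\<in>F n. indicator (?b i) x * m k x) + b * indicator (D - W n) x"
      proof eventually_elim
        case (elim x)
        show ?case
        proof (cases "x \<in> W n")
          case True
          then obtain i where i: "i \<in> F n" "x \<in> ?b i" by (auto simp: W_def)
          have "indicator (?b i) x * m k x \<le> (\<Sum>i\<in>F n. indicator (?b i) x * m k x)"
            using m0[of k x] by (intro member_le_sum[OF i(1) _ Fn]) auto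
          then show ?thesis using i True by simp
        next
          case False
          have "0 \<le> (\<Sum>i\<in>F n. indicator (?b i) x * m k x)" using m0[of k x] by (intro sum_nonneg) auto
          then show ?thesis using False elim by simp
        qed
      qed
    qed
    also have "\<dots> = (\<Sum>i\<in>F n. \<integral>x. indicator (?b i) x * m k x \<partial>lebesgue_on D) + b * (\<integral>x. indicator (D - W n) x \<partial>lebesgue_on D)"
      using ib sb iDW by (subst Bochner_Integration.integral_add) (auto simp: Bochner_Integration.integral_sum intro!: Bochner_Integration.integrable_sum)
    also have "(\<integral>x. indicator (D - W n) x \<partial>lebesgue_on D) = measure lebesgue (D - W n)"
      using DL by (simp add: measure_restrict_space fmeasurableD Diff_Int_distrib2 Int_absorb2 Wo(2))
    also have "(\<Sum>i\<in>F n. \<integral>x. indicator (?b i) x * m k x \<partial>lebesgue_on D) + b * measure lebesgue (D - W n) \<le> (\<Sum>i\<in>F n. \<eta> * snd i ^ CARD('n)) + b * \<delta>"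
      using N[OF k] small b by (intro add_mono sum_mono mult_left_mono) (auto intro: less_imp_le)
    also have "\<dots> \<le> \<eta> * (\<mu> / \<omega>) + e / 2"
      unfolding sum_distrib_left[symmetric] using vol eta(1) del(2) by (intro add_mono mult_left_mono) auto
    also have "\<dots> < e" using eta(2) by argo
    finally show "norm ((\<integral>x. m k x \<partial>lebesgue_on D) - 0) < e"
      using Bochner_Integration.integral_nonneg[of "lebesgue_on D" "m k", OF m0] by simp
  qed
qed

section \<open>Dilations\<close>

lemma lebesgue_scale:
  assumes "c \<noteq> 0"
  shows "(lebesgue :: 'a::euclidean_space measure) = density (distr lebesgue lebesgue (\<lambda>x. c *\<^sub>R x)) (\<lambda>_. ennreal (\<bar>c\<bar> ^ DIM('a)))"
proof -
  have "(\<lambda>x::'a. 0 + (\<Sum>j\<in>Basis. (c * (x \<bullet> j)) *\<^sub>R j)) = (\<lambda>x. c *\<^sub>R x)"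
    by (simp add: euclidean_representation flip: scaleR_scaleR scaleR_sum_right)
  then show ?thesis using lebesgue_affine_euclidean[of "\<lambda>_. c" "0::'a"] assms by simp
qed

text \<open>Formulated for the completed measure because the matrix fields are only Lebesgue
  measurable.\<close>

lemma nn_integral_lebesgue_scale:
  fixes f :: "'a::euclidean_space \<Rightarrow> ennreal"
  assumes "c \<noteq> 0" "f \<in> borel_measurable lebesgue"
  shows "(\<integral>\<^sup>+x. f x \<partial>lebesgue) = ennreal (\<bar>c\<bar> ^ DIM('a)) * (\<integral>\<^sup>+x. f (c *\<^sub>R x) \<partial>lebesgue)"
proof -
  have "(\<integral>\<^sup>+x. f x \<partial>lebesgue) = (\<integral>\<^sup>+x. f x \<partial>density (distr lebesgue lebesgue (\<lambda>x. c *\<^sub>R x)) (\<lambda>_. ennreal (\<bar>c\<bar> ^ DIM('a))))"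
    using lebesgue_scale[OF assms(1), where 'a = 'a] by simp
  also have "\<dots> = (\<integral>\<^sup>+x. ennreal (\<bar>c\<bar> ^ DIM('a)) * f x \<partial>distr lebesgue lebesgue (\<lambda>x. c *\<^sub>R x))"
    using assms(2) by (intro nn_integral_density) auto
  also have "\<dots> = (\<integral>\<^sup>+x. ennreal (\<bar>c\<bar> ^ DIM('a)) * f (c *\<^sub>R x) \<partial>lebesgue)"
    using assms(2) by (intro nn_integral_distr) (auto intro: lebesgue_measurable_scaling)
  also have "\<dots> = ennreal (\<bar>c\<bar> ^ DIM('a)) * (\<integral>\<^sup>+x. f (c *\<^sub>R x) \<partial>lebesgue)"
    using measurable_compose[OF lebesgue_measurable_scaling assms(2), of c] by (intro nn_integral_cmult) auto
  finally show ?thesis .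
qed

lemma AE_lebesgue_scale:
  fixes P :: "'a::euclidean_space \<Rightarrow> bool"
  assumes c: "c \<noteq> 0" and ae: "AE x in lebesgue. P x"
  shows "AE x in lebesgue. P (c *\<^sub>R x)"
proof -
  obtain N where N: "N \<in> null_sets lebesgue" "{x. \<not> P x} \<subseteq> N" using ae by (auto simp: eventually_ae_filter)
  have m: "(\<lambda>x. indicator N x :: ennreal) \<in> borel_measurable lebesgue" using N(1) by auto
  have mc: "(\<lambda>x. indicator N (c *\<^sub>R x) :: ennreal) \<in> borel_measurable lebesgue"
    by (rule measurable_compose[OF lebesgue_measurable_scaling m])
  have "(\<integral>\<^sup>+x. indicator N x \<partial>lebesgue) = 0" using N(1) by (auto simp: null_sets_def)
  then have "(\<integral>\<^sup>+x. indicator N (c *\<^sub>R x) \<partial>(lebesgue :: 'a measure)) = 0"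
    using nn_integral_lebesgue_scale[OF c m] c by auto
  then have "AE x in (lebesgue :: 'a measure). (indicator N (c *\<^sub>R x) :: ennreal) = 0" using mc by (subst (asm) nn_integral_0_iff_AE) auto
  then show ?thesis by eventually_elim (use N(2) in \<open>auto simp: indicator_def split: if_splits\<close>)
qed

lemma Mab_scale:
  fixes A :: "real^'n \<Rightarrow> real^'n^'n"
  assumes A: "Mab \<alpha> \<beta> UNIV A" and c: "c \<noteq> 0" and D: "D \<in> sets lebesgue"
  shows "Mab \<alpha> \<beta> D (\<lambda>x. A (c *\<^sub>R x))"
proof -
  have "A \<in> borel_measurable lebesgue" using Mab_measurable[OF A] by (simp add: lebesgue_on_UNIV_eq)
  then have "(\<lambda>x. A (c *\<^sub>R x)) \<in> borel_measurable lebesgue" by (rule measurable_compose[OF lebesgue_measurable_scaling])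
  then have m: "(\<lambda>x. A (c *\<^sub>R x)) \<in> borel_measurable (lebesgue_on D)" by (rule measurable_restrict_space1)
  have "AE x in lebesgue. (\<forall>\<xi>. \<alpha> * (norm \<xi>)\<^sup>2 \<le> (A x *v \<xi>) \<bullet> \<xi>) \<and> onorm (\<lambda>\<xi>. A x *v \<xi>) \<le> \<beta>"
    using A unfolding Mab_def by (simp add: AE_restrict_space_iff)
  from AE_lebesgue_scale[OF c this]
  have "AE x in lebesgue_on D. (\<forall>\<xi>. \<alpha> * (norm \<xi>)\<^sup>2 \<le> (A (c *\<^sub>R x) *v \<xi>) \<bullet> \<xi>) \<and> onorm (\<lambda>\<xi>. A (c *\<^sub>R x) *v \<xi>) \<le> \<beta>"
    using D by (subst AE_restrict_space_iff) auto
  then show ?thesis using m by (simp add: Mab_def)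
qed

text \<open>If \<open>D\<close> lies in the ball of radius \<open>b\<close>, rescaling carries the
  integral into the ball of radius \<open>R = b / eps k\<close>. The Jacobian
  \<open>eps k ^ CARD('n)\<close> equals \<open>b ^ CARD('n) / R ^ CARD('n)\<close>, so a fixed
  multiple of the average over a growing ball is the bound.\<close>

lemma scaled_L1_convergence:
  fixes A B :: "real^'n \<Rightarrow> real^'n^'n"
  assumes A: "Mab \<alpha> \<beta> UNIV A" and B: "Mab \<alpha> \<beta> UNIV B" and be: "0 \<le> \<beta>" and eps: "\<And>k. 0 < eps k" "eps \<longlonglongrightarrow> 0"
    and lim: "((\<lambda>R. 1 / R ^ CARD('n) * set_lebesgue_integral lebesgue (ball 0 R)
                 (\<lambda>x. onorm (\<lambda>\<xi>. (A x - B x) *v \<xi>))) \<longlongrightarrow> 0) at_top"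
    and D: "bounded D" "open D"
  shows "(\<lambda>k. \<integral>x. onorm (\<lambda>\<xi>. (A ((1 / eps k) *\<^sub>R x) - B ((1 / eps k) *\<^sub>R x)) *v \<xi>) \<partial>lebesgue_on D) \<longlonglongrightarrow> 0"
proof -
  let ?m = "\<lambda>x. onorm (\<lambda>\<xi>. (A x - B x) *v \<xi>)"
  let ?J = "\<lambda>R. set_lebesgue_integral lebesgue (ball 0 R) ?m"
  have mm: "?m \<in> borel_measurable lebesgue"
    using onorm_diff_measurable[OF Mab_measurable[OF A] Mab_measurable[OF B]] by (simp add: lebesgue_on_UNIV_eq)
  have mle: "AE x in lebesgue. ?m x \<le> 2 * \<beta>" using Mab_diff_bounds[OF A B] by (simp add: AE_restrict_space_iff)
  obtain b where b: "b > 0" "\<And>x. x \<in> D \<Longrightarrow> norm x < b"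
  proof -
    obtain b0 where "b0 > 0" "\<And>x. x \<in> D \<Longrightarrow> norm x \<le> b0" using D(1) by (auto simp: bounded_pos)
    then show ?thesis using that[of "b0 + 1"] by force
  qed
  have intb: "integrable lebesgue (\<lambda>x. indicator (ball 0 R) x *\<^sub>R ?m x)" for R :: real
  proof (rule Bochner_Integration.integrable_bound)
    show "integrable lebesgue (\<lambda>x::real^'n. (2 * \<beta>) * indicator (ball 0 R) x)"
      using emeasure_lborel_ball_finite[of "0::real^'n" R] by (intro integrable_mult_right) (auto simp: integrable_indicator_iff)
    show "AE x in lebesgue. norm (indicator (ball 0 R) x *\<^sub>R ?m x) \<le> norm ((2 * \<beta>) * indicator (ball (0::real^'n) R) x)"
      using mle
    proof eventually_elim
      case (elim x)
      then show ?case using onorm_matrix_nonneg[of "A x - B x"] by (simp add: indicator_def)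
    qed
    show "(\<lambda>x. indicator (ball 0 R) x *\<^sub>R ?m x) \<in> borel_measurable lebesgue"
      by (intro borel_measurable_scaleR borel_measurable_indicator mm) auto
  qed
  have est: "(\<integral>x. ?m ((1 / eps k) *\<^sub>R x) \<partial>lebesgue_on D) \<le> b ^ CARD('n) * (1 / (b / eps k) ^ CARD('n) * ?J (b / eps k))" for k
  proof -
    have c: "1 / eps k \<noteq> 0" "0 < 1 / eps k" using eps(1)[of k] by auto
    let ?B = "ball (0::real^'n) (b / eps k)"
    have DL: "D \<in> lmeasurable" by (rule lmeasurable_open[OF D])
    have Jnn: "(\<integral>\<^sup>+x. ennreal (?m x) * indicator ?B x \<partial>lebesgue) = ennreal (?J (b / eps k))"
    proof -
      have "(\<integral>\<^sup>+x. ennreal (?m x) * indicator ?B x \<partial>lebesgue) = (\<integral>\<^sup>+x. ennreal (indicator ?B x *\<^sub>R ?m x) \<partial>lebesgue)"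
        by (intro nn_integral_cong) (auto simp: indicator_def)
      also have "\<dots> = ennreal (?J (b / eps k))" unfolding set_lebesgue_integral_def
        by (rule nn_integral_eq_integral[OF intb]) (auto simp: onorm_matrix_nonneg)
      finally show ?thesis .
    qed
    have int: "integrable (lebesgue_on D) (\<lambda>x. ?m ((1 / eps k) *\<^sub>R x))"
      using Mab_diff_integrable[OF DL Mab_scale[OF A c(1)] Mab_scale[OF B c(1)]] DL by (auto dest: fmeasurableD)
    have "ennreal (\<integral>x. ?m ((1 / eps k) *\<^sub>R x) \<partial>lebesgue_on D) = (\<integral>\<^sup>+x. ennreal (?m ((1 / eps k) *\<^sub>R x)) \<partial>lebesgue_on D)"
      by (rule nn_integral_eq_integral[OF int, symmetric]) (auto simp: onorm_matrix_nonneg)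
    also have "\<dots> = (\<integral>\<^sup>+x. ennreal (?m ((1 / eps k) *\<^sub>R x)) * indicator D x \<partial>lebesgue)"
      using DL by (subst nn_integral_restrict_space) (auto dest: fmeasurableD)
    also have "\<dots> \<le> (\<integral>\<^sup>+x. ennreal (?m ((1 / eps k) *\<^sub>R x)) * indicator ?B ((1 / eps k) *\<^sub>R x) \<partial>lebesgue)"
    proof (rule nn_integral_mono)
      fix x
      have "(1 / eps k) *\<^sub>R x \<in> ?B" if "x \<in> D" using b(2)[OF that] eps(1)[of k] by (simp add: divide_strict_right_mono)
      then show "ennreal (?m ((1 / eps k) *\<^sub>R x)) * indicator D x \<le> ennreal (?m ((1 / eps k) *\<^sub>R x)) * indicator ?B ((1 / eps k) *\<^sub>R x)"
        by (auto simp: indicator_def)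
    qed
    \<comment> \<open>A factor 1, written as a Jacobian and its inverse to match
      \<open>nn_integral_lebesgue_scale\<close>.\<close>
    also have "\<dots> = ennreal (eps k ^ CARD('n)) * (ennreal (\<bar>1 / eps k\<bar> ^ CARD('n)) * (\<integral>\<^sup>+x. ennreal (?m ((1 / eps k) *\<^sub>R x)) * indicator ?B ((1 / eps k) *\<^sub>R x) \<partial>lebesgue))"
      using eps(1)[of k] by (simp add: mult.assoc[symmetric] flip: ennreal_mult power_mult_distrib)
    also have "ennreal (\<bar>1 / eps k\<bar> ^ CARD('n)) * (\<integral>\<^sup>+x. ennreal (?m ((1 / eps k) *\<^sub>R x)) * indicator ?B ((1 / eps k) *\<^sub>R x) \<partial>lebesgue) = ennreal (?J (b / eps k))"
    proof -
      have "(\<lambda>x. ennreal (?m x) * indicator ?B x) \<in> borel_measurable lebesgue"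
        by (intro borel_measurable_times_ennreal borel_measurable_indicator measurable_compose[OF mm measurable_ennreal]) auto
      from nn_integral_lebesgue_scale[OF c(1) this] show ?thesis unfolding Jnn by simp
    qed
    also have "ennreal (eps k ^ CARD('n)) * ennreal (?J (b / eps k)) = ennreal (eps k ^ CARD('n) * ?J (b / eps k))"
      using eps(1)[of k] by (simp add: ennreal_mult')
    also have "eps k ^ CARD('n) * ?J (b / eps k) = b ^ CARD('n) * (1 / (b / eps k) ^ CARD('n) * ?J (b / eps k))"
      using b(1) eps(1)[of k] by (simp add: power_divide)
    finally have "ennreal (\<integral>x. ?m ((1 / eps k) *\<^sub>R x) \<partial>lebesgue_on D) \<le> ennreal (b ^ CARD('n) * (1 / (b / eps k) ^ CARD('n) * ?J (b / eps k)))" .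
    moreover have "0 \<le> ?J (b / eps k)" unfolding set_lebesgue_integral_def
      by (intro Bochner_Integration.integral_nonneg) (auto simp: onorm_matrix_nonneg)
    ultimately show ?thesis using b(1) eps(1)[of k] by (subst (asm) ennreal_le_iff) auto
  qed
  have "filterlim (\<lambda>k. b / eps k) at_top sequentially"
  proof -
    have "\<forall>\<^sub>F k in sequentially. eps k \<in> {0<..} \<and> eps k \<noteq> 0"
      using eps(1) by (intro always_eventually allI) (metis greaterThan_iff less_irrefl)
    then have "filterlim eps (at_right 0) sequentially" using eps(2) by (simp add: filterlim_at)
    then have "filterlim (\<lambda>k. inverse (eps k)) at_top sequentially" by (rule filterlim_compose[OF filterlim_inverse_at_top_right])
    then show ?thesis using filterlim_tendsto_pos_mult_at_top[OF tendsto_const b(1)] by (simp add: divide_inverse)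
  qed
  from tendsto_mult_left[OF filterlim_compose[OF lim this], of "b ^ CARD('n)"]
  have up: "(\<lambda>k. b ^ CARD('n) * (1 / (b / eps k) ^ CARD('n) * ?J (b / eps k))) \<longlonglongrightarrow> 0"
    by (simp only: mult_zero_right)
  show ?thesis
    by (rule tendsto_sandwich[OF always_eventually[OF allI] always_eventually[OF allI[OF est]] tendsto_const up])
      (intro Bochner_Integration.integral_nonneg onorm_matrix_nonneg)
qed

section \<open>Uniqueness of constant H-limits\<close>

lemma l2norm_zero_AE:
  assumes "L2 D f" "l2norm D f = 0"
  shows "AE x in lebesgue_on D. f x = 0"
proof -
  have "(\<integral>x. (norm (f x))\<^sup>2 \<partial>lebesgue_on D) = 0" using assms(2) l2norm_sq[of D f] by simp
  then have "AE x in lebesgue_on D. (norm (f x))\<^sup>2 = 0"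
    using integral_nonneg_eq_0_iff_AE[OF L2_integrable_sq[OF assms(1)]] by simp
  then show ?thesis by eventually_elim simp
qed

lemma not_AE_False_unit_ball:
  assumes "AE x in lebesgue_on (ball (0::real^'n) 1). False"
  shows False
proof -
  have "negligible {x \<in> ball (0::real^'n) 1. \<not> False}" by (rule AE_lebesgue_on_negligible[OF _ assms]) simp
  moreover have "{x \<in> ball (0::real^'n) 1. \<not> False} = ball 0 1" by blast
  moreover have "ball (0::real^'n) 1 \<noteq> {}" by (simp only: ball_eq_empty)
  ultimately show False using open_not_negligible[OF open_ball, of "0::real^'n" 1] by simp
qed

section \<open>The explicit solution on the unit ball\<close>

lemma C1_inner: "C1 (\<lambda>x. a \<bullet> x) (\<lambda>x. a)"
  unfolding C1_def by (auto intro!: derivative_eq_intros)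

text \<open>The divergence of the linear field is the trace. Componentwise, the derivative of
  \<open>v x * (M $ i \<bullet> x)\<close> in direction \<open>i\<close> has integral zero.\<close>

lemma linear_field_by_parts:
  fixes D :: "(real^'n) set" and M :: "real^'n^'n"
  assumes D: "bounded D" "open D" and t: "test_fun D v dv"
  shows "(\<integral>x. (M *v x) \<bullet> dv x \<partial>lebesgue_on D) = - trace M * (\<integral>x. v x \<partial>lebesgue_on D)"
proof -
  note C = test_fun_C1[OF t]
  obtain K where K: "compact K" "K \<subseteq> D" "\<And>x. x \<notin> K \<Longrightarrow> v x = 0" "\<And>x. x \<notin> K \<Longrightarrow> dv x = 0"
    by (rule test_fun_support[OF t]) blast
  have comp: "(\<integral>x. (M $ i \<bullet> x) * (dv x $ i) + M $ i $ i * v x \<partial>lebesgue_on D) = 0" for i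
  proof -
    have c: "C1 (\<lambda>x. v x * (M $ i \<bullet> x)) (\<lambda>x. (M $ i \<bullet> x) *\<^sub>R dv x + v x *\<^sub>R M $ i)"
      by (rule C1_mult[OF C C1_inner])
    have "(\<integral>x. ((M $ i \<bullet> x) *\<^sub>R dv x + v x *\<^sub>R M $ i) \<bullet> axis i 1 \<partial>lborel) = 0"
      by (rule C1_integral_gradient_zero[OF c K(1)]) (simp_all add: K(3,4))
    then have "(\<integral>x. (M $ i \<bullet> x) * (dv x $ i) + M $ i $ i * v x \<partial>lborel) = 0"
      by (simp add: inner_add_left inner_axis mult.commute)
    moreover have "(\<integral>x. (M $ i \<bullet> x) * (dv x $ i) + M $ i $ i * v x \<partial>lebesgue_on D) = (\<integral>x. (M $ i \<bullet> x) * (dv x $ i) + M $ i $ i * v x \<partial>lborel)"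
    proof (rule lebesgue_on_zero_outside(2))
      have "continuous_on UNIV (\<lambda>x. (M $ i \<bullet> x) * (dv x $ i) + M $ i $ i * v x)"
        using C1_continuous[OF C] C1_continuous_grad[OF C] by (intro continuous_intros)
      then show "(\<lambda>x. (M $ i \<bullet> x) * (dv x $ i) + M $ i $ i * v x) \<in> borel_measurable borel"
        by (rule borel_measurable_continuous_onI)
      show "(M $ i \<bullet> x) * (dv x $ i) + M $ i $ i * v x = 0" if "x \<notin> D" for x
        using test_fun_outside[OF t that] by simp
    qed (use D in simp)
    ultimately show ?thesis by simp
  qed
  have vL: "L2 D v" "L2 D dv" by (rule test_fun_L2[OF D t])+
  have int: "integrable (lebesgue_on D) v"
    using L1_le_l2norm(1)[OF lmeasurable_open[OF D] vL(1)] L2_measurable[OF vL(1)] by (rule integrable_norm_cancel)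
  have int2: "integrable (lebesgue_on D) (\<lambda>x. (M $ i \<bullet> x) * (dv x $ i))" for i
  proof -
    have "L2 D (\<lambda>x. M $ i \<bullet> x)" by (rule C1_L2(1)[OF D C1_inner])
    moreover have "L2 D (\<lambda>x. dv x $ i)"
    proof (rule L2_bound(1)[OF vL(2), of _ 1])
      show "(\<lambda>x. dv x $ i) \<in> borel_measurable (lebesgue_on D)"
        using C1_continuous_grad[OF C] by (intro borel_imp_lebesgue_on borel_measurable_continuous_onI continuous_intros)
      show "AE x in lebesgue_on D. norm (dv x $ i) \<le> 1 * norm (dv x)" using component_le_norm_cart[of "dv _" i] by simp
    qed simp
    ultimately show ?thesis using L2_inner_integrable[of D "\<lambda>x. M $ i \<bullet> x" "\<lambda>x. dv x $ i"] by simp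
  qed
  have "(\<integral>x. (M *v x) \<bullet> dv x \<partial>lebesgue_on D) = (\<integral>x. (\<Sum>i\<in>UNIV. (M $ i \<bullet> x) * (dv x $ i)) \<partial>lebesgue_on D)"
    by (simp add: inner_vec_def matrix_vector_mul_component)
  also have "\<dots> = (\<Sum>i\<in>UNIV. \<integral>x. (M $ i \<bullet> x) * (dv x $ i) \<partial>lebesgue_on D)" by (rule Bochner_Integration.integral_sum[OF int2])
  also have "\<dots> = (\<Sum>i\<in>UNIV. - (M $ i $ i) * (\<integral>x. v x \<partial>lebesgue_on D))"
  proof (rule sum.cong)
    fix i
    show "(\<integral>x. (M $ i \<bullet> x) * (dv x $ i) \<partial>lebesgue_on D) = - (M $ i $ i) * (\<integral>x. v x \<partial>lebesgue_on D)"
      using comp[of i] int int2[of i] by simp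
  qed simp
  also have "\<dots> = - trace M * (\<integral>x. v x \<partial>lebesgue_on D)" by (simp add: trace_def sum_distrib_right sum_negf)
  finally show ?thesis .
qed

text \<open>The approximations are \<open>q(1 - \<delta> - |x|\<^sup>2)\<close>, where \<open>q\<close> vanishes on the negative axis, is quadratic on
  \<open>[0, \<delta>]\<close> and equals \<open>t - \<delta>/2\<close> beyond.\<close>
lemma H10_paraboloid:
  "H10 (ball (0::real^'n) 1) (\<lambda>x. 1 - (norm x)\<^sup>2) (\<lambda>x. - 2 *\<^sub>R x)"
proof -
  let ?D = "ball (0::real^'n) 1"
  have D: "bounded ?D" "open ?D" by auto
  have C: "C1 (\<lambda>x::real^'n. a - (norm x)\<^sup>2) (\<lambda>x. - 2 *\<^sub>R x)" for a
    using C1_norm_sq[of a "-1" 0] by simp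
  note L = C1_L2[OF D C[of 1]]
  define \<delta> where "\<delta> n = 1 / real (Suc n)" for n
  have dp: "0 < \<delta> n" "\<delta> n \<le> 1" for n by (auto simp: \<delta>_def)
  have d0: "\<delta> \<longlonglongrightarrow> 0" unfolding \<delta>_def by (rule LIMSEQ_Suc[OF lim_1_over_n])
  define t where "t n x = 1 - \<delta> n - (norm x)\<^sup>2" for n and x :: "real^'n"
  define \<phi> where "\<phi> n x = ((max 0 (t n x))\<^sup>2 - (max 0 (t n x - \<delta> n))\<^sup>2) / (2 * \<delta> n)" for n and x :: "real^'n"
  define s where "s n x = (max 0 (t n x) - max 0 (t n x - \<delta> n)) / \<delta> n" for n and x :: "real^'n"
  define d\<phi> where "d\<phi> n x = s n x *\<^sub>R (- 2 *\<^sub>R x)" for n and x :: "real^'n"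
  have test: "test_fun ?D (\<phi> n) (d\<phi> n)" for n
  \<comment> \<open>Outside this ball \<open>t n\<close> is negative and both positive parts vanish;
    it is compactly contained in the unit ball because \<open>\<delta> n\<close> is
    positive.\<close>
  proof (rule test_funI[of _ _ "cball 0 (sqrt (1 - \<delta> n))"])
    have "C1 (t n) (\<lambda>x. - 2 *\<^sub>R x)" "C1 (\<lambda>x. t n x - \<delta> n) (\<lambda>x. - 2 *\<^sub>R x)"
      using C[of "1 - \<delta> n"] C[of "1 - \<delta> n - \<delta> n"] by (simp_all add: t_def[abs_def] algebra_simps)
    from C1_lincomb[OF C1_max0_sq[OF this(1)] C1_max0_sq[OF this(2)], of "1 / (2 * \<delta> n)" "- 1 / (2 * \<delta> n)"]
    have "C1 (\<lambda>x. (1 / (2 * \<delta> n)) * (max 0 (t n x))\<^sup>2 + (- 1 / (2 * \<delta> n)) * (max 0 (t n x - \<delta> n))\<^sup>2)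
      (\<lambda>x. (1 / (2 * \<delta> n)) *\<^sub>R ((2 * max 0 (t n x)) *\<^sub>R (- 2 *\<^sub>R x)) + (- 1 / (2 * \<delta> n)) *\<^sub>R ((2 * max 0 (t n x - \<delta> n)) *\<^sub>R (- 2 *\<^sub>R x)))" .
    moreover have "(\<lambda>x. (1 / (2 * \<delta> n)) * (max 0 (t n x))\<^sup>2 + (- 1 / (2 * \<delta> n)) * (max 0 (t n x - \<delta> n))\<^sup>2) = \<phi> n"
      by (simp add: fun_eq_iff \<phi>_def diff_divide_distrib)
    moreover have "(\<lambda>x. (1 / (2 * \<delta> n)) *\<^sub>R ((2 * max 0 (t n x)) *\<^sub>R (- 2 *\<^sub>R x)) + (- 1 / (2 * \<delta> n)) *\<^sub>R ((2 * max 0 (t n x - \<delta> n)) *\<^sub>R (- 2 *\<^sub>R x))) = d\<phi> n"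
    proof
      fix x
      have "(1 / (2 * \<delta> n)) *\<^sub>R ((2 * max 0 (t n x)) *\<^sub>R (- 2 *\<^sub>R x)) + (- 1 / (2 * \<delta> n)) *\<^sub>R ((2 * max 0 (t n x - \<delta> n)) *\<^sub>R (- 2 *\<^sub>R x))
        = (max 0 (t n x) / \<delta> n + - (max 0 (t n x - \<delta> n) / \<delta> n)) *\<^sub>R (- 2 *\<^sub>R x)"
        unfolding scaleR_add_left by (simp add: mult.commute)
      then show "(1 / (2 * \<delta> n)) *\<^sub>R ((2 * max 0 (t n x)) *\<^sub>R (- 2 *\<^sub>R x)) + (- 1 / (2 * \<delta> n)) *\<^sub>R ((2 * max 0 (t n x - \<delta> n)) *\<^sub>R (- 2 *\<^sub>R x)) = d\<phi> n x"
        by (simp add: d\<phi>_def s_def diff_divide_distrib)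
    qed
    ultimately show "C1 (\<phi> n) (d\<phi> n)" by simp
    have "sqrt (1 - \<delta> n) < 1" using dp by simp
    then show "cball 0 (sqrt (1 - \<delta> n)) \<subseteq> ?D" by (intro cball_subset_ball_iff[THEN iffD2] disjI1) simp
    fix x :: "real^'n" assume "x \<notin> cball 0 (sqrt (1 - \<delta> n))"
    then have "sqrt (1 - \<delta> n) < norm x" by simp
    then have "(sqrt (1 - \<delta> n))\<^sup>2 < (norm x)\<^sup>2" using dp by (intro power_strict_mono) auto
    then have "t n x < 0" using dp by (simp add: t_def)
    then show "\<phi> n x = 0" "d\<phi> n x = 0" using dp(1)[of n] by (simp_all add: \<phi>_def d\<phi>_def s_def)
  qed auto
  \<comment> \<open>At a fixed point the approximation is eventually in its linear regime. The error
    is then constant in the point: \<open>\<delta> n\<close> from the shift and half of that from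
    the rounding.\<close>
  have conv: "\<exists>N. \<forall>n\<ge>N. \<phi> n x - (1 - (norm x)\<^sup>2) = - (3/2) * \<delta> n \<and> d\<phi> n x = - 2 *\<^sub>R x" if x: "x \<in> ?D" for x
  proof -
    have "norm x < 1" using x by simp
    then have "(norm x)\<^sup>2 < 1" by (simp add: power_less_one_iff)
    then have "\<forall>\<^sub>F n in sequentially. \<delta> n < (1 - (norm x)\<^sup>2) / 2" by (intro order_tendstoD(2)[OF d0]) simp
    then obtain N where N: "\<And>n. n \<ge> N \<Longrightarrow> \<delta> n < (1 - (norm x)\<^sup>2) / 2" by (auto simp: eventually_sequentially)
    have "\<phi> n x - (1 - (norm x)\<^sup>2) = - (3/2) * \<delta> n \<and> d\<phi> n x = - 2 *\<^sub>R x" if "n \<ge> N" for n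
    proof -
      have "t n x - \<delta> n > 0" using N[OF that] by (simp add: t_def)
      then have m: "max 0 (t n x) = t n x" "max 0 (t n x - \<delta> n) = t n x - \<delta> n" using dp(1)[of n] by auto
      have "\<phi> n x = t n x - \<delta> n / 2" using dp(1)[of n] unfolding \<phi>_def m by (simp add: power2_eq_square field_simps)
      moreover have "s n x = 1" using dp(1)[of n] unfolding s_def m by simp
      ultimately show ?thesis by (simp add: d\<phi>_def t_def)
    qed
    then show ?thesis by blast
  qed
  have tn: "t n x \<le> 1" for n x using dp(1)[of n] zero_le_power2[of "norm x"] unfolding t_def by linarith
  have s01: "0 \<le> s n x \<and> s n x \<le> 1" for n x
    using dp(1)[of n] by (auto simp: s_def divide_le_eq max_def)
  have phib: "\<bar>\<phi> n x\<bar> \<le> 1" for n x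
  proof -
    have "\<phi> n x = s n x * ((max 0 (t n x) + max 0 (t n x - \<delta> n)) / 2)"
      using dp(1)[of n] by (simp add: \<phi>_def s_def power2_eq_square field_simps)
    moreover have "0 \<le> (max 0 (t n x) + max 0 (t n x - \<delta> n)) / 2" "(max 0 (t n x) + max 0 (t n x - \<delta> n)) / 2 \<le> 1"
      using tn[of n x] dp(1)[of n] by auto
    ultimately have "0 \<le> \<phi> n x" "\<phi> n x \<le> 1 * 1" using s01[of n x] by (metis mult_nonneg_nonneg, metis mult_mono zero_le_one)
    then show ?thesis by simp
  qed
  have cint: "integrable (lebesgue_on ?D) (\<lambda>x. c::real)" for c
    using lmeasurable_open[OF D] by (intro finite_measure.integrable_const finite_measure_lebesgue_on)
  note bm = C1_borel[OF test_fun_C1[OF test]] C1_borel[OF C[of 1]]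
  have "(\<lambda>n. \<integral>x. (\<phi> n x - (1 - (norm x)\<^sup>2))\<^sup>2 \<partial>lebesgue_on ?D) \<longlonglongrightarrow> (\<integral>x. 0 \<partial>lebesgue_on ?D)"
  proof (rule integral_dominated_convergence[OF _ _ cint[of 4]])
    show "(\<lambda>x. (\<phi> n x - (1 - (norm x)\<^sup>2))\<^sup>2) \<in> borel_measurable (lebesgue_on ?D)" for n
      by (intro borel_measurable_power borel_measurable_diff borel_imp_lebesgue_on bm)
    show "AE x in lebesgue_on ?D. (\<lambda>n. (\<phi> n x - (1 - (norm x)\<^sup>2))\<^sup>2) \<longlonglongrightarrow> 0"
    proof (rule AE_I2)
      fix x assume "x \<in> space (lebesgue_on ?D)"
      then obtain N where N: "\<And>n. n \<ge> N \<Longrightarrow> \<phi> n x - (1 - (norm x)\<^sup>2) = - (3/2) * \<delta> n" using conv[of x] by auto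
      have "(\<lambda>n. (- (3/2) * \<delta> n)\<^sup>2) \<longlonglongrightarrow> 0" using tendsto_power[OF tendsto_mult_left[OF d0, of "- (3/2)"], of 2] by simp
      then show "(\<lambda>n. (\<phi> n x - (1 - (norm x)\<^sup>2))\<^sup>2) \<longlonglongrightarrow> 0"
        by (rule Lim_transform_eventually) (use N in \<open>auto simp: eventually_sequentially intro!: exI[of _ N]\<close>)
    qed
    show "AE x in lebesgue_on ?D. norm ((\<phi> n x - (1 - (norm x)\<^sup>2))\<^sup>2) \<le> 4" for n
    proof (rule AE_I2)
      fix x assume "x \<in> space (lebesgue_on ?D)"
      then have "(norm x)\<^sup>2 \<le> 1" by (intro power_le_one) auto
      then have "\<bar>\<phi> n x - (1 - (norm x)\<^sup>2)\<bar> \<le> 2" using phib[of n x] zero_le_power2[of "norm x"] by linarith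
      then have "\<bar>\<phi> n x - (1 - (norm x)\<^sup>2)\<bar>\<^sup>2 \<le> 2\<^sup>2" by (intro power_mono) auto
      then show "norm ((\<phi> n x - (1 - (norm x)\<^sup>2))\<^sup>2) \<le> 4" by simp
    qed
  qed simp
  moreover have "(\<lambda>n. \<integral>x. (norm (d\<phi> n x - - 2 *\<^sub>R x))\<^sup>2 \<partial>lebesgue_on ?D) \<longlonglongrightarrow> (\<integral>x. 0 \<partial>lebesgue_on ?D)"
  proof (rule integral_dominated_convergence[OF _ _ cint[of 4]])
    show "(\<lambda>x. (norm (d\<phi> n x - - 2 *\<^sub>R x))\<^sup>2) \<in> borel_measurable (lebesgue_on ?D)" for n
      by (intro borel_imp_lebesgue_on borel_measurable_power measurable_compose[OF _ borel_measurable_norm] borel_measurable_diff bm)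
    show "AE x in lebesgue_on ?D. (\<lambda>n. (norm (d\<phi> n x - - 2 *\<^sub>R x))\<^sup>2) \<longlonglongrightarrow> 0"
    proof (rule AE_I2)
      fix x assume "x \<in> space (lebesgue_on ?D)"
      then obtain N where N: "\<And>n. n \<ge> N \<Longrightarrow> d\<phi> n x = - 2 *\<^sub>R x" using conv[of x] by auto
      show "(\<lambda>n. (norm (d\<phi> n x - - 2 *\<^sub>R x))\<^sup>2) \<longlonglongrightarrow> 0"
        by (rule tendsto_eventually) (use N in \<open>auto simp: eventually_sequentially intro!: exI[of _ N]\<close>)
    qed
    show "AE x in lebesgue_on ?D. norm ((norm (d\<phi> n x - - 2 *\<^sub>R x))\<^sup>2) \<le> 4" for n
    proof (rule AE_I2)
      fix x assume "x \<in> space (lebesgue_on ?D)"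
      then have x: "norm x \<le> 1" by simp
      have "d\<phi> n x - - 2 *\<^sub>R x = (2 * (1 - s n x)) *\<^sub>R x" by (simp add: d\<phi>_def algebra_simps flip: scaleR_add_left)
      then have "norm (d\<phi> n x - - 2 *\<^sub>R x) = (2 * (1 - s n x)) * norm x" using s01[of n x] by simp
      also have "\<dots> \<le> 2 * 1" using s01[of n x] x by (intro mult_mono) auto
      finally have "(norm (d\<phi> n x - - 2 *\<^sub>R x))\<^sup>2 \<le> 2\<^sup>2" by (intro power_mono) auto
      then show "norm ((norm (d\<phi> n x - - 2 *\<^sub>R x))\<^sup>2) \<le> 4" by simp
    qed
  qed simp
  ultimately have "\<forall>n. test_fun ?D (\<phi> n) (d\<phi> n)" "(\<lambda>n. \<integral>x. (\<phi> n x - (1 - (norm x)\<^sup>2))\<^sup>2 \<partial>lebesgue_on ?D) \<longlonglongrightarrow> 0"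
      "(\<lambda>n. \<integral>x. (norm (d\<phi> n x - - 2 *\<^sub>R x))\<^sup>2 \<partial>lebesgue_on ?D) \<longlonglongrightarrow> 0" using test by simp_all
  then show ?thesis using L unfolding H10_def by blast
qed

lemma Hminus1_integral:
  assumes D: "bounded D" "open D"
  shows "Hminus1 D (\<lambda>v. \<integral>x. v x \<partial>lebesgue_on D)"
proof -
  have e: "(\<integral>x. v x \<partial>lebesgue_on D) = l2inner D (\<lambda>x. 1) v" for v :: "real^'a \<Rightarrow> real" by (simp add: l2inner_def)
  note one = L2_const[OF D, of 1]
  have lin: "l2inner D (\<lambda>x. 1) (\<lambda>x. a * u x + b * v x) = a * l2inner D (\<lambda>x. 1) u + b * l2inner D (\<lambda>x. 1) v"
    if "H10 D u g" "H10 D v h" for u g v h a b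
    using l2inner_lincomb_right[OF H10_L2(1)[OF that(1)] H10_L2(1)[OF that(2)] one, of a b] by simp
  have bd: "\<bar>l2inner D (\<lambda>x. 1) u\<bar> \<le> l2norm D (\<lambda>x. 1::real) * sqrt (l2inner D u u + l2inner D g g)" if "H10 D u g" for u g
  proof -
    have "\<bar>l2inner D (\<lambda>x. 1) u\<bar> \<le> l2norm D (\<lambda>x. 1::real) * l2norm D u" by (rule l2_cauchy_schwarz[OF one H10_L2(1)[OF that]])
    also have "l2norm D u \<le> sqrt (l2inner D u u + l2inner D g g)" unfolding l2norm_def by (simp add: l2inner_self)
    finally show ?thesis by (simp add: mult_left_mono)
  qed
  show ?thesis unfolding Hminus1_def e using lin bd by blast
qed

text \<open>The flux \<open>- 2 * c\<close> times \<open>M *v x\<close> has divergence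
  \<open>- 2 * c * trace M\<close>, and the choice of \<open>c\<close> makes this -1.\<close>

lemma paraboloid_wsol:
  fixes M :: "real^'n^'n"
  assumes tr: "trace M \<noteq> 0" and c: "c = 1 / (2 * trace M)"
  shows "wsol (ball 0 1) (\<lambda>x. M) (\<lambda>v. \<integral>x. v x \<partial>lebesgue_on (ball 0 1)) (\<lambda>x. c * (1 - (norm x)\<^sup>2)) (\<lambda>x. c *\<^sub>R (- 2 *\<^sub>R x))"
proof -
  let ?D = "ball (0::real^'n) 1"
  have D: "bounded ?D" "open ?D" by auto
  have H: "H10 ?D (\<lambda>x. c * (1 - (norm x)\<^sup>2)) (\<lambda>x. c *\<^sub>R (- 2 *\<^sub>R x))"
    using H10_lincomb[OF D H10_paraboloid H10_paraboloid, of c 0] by simp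
  have flux: "M *v (c *\<^sub>R (- 2 *\<^sub>R x)) = (- 2 * c) *\<^sub>R (M *v x)" for x
    using matrix_vector_mult_scaleR[of M "- 2 * c" x] by (simp add: mult.commute)
  have FL: "L2 ?D (\<lambda>x. M *v (c *\<^sub>R (- 2 *\<^sub>R x)))"
  proof (rule L2_bound(1)[OF H10_L2(2)[OF H]])
    show "(\<lambda>x. M *v (c *\<^sub>R (- 2 *\<^sub>R x))) \<in> borel_measurable (lebesgue_on ?D)"
      by (rule measurable_matrix_vector_mult[OF borel_measurable_const L2_measurable[OF H10_L2(2)[OF H]]])
    show "AE x in lebesgue_on ?D. norm (M *v (c *\<^sub>R (- 2 *\<^sub>R x))) \<le> onorm (\<lambda>\<xi>. M *v \<xi>) * norm (c *\<^sub>R (- 2 *\<^sub>R x))"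
      by (intro AE_I2 norm_matrix_vector_le)
  qed (rule onorm_matrix_nonneg)
  have test: "l2inner ?D (\<lambda>x. M *v (c *\<^sub>R (- 2 *\<^sub>R x))) dv = (\<integral>x. v x \<partial>lebesgue_on ?D)" if t: "test_fun ?D v dv" for v dv
  proof -
    have "l2inner ?D (\<lambda>x. M *v (c *\<^sub>R (- 2 *\<^sub>R x))) dv = (\<integral>x. (- 2 * c) * ((M *v x) \<bullet> dv x) \<partial>lebesgue_on ?D)"
      unfolding l2inner_def flux by simp
    also have "\<dots> = (- 2 * c) * (\<integral>x. (M *v x) \<bullet> dv x \<partial>lebesgue_on ?D)" by (rule integral_mult_right_zero)
    also have "\<dots> = (\<integral>x. v x \<partial>lebesgue_on ?D)" unfolding linear_field_by_parts[OF D t] using tr by (simp add: c)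
    finally show ?thesis .
  qed
  have "l2inner ?D (\<lambda>x. M *v (c *\<^sub>R (- 2 *\<^sub>R x))) h = (\<integral>x. v x \<partial>lebesgue_on ?D)" if vh: "H10 ?D v h" for v h
  proof -
    note one = L2_const[OF D, of 1]
    let ?F = "\<lambda>x. M *v (c *\<^sub>R (- 2 *\<^sub>R x))"
    \<comment> \<open>Both sides are continuous in \<open>v\<close> and \<open>h\<close>, so the
      identity passes from test functions to \<open>H10\<close>; \<open>q\<close> dominates the
      norms of the two functionals.\<close>
    have e: "\<bar>l2inner ?D ?F h - l2inner ?D (\<lambda>x. 1) v\<bar> \<le> 0 + \<epsilon>" if \<epsilon>: "\<epsilon> > 0" for \<epsilon>
    proof -
      define q where "q = l2norm ?D ?F + l2norm ?D (\<lambda>x. 1::real) + 1"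
      have q: "q > 0" by (simp add: q_def add_nonneg_pos)
      have qe: "\<epsilon> / q > 0" using \<epsilon> q by simp
      obtain \<phi> d\<phi> where p: "test_fun ?D \<phi> d\<phi>" "l2norm ?D (\<lambda>x. \<phi> x - v x) < \<epsilon> / q" "l2norm ?D (\<lambda>x. d\<phi> x - h x) < \<epsilon> / q"
        by (rule H10_approx[OF vh qe])
      note pL = test_fun_L2[OF D p(1)] and vL = H10_L2[OF vh]
      have t0: "l2inner ?D ?F d\<phi> = l2inner ?D (\<lambda>x. 1) \<phi>" using test[OF p(1)] by (simp add: l2inner_def)
      have "\<bar>l2inner ?D ?F h - l2inner ?D (\<lambda>x. 1) v\<bar> = \<bar>l2inner ?D (\<lambda>x. 1) (\<lambda>x. \<phi> x - v x) - l2inner ?D ?F (\<lambda>x. d\<phi> x - h x)\<bar>"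
        using l2inner_diff_right[OF pL(1) vL(1) one] l2inner_diff_right[OF pL(2) vL(2) FL] t0 by linarith
      also have "\<dots> \<le> l2norm ?D (\<lambda>x. 1::real) * l2norm ?D (\<lambda>x. \<phi> x - v x) + l2norm ?D ?F * l2norm ?D (\<lambda>x. d\<phi> x - h x)"
        using l2_cauchy_schwarz[OF one L2_diff[OF pL(1) vL(1)]] l2_cauchy_schwarz[OF FL L2_diff[OF pL(2) vL(2)]] by linarith
      also have "\<dots> \<le> l2norm ?D (\<lambda>x. 1::real) * (\<epsilon> / q) + l2norm ?D ?F * (\<epsilon> / q)"
        using p by (intro add_mono mult_left_mono) auto
      also have "\<dots> \<le> q * (\<epsilon> / q)" using qe by (simp add: q_def distrib_right[symmetric] mult_right_mono del: times_divide_eq_right)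
      also have "\<dots> = \<epsilon>" using q by simp
      finally show ?thesis by simp
    qed
    have "\<bar>l2inner ?D ?F h - l2inner ?D (\<lambda>x. 1) v\<bar> \<le> 0" by (rule field_le_epsilon[OF e])
    then show ?thesis by (simp add: l2inner_def)
  qed
  then show ?thesis using H unfolding wsol_def by blast
qed

text \<open>For a constant field an almost everywhere statement on a nonempty open set is a plain
  statement.\<close>

lemma Mab_const_coercive:
  fixes M :: "real^'n^'n"
  assumes "Mab \<alpha> \<beta> (ball 0 1) (\<lambda>x. M)"
  shows "\<alpha> * (norm \<xi>)\<^sup>2 \<le> (M *v \<xi>) \<bullet> \<xi>"
proof (rule ccontr)
  assume "\<not> ?thesis"
  then have "AE x in lebesgue_on (ball (0::real^'n) 1). False" using Mab_bounds[OF assms] by auto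
  then show False by (rule not_AE_False_unit_ball)
qed

lemma Mab_const_trace_pos:
  fixes M :: "real^'n^'n"
  assumes "Mab \<alpha> \<beta> (ball 0 1) (\<lambda>x. M)" "0 < \<alpha>"
  shows "0 < trace M"
proof -
  have "\<alpha> \<le> M $ i $ i" for i
    using Mab_const_coercive[OF assms(1), of "axis i 1"] by (simp add: norm_axis_1 matrix_vector_mul_component inner_axis)
  then have "0 < M $ i $ i" for i using assms(2) less_le_trans by blast
  then show ?thesis unfolding trace_def by (intro sum_pos) auto
qed

text \<open>On the unit ball, with right-hand side 1, the solution for a constant matrix \<open>M\<close> is
  \<open>(1 - |x|\<^sup>2) / (2 tr M)\<close>: the limit solution determines \<open>tr M\<close>, and then the limit flux determines \<open>M\<close>.\<close>
lemma Hconv_const_unique: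
  fixes M N :: "real^'n^'n"
  assumes al: "0 < \<alpha>" and be: "0 \<le> \<beta>" and A: "\<And>k. Mab \<alpha> \<beta> (ball 0 1) (Ak k)"
    and M: "Hconv \<alpha> (ball 0 1) Ak (\<lambda>x. M)" and N: "Hconv \<alpha> (ball 0 1) Ak (\<lambda>x. N)"
  shows "M = N"
proof -
  let ?D = "ball (0::real^'n) 1"
  have D: "bounded ?D" "open ?D" by auto
  let ?T = "\<lambda>v::real^'n \<Rightarrow> real. \<integral>x. v x \<partial>lebesgue_on ?D"
  have T: "Hminus1 ?D ?T" by (rule Hminus1_integral[OF D])
  have tM: "0 < trace M" and tN: "0 < trace N"
    using M N Mab_const_trace_pos[OF _ al] unfolding Hconv_def by blast+
  define cM where "cM = 1 / (2 * trace M)"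
  define cN where "cN = 1 / (2 * trace N)"
  have "\<exists>p. wsol ?D (Ak k) ?T (fst p) (snd p)" for k
  proof -
    obtain u g where "wsol ?D (Ak k) ?T u g" by (rule wsol_exists[OF D A al be T])
    then show ?thesis by (intro exI[of _ "(u, g)"]) simp
  qed
  then obtain p where p: "\<And>k. wsol ?D (Ak k) ?T (fst (p k)) (snd (p k))" by metis
  define uk gk where "uk k = fst (p k)" and "gk k = snd (p k)" for k
  have s: "\<forall>k. wsol ?D (Ak k) ?T (uk k) (gk k)" using p by (simp add: uk_def gk_def)
  let ?P = "\<lambda>x::real^'n. 1 - (norm x)\<^sup>2" and ?G = "\<lambda>x::real^'n. - 2 *\<^sub>R x"
  have sM: "wsol ?D (\<lambda>x. M) ?T (\<lambda>x. cM * ?P x) (\<lambda>x. cM *\<^sub>R ?G x)" using tM by (intro paraboloid_wsol) (auto simp: cM_def)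
  have sN: "wsol ?D (\<lambda>x. N) ?T (\<lambda>x. cN * ?P x) (\<lambda>x. cN *\<^sub>R ?G x)" using tN by (intro paraboloid_wsol) (auto simp: cN_def)
  have wM: "H10_weak ?D uk gk (\<lambda>x. cM * ?P x) (\<lambda>x. cM *\<^sub>R ?G x)" "L2_weak ?D (\<lambda>k x. Ak k x *v gk k x) (\<lambda>x. M *v (cM *\<^sub>R ?G x))"
    using M T sM s unfolding Hconv_def by blast+
  have wN: "H10_weak ?D uk gk (\<lambda>x. cN * ?P x) (\<lambda>x. cN *\<^sub>R ?G x)" "L2_weak ?D (\<lambda>k x. Ak k x *v gk k x) (\<lambda>x. N *v (cN *\<^sub>R ?G x))"
    using N T sN s unfolding Hconv_def by blast+
  note P = H10_paraboloid[where 'n = 'n] and PL = H10_L2[OF H10_paraboloid[where 'n = 'n]]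
  have scale: "l2inner ?D (\<lambda>x. a * ?P x) ?P + l2inner ?D (\<lambda>x. a *\<^sub>R ?G x) ?G = a * ((l2norm ?D ?P)\<^sup>2 + (l2norm ?D ?G)\<^sup>2)" for a
    using l2inner_lincomb_left[OF PL(1) PL(1) PL(1), of a 0] l2inner_lincomb_left[OF PL(2) PL(2) PL(2), of a 0]
    by (simp add: l2norm_sq_inner algebra_simps)
  \<comment> \<open>The two weak limits are multiples of one paraboloid. Testing with the paraboloid
    itself compares the factors, and hence the traces.\<close>
  have "cM * ((l2norm ?D ?P)\<^sup>2 + (l2norm ?D ?G)\<^sup>2) = cN * ((l2norm ?D ?P)\<^sup>2 + (l2norm ?D ?G)\<^sup>2)"
    using wM(1) wN(1) P unfolding H10_weak_def scale[symmetric] by (blast intro: LIMSEQ_unique)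
  moreover have "(l2norm ?D ?P)\<^sup>2 + (l2norm ?D ?G)\<^sup>2 \<noteq> 0"
  proof
    assume "(l2norm ?D ?P)\<^sup>2 + (l2norm ?D ?G)\<^sup>2 = 0"
    then have "l2norm ?D ?P = 0" by (simp add: sum_power2_eq_zero_iff)
    from l2norm_zero_AE[OF PL(1) this] have "AE x in lebesgue_on ?D. ?P x = 0" .
    moreover have "AE x in lebesgue_on ?D. ?P x \<noteq> 0"
    proof (rule AE_I2)
      fix x assume "x \<in> space (lebesgue_on ?D)"
      then have "norm x < 1" by simp
      then have "(norm x)\<^sup>2 < 1\<^sup>2" by (intro power_strict_mono) auto
      then show "?P x \<noteq> 0" by simp
    qed
    ultimately have "AE x in lebesgue_on ?D. False" by eventually_elim simp
    then show False by (rule not_AE_False_unit_ball)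
  qed
  ultimately have c: "cN = cM" by (metis mult_right_cancel)
  have c0: "cM \<noteq> 0" using tM by (simp add: cM_def)
  have FM: "L2 ?D (\<lambda>x. M *v (cM *\<^sub>R ?G x))" and FN: "L2 ?D (\<lambda>x. N *v (cM *\<^sub>R ?G x))"
  proof -
    have "L2 ?D (\<lambda>x. Q *v (cM *\<^sub>R ?G x))" for Q :: "real^'n^'n"
    proof (rule L2_bound(1)[OF L2_scaleR[OF PL(2)]])
      show "(\<lambda>x. Q *v (cM *\<^sub>R ?G x)) \<in> borel_measurable (lebesgue_on ?D)"
        by (rule measurable_matrix_vector_mult[OF borel_measurable_const L2_measurable[OF L2_scaleR[OF PL(2)]]])
      show "AE x in lebesgue_on ?D. norm (Q *v (cM *\<^sub>R ?G x)) \<le> onorm (\<lambda>\<xi>. Q *v \<xi>) * norm (cM *\<^sub>R ?G x)"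
        by (intro AE_I2 norm_matrix_vector_le)
    qed (rule onorm_matrix_nonneg)
    then show "L2 ?D (\<lambda>x. M *v (cM *\<^sub>R ?G x))" "L2 ?D (\<lambda>x. N *v (cM *\<^sub>R ?G x))" by blast+
  qed
  let ?d = "\<lambda>x. M *v (cM *\<^sub>R ?G x) - N *v (cM *\<^sub>R ?G x)"
  have dL: "L2 ?D ?d" by (rule L2_diff[OF FM FN])
  have "l2inner ?D (\<lambda>x. M *v (cM *\<^sub>R ?G x)) ?d = l2inner ?D (\<lambda>x. N *v (cM *\<^sub>R ?G x)) ?d"
    using wM(2) wN(2) dL unfolding L2_weak_def c by (blast intro: LIMSEQ_unique)
  then have "l2inner ?D ?d ?d = 0" using l2inner_diff_left[OF FM FN dL] by linarith
  then have "l2norm ?D ?d = 0" by (simp add: l2norm_def)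
  then have ae: "AE x in lebesgue_on ?D. ?d x = 0" by (rule l2norm_zero_AE[OF dL])
  show ?thesis
  proof (rule ccontr)
    assume "M \<noteq> N"
    then obtain i where i: "M $ i - N $ i \<noteq> 0" by (auto simp: vec_eq_iff)
    \<comment> \<open>If row \<open>i\<close> differed, that component of the flux difference would
      vanish only on a hyperplane.\<close>
    have "negligible {x. (M $ i - N $ i) \<bullet> x = 0}" by (rule negligible_hyperplane) (use i in auto)
    then have "AE x in lebesgue_on ?D. x \<notin> {x. (M $ i - N $ i) \<bullet> x = 0}" by (intro negligible_AE_lebesgue_on) auto
    with ae have "AE x in lebesgue_on ?D. False"
    proof eventually_elim
      case (elim x)
      have "?d x $ i = (cM * - 2) * ((M $ i - N $ i) \<bullet> x)"
        by (simp add: matrix_vector_mul_component inner_diff_left algebra_simps)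
      then show ?case using elim c0 by simp
    qed
    then show False by (rule not_AE_False_unit_ball)
  qed
qed

section \<open>Homogenizable fields and the two assertions\<close>

lemma homogenizes_to_perturbation:
  fixes A B :: "real^'n \<Rightarrow> real^'n^'n"
  assumes al: "0 < \<alpha>" and ab: "\<alpha> \<le> \<beta>" and A: "Mab \<alpha> \<beta> UNIV A" and B: "Mab \<alpha> \<beta> UNIV B" and eps: "\<And>k. 0 < eps k" "eps \<longlonglongrightarrow> 0"
    and lim: "((\<lambda>R. 1 / R ^ CARD('n) * set_lebesgue_integral lebesgue (ball 0 R)
                 (\<lambda>x. onorm (\<lambda>\<xi>. (A x - B x) *v \<xi>))) \<longlongrightarrow> 0) at_top"
    and h: "homogenizes_to \<alpha> eps A M"
  shows "homogenizes_to \<alpha> eps B M"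
  unfolding homogenizes_to_def
proof (intro allI impI)
  fix D :: "(real^'n) set" assume "bounded D \<and> open D"
  then have D: "bounded D" "open D" by auto
  have c: "1 / eps k \<noteq> 0" for k using eps(1)[of k] by simp
  have be: "0 \<le> \<beta>" using al ab by linarith
  show "Hconv \<alpha> D (\<lambda>k x. B ((1 / eps k) *\<^sub>R x)) (\<lambda>x. M)"
  proof (rule Hconv_L1_perturbation[OF D al ab])
    show "Mab \<alpha> \<beta> D (\<lambda>x. A ((1 / eps k) *\<^sub>R x))" "Mab \<alpha> \<beta> D (\<lambda>x. B ((1 / eps k) *\<^sub>R x))" for k
      using D by (auto intro!: Mab_scale[OF _ c] A B)
    show "Hconv \<alpha> D (\<lambda>k x. A ((1 / eps k) *\<^sub>R x)) (\<lambda>x. M)" using h D unfolding homogenizes_to_def by blast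
  qed (rule scaled_L1_convergence[OF A B be eps lim D])
qed

lemma onorm_matrix_minus_commute: "onorm (\<lambda>\<xi>. (A - B :: real^'n^'m) *v \<xi>) = onorm (\<lambda>\<xi>. (B - A) *v \<xi>)"
proof -
  have "(\<lambda>\<xi>. (A - B) *v \<xi>) = (\<lambda>\<xi>. - ((B - A) *v \<xi>))" by (simp add: matrix_vector_mult_diff_rdistrib)
  then show ?thesis by (simp add: onorm_neg)
qed

theorem theorem8p4:
  fixes \<alpha> \<beta> :: real
  assumes "0 < \<alpha>" and "\<alpha> \<le> \<beta>"
  shows "(\<forall>(D :: (real^'n) set) Ak Bk A (E :: real set).
            bounded D \<and> open D \<and> (\<forall>k. Mab \<alpha> \<beta> D (Ak k)) \<and> (\<forall>k. Mab \<alpha> \<beta> D (Bk k)) \<and>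
            Hconv \<alpha> D Ak A \<and> E \<subseteq> {0<..} \<and> 0 \<in> closure E \<and>
            (AE x in lebesgue_on D.
               ((\<lambda>\<rho>. limsup (\<lambda>k. ereal (1 / \<rho> ^ CARD('n) *
                   set_lebesgue_integral lebesgue (ball x \<rho> \<inter> D)
                     (\<lambda>y. onorm (\<lambda>\<xi>. (Ak k y - Bk k y) *v \<xi>)))))
                 \<longlongrightarrow> 0) (at 0 within E))
          \<longrightarrow> Hconv \<alpha> D Bk A)
       \<and> (\<forall>(A :: real^'n \<Rightarrow> real^'n^'n) B (eps :: nat \<Rightarrow> real).
            Mab \<alpha> \<beta> UNIV A \<and> Mab \<alpha> \<beta> UNIV B \<and> (\<forall>k. 0 < eps k) \<and> eps \<longlonglongrightarrow> 0 \<and>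
            ((\<lambda>R. 1 / R ^ CARD('n) * set_lebesgue_integral lebesgue (ball 0 R)
                 (\<lambda>x. onorm (\<lambda>\<xi>. (A x - B x) *v \<xi>))) \<longlongrightarrow> 0) at_top
          \<longrightarrow> (homogenizable \<alpha> eps A \<longleftrightarrow> homogenizable \<alpha> eps B) \<and>
              (\<forall>Ahom Bhom. homogenizes_to \<alpha> eps A Ahom \<and> homogenizes_to \<alpha> eps B Bhom \<longrightarrow> Ahom = Bhom))"
proof -
  have be: "0 \<le> \<beta>" using assms by linarith
  have part1: "Hconv \<alpha> D Bk A"
    if D: "bounded D" "open D" and Ak: "\<And>k. Mab \<alpha> \<beta> D (Ak k)" and Bk: "\<And>k. Mab \<alpha> \<beta> D (Bk k)"
      and hc: "Hconv \<alpha> D Ak A" and E: "E \<subseteq> {0<..}" "0 \<in> closure E"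
      and ae: "AE x in lebesgue_on D.
               ((\<lambda>\<rho>. limsup (\<lambda>k. ereal (1 / \<rho> ^ CARD('n) *
                   set_lebesgue_integral lebesgue (ball x \<rho> \<inter> D)
                     (\<lambda>y. onorm (\<lambda>\<xi>. (Ak k y - Bk k y) *v \<xi>)))))
                 \<longlongrightarrow> 0) (at 0 within E)"
    for D :: "(real^'n) set" and Ak Bk A and E :: "real set"
  proof -
    let ?m = "\<lambda>k y. onorm (\<lambda>\<xi>. (Ak k y - Bk k y) *v \<xi>)"
    define L where "L x \<rho> = limsup (\<lambda>k. ereal (1 / \<rho> ^ CARD('n) * set_lebesgue_integral lebesgue (ball x \<rho> \<inter> D) (?m k)))" for x \<rho>
    define S where "S = {x \<in> D. (L x \<longlongrightarrow> 0) (at 0 within E)}"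
    note DL = lmeasurable_open[OF D]
    have S: "S \<subseteq> D" "negligible (D - S)"
    proof -
      show "S \<subseteq> D" by (auto simp: S_def)
      have "negligible {x \<in> D. \<not> (L x \<longlongrightarrow> 0) (at 0 within E)}"
        by (rule AE_lebesgue_on_negligible) (use D ae in \<open>auto simp: L_def[abs_def]\<close>)
      moreover have "D - S = {x \<in> D. \<not> (L x \<longlongrightarrow> 0) (at 0 within E)}" by (auto simp: S_def)
      ultimately show "negligible (D - S)" by simp
    qed
    \<comment> \<open>The truncated ball in the statement is rewritten as a weight on
      \<open>D\<close>, the form used by the covering lemma.\<close>
    have eqi: "set_lebesgue_integral lebesgue (ball x \<rho> \<inter> D) (?m k) = (\<integral>y. indicator (ball x \<rho>) y * ?m k y \<partial>lebesgue_on D)" for x \<rho> k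
    proof -
      have "(\<integral>y. indicator (ball x \<rho>) y * ?m k y \<partial>lebesgue_on D) = (\<integral>y. indicator D y *\<^sub>R (indicator (ball x \<rho>) y * ?m k y) \<partial>lebesgue)"
        using DL by (intro integral_restrict_space) (auto dest: fmeasurableD)
      also have "\<dots> = set_lebesgue_integral lebesgue (ball x \<rho> \<inter> D) (?m k)"
        unfolding set_lebesgue_integral_def by (intro Bochner_Integration.integral_cong) (auto simp: indicator_def)
      finally show ?thesis ..
    qed
    have "(\<lambda>k. \<integral>x. ?m k x \<partial>lebesgue_on D) \<longlonglongrightarrow> 0"
    proof (rule L1_convergence_from_averages[OF D _ _ _ _ S, of _ "2 * \<beta>"])
      show "integrable (lebesgue_on D) (?m k)" for k by (rule Mab_diff_integrable[OF DL Ak Bk])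
      show "0 \<le> ?m k x" for k x by (rule onorm_matrix_nonneg)
      show "AE x in lebesgue_on D. ?m k x \<le> 2 * \<beta>" for k by (rule Mab_diff_bounds[OF Ak Bk])
      show "0 \<le> 2 * \<beta>" using be by simp
      fix x and \<eta> d :: real assume x: "x \<in> S" and eta: "0 < \<eta>" and d: "0 < d"
      have lim: "(L x \<longlongrightarrow> 0) (at 0 within E)" using x by (simp add: S_def)
      have "\<forall>\<^sub>F \<rho> in at 0 within E. L x \<rho> < ereal \<eta>" using eta by (intro order_tendstoD(2)[OF lim]) simp
      then obtain r where r: "r > 0" "\<And>\<rho>. \<rho> \<in> E \<Longrightarrow> \<rho> \<noteq> 0 \<Longrightarrow> dist \<rho> 0 < r \<Longrightarrow> L x \<rho> < ereal \<eta>"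
        unfolding eventually_at by auto
      \<comment> \<open>0 is a limit point of \<open>E\<close>: it lies in the closure, and all
        members of \<open>E\<close> are positive. So admissible radii exist below every
        bound.\<close>
      obtain \<rho> where rho: "\<rho> \<in> E" "dist \<rho> 0 < min r d" using E(2) r(1) d unfolding closure_approachable by (metis min_less_iff_conj)
      have rp: "0 < \<rho>" "\<rho> < d" using rho E(1) by (auto simp: dist_real_def)
      have "L x \<rho> < ereal \<eta>" using r(2)[OF rho(1)] rho(2) rp(1) by auto
      then have "\<forall>\<^sub>F k in sequentially. ereal (1 / \<rho> ^ CARD('n) * set_lebesgue_integral lebesgue (ball x \<rho> \<inter> D) (?m k)) < ereal \<eta>"
        unfolding L_def by (rule Limsup_lessD)
      then have "\<forall>\<^sub>F k in sequentially. (\<integral>y. indicator (ball x \<rho>) y * ?m k y \<partial>lebesgue_on D) < \<eta> * \<rho> ^ CARD('n)"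
      proof eventually_elim
        case (elim k)
        then show ?case using rp(1) unfolding eqi by (simp add: divide_less_eq)
      qed
      then show "\<exists>\<rho>>0. \<rho> < d \<and> (\<forall>\<^sub>F k in sequentially. (\<integral>y. indicator (ball x \<rho>) y * ?m k y \<partial>lebesgue_on D) < \<eta> * \<rho> ^ CARD('n))"
        using rp by blast
    qed
    then show ?thesis by (rule Hconv_L1_perturbation[OF D assms Ak Bk hc])
  qed
  have part2: "(homogenizable \<alpha> eps A \<longleftrightarrow> homogenizable \<alpha> eps B) \<and>
              (\<forall>Ahom Bhom. homogenizes_to \<alpha> eps A Ahom \<and> homogenizes_to \<alpha> eps B Bhom \<longrightarrow> Ahom = Bhom)"
    if A: "Mab \<alpha> \<beta> UNIV A" and B: "Mab \<alpha> \<beta> UNIV B" and eps: "\<And>k. 0 < eps k" "eps \<longlonglongrightarrow> 0"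
      and lim: "((\<lambda>R. 1 / R ^ CARD('n) * set_lebesgue_integral lebesgue (ball 0 R)
                 (\<lambda>x. onorm (\<lambda>\<xi>. (A x - B x) *v \<xi>))) \<longlongrightarrow> 0) at_top"
    for A B :: "real^'n \<Rightarrow> real^'n^'n" and eps :: "nat \<Rightarrow> real"
  proof -
    have lim': "((\<lambda>R. 1 / R ^ CARD('n) * set_lebesgue_integral lebesgue (ball 0 R)
                 (\<lambda>x. onorm (\<lambda>\<xi>. (B x - A x) *v \<xi>))) \<longlongrightarrow> 0) at_top"
      using lim by (subst onorm_matrix_minus_commute)
    have AB: "homogenizes_to \<alpha> eps B M" if "homogenizes_to \<alpha> eps A M" for M
      by (rule homogenizes_to_perturbation[OF assms A B eps lim that])
    have BA: "homogenizes_to \<alpha> eps A M" if "homogenizes_to \<alpha> eps B M" for M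
      by (rule homogenizes_to_perturbation[OF assms B A eps lim' that])
    have "M = N" if M: "homogenizes_to \<alpha> eps A M" and N: "homogenizes_to \<alpha> eps B N" for M N
    proof (rule Hconv_const_unique[OF assms(1) be])
      show "Mab \<alpha> \<beta> (ball 0 1) (\<lambda>x. A ((1 / eps k) *\<^sub>R x))" for k
        using eps(1)[of k] by (intro Mab_scale[OF A]) auto
      show "Hconv \<alpha> (ball 0 1) (\<lambda>k x. A ((1 / eps k) *\<^sub>R x)) (\<lambda>x. M)"
        using M unfolding homogenizes_to_def by (simp del: scaleR_one)
      \<comment> \<open>By \<open>BA\<close> the constant belonging to \<open>B\<close> is also a
        limit for \<open>A\<close>; uniqueness is then applied to a single sequence.\<close>
      show "Hconv \<alpha> (ball 0 1) (\<lambda>k x. A ((1 / eps k) *\<^sub>R x)) (\<lambda>x. N)"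
        using BA[OF N] unfolding homogenizes_to_def by simp
    qed
    then show ?thesis using AB BA unfolding homogenizable_def by blast
  qed
  show ?thesis using part1 part2 by blast
qed

end
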